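(* Let $\Omega$ be $C^{1,1}$, $\mathrm{Ra}\ge 1$, $d=\min_{0\le x_1\le\Gamma}(h^+(x_1)-h^-(x_1))>0$, $u_0\in L^2(\Omega)$ and $0<\alpha\in L^\infty(\gamma^-\cup\gamma^+)$. Then the Nusselt number is bounded by $$\mathrm{Nu}\le C_0\,C_2^{\frac12}\,\mathrm{Ra}^{\frac12}$$ uniformly in $\mathrm{Pr}$, where $C_2=C_2(\alpha,\kappa)=1+\|\alpha^{-1}(1+|\kappa|)\|_\infty$ and the constant $C_0>0$ depends only on $d$, the Lipschitz constant of the domain and $\Gamma$. If $\mathrm{Ra}$ is sufficiently large, i.e. $\mathrm{Ra}\ge d^{-2}$, then $C_0$ is independent of $d$. If additionally $|\kappa|\le 2\alpha$, the bound improves to $$\mathrm{Nu}\le C_0\,\mathrm{Ra}^{\frac12}.$$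
   Context: Domain: $\Gamma>0$, $\Omega=\{(x_1,x_2): 0\le x_1\le\Gamma,\ h^-(x_1)\le x_2\le h^+(x_1)\}$, where $h^\pm$ are $\Gamma$-periodic functions with $h^-<h^+$ and $|\Omega|=\Gamma$ (average height $1$); all functions are $\Gamma$-periodic in $x_1$. The boundaries are $\gamma^\pm=\{0\le x_1\le\Gamma,\ x_2=h^\pm(x_1)\}$. $\Omega$ is of class $C^{k,1}$ if $h^\pm$ have Lipschitz derivatives up to order $k$. $n$ is the outward unit normal, $\tau=n^\perp$ with $(a_1,a_2)^\perp=(-a_2,a_1)$, $u_\tau=u\cdot\tau$, $\mathbb{D}u=\frac12(\nabla u+\nabla u^T)$, and $\kappa=n\cdot(\tau\cdot\nabla)\tau$ is the boundary curvature on $\gamma^-\cup\gamma^+$. The slip coefficient $\alpha=\alpha(x)>0$ is a function on $\gamma^-\cup\gamma^+$. Norms $\|\alpha^{-1}(1+|\kappa|)\|_\infty$ are $L^\infty(\gamma^-\cup\gamma^+)$ norms. Rayleigh–Bénard system: for $\mathrm{Pr},\mathrm{Ra}>0$, $(u,p,\theta)$ is a (sufficiently regular, global in time) solution of $\mathrm{Pr}^{-1}(u_t+u\cdot\nabla u)+\nabla p-\Delta u=\mathrm{Ra}\,\theta e_2$, $\nabla\cdot u=0$, $\theta_t+u\cdot\nabla\theta-\Delta\theta=0$ in $\Omega$; $n\cdot u=0$ and $\tau\cdot(\mathbb{D}u\,n+\alpha u)=0$ on $\gamma^-\cup\gamma^+$; $\theta=0$ on $\gamma^+$, $\theta=1$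 on $\gamma^-$; $(u,\theta)(\cdot,0)=(u_0,\theta_0)$, with $e_2=(0,1)$ and $0\le\theta_0\le1$ a.e. (hence $0\le\theta\le1$ by the maximum principle). The Nusselt number is $\mathrm{Nu}=\langle n\cdot\nabla\theta\rangle_{\gamma^-}$, where $\langle f\rangle_X=\limsup_{T\to\infty}\frac1T\int_0^T\frac1\Gamma\int_X f(x,t)\,dx\,dt$. *)

theory Defs
  imports "HOL-Analysis.Analysis" "HOL-Probability.Essential_Supremum"
begin

section \<open>Differential operators in the plane\<close>

type_synonym point = "real \<times> real"

definition dx1 :: "(point \<Rightarrow> 'a::real_normed_vector) \<Rightarrow> point \<Rightarrow> 'a" where
  "dx1 f x = vector_derivative (\<lambda>s. f (s, snd x)) (at (fst x))"

definition dx2 :: "(point \<Rightarrow> 'a::real_normed_vector) \<Rightarrow> point \<Rightarrow> 'a" where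
  "dx2 f x = vector_derivative (\<lambda>s. f (fst x, s)) (at (snd x))"

definition dt :: "(real \<Rightarrow> point \<Rightarrow> 'a::real_normed_vector) \<Rightarrow> real \<Rightarrow> point \<Rightarrow> 'a" where
  "dt f t x = vector_derivative (\<lambda>s. f s x) (at t)"

definition grad :: "(point \<Rightarrow> 'a::real_normed_vector) \<Rightarrow> point \<Rightarrow> 'a \<times> 'a" where
  "grad f x = (dx1 f x, dx2 f x)"

definition laplace :: "(point \<Rightarrow> 'a::real_normed_vector) \<Rightarrow> point \<Rightarrow> 'a" where
  "laplace f x = dx1 (dx1 f) x + dx2 (dx2 f) x"

definition divergence :: "(point \<Rightarrow> point) \<Rightarrow> point \<Rightarrow> real" where
  "divergence u x = fst (dx1 u x) + snd (dx2 u x)"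

definition advect :: "point \<Rightarrow> (point \<Rightarrow> 'a::real_normed_vector) \<Rightarrow> point \<Rightarrow> 'a" where
  "advect v f x = fst v *\<^sub>R dx1 f x + snd v *\<^sub>R dx2 f x"

text \<open>For a velocity gradient \<open>G\<close>, i.e. the pair of vectors \<open>(\<partial>\<^sub>1 u, \<partial>\<^sub>2 u)\<close>, this is
  the symmetric gradient \<open>(\<nabla>u + \<nabla>u\<^sup>T) / 2\<close> applied to the vector \<open>v\<close>.\<close>

definition strain :: "point \<times> point \<Rightarrow> point \<Rightarrow> point" where
  "strain G v =
     (let e11 = fst (fst G); e22 = snd (snd G); e12 = (snd (fst G) + fst (snd G)) / 2
      in (e11 * fst v + e12 * snd v, e12 * fst v + e22 * snd v))"

definition perp :: "point \<Rightarrow> point" where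
  "perp a = (- snd a, fst a)"

section \<open>The periodic channel\<close>

text \<open>Lipschitz derivatives up to order \<open>k\<close>.\<close>

definition class_Ck1 :: "nat \<Rightarrow> (real \<Rightarrow> real) \<Rightarrow> bool" where
  "class_Ck1 k h \<longleftrightarrow>
     (\<forall>j<k. \<forall>x. (deriv ^^ j) h field_differentiable (at x)) \<and>
     (\<forall>j\<le>k. \<exists>L. L-lipschitz_on UNIV ((deriv ^^ j) h))"

definition strip :: "(real \<Rightarrow> real) \<Rightarrow> (real \<Rightarrow> real) \<Rightarrow> point set" where
  "strip hm hp = {x. hm (fst x) < snd x \<and> snd x < hp (fst x)}"

definition closed_strip :: "(real \<Rightarrow> real) \<Rightarrow> (real \<Rightarrow> real) \<Rightarrow> point set" where
  "closed_strip hm hp = {x. hm (fst x) \<le> snd x \<and> snd x \<le> hp (fst x)}"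

definition cell :: "real \<Rightarrow> (real \<Rightarrow> real) \<Rightarrow> (real \<Rightarrow> real) \<Rightarrow> point set" where
  "cell \<Gamma> hm hp = {x. 0 \<le> fst x \<and> fst x \<le> \<Gamma> \<and> hm (fst x) \<le> snd x \<and> snd x \<le> hp (fst x)}"

definition wall :: "real \<Rightarrow> (real \<Rightarrow> real) \<Rightarrow> point set" where
  "wall \<Gamma> h = {x. 0 \<le> fst x \<and> fst x \<le> \<Gamma> \<and> snd x = h (fst x)}"

definition channel :: "real \<Rightarrow> (real \<Rightarrow> real) \<Rightarrow> (real \<Rightarrow> real) \<Rightarrow> bool" where
  "channel \<Gamma> hm hp \<longleftrightarrow>
     0 < \<Gamma> \<and> (\<forall>s. hm (s + \<Gamma>) = hm s) \<and> (\<forall>s. hp (s + \<Gamma>) = hp s) \<and> (\<forall>s. hm s < hp s) \<and>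
     emeasure lborel (cell \<Gamma> hm hp) = ennreal \<Gamma>"

text \<open>Arc length measure on one period of the graph of \<open>h\<close>.\<close>

definition arc_measure :: "real \<Rightarrow> (real \<Rightarrow> real) \<Rightarrow> point measure" where
  "arc_measure \<Gamma> h =
     distr (density lborel (\<lambda>s. indicator {0..\<Gamma>} s * ennreal (sqrt (1 + (deriv h s)\<^sup>2))))
           borel (\<lambda>s. (s, h s))"

definition AE_walls :: "real \<Rightarrow> (real \<Rightarrow> real) \<Rightarrow> (real \<Rightarrow> real) \<Rightarrow> (point \<Rightarrow> bool) \<Rightarrow> bool" where
  "AE_walls \<Gamma> hm hp P \<longleftrightarrow> (AE x in arc_measure \<Gamma> hm. P x) \<and> (AE x in arc_measure \<Gamma> hp. P x)"

definition sup_norm_walls ::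
    "real \<Rightarrow> (real \<Rightarrow> real) \<Rightarrow> (real \<Rightarrow> real) \<Rightarrow> (point \<Rightarrow> real) \<Rightarrow> ereal" where
  "sup_norm_walls \<Gamma> hm hp f =
     max (esssup (arc_measure \<Gamma> hm) (\<lambda>x. ereal \<bar>f x\<bar>))
         (esssup (arc_measure \<Gamma> hp) (\<lambda>x. ereal \<bar>f x\<bar>))"

text \<open>The next three functions are meaningful at points of the two walls only.\<close>

definition outer_normal :: "(real \<Rightarrow> real) \<Rightarrow> (real \<Rightarrow> real) \<Rightarrow> point \<Rightarrow> point" where
  "outer_normal hm hp x =
     (if snd x = hm (fst x)
      then (1 / sqrt (1 + (deriv hm (fst x))\<^sup>2)) *\<^sub>R (deriv hm (fst x), - 1)
      else (1 / sqrt (1 + (deriv hp (fst x))\<^sup>2)) *\<^sub>R (- deriv hp (fst x), 1))"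

definition tangent :: "(real \<Rightarrow> real) \<Rightarrow> (real \<Rightarrow> real) \<Rightarrow> point \<Rightarrow> point" where
  "tangent hm hp x = perp (outer_normal hm hp x)"

text \<open>On the graph of \<open>h\<close> the tangential derivative \<open>\<tau> \<cdot> \<nabla>\<close> is \<open>\<tau>\<^sub>1\<close> times the derivative of
  \<open>s \<mapsto> f (s, h s)\<close>.  For walls of class \<open>C\<^sup>1\<^sup>,\<^sup>1\<close> the derivative of \<open>\<tau>\<close> exists almost everywhere.\<close>

definition curvature :: "(real \<Rightarrow> real) \<Rightarrow> (real \<Rightarrow> real) \<Rightarrow> point \<Rightarrow> real" where
  "curvature hm hp x =
     (let h = (if snd x = hm (fst x) then hm else hp)
      in outer_normal hm hp x \<bullet>
         (fst (tangent hm hp x) *\<^sub>R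
            vector_derivative (\<lambda>s. tangent hm hp (s, h s)) (at (fst x))))"

section \<open>Regularity of time-dependent fields\<close>

definition C1_in_space :: "point set \<Rightarrow> (real \<Rightarrow> point \<Rightarrow> 'a::real_normed_vector) \<Rightarrow> bool" where
  "C1_in_space S f \<longleftrightarrow>
     (\<forall>t>0. \<forall>x\<in>S. f t differentiable (at x)) \<and>
     continuous_on ({0<..} \<times> S) (\<lambda>(t, x). f t x) \<and>
     continuous_on ({0<..} \<times> S) (\<lambda>(t, x). grad (f t) x)"

definition C1_in_time :: "point set \<Rightarrow> (real \<Rightarrow> point \<Rightarrow> 'a::real_normed_vector) \<Rightarrow> bool" where
  "C1_in_time S f \<longleftrightarrow>
     (\<forall>t>0. \<forall>x\<in>S. (\<lambda>s. f s x) differentiable (at t)) \<and>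
     continuous_on ({0<..} \<times> S) (\<lambda>(t, x). dt f t x)"

text \<open>Once in time and twice in space continuously differentiable, for positive times.\<close>

definition C1_C2 :: "point set \<Rightarrow> (real \<Rightarrow> point \<Rightarrow> 'a::real_normed_vector) \<Rightarrow> bool" where
  "C1_C2 S f \<longleftrightarrow>
     C1_in_time S f \<and> C1_in_space S f \<and>
     C1_in_space S (\<lambda>t. dx1 (f t)) \<and> C1_in_space S (\<lambda>t. dx2 (f t))"

definition periodic_in :: "point set \<Rightarrow> real \<Rightarrow> (real \<Rightarrow> point \<Rightarrow> 'a) \<Rightarrow> bool" where
  "periodic_in S \<Gamma> f \<longleftrightarrow> (\<forall>t>0. \<forall>x\<in>S. f t (fst x + \<Gamma>, snd x) = f t x)"

text \<open>\<open>g\<close> is the boundary trace of \<open>f\<close>: the restrictions of \<open>f\<close> to the walls translated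
  vertically by \<open>s\<close> into the domain tend to \<open>g\<close> in \<open>L\<^sup>2\<close>, locally in \<open>t \<in> (0,\<infinity>)\<close>, as \<open>s \<down> 0\<close>.\<close>

definition has_trace ::
    "real \<Rightarrow> (real \<Rightarrow> real) \<Rightarrow> (real \<Rightarrow> real) \<Rightarrow>
     (real \<Rightarrow> point \<Rightarrow> 'a::euclidean_space) \<Rightarrow> (real \<Rightarrow> point \<Rightarrow> 'a) \<Rightarrow> bool" where
  "has_trace \<Gamma> hm hp f g \<longleftrightarrow>
     (\<lambda>(t, x). g t x) \<in> borel_measurable borel \<and>
     (\<forall>a>0. \<forall>b>a.
        ((\<lambda>s. \<integral>\<^sup>+ t\<in>{a..b}. (\<integral>\<^sup>+ x. ennreal ((norm (f t (x + (0, s)) - g t x))\<^sup>2)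
                 \<partial>arc_measure \<Gamma> hm) \<partial>lborel) \<longlongrightarrow> 0) (at_right 0) \<and>
        ((\<lambda>s. \<integral>\<^sup>+ t\<in>{a..b}. (\<integral>\<^sup>+ x. ennreal ((norm (f t (x - (0, s)) - g t x))\<^sup>2)
                 \<partial>arc_measure \<Gamma> hp) \<partial>lborel) \<longlongrightarrow> 0) (at_right 0))"

definition L2_on :: "point set \<Rightarrow> (point \<Rightarrow> 'a::euclidean_space) \<Rightarrow> bool" where
  "L2_on S f \<longleftrightarrow> set_borel_measurable lborel S f \<and> set_integrable lborel S (\<lambda>x. (norm (f x))\<^sup>2)"

definition initial_value ::
    "point set \<Rightarrow> (real \<Rightarrow> point \<Rightarrow> 'a::euclidean_space) \<Rightarrow> (point \<Rightarrow> 'a) \<Rightarrow> bool" where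
  "initial_value S f f0 \<longleftrightarrow>
     ((\<lambda>t. \<integral>\<^sup>+ x\<in>S. ennreal ((norm (f t x - f0 x))\<^sup>2) \<partial>lborel) \<longlongrightarrow> 0) (at_right 0)"

section \<open>The Rayleigh-Benard system with Navier-slip conditions\<close>

text \<open>
  The equations hold pointwise in the open strip for positive times, and the initial data are
  attained in \<open>L\<^sup>2\<close>.  Velocity, temperature and temperature gradient are continuous up to the
  walls.  The velocity gradient and the pressure are only required to have \<open>L\<^sup>2\<close> traces, and the
  slip condition holds almost everywhere on the walls: since \<open>\<alpha>\<close> is merely bounded and
  measurable, the slip condition forces a discontinuous stress wherever \<open>\<alpha> u\<close> jumps.
\<close>

definition regular_solution ::
    "real \<Rightarrow> (real \<Rightarrow> real) \<Rightarrow> (real \<Rightarrow> real) \<Rightarrow>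
     (real \<Rightarrow> point \<Rightarrow> point) \<Rightarrow> (real \<Rightarrow> point \<Rightarrow> real) \<Rightarrow> (real \<Rightarrow> point \<Rightarrow> real) \<Rightarrow> bool" where
  "regular_solution \<Gamma> hm hp u p \<theta> \<longleftrightarrow>
     periodic_in (closed_strip hm hp) \<Gamma> u \<and>
     periodic_in (strip hm hp) \<Gamma> p \<and>
     periodic_in (closed_strip hm hp) \<Gamma> \<theta> \<and>
     C1_C2 (strip hm hp) u \<and> C1_in_space (strip hm hp) p \<and> C1_C2 (strip hm hp) \<theta> \<and>
     continuous_on ({0<..} \<times> closed_strip hm hp) (\<lambda>(t, x). u t x) \<and>
     continuous_on ({0<..} \<times> closed_strip hm hp) (\<lambda>(t, x). \<theta> t x) \<and>
     (\<exists>q. continuous_on ({0<..} \<times> closed_strip hm hp) (\<lambda>(t, x). q t x) \<and>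
          (\<forall>t>0. \<forall>x\<in>strip hm hp. q t x = grad (\<theta> t) x)) \<and>
     (\<exists>P. has_trace \<Gamma> hm hp p P)"

definition rayleigh_benard_solution ::
    "real \<Rightarrow> (real \<Rightarrow> real) \<Rightarrow> (real \<Rightarrow> real) \<Rightarrow> (point \<Rightarrow> real) \<Rightarrow> real \<Rightarrow> real \<Rightarrow>
     (point \<Rightarrow> point) \<Rightarrow> (point \<Rightarrow> real) \<Rightarrow>
     (real \<Rightarrow> point \<Rightarrow> point) \<Rightarrow> (real \<Rightarrow> point \<Rightarrow> real) \<Rightarrow> (real \<Rightarrow> point \<Rightarrow> real) \<Rightarrow> bool" where
  "rayleigh_benard_solution \<Gamma> hm hp \<alpha> Pr Ra u0 \<theta>0 u p \<theta> \<longleftrightarrow>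
     regular_solution \<Gamma> hm hp u p \<theta> \<and>
     (\<forall>t>0. \<forall>x\<in>strip hm hp.
        (1 / Pr) *\<^sub>R (dt u t x + advect (u t x) (u t) x) + grad (p t) x - laplace (u t) x
          = (Ra * \<theta> t x) *\<^sub>R (0, 1) \<and>
        divergence (u t) x = 0 \<and>
        dt \<theta> t x + advect (u t x) (\<theta> t) x - laplace (\<theta> t) x = 0) \<and>
     (\<forall>t>0. \<forall>x\<in>wall \<Gamma> hm \<union> wall \<Gamma> hp. outer_normal hm hp x \<bullet> u t x = 0) \<and>
     (\<exists>G. has_trace \<Gamma> hm hp (\<lambda>t. grad (u t)) G \<and>
        (AE t in lborel. 0 < t \<longrightarrow> AE_walls \<Gamma> hm hp (\<lambda>x.
           tangent hm hp x \<bullet> (strain (G t x) (outer_normal hm hp x) + \<alpha> x *\<^sub>R u t x) = 0))) \<and>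
     (\<forall>t>0. \<forall>x\<in>wall \<Gamma> hp. \<theta> t x = 0) \<and>
     (\<forall>t>0. \<forall>x\<in>wall \<Gamma> hm. \<theta> t x = 1) \<and>
     initial_value (cell \<Gamma> hm hp) u u0 \<and>
     initial_value (cell \<Gamma> hm hp) \<theta> \<theta>0"

text \<open>On the lower wall \<open>\<nabla>\<theta>\<close> is the limit from inside the domain; the values of \<open>\<theta>\<close> outside
  the closed strip are irrelevant.\<close>

definition nusselt ::
    "real \<Rightarrow> (real \<Rightarrow> real) \<Rightarrow> (real \<Rightarrow> real) \<Rightarrow> (real \<Rightarrow> point \<Rightarrow> real) \<Rightarrow> ereal" where
  "nusselt \<Gamma> hm hp \<theta> =
     Limsup at_top (\<lambda>T. ereal (1 / T * (LINT t:{0..T}|lborel. 1 / \<Gamma> *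
       (LINT x|arc_measure \<Gamma> hm.
          outer_normal hm hp x \<bullet> Lim (at x within strip hm hp) (grad (\<theta> t))))))"

section \<open>The constant in the bound\<close>

text \<open>It is infinite when \<open>\<alpha>\<close> is not bounded away from zero; the bound is then void.\<close>

definition C2_const ::
    "real \<Rightarrow> (real \<Rightarrow> real) \<Rightarrow> (real \<Rightarrow> real) \<Rightarrow> (point \<Rightarrow> real) \<Rightarrow> ereal" where
  "C2_const \<Gamma> hm hp \<alpha> =
     1 + sup_norm_walls \<Gamma> hm hp (\<lambda>x. inverse (\<alpha> x) * (1 + \<bar>curvature hm hp x\<bar>))"

definition ereal_sqrt :: "ereal \<Rightarrow> ereal" where
  "ereal_sqrt c = (if c = \<infinity> then \<infinity> else ereal (sqrt (real_of_ereal c)))"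

end

theory Submission
  imports Defs
begin

text \<open>
  The Nusselt number is the long time average of the heat entering through the bottom wall, and the
  proof bounds this heat by itself with a small factor.

  The temperature stays between its wall values (\<open>temperature_range\<close>), so heat flows inwards
  everywhere at the bottom and outwards everywhere at the top (\<open>wall_flux_nonneg\<close>).  Testing the heat
  equation with \<open>1\<close>, \<open>\<theta>\<close> and the height above the lowest point of the channel bounds, up to constants,
  the outgoing heat, the dissipation of temperature and the work \<open>\<integral> \<theta> u\<^sub>2\<close> of the buoyancy by the
  incoming heat \<open>H\<close> (\<open>heat_out_le\<close>, \<open>temperature_dissipation_le\<close>, \<open>buoyancy_work_le\<close>).  Testing it with
  a weight supported in a layer of thickness \<open>\<delta>\<close> along the bottom wall bounds \<open>H\<close>, up to a constant
  and a quarter of \<open>H\<close> itself, by a multiple of \<open>T / \<delta>\<close>, for a time interval of length \<open>T\<close>, plus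
  \<open>1 / \<delta>\<close> times the integral of \<open>|u\<^sub>2 - h' u\<^sub>1|\<close> over the layer (\<open>heat_in_boundary_layer\<close>).
  This velocity component vanishes at the wall and is therefore controlled by \<open>\<delta>\<close> and the dissipation \<open>\<integral> |\<nabla> u|\<^sup>2\<close> (\<open>boundary_layer_velocity\<close>).

  The dissipation in turn is bounded by \<open>c Ra \<integral> \<theta> u\<^sub>2\<close>, apart from the kinetic energy at the beginning
  of the time interval, hence by a multiple of \<open>c Ra H\<close> (\<open>dissipation_le\<close>).  Here
  the boundary enters.  The energy balance with the slip condition controls
  \<open>2 \<integral> |D u|\<^sup>2\<close> plus the friction \<open>2 \<integral> \<alpha> |u|\<^sup>2\<close> at the walls, whereas \<open>\<integral> |\<nabla> u|\<^sup>2\<close> differs from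
  \<open>2 \<integral> |D u|\<^sup>2\<close> by a wall integral of \<open>\<kappa> |u|\<^sup>2\<close>.  Multiplying the balance by \<open>c \<ge> 1\<close> makes the friction
  absorb the curvature as soon as \<open>|\<kappa>| \<le> 2 c \<alpha>\<close>.  The factor \<open>c = C\<^sub>2\<close> suffices if it is finite, and \<open>c = 1\<close>
  suffices if \<open>|\<kappa>| \<le> 2 \<alpha>\<close>.  The Prandtl number only multiplies the kinetic energy, which is
  nonnegative and finite at the initial time of the interval, so it does not affect the averages.

  Closing the circle, half of \<open>H\<close> is absorbed and the other half is at most a constant plus a multiple
  of \<open>(\<delta> c Ra + 1 / \<delta>) T\<close> (\<open>heat_in_growth\<close>).  The choice of \<open>\<delta>\<close> proportional to \<open>1 / sqrt (c Ra)\<close> gives the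
  theorem; the channel has room for this layer if \<open>Ra \<ge> 1 / d\<^sup>2\<close>, and otherwise \<open>\<delta>\<close> is reduced to \<open>d / 2\<close>
  at the expense of a constant depending on \<open>d\<close>.

  The main technical difficulty is the low regularity at the walls: the pressure and the velocity
  gradient have traces only in the sense of \<open>L\<^sup>2\<close> limits, and \<open>h''\<close> is only a bounded function.  The
  energy balance is therefore written between level curves \<open>h + s\<close>, and \<open>wall_flux_limit\<close> passes to
  the limit after an integration by parts along the curve has removed the derivatives of the velocity
  trace.  This uses that Lipschitz functions, here \<open>h'\<close>, are differentiable almost everywhere.
\<close>

section \<open>Almost everywhere differentiability of Lipschitz functions\<close>

text \<open>The balls on which \<open>\<mu>\<close> is dominated by \<open>\<nu>\<close> form a fine cover of \<open>E\<close>.  By Vitali's covering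
theorem countably many disjoint ones, all inside an open set \<open>U \<supseteq> E\<close> with \<open>\<nu> U\<close> close to \<open>\<nu> E\<close>,
cover \<open>E\<close> up to a Lebesgue null set, which \<open>\<mu>\<close> ignores.\<close>

lemma Vitali_emeasure_le:
  fixes \<mu> \<nu> :: "real measure"
  assumes \<mu>: "sets \<mu> = sets borel" and \<nu>: "sets \<nu> = sets borel"
    and fin: "emeasure \<nu> UNIV \<noteq> \<infinity>"
    and ac: "\<And>A. A \<in> null_sets lborel \<Longrightarrow> emeasure \<mu> A = 0"
    and E: "E \<in> sets borel"
    and cover: "\<And>x d. \<lbrakk>x \<in> E; 0 < d\<rbrakk> \<Longrightarrow> \<exists>a r. 0 < r \<and> r < d \<and> x \<in> cball a r \<and>
                  emeasure \<mu> (cball a r) \<le> emeasure \<nu> (cball a r)"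
  shows "emeasure \<mu> E \<le> emeasure \<nu> E"
proof (rule ennreal_le_epsilon)
  fix e :: real
  assume "0 < e" "emeasure \<nu> E < top"
  have "emeasure \<nu> (space \<nu>) \<noteq> \<infinity>"
    using fin \<nu> by (metis sets_eq_imp_space_eq space_borel)
  then have "emeasure \<nu> E = (INF U\<in>{U. E \<subseteq> U \<and> open U}. emeasure \<nu> U)"
    using \<nu> E by (intro outer_regular) auto
  moreover have "emeasure \<nu> E < emeasure \<nu> E + ennreal e"
    using \<open>0 < e\<close> \<open>emeasure \<nu> E < top\<close> by (simp add: ennreal_add_left_cancel_less)
  ultimately have "(INF U\<in>{U. E \<subseteq> U \<and> open U}. emeasure \<nu> U) < emeasure \<nu> E + ennreal e"
    by metis
  then obtain U where U: "E \<subseteq> U" "open U" "emeasure \<nu> U < emeasure \<nu> E + ennreal e"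
    by (auto simp: INF_less_iff)
  define K where "K = {i :: real \<times> real. 0 < snd i \<and> cball (fst i) (snd i) \<subseteq> U \<and>
       emeasure \<mu> (cball (fst i) (snd i)) \<le> emeasure \<nu> (cball (fst i) (snd i))}"
  have cov: "\<exists>i. i \<in> K \<and> x \<in> cball (fst i) (snd i) \<and> snd i < d" if "x \<in> E" "0 < d" for x d
  proof -
    obtain e where e: "0 < e" "ball x e \<subseteq> U"
      using U \<open>x \<in> E\<close> by (meson openE subsetD)
    obtain a r where ar: "0 < r" "r < min d (e/2)" "x \<in> cball a r"
        "emeasure \<mu> (cball a r) \<le> emeasure \<nu> (cball a r)"
      using cover[of x "min d (e/2)"] \<open>x \<in> E\<close> \<open>0 < d\<close> e by auto
    have "cball a r \<subseteq> ball x e"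
      using ar by (auto simp: dist_real_def)
    then show ?thesis
      using ar e by (intro exI[of _ "(a, r)"]) (auto simp: K_def)
  qed
  obtain C where C: "countable C" "C \<subseteq> K"
     "pairwise (\<lambda>i j. disjnt (cball (fst i) (snd i)) (cball (fst j) (snd j))) C"
     "negligible (E - (\<Union>i \<in> C. cball (fst i) (snd i)))"
    using Vitali_covering_theorem_cballs[of K snd E fst] cov
    by (metis (no_types, lifting) K_def mem_Collect_eq)
  let ?B = "\<lambda>i::real \<times> real. cball (fst i) (snd i)"
  have disj: "disjoint_family_on ?B C"
    using C(3) by (auto simp: disjoint_family_on_def pairwise_def disjnt_def)
  have UB: "(\<Union>i\<in>C. ?B i) \<in> sets borel"
    using C(1) by auto
  have "E - (\<Union>i\<in>C. ?B i) \<in> null_sets lebesgue"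
    using C(4) negligible_iff_null_sets by blast
  then have "E - (\<Union>i\<in>C. ?B i) \<in> null_sets lborel"
    using E UB by (simp add: null_sets_completion_iff)
  then have null: "emeasure \<mu> (E - (\<Union>i\<in>C. ?B i)) = 0"
    by (rule ac)
  have "emeasure \<mu> E \<le> emeasure \<mu> ((E - (\<Union>i\<in>C. ?B i)) \<union> (\<Union>i\<in>C. ?B i))"
    using E UB \<mu> by (intro emeasure_mono) auto
  also have "\<dots> \<le> emeasure \<mu> (E - (\<Union>i\<in>C. ?B i)) + emeasure \<mu> (\<Union>i\<in>C. ?B i)"
    using E UB \<mu> by (intro emeasure_subadditive) auto
  also have "\<dots> = emeasure \<mu> (\<Union>i\<in>C. ?B i)" by (simp add: null)
  also have "\<dots> = (\<integral>\<^sup>+i. emeasure \<mu> (?B i) \<partial>count_space C)"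
    using disj C(1) \<mu> by (intro emeasure_UN_countable) auto
  also have "\<dots> \<le> (\<integral>\<^sup>+i. emeasure \<nu> (?B i) \<partial>count_space C)"
    using C(2) by (intro nn_integral_mono) (auto simp: K_def)
  also have "\<dots> = emeasure \<nu> (\<Union>i\<in>C. ?B i)"
    using disj C(1) \<nu> by (intro emeasure_UN_countable[symmetric]) auto
  also have "\<dots> \<le> emeasure \<nu> U"
    using C(2) \<nu> \<open>open U\<close> by (intro emeasure_mono) (auto simp: K_def)
  also have "\<dots> \<le> emeasure \<nu> E + ennreal e" using U(3) by simp
  finally show "emeasure \<mu> E \<le> emeasure \<nu> E + ennreal e" .
qed

text \<open>If the lower limit were smaller than the upper one, two rational numbers would separate them.\<close>

lemma tendsto_real_of_bounded_no_oscillation: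
  fixes f :: "'a \<Rightarrow> real"
  assumes F: "F \<noteq> bot" and bdd: "\<forall>\<^sub>F x in F. \<bar>f x\<bar> \<le> M"
    and osc: "\<And>p q. \<lbrakk>p \<in> \<rat>; q \<in> \<rat>; p < q; \<exists>\<^sub>F x in F. f x < p; \<exists>\<^sub>F x in F. q < f x\<rbrakk> \<Longrightarrow> False"
  shows "\<exists>l. (f \<longlongrightarrow> l) F"
proof -
  let ?f = "\<lambda>x. ereal (f x)"
  have le: "Liminf F ?f \<le> Limsup F ?f" using F by (rule Liminf_le_Limsup)
  have 1: "ereal (-M) \<le> Liminf F ?f"
    using bdd by (intro Liminf_bounded) (auto elim!: eventually_mono)
  have 2: "Limsup F ?f \<le> ereal M"
    using bdd by (intro Limsup_bounded) (auto elim!: eventually_mono)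
  have eq: "Liminf F ?f = Limsup F ?f"
  proof (rule ccontr)
    assume "\<not> ?thesis"
    with le have "Liminf F ?f < Limsup F ?f" by simp
    then obtain a b where ab: "Liminf F ?f = ereal a" "Limsup F ?f = ereal b" "a < b"
      using 1 2 by (cases "Liminf F ?f"; cases "Limsup F ?f") auto
    obtain p where p: "p \<in> \<rat>" "a < p" "p < b" using Rats_dense_in_real ab(3) by blast
    obtain q where q: "q \<in> \<rat>" "p < q" "q < b" using Rats_dense_in_real p(3) by blast
    have "\<exists>\<^sub>F x in F. f x < p"
    proof (rule ccontr)
      assume "\<not> ?thesis"
      then have "\<forall>\<^sub>F x in F. ereal p \<le> ?f x"
        by (auto simp: frequently_def not_less elim!: eventually_mono)
      then have "ereal p \<le> Liminf F ?f" by (rule Liminf_bounded)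
      with ab p show False by simp
    qed
    moreover have "\<exists>\<^sub>F x in F. q < f x"
    proof (rule ccontr)
      assume "\<not> ?thesis"
      then have "\<forall>\<^sub>F x in F. ?f x \<le> ereal q"
        by (auto simp: frequently_def not_less elim!: eventually_mono)
      then have "Limsup F ?f \<le> ereal q" by (rule Limsup_bounded)
      with ab q show False by simp
    qed
    ultimately show False using osc[of p q] p q by blast
  qed
  obtain l where "Liminf F ?f = ereal l"
    using 1 2 unfolding eq by (cases "Limsup F ?f") auto
  then have "(?f \<longlongrightarrow> ereal l) F"
    using eq F by (intro Liminf_eq_Limsup) auto
  then show ?thesis by (auto simp: lim_ereal)
qed

text \<open>Lebesgue's argument for an increasing \<open>f\<close>.  Let \<open>F\<close> be the measure \<open>A \<mapsto> |f(A)|\<close>, whose mass on an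
interval is the increment of \<open>f\<close>.  Where the difference quotients drop below \<open>p\<close> and rise above
\<open>q > p\<close> arbitrarily close to the point, the comparison of measures above yields
\<open>q |E| \<le> F(E) \<le> p |E|\<close>, so that \<open>|E| = 0\<close>.  The lower Lipschitz bound makes \<open>f\<close> a homeomorphism
with Lipschitz inverse, so that \<open>F\<close> is a Borel measure.\<close>

lemma bilipschitz_differentiable_AE:
  fixes f :: "real \<Rightarrow> real"
  assumes lo: "\<And>x y. x \<le> y \<Longrightarrow> y - x \<le> f y - f x"
    and up: "\<And>x y. x \<le> y \<Longrightarrow> f y - f x \<le> M * (y - x)"
  shows "AE x in lborel. f differentiable (at x)"
proof -
  have "1 \<le> M" using lo[of 0 1] up[of 0 1] by simp
  have lip: "M-lipschitz_on UNIV f"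
  proof (rule lipschitz_onI)
    fix x y show "dist (f x) (f y) \<le> M * dist x y"
      using lo[of x y] up[of x y] lo[of y x] up[of y x] by (cases "x \<le> y") (auto simp: dist_real_def)
  qed (use \<open>1 \<le> M\<close> in auto)
  then have cont: "continuous_on UNIV f" by (rule lipschitz_on_continuous_on)
  have inj: "inj f"
  proof (rule injI)
    fix x y assume "f x = f y" then show "x = y"
      using lo[of x y] lo[of y x] by linarith
  qed
  have surj: "surj f"
    unfolding surj_def
  proof
    fix y
    have "\<exists>x. -\<bar>y - f 0\<bar> \<le> x \<and> x \<le> \<bar>y - f 0\<bar> \<and> f x = y"
      using lo[of "-\<bar>y - f 0\<bar>" 0] lo[of 0 "\<bar>y - f 0\<bar>"] cont
      by (intro IVT') (auto intro: continuous_on_subset)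
    then show "\<exists>x. y = f x" by auto
  qed
  have mono: "f x \<le> f y \<longleftrightarrow> x \<le> y" for x y
    using lo[of x y] lo[of y x] by linarith
  define g where "g = inv f"
  have fg: "f (g y) = y" and gf: "g (f x) = x" for x y
    using surj inj by (auto simp: g_def surj_f_inv_f)
  have glip: "1-lipschitz_on UNIV g"
  proof (rule lipschitz_onI)
    fix x y
    have "\<bar>g x - g y\<bar> \<le> \<bar>x - y\<bar>"
      using lo[of "g x" "g y"] lo[of "g y" "g x"] unfolding fg by arith
    then show "dist (g x) (g y) \<le> 1 * dist x y" by (simp add: dist_real_def)
  qed auto
  then have gcont: "continuous_on UNIV g" by (rule lipschitz_on_continuous_on)
  then have gmeas[measurable]: "g \<in> borel_measurable borel"
    by (rule borel_measurable_continuous_onI)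
  have fmeas[measurable]: "f \<in> borel_measurable borel"
    using cont by (rule borel_measurable_continuous_onI)
  define F where "F = distr lborel borel g"
  have vim: "g -` A = f ` A" for A
    using fg gf by (auto simp: image_iff) metis
  have F: "emeasure F A = emeasure lborel (f ` A)" if "A \<in> sets borel" for A
    using that by (simp add: F_def emeasure_distr vim)
  have Fcb: "emeasure F (cball a r) = ennreal (f (a + r) - f (a - r))" if "0 < r" for a r
  proof -
    have "f ` cball a r = {f (a - r) .. f (a + r)}"
    proof (intro equalityI subsetI)
      fix y assume "y \<in> {f (a - r) .. f (a + r)}"
      then have "a - r \<le> g y" "g y \<le> a + r" using mono fg by (metis atLeastAtMost_iff)+
      then show "y \<in> f ` cball a r"
        by (intro image_eqI[of _ _ "g y"]) (auto simp: fg dist_real_def)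
    qed (auto simp: mono dist_real_def)
    then show ?thesis using that F[of "cball a r"] mono[of "a - r" "a + r"] by simp
  qed
  have Fnull: "emeasure F A = 0" if "A \<in> null_sets lborel" for A
  proof -
    have "A \<in> sets borel" using that by auto
    have "negligible A"
      using that by (auto simp: negligible_iff_null_sets intro: null_sets_completionI)
    then have "negligible (f ` A)"
      using lip by (intro negligible_locally_Lipschitz_image)
        (auto simp: lipschitz_on_def dist_norm intro!: exI[of _ UNIV] exI[of _ M])
    moreover have "f ` A \<in> sets borel"
      using \<open>A \<in> sets borel\<close> gmeas by (metis vim measurable_sets_borel)
    ultimately have "f ` A \<in> null_sets lborel"
      by (simp add: negligible_iff_null_sets null_sets_completion_iff)
    then show ?thesis using F \<open>A \<in> sets borel\<close> by auto
  qed
  define slope where "slope x h = (f (x + h) - f x) / h" for x h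
  \<comment> \<open>Restricting to \<open>|x| < n\<close> makes the measures to be compared finite.\<close>
  define E where "E p q n = {x. \<bar>x\<bar> < real n \<and> (\<exists>\<^sub>F h in at 0. slope x h < p) \<and> (\<exists>\<^sub>F h in at 0. q < slope x h)}"
    for p q :: real and n
  have freq: "(\<exists>\<^sub>F h in at (0::real). P h) \<longleftrightarrow> (\<forall>n::nat. \<exists>h. h \<noteq> 0 \<and> \<bar>h\<bar> < 1 / Suc n \<and> P h)" for P
  proof
    assume L: "\<exists>\<^sub>F h in at (0::real). P h"
    show "\<forall>n::nat. \<exists>h. h \<noteq> 0 \<and> \<bar>h\<bar> < 1 / Suc n \<and> P h"
    proof
      fix n :: nat
      have "\<forall>\<^sub>F h in at (0::real). h \<noteq> 0 \<and> \<bar>h\<bar> < 1 / Suc n"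
        unfolding eventually_at by (intro exI[of _ "1 / Suc n"]) auto
      then have "\<exists>\<^sub>F h in at (0::real). (h \<noteq> 0 \<and> \<bar>h\<bar> < 1 / Suc n) \<and> P h"
        using L by (intro frequently_eventually_conj)
      then show "\<exists>h. h \<noteq> 0 \<and> \<bar>h\<bar> < 1 / Suc n \<and> P h" by (auto dest: frequently_ex)
    qed
  next
    assume R: "\<forall>n::nat. \<exists>h. h \<noteq> 0 \<and> \<bar>h\<bar> < 1 / Suc n \<and> P h"
    show "\<exists>\<^sub>F h in at (0::real). P h"
    proof (rule ccontr)
      assume "\<not> ?thesis"
      then obtain d where d: "0 < d" "\<And>h. h \<noteq> 0 \<Longrightarrow> \<bar>h\<bar> < d \<Longrightarrow> \<not> P h"
        by (auto simp: frequently_def eventually_at dist_real_def)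
      obtain n :: nat where "1 / Suc n < d" using d(1) nat_approx_posE by blast
      then show False using R d(2) by (meson less_trans)
    qed
  qed
  have meas_lt: "{x. \<exists>h. h \<noteq> 0 \<and> \<bar>h\<bar> < 1 / Suc m \<and> P (slope x h)} \<in> sets borel"
    if "open (Collect P)" for m P
  proof -
    have "open {x. P (slope x h)}" if "h \<noteq> 0" for h
    proof -
      have "continuous_on UNIV (\<lambda>x. slope x h)"
        unfolding slope_def using that
        by (auto intro!: continuous_intros continuous_on_compose2[OF cont])
      then show ?thesis
        using open_vimage[OF \<open>open (Collect P)\<close>] by (simp add: vimage_def)
    qed
    then have "open (\<Union>h\<in>{h. h \<noteq> 0 \<and> \<bar>h\<bar> < 1 / Suc m}. {x. P (slope x h)})" by auto
    moreover have "(\<Union>h\<in>{h. h \<noteq> 0 \<and> \<bar>h\<bar> < 1 / Suc m}. {x. P (slope x h)}) =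
       {x. \<exists>h. h \<noteq> 0 \<and> \<bar>h\<bar> < 1 / Suc m \<and> P (slope x h)}" by auto
    ultimately show ?thesis by simp
  qed
  have Emeas: "E p q n \<in> sets borel" for p q n
  proof -
    have "E p q n = {-real n<..<real n} \<inter>
       (\<Inter>m::nat. {x. \<exists>h. h \<noteq> 0 \<and> \<bar>h\<bar> < 1 / Suc m \<and> slope x h < p}) \<inter>
       (\<Inter>m::nat. {x. \<exists>h. h \<noteq> 0 \<and> \<bar>h\<bar> < 1 / Suc m \<and> q < slope x h})"
      unfolding E_def freq by auto
    moreover have "open {s. s < p}" "open {s. q < s}"
      by (auto simp: lessThan_def[symmetric] greaterThan_def[symmetric])
    ultimately show ?thesis
      using meas_lt[of "\<lambda>s. s < p"] meas_lt[of "\<lambda>s. q < s"] by auto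
  qed
  \<comment> \<open>The interval between \<open>x\<close> and \<open>x + h\<close> is a ball, on which \<open>F\<close> has the density \<open>slope x h\<close> on average.\<close>
  have ball: "\<exists>a r h. 0 < r \<and> r < d \<and> x \<in> cball a r \<and> cball a r \<subseteq> {-real n<..<real n} \<and>
        f (a + r) - f (a - r) = slope x h * (2 * r) \<and> P h"
    if fr: "\<exists>\<^sub>F h in at 0. P h" and "\<bar>x\<bar> < real n" "0 < d" for x n d P
  proof -
    have "\<forall>\<^sub>F h in at (0::real). h \<noteq> 0 \<and> \<bar>h\<bar> < min d (real n - \<bar>x\<bar>)"
      unfolding eventually_at using that
      by (intro exI[of _ "min d (real n - \<bar>x\<bar>)"]) auto
    then obtain h where h: "P h" "h \<noteq> 0" "\<bar>h\<bar> < d" "\<bar>h\<bar> < real n - \<bar>x\<bar>"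
      using frequently_eventually_conj[OF fr] by (auto dest!: frequently_ex)
    define a r where "a = x + h / 2" and "r = \<bar>h\<bar> / 2"
    have "f (a + r) - f (a - r) = slope x h * (2 * r)"
    proof (cases "0 < h")
      case True
      then have e: "a + r = x + h" "a - r = x" by (auto simp: a_def r_def)
      show ?thesis unfolding e slope_def using True by (simp add: r_def)
    next
      case False
      then have e: "a + r = x" "a - r = x + h" by (auto simp: a_def r_def)
      show ?thesis unfolding e slope_def using False h(2) by (simp add: r_def)
    qed
    moreover have "cball a r \<subseteq> {-real n<..<real n}"
      using h(3,4) by (auto simp: a_def r_def dist_real_def abs_if split: if_splits)
    moreover have "0 < r" "r < d" "x \<in> cball a r"
      using h by (auto simp: a_def r_def dist_real_def)
    ultimately show ?thesis
      using h(1) by (intro exI[of _ a] exI[of _ r] exI[of _ h] conjI)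
  qed
  have slope1: "1 \<le> slope x h" if "h \<noteq> 0" for x h
    using lo[of x "x + h"] lo[of "x + h" x] that
    by (cases "0 < h") (auto simp: slope_def field_simps)
  have slopeM: "slope x h \<le> M" if "h \<noteq> 0" for x h
    using up[of x "x + h"] up[of "x + h" x] that
    by (cases "0 < h") (auto simp: slope_def field_simps)
  have null: "E p q n \<in> null_sets lborel" if "p < q" for p q n
  proof (cases "E p q n = {}")
    case False
    then obtain x h where "h \<noteq> 0" "slope x h < p"
      unfolding E_def freq by blast
    then have "1 < p" using slope1[of h x] by simp
    let ?I = "{-real n<..<real n}"
    define L where "L = density lborel (indicator ?I)"
    define Fn where "Fn = density F (indicator ?I)"
    have sets[simp]: "sets L = sets borel" "sets Fn = sets borel" "sets F = sets borel"
      by (auto simp: L_def Fn_def F_def)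
    have Lm: "emeasure L A = emeasure lborel (?I \<inter> A)" if "A \<in> sets borel" for A
      unfolding L_def using that by (intro emeasure_restricted) auto
    have Fm: "emeasure Fn A = emeasure F (?I \<inter> A)" if "A \<in> sets borel" for A
      unfolding Fn_def using that by (intro emeasure_restricted) auto
    have scale: "emeasure (density L (\<lambda>_. ennreal c)) A = ennreal c * emeasure L A" if "A \<in> sets borel" for A c
      using that by (intro emeasure_density_const) auto
    have cb: "?I \<inter> cball a r = cball a r" if "cball a r \<subseteq> ?I" for a r
      using that by blast
    have len: "emeasure lborel (cball a r) = ennreal (2 * r)" if "0 < r" for a r :: real
      using that by (simp add: cball_eq_atLeastAtMost)
    have EI: "E p q n \<subseteq> ?I" by (auto simp: E_def)
    have Lfin: "emeasure L UNIV \<noteq> \<infinity>" using Lm[of UNIV] by simp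
    have "emeasure Fn UNIV \<le> emeasure F (cball 0 (real n + 1))"
      using Fm[of UNIV] by (auto simp: dist_real_def intro!: emeasure_mono)
    then have Ffin: "emeasure Fn UNIV \<noteq> \<infinity>"
      using Fcb[of "real n + 1" 0] by (auto simp: top_unique)
    have le1: "emeasure Fn (E p q n) \<le> emeasure (density L (\<lambda>_. ennreal p)) (E p q n)"
    proof (rule Vitali_emeasure_le)
      show "emeasure (density L (\<lambda>_. ennreal p)) UNIV \<noteq> \<infinity>"
        using Lfin by (simp add: scale ennreal_mult_eq_top_iff)
      show "emeasure Fn A = 0" if "A \<in> null_sets lborel" for A
      proof -
        have "A \<in> sets borel" using that by auto
        then show ?thesis
          using Fm[of A] Fnull[OF that] emeasure_mono[of "?I \<inter> A" A F] by auto
      qed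
      fix x d :: real assume "x \<in> E p q n" "0 < d"
      then have "\<exists>\<^sub>F h in at 0. slope x h < p" "\<bar>x\<bar> < real n" by (auto simp: E_def)
      from ball[OF this \<open>0 < d\<close>] obtain a r h where ar: "0 < r" "r < d" "x \<in> cball a r"
        "cball a r \<subseteq> ?I" "f (a + r) - f (a - r) = slope x h * (2 * r)" "slope x h < p" by metis
      have "slope x h * (2 * r) \<le> p * (2 * r)" using ar by (intro mult_right_mono) auto
      then have "emeasure Fn (cball a r) \<le> emeasure (density L (\<lambda>_. ennreal p)) (cball a r)"
        using ar \<open>1 < p\<close> by (simp add: Fm scale Lm cb Fcb len ennreal_mult''[symmetric] ennreal_leI)
      then show "\<exists>a r. 0 < r \<and> r < d \<and> x \<in> cball a r \<and>
         emeasure Fn (cball a r) \<le> emeasure (density L (\<lambda>_. ennreal p)) (cball a r)"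
        using ar by blast
    qed (auto simp: Emeas)
    have le2: "emeasure (density L (\<lambda>_. ennreal q)) (E p q n) \<le> emeasure Fn (E p q n)"
    proof (rule Vitali_emeasure_le)
      show "emeasure Fn UNIV \<noteq> \<infinity>" by (rule Ffin)
      show "emeasure (density L (\<lambda>_. ennreal q)) A = 0" if "A \<in> null_sets lborel" for A
      proof -
        have "A \<in> sets borel" using that by auto
        then show ?thesis
          using that Lm[of A] emeasure_mono[of "?I \<inter> A" A lborel] by (auto simp: scale null_sets_def)
      qed
      fix x d :: real assume "x \<in> E p q n" "0 < d"
      then have "\<exists>\<^sub>F h in at 0. q < slope x h" "\<bar>x\<bar> < real n" by (auto simp: E_def)
      from ball[OF this \<open>0 < d\<close>] obtain a r h where ar: "0 < r" "r < d" "x \<in> cball a r"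
        "cball a r \<subseteq> ?I" "f (a + r) - f (a - r) = slope x h * (2 * r)" "q < slope x h" by metis
      have "q * (2 * r) \<le> slope x h * (2 * r)" using ar by (intro mult_right_mono) auto
      then have "emeasure (density L (\<lambda>_. ennreal q)) (cball a r) \<le> emeasure Fn (cball a r)"
        using ar \<open>1 < p\<close> \<open>p < q\<close> by (simp add: Fm scale Lm cb Fcb len ennreal_mult''[symmetric] ennreal_leI)
      then show "\<exists>a r. 0 < r \<and> r < d \<and> x \<in> cball a r \<and>
         emeasure (density L (\<lambda>_. ennreal q)) (cball a r) \<le> emeasure Fn (cball a r)"
        using ar by blast
    qed (auto simp: Emeas)
    have "ennreal q * emeasure L (E p q n) \<le> ennreal p * emeasure L (E p q n)"
      using le1 le2 by (simp add: scale Emeas)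
    moreover have "emeasure L (E p q n) < top"
      using Lfin emeasure_mono[of "E p q n" UNIV L] by (auto simp: less_top top_unique)
    ultimately have "emeasure L (E p q n) = 0"
      using \<open>1 < p\<close> \<open>p < q\<close>
      by (cases "emeasure L (E p q n)") (auto simp: ennreal_mult[symmetric] ennreal_le_iff mult_le_cancel_right)
    then show ?thesis
      using EI Emeas by (simp add: Lm Int_absorb1 null_sets_def)
  qed auto
  define N where "N = (\<Union>p\<in>\<rat>. \<Union>q\<in>\<rat>\<inter>{p<..}. \<Union>n. E p q n)"
  have "N \<in> null_sets lborel"
    unfolding N_def using countable_rat null
    by (intro null_sets_UN' null_sets_UN countable_Int1) auto
  moreover have "{x. \<not> f differentiable (at x)} \<subseteq> N"
  proof (rule subsetI, rule ccontr)
    fix x assume "x \<in> {x. \<not> f differentiable (at x)}" "x \<notin> N"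
    obtain n where "\<bar>x\<bar> < real n" using reals_Archimedean2 by blast
    have "\<exists>l. (slope x \<longlongrightarrow> l) (at 0)"
    proof (rule tendsto_real_of_bounded_no_oscillation)
      have "\<bar>slope x h\<bar> \<le> M" if "h \<noteq> 0" for h
        using slope1[OF that, of x] slopeM[OF that, of x] by simp
      then show "\<forall>\<^sub>F h in at 0. \<bar>slope x h\<bar> \<le> M"
        by (auto simp: eventually_at intro!: exI[of _ 1])
    next
      fix p q assume "p \<in> \<rat>" "q \<in> \<rat>" "p < q"
        "\<exists>\<^sub>F h in at 0. slope x h < p" "\<exists>\<^sub>F h in at 0. q < slope x h"
      then have "x \<in> E p q n" using \<open>\<bar>x\<bar> < real n\<close> by (auto simp: E_def)
      then show False using \<open>x \<notin> N\<close> \<open>p \<in> \<rat>\<close> \<open>q \<in> \<rat>\<close> \<open>p < q\<close> by (auto simp: N_def)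
    qed auto
    then obtain l where "(f has_field_derivative l) (at x)"
      unfolding DERIV_def slope_def by blast
    then have "f differentiable (at x)"
      using real_differentiable_def by blast
    then show False using \<open>x \<in> {x. \<not> f differentiable (at x)}\<close> by simp
  qed
  ultimately show ?thesis
    by (intro AE_I[of _ _ N]) auto
qed

text \<open>Adding a steep linear function reduces the statement to increasing bi-Lipschitz functions.\<close>

theorem lipschitz_differentiable_AE:
  fixes g :: "real \<Rightarrow> real"
  assumes g: "L-lipschitz_on UNIV g"
  shows "AE x in lborel. g differentiable (at x)"
proof -
  define f where "f x = g x + (L + 1) * x" for x
  have b: "\<bar>g y - g x\<bar> \<le> L * (y - x)" if "x \<le> y" for x y
    using lipschitz_onD[OF g, of y x] that by (simp add: dist_real_def)
  have "AE x in lborel. f differentiable (at x)"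
  proof (rule bilipschitz_differentiable_AE)
    fix x y :: real assume "x \<le> y"
    then show "y - x \<le> f y - f x" using b[of x y] by (simp add: f_def algebra_simps)
    show "f y - f x \<le> (2 * L + 1) * (y - x)"
      using b[of x y] \<open>x \<le> y\<close> by (simp add: f_def algebra_simps)
  qed
  then show ?thesis
  proof eventually_elim
    fix x assume "f differentiable (at x)"
    then have "(\<lambda>x. f x - (L + 1) * x) differentiable (at x)"
      by (intro derivative_intros)
    then show "g differentiable (at x)" by (simp add: f_def)
  qed
qed

section \<open>Calculus in the plane\<close>

text \<open>The total derivative with the two partial derivatives as explicit arguments, so that the partial
derivatives of a compound expression can be computed by rules.\<close>

definition plane_deriv :: "(point \<Rightarrow> 'a::real_normed_vector) \<Rightarrow> 'a \<Rightarrow> 'a \<Rightarrow> point \<Rightarrow> bool" where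
  "plane_deriv f A B x \<longleftrightarrow> (f has_derivative (\<lambda>h. fst h *\<^sub>R A + snd h *\<^sub>R B)) (at x)"

lemma plane_deriv_const [intro]: "plane_deriv (\<lambda>x. c) 0 0 x"
  by (simp add: plane_deriv_def)

lemma plane_deriv_fst [intro]: "plane_deriv fst (1::real) 0 x"
  unfolding plane_deriv_def by (auto intro!: derivative_eq_intros)

lemma plane_deriv_snd [intro]: "plane_deriv snd (0::real) 1 x"
  unfolding plane_deriv_def by (auto intro!: derivative_eq_intros)

lemma plane_deriv_add:
  "plane_deriv f A B x \<Longrightarrow> plane_deriv g C D x \<Longrightarrow> plane_deriv (\<lambda>x. f x + g x) (A + C) (B + D) x"
  unfolding plane_deriv_def by (auto intro!: derivative_eq_intros simp: algebra_simps)

lemma plane_deriv_diff: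
  "plane_deriv f A B x \<Longrightarrow> plane_deriv g C D x \<Longrightarrow> plane_deriv (\<lambda>x. f x - g x) (A - C) (B - D) x"
  unfolding plane_deriv_def by (auto intro!: derivative_eq_intros simp: algebra_simps)

lemma plane_deriv_mult:
  fixes f g :: "point \<Rightarrow> real"
  shows "plane_deriv f A B x \<Longrightarrow> plane_deriv g C D x \<Longrightarrow>
    plane_deriv (\<lambda>x. f x * g x) (A * g x + f x * C) (B * g x + f x * D) x"
  unfolding plane_deriv_def by (auto intro!: derivative_eq_intros simp: algebra_simps)

lemma plane_deriv_cmult:
  fixes f :: "point \<Rightarrow> real"
  shows "plane_deriv f A B x \<Longrightarrow> plane_deriv (\<lambda>x. c * f x) (c * A) (c * B) x"
  unfolding plane_deriv_def by (auto intro!: derivative_eq_intros simp: algebra_simps)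

lemma plane_deriv_compose:
  fixes f :: "point \<Rightarrow> real" and F :: "real \<Rightarrow> real"
  assumes "plane_deriv f A B x" "(F has_real_derivative F') (at (f x))"
  shows "plane_deriv (\<lambda>x. F (f x)) (F' * A) (F' * B) x"
  using has_derivative_compose[OF assms(1)[unfolded plane_deriv_def]
      assms(2)[unfolded has_field_derivative_def]]
  by (simp add: plane_deriv_def algebra_simps)

lemma plane_deriv_fst_comp:
  fixes f :: "point \<Rightarrow> 'a::real_normed_vector \<times> 'b::real_normed_vector"
  shows "plane_deriv f A B x \<Longrightarrow> plane_deriv (\<lambda>x. fst (f x)) (fst A) (fst B) x"
  unfolding plane_deriv_def by (auto intro!: derivative_eq_intros)

lemma plane_deriv_snd_comp:
  fixes f :: "point \<Rightarrow> 'a::real_normed_vector \<times> 'b::real_normed_vector"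
  shows "plane_deriv f A B x \<Longrightarrow> plane_deriv (\<lambda>x. snd (f x)) (snd A) (snd B) x"
  unfolding plane_deriv_def by (auto intro!: derivative_eq_intros)

lemma plane_deriv_continuous_on:
  assumes "\<And>x. x \<in> S \<Longrightarrow> plane_deriv f (A x) (B x) x"
  shows "continuous_on S f"
proof (rule continuous_at_imp_continuous_on, rule ballI)
  fix x assume "x \<in> S"
  then show "isCont f x"
    using assms has_derivative_continuous unfolding plane_deriv_def by blast
qed

lemma plane_deriv_curve:
  assumes f: "plane_deriv f A B (a s, b s)"
    and a: "(a has_real_derivative a') (at s within T)"
    and b: "(b has_real_derivative b') (at s within T)"
  shows "((\<lambda>s. f (a s, b s)) has_vector_derivative a' *\<^sub>R A + b' *\<^sub>R B) (at s within T)"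
proof -
  have "((\<lambda>s. (a s, b s)) has_derivative (\<lambda>h. (a' * h, b' * h))) (at s within T)"
    using a b by (auto intro!: has_derivative_Pair simp: has_field_derivative_def)
  from has_derivative_compose[OF this f[unfolded plane_deriv_def]]
  show ?thesis
    by (simp add: has_vector_derivative_def algebra_simps)
qed

lemma plane_deriv_graph:
  fixes f :: "point \<Rightarrow> real"
  assumes "plane_deriv f A B (s, g s)" "(g has_real_derivative g') (at s within T)"
  shows "((\<lambda>s. f (s, g s)) has_real_derivative A + B * g') (at s within T)"
  using plane_deriv_curve[of f A B "\<lambda>s. s" s g 1 T g'] assms
  by (simp add: has_real_derivative_iff_has_vector_derivative mult.commute)

lemma plane_deriv_vertical:
  fixes f :: "point \<Rightarrow> real"
  assumes "plane_deriv f A B (x, g s)" "(g has_real_derivative g') (at s within T)"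
  shows "((\<lambda>s. f (x, g s)) has_real_derivative B * g') (at s within T)"
  using plane_deriv_curve[of f A B "\<lambda>s. x" s g 0 T g'] assms
  by (simp add: has_real_derivative_iff_has_vector_derivative mult.commute)

lemma differentiable_plane_deriv:
  assumes "f differentiable (at x)"
  shows "plane_deriv f (dx1 f x) (dx2 f x) x"
proof -
  obtain f' where f': "(f has_derivative f') (at x)"
    using assms by (auto simp: differentiable_def)
  have lin: "f' (h, k) = h *\<^sub>R f' (1, 0) + k *\<^sub>R f' (0, 1)" for h k
  proof -
    have "f' (h, k) = f' (h *\<^sub>R (1, 0) + k *\<^sub>R (0, 1))" by simp
    also have "\<dots> = h *\<^sub>R f' (1, 0) + k *\<^sub>R f' (0, 1)"
      using has_derivative_linear[OF f'] by (simp only: linear_add linear_scale)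
    finally show ?thesis .
  qed
  have "f' = (\<lambda>h. fst h *\<^sub>R f' (1, 0) + snd h *\<^sub>R f' (0, 1))"
  proof
    fix h show "f' h = fst h *\<^sub>R f' (1, 0) + snd h *\<^sub>R f' (0, 1)"
      using lin[of "fst h" "snd h"] by simp
  qed
  then have pd: "plane_deriv f (f' (1, 0)) (f' (0, 1)) x"
    using f' unfolding plane_deriv_def by metis
  have "((\<lambda>s. f (s, snd x)) has_vector_derivative f' (1, 0)) (at (fst x))"
    using plane_deriv_curve[of f _ _ "\<lambda>s. s" "fst x" "\<lambda>s. snd x" 1 UNIV 0] pd
    by (auto intro!: derivative_eq_intros)
  then have "dx1 f x = f' (1, 0)"
    unfolding dx1_def by (rule vector_derivative_at)
  moreover have "((\<lambda>s. f (fst x, s)) has_vector_derivative f' (0, 1)) (at (snd x))"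
    using plane_deriv_curve[of f _ _ "\<lambda>s. fst x" "snd x" "\<lambda>s. s" 0 UNIV 1] pd
    by (auto intro!: derivative_eq_intros)
  then have "dx2 f x = f' (0, 1)"
    unfolding dx2_def by (rule vector_derivative_at)
  ultimately show ?thesis using pd by simp
qed

text \<open>By the mean value theorem, applied in the two possible orders, the second difference of \<open>f\<close> over a
small square is both a value of \<open>\<partial>\<^sub>2\<partial>\<^sub>1 f\<close> and a value of \<open>\<partial>\<^sub>1\<partial>\<^sub>2 f\<close> near \<open>x\<close>.\<close>

lemma symmetric_second_derivatives:
  fixes f A B A2 B1 :: "point \<Rightarrow> real"
  assumes S: "open S" "x \<in> S"
    and f: "\<And>y. y \<in> S \<Longrightarrow> plane_deriv f (A y) (B y) y"
    and A: "\<And>y. y \<in> S \<Longrightarrow> plane_deriv A (A1 y) (A2 y) y"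
    and B: "\<And>y. y \<in> S \<Longrightarrow> plane_deriv B (B1 y) (B2 y) y"
    and cont: "continuous_on S A2" "continuous_on S B1"
  shows "A2 x = B1 x"
proof (rule ccontr)
  assume "A2 x \<noteq> B1 x"
  define e where "e = \<bar>A2 x - B1 x\<bar> / 2"
  have "e > 0" using \<open>A2 x \<noteq> B1 x\<close> by (simp add: e_def)
  obtain d0 where d0: "d0 > 0" "ball x d0 \<subseteq> S" using S by (meson openE)
  have "isCont A2 x" "isCont B1 x"
    using cont S continuous_on_eq_continuous_at by blast+
  then have ex: "\<exists>d>0. \<forall>y. dist y x < d \<longrightarrow> dist (A2 y) (A2 x) < e"
    "\<exists>d>0. \<forall>y. dist y x < d \<longrightarrow> dist (B1 y) (B1 x) < e"
    using \<open>e > 0\<close> unfolding continuous_at_eps_delta by blast+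
  from ex(1) obtain d1 where d1: "d1 > 0" "\<And>y. dist y x < d1 \<Longrightarrow> dist (A2 y) (A2 x) < e" by blast
  from ex(2) obtain d2 where d2: "d2 > 0" "\<And>y. dist y x < d2 \<Longrightarrow> dist (B1 y) (B1 x) < e" by blast
  define h where "h = min d0 (min d1 d2) / 3"
  have h: "h > 0" using d0 d1 d2 by (simp add: h_def)
  obtain a b where x: "x = (a, b)" by (cases x)
  have near: "dist (s, t) x < d0 \<and> dist (s, t) x < d1 \<and> dist (s, t) x < d2"
    if "a \<le> s" "s \<le> a + h" "b \<le> t" "t \<le> b + h" for s t
  proof -
    have "dist (s, t) x \<le> \<bar>s - a\<bar> + \<bar>t - b\<bar>"
      using norm_Pair_le[of "s - a" "t - b"] by (simp add: x dist_norm)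
    then show ?thesis using that h d0(1) d1(1) d2(1) unfolding h_def by linarith
  qed
  then have inS: "(s, t) \<in> S" if "a \<le> s" "s \<le> a + h" "b \<le> t" "t \<le> b + h" for s t
    using d0(2) that by (auto simp: dist_commute)
  have D1: "((\<lambda>s. g (s, t)) has_real_derivative g1 (s, t)) (at s)"
    if "plane_deriv g (g1 (s, t)) (g2 (s, t)) (s, t)" for g g1 g2 :: "point \<Rightarrow> real" and s t
    using plane_deriv_curve[of g _ _ "\<lambda>s. s" s "\<lambda>s. t" 1 UNIV 0] that
    by (auto intro!: derivative_eq_intros simp: has_real_derivative_iff_has_vector_derivative)
  have D2: "((\<lambda>t. g (s, t)) has_real_derivative g2 (s, t)) (at t)"
    if "plane_deriv g (g1 (s, t)) (g2 (s, t)) (s, t)" for g g1 g2 :: "point \<Rightarrow> real" and s t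
    using plane_deriv_curve[of g _ _ "\<lambda>t. s" t "\<lambda>t. t" 0 UNIV 1] that
    by (auto intro!: derivative_eq_intros simp: has_real_derivative_iff_has_vector_derivative)
  let ?D = "f (a + h, b + h) - f (a + h, b) - f (a, b + h) + f (a, b)"
  have "\<exists>s. a < s \<and> s < a + h \<and> (f (a + h, b + h) - f (a + h, b)) - (f (a, b + h) - f (a, b)) =
      (a + h - a) * (A (s, b + h) - A (s, b))"
    using h by (intro MVT2) (auto intro!: derivative_eq_intros D1 f inS)
  then obtain s1 where s1: "a < s1" "s1 < a + h" "?D = h * (A (s1, b + h) - A (s1, b))"
    by (auto simp: algebra_simps)
  have "\<exists>t. b < t \<and> t < b + h \<and> A (s1, b + h) - A (s1, b) = (b + h - b) * A2 (s1, t)"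
    using h s1 by (intro MVT2) (auto intro!: D2 A inS)
  then obtain t1 where t1: "b < t1" "t1 < b + h" "?D = h * h * A2 (s1, t1)"
    using s1(3) by (auto simp: algebra_simps)
  have "\<exists>t. b < t \<and> t < b + h \<and> (f (a + h, b + h) - f (a, b + h)) - (f (a + h, b) - f (a, b)) =
      (b + h - b) * (B (a + h, t) - B (a, t))"
    using h by (intro MVT2) (auto intro!: derivative_eq_intros D2 f inS)
  then obtain t2 where t2: "b < t2" "t2 < b + h" "?D = h * (B (a + h, t2) - B (a, t2))"
    by (auto simp: algebra_simps)
  have "\<exists>s. a < s \<and> s < a + h \<and> B (a + h, t2) - B (a, t2) = (a + h - a) * B1 (s, t2)"
    using h t2 by (intro MVT2) (auto intro!: D1 B inS)
  then obtain s2 where s2: "a < s2" "s2 < a + h" "?D = h * h * B1 (s2, t2)"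
    using t2(3) by (auto simp: algebra_simps)
  have "A2 (s1, t1) = B1 (s2, t2)" using t1(3) s2(3) h by simp
  moreover have "dist (A2 (s1, t1)) (A2 x) < e" "dist (B1 (s2, t2)) (B1 x) < e"
    using d1(2)[of "(s1, t1)"] d2(2)[of "(s2, t2)"] near[of s1 t1] near[of s2 t2] s1(1,2) t1(1,2) s2(1,2) t2(1,2)
    by auto
  ultimately have "\<bar>A2 x - B1 x\<bar> < 2 * e" unfolding dist_real_def by arith
  then show False by (simp add: e_def)
qed

lemma plane_deriv_dx:
  assumes "plane_deriv f A B x"
  shows "dx1 f x = A" "dx2 f x = B"
proof -
  have "((\<lambda>s. f (s, snd x)) has_vector_derivative A) (at (fst x))"
    using plane_deriv_curve[of f A B "\<lambda>s. s" "fst x" "\<lambda>s. snd x" 1 UNIV 0] assms by simp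
  then show "dx1 f x = A" unfolding dx1_def by (rule vector_derivative_at)
  have "((\<lambda>s. f (fst x, s)) has_vector_derivative B) (at (snd x))"
    using plane_deriv_curve[of f A B "\<lambda>s. fst x" "snd x" "\<lambda>s. s" 0 UNIV 1] assms by simp
  then show "dx2 f x = B" unfolding dx2_def by (rule vector_derivative_at)
qed

lemma plane_deriv_transform_open:
  assumes "plane_deriv f A B x" "open S" "x \<in> S" "\<And>y. y \<in> S \<Longrightarrow> f y = g y"
  shows "plane_deriv g A B x"
  using assms unfolding plane_deriv_def by (rule has_derivative_transform_within_open)

lemma gradient_periodic:
  assumes S: "open S" "x \<in> S" and f: "f differentiable (at (fst x + \<Gamma>, snd x))"
    and per: "\<And>y. y \<in> S \<Longrightarrow> f (fst y + \<Gamma>, snd y) = f y"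
  shows "dx1 f (fst x + \<Gamma>, snd x) = dx1 f x" "dx2 f (fst x + \<Gamma>, snd x) = dx2 f x"
proof -
  let ?x = "(fst x + \<Gamma>, snd x)"
  have "plane_deriv f (dx1 f ?x) (dx2 f ?x) ?x" using f by (rule differentiable_plane_deriv)
  moreover have "((\<lambda>y::point. (fst y + \<Gamma>, snd y)) has_derivative (\<lambda>h. h)) (at x)"
    by (auto intro!: derivative_eq_intros)
  ultimately have "plane_deriv (\<lambda>y. f (fst y + \<Gamma>, snd y)) (dx1 f ?x) (dx2 f ?x) x"
    unfolding plane_deriv_def using has_derivative_compose by fastforce
  then have "plane_deriv f (dx1 f ?x) (dx2 f ?x) x"
    using S by (rule plane_deriv_transform_open) (use per in auto)
  then show "dx1 f ?x = dx1 f x" "dx2 f ?x = dx2 f x" by (simp_all add: plane_deriv_dx)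
qed

lemma C1_in_space_plane_deriv:
  "C1_in_space S f \<Longrightarrow> 0 < t \<Longrightarrow> x \<in> S \<Longrightarrow> plane_deriv (f t) (dx1 (f t) x) (dx2 (f t) x) x"
  by (auto simp: C1_in_space_def intro: differentiable_plane_deriv)

lemma C1_in_space_continuous:
  assumes "C1_in_space S f"
  shows "continuous_on ({0<..} \<times> S) (\<lambda>(t, x). f t x)"
    "continuous_on ({0<..} \<times> S) (\<lambda>(t, x). dx1 (f t) x)"
    "continuous_on ({0<..} \<times> S) (\<lambda>(t, x). dx2 (f t) x)"
proof -
  have g: "continuous_on ({0<..} \<times> S) (\<lambda>z. grad (f (fst z)) (snd z))"
    using assms by (simp add: C1_in_space_def split_beta)
  show "continuous_on ({0<..} \<times> S) (\<lambda>(t, x). f t x)" using assms by (simp add: C1_in_space_def)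
  show "continuous_on ({0<..} \<times> S) (\<lambda>(t, x). dx1 (f t) x)"
    using continuous_on_fst[OF g] by (simp add: grad_def split_beta)
  show "continuous_on ({0<..} \<times> S) (\<lambda>(t, x). dx2 (f t) x)"
    using continuous_on_snd[OF g] by (simp add: grad_def split_beta)
qed

section \<open>The divergence theorem between two graphs\<close>

text \<open>The integral of \<open>f\<close> over the region between the graphs of \<open>l\<close> and \<open>r\<close>, written on the rectangle
that parametrizes this region by straightening its vertical segments.  The domain of integration is
then fixed, and continuity in parameters on which \<open>l\<close>, \<open>r\<close> and \<open>f\<close> depend is immediate.\<close>

definition area :: "real \<Rightarrow> (real \<Rightarrow> real) \<Rightarrow> (real \<Rightarrow> real) \<Rightarrow> (point \<Rightarrow> real) \<Rightarrow> real" where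
  "area \<Gamma> l r f = integral (cbox (0, 0) (\<Gamma>, 1))
     (\<lambda>w. f (fst w, (1 - snd w) * l (fst w) + snd w * r (fst w)) * (r (fst w) - l (fst w)))"

definition region :: "real \<Rightarrow> (real \<Rightarrow> real) \<Rightarrow> (real \<Rightarrow> real) \<Rightarrow> point set" where
  "region \<Gamma> l r = {x. 0 \<le> fst x \<and> fst x \<le> \<Gamma> \<and> l (fst x) \<le> snd x \<and> snd x \<le> r (fst x)}"

text \<open>The lateral sides belong to this set: the fields are periodic and smooth across them.\<close>

definition open_region :: "real \<Rightarrow> (real \<Rightarrow> real) \<Rightarrow> (real \<Rightarrow> real) \<Rightarrow> point set" where
  "open_region \<Gamma> l r = {x. 0 \<le> fst x \<and> fst x \<le> \<Gamma> \<and> l (fst x) < snd x \<and> snd x < r (fst x)}"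

lemma straightened_in_region:
  assumes "\<And>x. 0 \<le> x \<Longrightarrow> x \<le> \<Gamma> \<Longrightarrow> l x \<le> r x" "w \<in> cbox (0, 0) (\<Gamma>, 1)"
  shows "(fst w, (1 - snd w) * l (fst w) + snd w * r (fst w)) \<in> region \<Gamma> l r"
proof -
  obtain x z where w: "w = (x, z)" by (cases w)
  have xz: "0 \<le> x" "x \<le> \<Gamma>" "0 \<le> z" "z \<le> 1" using assms(2) by (auto simp: w cbox_Pair_eq)
  then have "l x \<le> r x" using assms(1) by auto
  then have "0 \<le> z * (r x - l x)" "0 \<le> (1 - z) * (r x - l x)" using xz by simp_all
  then show ?thesis using xz by (simp add: region_def w algebra_simps)
qed

lemma area_eq_iterated:
  assumes cont: "continuous_on (region \<Gamma> l r) f"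
    and l: "continuous_on {0..\<Gamma>} l" and r: "continuous_on {0..\<Gamma>} r"
    and le: "\<And>x. 0 \<le> x \<Longrightarrow> x \<le> \<Gamma> \<Longrightarrow> l x \<le> r x"
  shows "area \<Gamma> l r f = integral {0..\<Gamma>} (\<lambda>x. integral {l x..r x} (\<lambda>y. f (x, y)))"
proof -
  let ?F = "\<lambda>w. f (fst w, (1 - snd w) * l (fst w) + snd w * r (fst w)) * (r (fst w) - l (fst w))"
  have "continuous_on (cbox (0, 0) (\<Gamma>, 1)) ?F"
    by (intro continuous_intros continuous_on_compose2[OF cont] continuous_on_compose2[OF l]
          continuous_on_compose2[OF r])
       (auto simp: cbox_Pair_eq intro!: straightened_in_region[of \<Gamma> l r "(_, _)", simplified] le)
  then have "area \<Gamma> l r f = integral {0..\<Gamma>} (\<lambda>x. integral {0..1} (\<lambda>z. ?F (x, z)))"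
    unfolding area_def by (subst integral_prod_continuous) auto
  also have "\<dots> = integral {0..\<Gamma>} (\<lambda>x. integral {l x..r x} (\<lambda>y. f (x, y)))"
  proof (rule integral_cong)
    fix x assume x: "x \<in> {0..\<Gamma>}"
    then have lr: "l x \<le> r x" using le by auto
    have "((\<lambda>z. (r x - l x) *\<^sub>R f (x, (1 - z) * l x + z * r x)) has_integral
       (integral {(1 - 0) * l x + 0 * r x..(1 - 1) * l x + 1 * r x} (\<lambda>y. f (x, y)))) {0..1}"
    proof (rule has_integral_substitution)
      show "(\<lambda>z. (1 - z) * l x + z * r x) ` {0..1} \<subseteq> {l x..r x}"
        using straightened_in_region[of \<Gamma> l r "(x, z)" for z] le x
        by (fastforce simp: cbox_Pair_eq region_def)
      show "continuous_on {l x..r x} (\<lambda>y. f (x, y))"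
        using x by (intro continuous_on_compose2[OF cont] continuous_intros) (auto simp: region_def)
    qed (auto intro!: derivative_eq_intros simp: lr)
    then show "integral {0..1} (\<lambda>z. ?F (x, z)) = integral {l x..r x} (\<lambda>y. f (x, y))"
      by (simp add: has_integral_iff mult.commute)
  qed
  finally show ?thesis .
qed

text \<open>In the straightened coordinates \<open>(x, z)\<close> the integrand is the sum of an \<open>x\<close>-derivative, which
integrates to zero by periodicity, and a \<open>z\<close>-derivative, which leaves the two boundary terms.\<close>

lemma divergence_between_graphs:
  fixes l r l' r' :: "real \<Rightarrow> real" and V1 V2 A11 A12 A21 A22 :: "point \<Rightarrow> real"
  assumes \<Gamma>: "0 \<le> \<Gamma>"
    and l: "\<And>x. 0 \<le> x \<Longrightarrow> x \<le> \<Gamma> \<Longrightarrow> (l has_real_derivative l' x) (at x)"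
    and r: "\<And>x. 0 \<le> x \<Longrightarrow> x \<le> \<Gamma> \<Longrightarrow> (r has_real_derivative r' x) (at x)"
    and l': "continuous_on {0..\<Gamma>} l'" and r': "continuous_on {0..\<Gamma>} r'"
    and le: "\<And>x. 0 \<le> x \<Longrightarrow> x \<le> \<Gamma> \<Longrightarrow> l x \<le> r x"
    and V1: "\<And>x. x \<in> region \<Gamma> l r \<Longrightarrow> plane_deriv V1 (A11 x) (A12 x) x"
    and V2: "\<And>x. x \<in> region \<Gamma> l r \<Longrightarrow> plane_deriv V2 (A21 x) (A22 x) x"
    and A: "continuous_on (region \<Gamma> l r) A11" "continuous_on (region \<Gamma> l r) A12"
           "continuous_on (region \<Gamma> l r) A22"
    and per: "l 0 = l \<Gamma>" "r 0 = r \<Gamma>" "\<And>y. l 0 \<le> y \<Longrightarrow> y \<le> r 0 \<Longrightarrow> V1 (0, y) = V1 (\<Gamma>, y)"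
  shows "area \<Gamma> l r (\<lambda>x. A11 x + A22 x) =
     integral {0..\<Gamma>} (\<lambda>x. V2 (x, r x) - r' x * V1 (x, r x)) -
     integral {0..\<Gamma>} (\<lambda>x. V2 (x, l x) - l' x * V1 (x, l x))"
proof -
  define g where "g w = (1 - snd w) * l (fst w) + snd w * r (fst w)" for w :: point
  define gx where "gx w = (1 - snd w) * l' (fst w) + snd w * r' (fst w)" for w :: point
  define J where "J w = r (fst w) - l (fst w)" for w :: point
  define J' where "J' w = r' (fst w) - l' (fst w)" for w :: point
  let ?G = "\<lambda>w. (fst w, g w)"
  let ?B = "cbox (0, 0) (\<Gamma>, 1) :: point set"
  define P where "P w = (A11 (?G w) + A12 (?G w) * gx w) * J w + V1 (?G w) * J' w" for w
  define Q where "Q w = A22 (?G w) * J w - (A12 (?G w) * J w * gx w + V1 (?G w) * J' w)" for w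
  have G: "?G w \<in> region \<Gamma> l r" if "w \<in> ?B" for w
    using straightened_in_region[OF le that] by (simp add: g_def)
  have lc: "continuous_on {0..\<Gamma>} l" and rc: "continuous_on {0..\<Gamma>} r"
    using l r by (auto intro!: continuous_at_imp_continuous_on DERIV_isCont)
  have V1c: "continuous_on (region \<Gamma> l r) V1"
    using V1 by (rule plane_deriv_continuous_on)
  have fst_B: "fst ` ?B \<subseteq> {0..\<Gamma>}" by (auto simp: cbox_Pair_eq)
  have gc: "continuous_on ?B g" unfolding g_def
    by (intro continuous_intros continuous_on_compose2[OF lc] continuous_on_compose2[OF rc])
       (auto simp: cbox_Pair_eq)
  have gxc: "continuous_on ?B gx" unfolding gx_def
    by (intro continuous_intros continuous_on_compose2[OF l'] continuous_on_compose2[OF r'])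
       (auto simp: cbox_Pair_eq)
  have Jc: "continuous_on ?B J" unfolding J_def
    by (intro continuous_intros continuous_on_compose2[OF lc] continuous_on_compose2[OF rc])
       (auto simp: cbox_Pair_eq)
  have J'c: "continuous_on ?B J'" unfolding J'_def
    by (intro continuous_intros continuous_on_compose2[OF l'] continuous_on_compose2[OF r'])
       (auto simp: cbox_Pair_eq)
  have comp: "continuous_on ?B (\<lambda>w. F (?G w))" if "continuous_on (region \<Gamma> l r) F" for F :: "point \<Rightarrow> real"
    by (rule continuous_on_compose2[OF that]) (auto intro!: continuous_intros gc G)
  have Pc: "continuous_on ?B P" unfolding P_def
    by (intro continuous_intros comp A gxc Jc J'c V1c)
  have Qc: "continuous_on ?B Q" unfolding Q_def
    by (intro continuous_intros comp A gxc Jc J'c V1c)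
  have gdx: "((\<lambda>x. g (x, z)) has_real_derivative gx (x, z)) (at x)" if "0 \<le> x" "x \<le> \<Gamma>" for x z
    unfolding g_def gx_def using l[OF that] r[OF that] by (auto intro!: derivative_eq_intros)
  have gdz: "((\<lambda>z. g (x, z)) has_real_derivative J (x, z)) (at z)" for x z
    unfolding g_def J_def by (auto intro!: derivative_eq_intros)
  have "area \<Gamma> l r (\<lambda>x. A11 x + A22 x) = integral ?B (\<lambda>w. P w + Q w)"
    unfolding area_def by (intro integral_cong) (simp add: P_def Q_def g_def J_def algebra_simps)
  also have "\<dots> = integral ?B P + integral ?B Q"
    using Pc Qc by (intro integral_add integrable_continuous)
  also have "integral ?B P = 0"
  proof -
    have "integral ?B P = integral {0..\<Gamma>} (\<lambda>x. integral {0..1} (\<lambda>z. P (x, z)))"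
      using integral_prod_continuous[OF Pc] by simp
    also have "\<dots> = integral {0..1} (\<lambda>z. integral {0..\<Gamma>} (\<lambda>x. P (x, z)))"
      using integral_swap_continuous[of 0 0 \<Gamma> 1 "\<lambda>x z. P (x, z)"] Pc by simp
    also have "\<dots> = integral {0..1::real} (\<lambda>z. 0)"
    proof (rule integral_cong)
      fix z :: real assume z: "z \<in> {0..1}"
      have "((\<lambda>x. P (x, z)) has_integral
           (V1 (?G (\<Gamma>, z)) * J (\<Gamma>, z) - V1 (?G (0, z)) * J (0, z))) {0..\<Gamma>}"
      proof (rule fundamental_theorem_of_calculus[OF \<Gamma>])
        fix x assume x: "x \<in> {0..\<Gamma>}"
        have Gin: "?G (x, z) \<in> region \<Gamma> l r" using x z by (intro G) (auto simp: cbox_Pair_eq)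
        have "((\<lambda>x. V1 (x, g (x, z))) has_real_derivative
              A11 (?G (x, z)) + A12 (?G (x, z)) * gx (x, z)) (at x within {0..\<Gamma>})"
          using plane_deriv_graph[of V1 _ _ x "\<lambda>x. g (x, z)"] V1[OF Gin] gdx[of x z] x
          by (auto intro: has_field_derivative_at_within)
        moreover have "((\<lambda>x. J (x, z)) has_real_derivative J' (x, z)) (at x within {0..\<Gamma>})"
          unfolding J_def J'_def fst_conv
          by (intro DERIV_diff has_field_derivative_at_within[OF l] has_field_derivative_at_within[OF r])
            (use x in auto)
        ultimately have "((\<lambda>x. V1 (x, g (x, z)) * J (x, z)) has_real_derivative P (x, z)) (at x within {0..\<Gamma>})"
          by (rule DERIV_cong[OF DERIV_mult]) (simp_all add: P_def)
        then show "((\<lambda>x. V1 (?G (x, z)) * J (x, z)) has_vector_derivative P (x, z)) (at x within {0..\<Gamma>})"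
          by (simp add: has_real_derivative_iff_has_vector_derivative)
      qed
      moreover have "J (\<Gamma>, z) = J (0, z)" "g (\<Gamma>, z) = g (0, z)" using per by (auto simp: J_def g_def)
      moreover have "V1 (0, g (0, z)) = V1 (\<Gamma>, g (0, z))"
        using G[of "(0, z)"] z \<Gamma> by (intro per(3)) (auto simp: region_def cbox_Pair_eq)
      ultimately show "integral {0..\<Gamma>} (\<lambda>x. P (x, z)) = 0" by (simp add: integral_unique)
    qed
    finally show ?thesis by simp
  qed
  also have "integral ?B Q = integral {0..\<Gamma>} (\<lambda>x. integral {0..1} (\<lambda>z. Q (x, z)))"
    using integral_prod_continuous[OF Qc] by simp
  also have "\<dots> = integral {0..\<Gamma>} (\<lambda>x. (V2 (x, r x) - r' x * V1 (x, r x)) - (V2 (x, l x) - l' x * V1 (x, l x)))"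
  proof (rule integral_cong)
    fix x assume x: "x \<in> {0..\<Gamma>}"
    have "((\<lambda>z. Q (x, z)) has_integral
        (V2 (?G (x, 1)) - V1 (?G (x, 1)) * gx (x, 1)) - (V2 (?G (x, 0)) - V1 (?G (x, 0)) * gx (x, 0))) {0..1}"
    proof (rule fundamental_theorem_of_calculus)
      fix z :: real assume z: "z \<in> {0..1}"
      have Gin: "?G (x, z) \<in> region \<Gamma> l r" using x z by (intro G) (auto simp: cbox_Pair_eq)
      have "((\<lambda>z. V1 (x, g (x, z))) has_real_derivative A12 (?G (x, z)) * J (x, z)) (at z within {0..1})"
        using plane_deriv_vertical[of V1 _ _ x "\<lambda>z. g (x, z)" z] V1[OF Gin] gdz[of x z]
        by (auto intro: has_field_derivative_at_within)
      moreover have "((\<lambda>z. V2 (x, g (x, z))) has_real_derivative A22 (?G (x, z)) * J (x, z)) (at z within {0..1})"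
        using plane_deriv_vertical[of V2 _ _ x "\<lambda>z. g (x, z)" z] V2[OF Gin] gdz[of x z]
        by (auto intro: has_field_derivative_at_within)
      moreover have "((\<lambda>z. gx (x, z)) has_real_derivative J' (x, z)) (at z within {0..1})"
        unfolding gx_def J'_def by (auto intro!: derivative_eq_intros)
      ultimately have "((\<lambda>z. V2 (x, g (x, z)) - V1 (x, g (x, z)) * gx (x, z)) has_real_derivative Q (x, z)) (at z within {0..1})"
        by (rule_tac DERIV_cong[OF DERIV_diff[OF _ DERIV_mult]]) (assumption+, simp add: Q_def)
      then show "((\<lambda>z. V2 (?G (x, z)) - V1 (?G (x, z)) * gx (x, z)) has_vector_derivative Q (x, z)) (at z within {0..1})"
        by (simp add: has_real_derivative_iff_has_vector_derivative)
    qed simp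
    then show "integral {0..1} (\<lambda>z. Q (x, z)) = (V2 (x, r x) - r' x * V1 (x, r x)) - (V2 (x, l x) - l' x * V1 (x, l x))"
      by (simp add: integral_unique g_def gx_def mult.commute)
  qed
  also have "\<dots> = integral {0..\<Gamma>} (\<lambda>x. V2 (x, r x) - r' x * V1 (x, r x)) -
     integral {0..\<Gamma>} (\<lambda>x. V2 (x, l x) - l' x * V1 (x, l x))"
  proof (intro integral_diff integrable_continuous_real)
    have V2c: "continuous_on (region \<Gamma> l r) V2"
      using V2 by (rule plane_deriv_continuous_on)
    have *: "continuous_on {0..\<Gamma>} (\<lambda>x. V (x, r x))" "continuous_on {0..\<Gamma>} (\<lambda>x. V (x, l x))"
      if "continuous_on (region \<Gamma> l r) V" for V :: "point \<Rightarrow> real"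
      by (rule continuous_on_compose2[OF that]; auto intro!: continuous_intros lc rc simp: region_def le)+
    show "continuous_on {0..\<Gamma>} (\<lambda>x. V2 (x, r x) - r' x * V1 (x, r x))"
      "continuous_on {0..\<Gamma>} (\<lambda>x. V2 (x, l x) - l' x * V1 (x, l x))"
      by (intro continuous_intros * V1c V2c l' r')+
  qed
  finally show ?thesis by simp
qed

section \<open>Space-time identities\<close>

lemma area_continuous_on_param:
  fixes l r :: "'p::topological_space \<Rightarrow> real \<Rightarrow> real" and F :: "'p \<Rightarrow> point \<Rightarrow> real"
  assumes l: "continuous_on (U \<times> {0..\<Gamma>}) (\<lambda>(p, x). l p x)"
    and r: "continuous_on (U \<times> {0..\<Gamma>}) (\<lambda>(p, x). r p x)"
    and F: "continuous_on (SIGMA p:U. region \<Gamma> (l p) (r p)) (\<lambda>(p, x). F p x)"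
    and le: "\<And>p x. p \<in> U \<Longrightarrow> 0 \<le> x \<Longrightarrow> x \<le> \<Gamma> \<Longrightarrow> l p x \<le> r p x"
  shows "continuous_on U (\<lambda>p. area \<Gamma> (l p) (r p) (F p))"
proof -
  let ?B = "cbox (0, 0) (\<Gamma>, 1) :: point set"
  have lc: "continuous_on (U \<times> ?B) (\<lambda>z. l (fst z) (fst (snd z)))"
    by (rule continuous_on_compose2[OF l[unfolded split_beta], of _ "\<lambda>z. (fst z, fst (snd z))", simplified])
      (auto intro!: continuous_intros simp: cbox_Pair_eq)
  have rc: "continuous_on (U \<times> ?B) (\<lambda>z. r (fst z) (fst (snd z)))"
    by (rule continuous_on_compose2[OF r[unfolded split_beta], of _ "\<lambda>z. (fst z, fst (snd z))", simplified])
      (auto intro!: continuous_intros simp: cbox_Pair_eq)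
  define G where "G z = (fst (snd z), (1 - snd (snd z)) * l (fst z) (fst (snd z)) +
      snd (snd z) * r (fst z) (fst (snd z)))" for z :: "'p \<times> point"
  have Gin: "G z \<in> region \<Gamma> (l (fst z)) (r (fst z))" if "z \<in> U \<times> ?B" for z
    using straightened_in_region[of \<Gamma> "l (fst z)" "r (fst z)" "snd z"] le that
    by (auto simp: G_def)
  have Gc: "continuous_on (U \<times> ?B) G"
    unfolding G_def by (intro continuous_intros lc rc)
  have Fc: "continuous_on (U \<times> ?B) (\<lambda>z. F (fst z) (G z))"
    by (rule continuous_on_compose2[OF F[unfolded split_beta], of _ "\<lambda>z. (fst z, G z)", simplified])
      (use Gin in \<open>auto intro!: continuous_intros Gc\<close>)
  show ?thesis
    unfolding area_def
  proof (rule integral_continuous_on_param)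
    show "continuous_on (U \<times> ?B) (\<lambda>(p, w). F p (fst w, (1 - snd w) * l p (fst w) + snd w * r p (fst w)) *
        (r p (fst w) - l p (fst w)))"
      using Fc lc rc unfolding G_def split_beta by (intro continuous_intros)
  qed
qed

text \<open>The flux of the field \<open>(V1, V2)\<close> through the graph of \<open>g\<close> in the upward direction: the arc length
element turns the upward unit normal into \<open>(- g', 1)\<close>.\<close>

definition flux :: "real \<Rightarrow> real \<Rightarrow> real \<Rightarrow> (real \<Rightarrow> real) \<Rightarrow> (real \<Rightarrow> real) \<Rightarrow>
    (real \<Rightarrow> point \<Rightarrow> real) \<Rightarrow> (real \<Rightarrow> point \<Rightarrow> real) \<Rightarrow> real" where
  "flux a b \<Gamma> g g' V1 V2 = integral (cbox (a, 0) (b, \<Gamma>))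
     (\<lambda>w. V2 (fst w) (snd w, g (snd w)) - g' (snd w) * V1 (fst w) (snd w, g (snd w)))"

lemma continuous_on_compose_pair:
  assumes V: "continuous_on (T \<times> K) (\<lambda>(t, x). V t x)"
    and p: "continuous_on X p" and q: "continuous_on X q"
    and inK: "\<And>z. z \<in> X \<Longrightarrow> p z \<in> T" "\<And>z. z \<in> X \<Longrightarrow> q z \<in> K"
  shows "continuous_on X (\<lambda>z. V (p z) (q z))"
proof -
  have "(\<lambda>z. (p z, q z)) ` X \<subseteq> T \<times> K" using inK by auto
  from continuous_on_compose2[OF V continuous_on_Pair[OF p q] this]
  show ?thesis by simp
qed

lemma continuous_on_along_graph:
  fixes V :: "real \<Rightarrow> point \<Rightarrow> 'a::topological_space"
  assumes V: "continuous_on (T \<times> K) (\<lambda>(t, x). V t x)"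
    and g: "continuous_on {0..\<Gamma>} g"
    and inK: "\<And>x. 0 \<le> x \<Longrightarrow> x \<le> \<Gamma> \<Longrightarrow> (x, g x) \<in> K"
  shows "continuous_on (T \<times> {0..\<Gamma>}) (\<lambda>w. V (fst w) (snd w, g (snd w)))"
  by (intro continuous_on_compose_pair[OF V] continuous_intros continuous_on_compose2[OF g])
     (use inK in auto)

text \<open>The spatial divergence theorem at each time, integrated in time; the density contributes the
increment of its area integral, by differentiation under the integral sign.\<close>

lemma spacetime_divergence:
  fixes e e' V1 V2 A11 A12 A21 A22 f :: "real \<Rightarrow> point \<Rightarrow> real"
  assumes ab: "a \<le> b" and \<Gamma>: "0 \<le> \<Gamma>"
    and l: "\<And>x. 0 \<le> x \<Longrightarrow> x \<le> \<Gamma> \<Longrightarrow> (l has_real_derivative l' x) (at x)"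
    and r: "\<And>x. 0 \<le> x \<Longrightarrow> x \<le> \<Gamma> \<Longrightarrow> (r has_real_derivative r' x) (at x)"
    and l': "continuous_on {0..\<Gamma>} l'" and r': "continuous_on {0..\<Gamma>} r'"
    and le: "\<And>x. 0 \<le> x \<Longrightarrow> x \<le> \<Gamma> \<Longrightarrow> l x \<le> r x"
    and per: "l 0 = l \<Gamma>" "r 0 = r \<Gamma>"
      "\<And>t y. t \<in> {a..b} \<Longrightarrow> l 0 \<le> y \<Longrightarrow> y \<le> r 0 \<Longrightarrow> V1 t (0, y) = V1 t (\<Gamma>, y)"
    and e: "\<And>t x. t \<in> {a..b} \<Longrightarrow> x \<in> region \<Gamma> l r \<Longrightarrow> ((\<lambda>s. e s x) has_real_derivative e' t x) (at t)"
    and V1: "\<And>t x. t \<in> {a..b} \<Longrightarrow> x \<in> region \<Gamma> l r \<Longrightarrow> plane_deriv (V1 t) (A11 t x) (A12 t x) x"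
    and V2: "\<And>t x. t \<in> {a..b} \<Longrightarrow> x \<in> region \<Gamma> l r \<Longrightarrow> plane_deriv (V2 t) (A21 t x) (A22 t x) x"
    and cont: "continuous_on ({a..b} \<times> region \<Gamma> l r) (\<lambda>(t, x). e t x)"
       "continuous_on ({a..b} \<times> region \<Gamma> l r) (\<lambda>(t, x). e' t x)"
       "continuous_on ({a..b} \<times> region \<Gamma> l r) (\<lambda>(t, x). V1 t x)"
       "continuous_on ({a..b} \<times> region \<Gamma> l r) (\<lambda>(t, x). V2 t x)"
       "continuous_on ({a..b} \<times> region \<Gamma> l r) (\<lambda>(t, x). A11 t x)"
       "continuous_on ({a..b} \<times> region \<Gamma> l r) (\<lambda>(t, x). A12 t x)"
       "continuous_on ({a..b} \<times> region \<Gamma> l r) (\<lambda>(t, x). A22 t x)"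
    and f: "\<And>t x. t \<in> {a..b} \<Longrightarrow> x \<in> region \<Gamma> l r \<Longrightarrow> e' t x + A11 t x + A22 t x = f t x"
  shows "area \<Gamma> l r (e b) - area \<Gamma> l r (e a) + flux a b \<Gamma> r r' V1 V2 - flux a b \<Gamma> l l' V1 V2
    = integral {a..b} (\<lambda>t. area \<Gamma> l r (f t))"
proof -
  let ?B = "cbox (0, 0) (\<Gamma>, 1) :: point set" and ?K = "region \<Gamma> l r"
  have lc: "continuous_on {0..\<Gamma>} l" and rc: "continuous_on {0..\<Gamma>} r"
    using l r by (auto intro!: continuous_at_imp_continuous_on DERIV_isCont)
  have slice: "continuous_on ?K (F t)" if "continuous_on ({a..b} \<times> ?K) (\<lambda>(t, x). F t x)" "t \<in> {a..b}"
    for F :: "real \<Rightarrow> point \<Rightarrow> real" and t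
    by (rule continuous_on_compose_pair[OF that(1), of ?K "\<lambda>x. t" "\<lambda>x. x"])
      (use that(2) in \<open>auto intro!: continuous_intros\<close>)
  define G where "G w = (fst w, (1 - snd w) * l (fst w) + snd w * r (fst w))" for w :: point
  define J where "J w = r (fst w) - l (fst w)" for w :: point
  have Gin: "G w \<in> ?K" if "w \<in> ?B" for w
    using straightened_in_region[OF le that] by (simp add: G_def)
  have Gc: "continuous_on ?B G" "continuous_on ?B J" unfolding G_def J_def
    by (intro continuous_intros continuous_on_compose2[OF lc] continuous_on_compose2[OF rc];
        auto simp: cbox_Pair_eq)+
  have area_G: "area \<Gamma> l r h = integral ?B (\<lambda>w. h (G w) * J w)" for h
    by (simp add: area_def G_def J_def)
  have pull: "continuous_on ({a..b} \<times> ?B) (\<lambda>(t, w). F t (G w) * J w)"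
    if F: "continuous_on ({a..b} \<times> ?K) (\<lambda>(t, x). F t x)" for F :: "real \<Rightarrow> point \<Rightarrow> real"
  proof -
    have "continuous_on ({a..b} \<times> ?B) (\<lambda>z. F (fst z) (G (snd z)))"
      by (intro continuous_on_compose_pair[OF F] continuous_intros continuous_on_compose2[OF Gc(1)])
        (use Gin in auto)
    moreover have "continuous_on ({a..b} \<times> ?B) (\<lambda>z. J (snd z))"
      by (intro continuous_on_compose2[OF Gc(2)] continuous_intros) auto
    ultimately show ?thesis unfolding split_beta by (intro continuous_intros)
  qed
  have "((\<lambda>t. area \<Gamma> l r (e' t)) has_integral (area \<Gamma> l r (e b) - area \<Gamma> l r (e a))) {a..b}"
  proof (rule fundamental_theorem_of_calculus[OF ab])
    fix t assume t: "t \<in> {a..b}"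
    have "((\<lambda>t. integral ?B (\<lambda>w. e t (G w) * J w)) has_vector_derivative
        integral ?B (\<lambda>w. e' t (G w) * J w)) (at t within {a..b})"
    proof (rule leibniz_rule_vector_derivative)
      fix s w assume "s \<in> {a..b}" "w \<in> ?B"
      then show "((\<lambda>t. e t (G w) * J w) has_vector_derivative e' s (G w) * J w) (at s within {a..b})"
        using e[of s "G w"] Gin
        by (intro has_vector_derivative_mult_left)
           (auto simp: has_real_derivative_iff_has_vector_derivative[symmetric]
             intro: has_field_derivative_at_within)
    next
      fix s assume "s \<in> {a..b}"
      then have "continuous_on ?B (\<lambda>w. e s (G w))"
        using slice[OF cont(1)] Gin by (intro continuous_on_compose2[OF _ Gc(1)]) auto
      then show "(\<lambda>w. e s (G w) * J w) integrable_on ?B"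
        by (intro integrable_continuous continuous_intros Gc)
    qed (use t pull[OF cont(2)] in auto)
    then show "((\<lambda>t. area \<Gamma> l r (e t)) has_vector_derivative area \<Gamma> l r (e' t)) (at t within {a..b})"
      unfolding area_G .
  qed
  then have e_int: "integral {a..b} (\<lambda>t. area \<Gamma> l r (e' t)) = area \<Gamma> l r (e b) - area \<Gamma> l r (e a)"
    by (rule integral_unique)
  define \<Phi> where "\<Phi> g g' t = integral {0..\<Gamma>} (\<lambda>x. V2 t (x, g x) - g' x * V1 t (x, g x))"
    for g g' :: "real \<Rightarrow> real" and t
  have fluxc: "continuous_on ({a..b} \<times> {0..\<Gamma>}) (\<lambda>w. V2 (fst w) (snd w, g (snd w)) - g' (snd w) * V1 (fst w) (snd w, g (snd w)))"
    if "continuous_on {0..\<Gamma>} g" "continuous_on {0..\<Gamma>} g'" "\<And>x. 0 \<le> x \<Longrightarrow> x \<le> \<Gamma> \<Longrightarrow> (x, g x) \<in> ?K" for g g'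
    by (intro continuous_intros continuous_on_along_graph[OF cont(3)] continuous_on_along_graph[OF cont(4)]
         continuous_on_compose2[OF that(2)] that) auto
  have \<Phi>c: "continuous_on {a..b} (\<Phi> g g')" and \<Phi>flux: "integral {a..b} (\<Phi> g g') = flux a b \<Gamma> g g' V1 V2"
    if "continuous_on {0..\<Gamma>} g" "continuous_on {0..\<Gamma>} g'" "\<And>x. 0 \<le> x \<Longrightarrow> x \<le> \<Gamma> \<Longrightarrow> (x, g x) \<in> ?K" for g g'
  proof -
    show "continuous_on {a..b} (\<Phi> g g')"
      unfolding \<Phi>_def using fluxc[OF that]
      by (intro integral_continuous_on_param[of "{a..b}" 0 \<Gamma>, simplified]) (auto simp: split_beta)
    show "integral {a..b} (\<Phi> g g') = flux a b \<Gamma> g g' V1 V2"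
      unfolding flux_def using fluxc[OF that]
      by (subst integral_prod_continuous) (simp_all add: cbox_Pair_eq \<Phi>_def[abs_def])
  qed
  have rK: "(x, r x) \<in> ?K" and lK: "(x, l x) \<in> ?K" if "0 \<le> x" "x \<le> \<Gamma>" for x
    using that le by (auto simp: region_def)
  have div: "area \<Gamma> l r (f t) = area \<Gamma> l r (e' t) + (\<Phi> r r' t - \<Phi> l l' t)" if t: "t \<in> {a..b}" for t
  proof -
    have "area \<Gamma> l r (f t) = integral ?B (\<lambda>w. e' t (G w) * J w + (A11 t (G w) + A22 t (G w)) * J w)"
      unfolding area_G
      by (intro integral_cong) (simp add: f[OF t Gin, symmetric] algebra_simps)
    also have "\<dots> = area \<Gamma> l r (e' t) + area \<Gamma> l r (\<lambda>x. A11 t x + A22 t x)"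
      unfolding area_G
      using slice[OF cont(2) t] slice[OF cont(5) t] slice[OF cont(7) t] Gin
      by (intro integral_add integrable_continuous continuous_intros continuous_on_compose2[OF _ Gc(1)] Gc) auto
    also have "area \<Gamma> l r (\<lambda>x. A11 t x + A22 t x) = \<Phi> r r' t - \<Phi> l l' t"
      unfolding \<Phi>_def
      by (rule divergence_between_graphs[OF \<Gamma> l r l' r' le V1[OF t] V2[OF t]
            slice[OF cont(5) t] slice[OF cont(6) t] slice[OF cont(7) t] per(1,2) per(3)[OF t]])
    finally show ?thesis .
  qed
  have e'c: "continuous_on {a..b} (\<lambda>t. area \<Gamma> l r (e' t))"
    unfolding area_G using integral_continuous_on_param[OF pull[OF cont(2)]] by simp
  have "integral {a..b} (\<lambda>t. area \<Gamma> l r (f t)) =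
     integral {a..b} (\<lambda>t. area \<Gamma> l r (e' t) + (\<Phi> r r' t - \<Phi> l l' t))"
    using div by (intro integral_cong) auto
  also have "\<dots> = integral {a..b} (\<lambda>t. area \<Gamma> l r (e' t)) + (integral {a..b} (\<Phi> r r') - integral {a..b} (\<Phi> l l'))"
    using \<Phi>c[OF rc r' rK] \<Phi>c[OF lc l' lK] e'c
    by (subst integral_add, intro integrable_continuous_real, simp,
        intro integrable_continuous_real continuous_intros, simp, simp)
       (simp add: integral_diff integrable_continuous_real)
  finally show ?thesis
    using e_int \<Phi>flux[OF rc r' rK] \<Phi>flux[OF lc l' lK] by simp
qed

text \<open>If derivatives exist in the interior only, the identity holds between the curves \<open>l + s\<close> and \<open>r - s\<close>
for small \<open>s > 0\<close>.  All its terms depend continuously on \<open>s\<close> down to \<open>s = 0\<close>, since the densities,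
the fluxes and the source \<open>f\<close> are continuous up to the boundary.\<close>

lemma spacetime_divergence_up_to_boundary:
  fixes e e' V1 V2 A11 A12 A21 A22 f :: "real \<Rightarrow> point \<Rightarrow> real"
  assumes ab: "a \<le> b" and \<Gamma>: "0 \<le> \<Gamma>"
    and l: "\<And>x. 0 \<le> x \<Longrightarrow> x \<le> \<Gamma> \<Longrightarrow> (l has_real_derivative l' x) (at x)"
    and r: "\<And>x. 0 \<le> x \<Longrightarrow> x \<le> \<Gamma> \<Longrightarrow> (r has_real_derivative r' x) (at x)"
    and l': "continuous_on {0..\<Gamma>} l'" and r': "continuous_on {0..\<Gamma>} r'"
    and less: "\<And>x. 0 \<le> x \<Longrightarrow> x \<le> \<Gamma> \<Longrightarrow> l x < r x"
    and per: "l 0 = l \<Gamma>" "r 0 = r \<Gamma>"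
      "\<And>t y. t \<in> {a..b} \<Longrightarrow> l 0 < y \<Longrightarrow> y < r 0 \<Longrightarrow> V1 t (0, y) = V1 t (\<Gamma>, y)"
    and e: "\<And>t x. t \<in> {a..b} \<Longrightarrow> x \<in> open_region \<Gamma> l r \<Longrightarrow> ((\<lambda>s. e s x) has_real_derivative e' t x) (at t)"
    and V1: "\<And>t x. t \<in> {a..b} \<Longrightarrow> x \<in> open_region \<Gamma> l r \<Longrightarrow> plane_deriv (V1 t) (A11 t x) (A12 t x) x"
    and V2: "\<And>t x. t \<in> {a..b} \<Longrightarrow> x \<in> open_region \<Gamma> l r \<Longrightarrow> plane_deriv (V2 t) (A21 t x) (A22 t x) x"
    and cont: "continuous_on ({a..b} \<times> region \<Gamma> l r) (\<lambda>(t, x). e t x)"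
       "continuous_on ({a..b} \<times> open_region \<Gamma> l r) (\<lambda>(t, x). e' t x)"
       "continuous_on ({a..b} \<times> region \<Gamma> l r) (\<lambda>(t, x). V1 t x)"
       "continuous_on ({a..b} \<times> region \<Gamma> l r) (\<lambda>(t, x). V2 t x)"
       "continuous_on ({a..b} \<times> open_region \<Gamma> l r) (\<lambda>(t, x). A11 t x)"
       "continuous_on ({a..b} \<times> open_region \<Gamma> l r) (\<lambda>(t, x). A12 t x)"
       "continuous_on ({a..b} \<times> open_region \<Gamma> l r) (\<lambda>(t, x). A22 t x)"
       "continuous_on ({a..b} \<times> region \<Gamma> l r) (\<lambda>(t, x). f t x)"
    and f: "\<And>t x. t \<in> {a..b} \<Longrightarrow> x \<in> open_region \<Gamma> l r \<Longrightarrow> e' t x + A11 t x + A22 t x = f t x"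
  shows "area \<Gamma> l r (e b) - area \<Gamma> l r (e a) + flux a b \<Gamma> r r' V1 V2 - flux a b \<Gamma> l l' V1 V2
    = integral {a..b} (\<lambda>t. area \<Gamma> l r (f t))"
proof -
  let ?K = "region \<Gamma> l r"
  have lc: "continuous_on {0..\<Gamma>} l" and rc: "continuous_on {0..\<Gamma>} r"
    using l r by (auto intro!: continuous_at_imp_continuous_on DERIV_isCont)
  obtain s0 where s0: "s0 > 0" "\<And>x. 0 \<le> x \<Longrightarrow> x \<le> \<Gamma> \<Longrightarrow> l x + s0 \<le> r x - s0"
  proof -
    have "continuous_on {0..\<Gamma>} (\<lambda>x. r x - l x)" by (intro continuous_intros lc rc)
    then obtain x0 where x0: "x0 \<in> {0..\<Gamma>}" "\<And>x. x \<in> {0..\<Gamma>} \<Longrightarrow> r x0 - l x0 \<le> r x - l x"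
      using continuous_attains_inf[of "{0..\<Gamma>}" "\<lambda>x. r x - l x"] \<Gamma> by auto
    show ?thesis
    proof (rule that)
      show "(r x0 - l x0) / 2 > 0" using less[of x0] x0(1) by simp
      show "l x + (r x0 - l x0) / 2 \<le> r x - (r x0 - l x0) / 2" if "0 \<le> x" "x \<le> \<Gamma>" for x
      proof -
        define m where "m = (r x0 - l x0) / 2"
        have "2 * m \<le> r x - l x" using x0(2)[of x] that by (simp add: m_def)
        then have "l x + m \<le> r x - m" by simp
        then show ?thesis by (simp only: m_def)
      qed
    qed
  qed
  define ls where "ls s x = l x + s" for s x
  define rs where "rs s x = r x - s" for s x
  have sub: "region \<Gamma> (ls s) (rs s) \<subseteq> open_region \<Gamma> l r" if "s > 0" for s
    using that by (auto simp: region_def open_region_def ls_def rs_def)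
  have sub0: "region \<Gamma> (ls s) (rs s) \<subseteq> ?K" if "s \<ge> 0" for s
    using that by (auto simp: region_def ls_def rs_def)
  have open_region_sub: "open_region \<Gamma> l r \<subseteq> ?K" by (auto simp: region_def open_region_def)
  define D where "D s = area \<Gamma> (ls s) (rs s) (e b) - area \<Gamma> (ls s) (rs s) (e a) +
     flux a b \<Gamma> (rs s) r' V1 V2 - flux a b \<Gamma> (ls s) l' V1 V2 -
     integral {a..b} (\<lambda>t. area \<Gamma> (ls s) (rs s) (f t))" for s
  have D0: "D s = 0" if s: "s \<in> {0<..s0}" for s
  proof -
    have K: "region \<Gamma> (ls s) (rs s) \<subseteq> open_region \<Gamma> l r" "region \<Gamma> (ls s) (rs s) \<subseteq> ?K"
      using sub sub0 s by auto
    have "area \<Gamma> (ls s) (rs s) (e b) - area \<Gamma> (ls s) (rs s) (e a) +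
      flux a b \<Gamma> (rs s) r' V1 V2 - flux a b \<Gamma> (ls s) l' V1 V2 =
      integral {a..b} (\<lambda>t. area \<Gamma> (ls s) (rs s) (f t))"
    proof (rule spacetime_divergence[OF ab \<Gamma> _ _ l' r'])
      show "(ls s has_real_derivative l' x) (at x)" "(rs s has_real_derivative r' x) (at x)"
        if "0 \<le> x" "x \<le> \<Gamma>" for x
        using l[OF that] r[OF that] unfolding ls_def rs_def by (auto intro!: derivative_eq_intros)
      show "ls s x \<le> rs s x" if "0 \<le> x" "x \<le> \<Gamma>" for x
        using s0(2)[OF that] s by (auto simp: ls_def rs_def)
      show "V1 t (0, y) = V1 t (\<Gamma>, y)" if "t \<in> {a..b}" "ls s 0 \<le> y" "y \<le> rs s 0" for t y
        using per(3)[of t y] that s by (auto simp: ls_def rs_def)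
      fix t x assume tx: "t \<in> {a..b}" "x \<in> region \<Gamma> (ls s) (rs s)"
      then have x: "x \<in> open_region \<Gamma> l r" using K by blast
      show "((\<lambda>s. e s x) has_real_derivative e' t x) (at t)" by (rule e[OF tx(1) x])
      show "plane_deriv (V1 t) (A11 t x) (A12 t x) x" by (rule V1[OF tx(1) x])
      show "plane_deriv (V2 t) (A21 t x) (A22 t x) x" by (rule V2[OF tx(1) x])
      show "e' t x + A11 t x + A22 t x = f t x" by (rule f[OF tx(1) x])
    next
      show "continuous_on ({a..b} \<times> region \<Gamma> (ls s) (rs s)) (\<lambda>(t, x). e t x)"
        by (rule continuous_on_subset[OF cont(1)]) (use K in blast)
      show "continuous_on ({a..b} \<times> region \<Gamma> (ls s) (rs s)) (\<lambda>(t, x). e' t x)"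
        by (rule continuous_on_subset[OF cont(2)]) (use K in blast)
      show "continuous_on ({a..b} \<times> region \<Gamma> (ls s) (rs s)) (\<lambda>(t, x). V1 t x)"
        by (rule continuous_on_subset[OF cont(3)]) (use K in blast)
      show "continuous_on ({a..b} \<times> region \<Gamma> (ls s) (rs s)) (\<lambda>(t, x). V2 t x)"
        by (rule continuous_on_subset[OF cont(4)]) (use K in blast)
      show "continuous_on ({a..b} \<times> region \<Gamma> (ls s) (rs s)) (\<lambda>(t, x). A11 t x)"
        by (rule continuous_on_subset[OF cont(5)]) (use K in blast)
      show "continuous_on ({a..b} \<times> region \<Gamma> (ls s) (rs s)) (\<lambda>(t, x). A12 t x)"
        by (rule continuous_on_subset[OF cont(6)]) (use K in blast)
      show "continuous_on ({a..b} \<times> region \<Gamma> (ls s) (rs s)) (\<lambda>(t, x). A22 t x)"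
        by (rule continuous_on_subset[OF cont(7)]) (use K in blast)
    qed (use per in \<open>simp_all add: ls_def rs_def\<close>)
    then show ?thesis by (simp add: D_def)
  qed
  have area_cont: "continuous_on ({0..s0} \<times> {a..b}) (\<lambda>p. area \<Gamma> (ls (fst p)) (rs (fst p)) (F (snd p)))"
    if F: "continuous_on ({a..b} \<times> ?K) (\<lambda>(t, x). F t x)" for F :: "real \<Rightarrow> point \<Rightarrow> real"
  proof (rule area_continuous_on_param)
    show "continuous_on (({0..s0} \<times> {a..b}) \<times> {0..\<Gamma>}) (\<lambda>(p, x). ls (fst p) x)"
      "continuous_on (({0..s0} \<times> {a..b}) \<times> {0..\<Gamma>}) (\<lambda>(p, x). rs (fst p) x)"
      unfolding ls_def rs_def split_beta
      by (intro continuous_intros continuous_on_compose2[OF lc] continuous_on_compose2[OF rc]; auto)+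
    show "ls (fst p) x \<le> rs (fst p) x" if "p \<in> {0..s0} \<times> {a..b}" "0 \<le> x" "x \<le> \<Gamma>" for p x
      using s0(2)[OF that(2,3)] that(1) by (auto simp: ls_def rs_def)
    show "continuous_on (SIGMA p:{0..s0} \<times> {a..b}. region \<Gamma> (ls (fst p)) (rs (fst p)))
       (\<lambda>(p, x). F (snd p) x)"
      unfolding split_beta
      by (intro continuous_on_compose_pair[OF F] continuous_intros) (use sub0 in fastforce)+
  qed
  have area_e: "continuous_on {0..s0} (\<lambda>s. area \<Gamma> (ls s) (rs s) (e t))" if "t \<in> {a..b}" for t
    using continuous_on_compose2[OF area_cont[OF cont(1)], of "{0..s0}" "\<lambda>s. (s, t)"] that
    by (simp add: image_subset_iff continuous_on_Pair)
  have area_f: "continuous_on {0..s0} (\<lambda>s. integral {a..b} (\<lambda>t. area \<Gamma> (ls s) (rs s) (f t)))"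
    using area_cont[OF cont(8)]
    by (intro integral_continuous_on_param[of "{0..s0}" a b, simplified]) (simp add: split_beta)
  have flux_c: "continuous_on {0..s0} (\<lambda>s. flux a b \<Gamma> (gs s) g' V1 V2)"
    if gs: "continuous_on ({0..s0} \<times> {0..\<Gamma>}) (\<lambda>p. gs (fst p) (snd p))" and g': "continuous_on {0..\<Gamma>} g'"
     and K: "\<And>s x. s \<in> {0..s0} \<Longrightarrow> 0 \<le> x \<Longrightarrow> x \<le> \<Gamma> \<Longrightarrow> (x, gs s x) \<in> ?K" for gs g'
  proof -
    have gsc: "continuous_on ({0..s0} \<times> cbox (a, 0) (b, \<Gamma>)) (\<lambda>z. gs (fst z) (snd (snd z)))"
      by (rule continuous_on_compose2[OF gs, of _ "\<lambda>z. (fst z, snd (snd z))", simplified])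
        (auto intro!: continuous_intros simp: cbox_Pair_eq)
    have Vc: "continuous_on ({0..s0} \<times> cbox (a, 0) (b, \<Gamma>)) (\<lambda>z. V (fst (snd z)) (snd (snd z), gs (fst z) (snd (snd z))))"
      if V: "continuous_on ({a..b} \<times> ?K) (\<lambda>(t, x). V t x)" for V :: "real \<Rightarrow> point \<Rightarrow> real"
    proof -
      show ?thesis
        by (intro continuous_on_compose_pair[OF V] continuous_intros gsc)
          (use K in \<open>auto simp: cbox_Pair_eq\<close>)
    qed
    have g'c: "continuous_on ({0..s0} \<times> cbox (a, 0) (b, \<Gamma>)) (\<lambda>z. g' (snd (snd z)))"
      by (intro continuous_on_compose2[OF g'] continuous_intros) (auto simp: cbox_Pair_eq)
    have "continuous_on ({0..s0} \<times> cbox (a, 0) (b, \<Gamma>)) (\<lambda>z.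
       V2 (fst (snd z)) (snd (snd z), gs (fst z) (snd (snd z))) -
       g' (snd (snd z)) * V1 (fst (snd z)) (snd (snd z), gs (fst z) (snd (snd z))))"
      by (intro continuous_intros Vc[OF cont(3)] Vc[OF cont(4)] g'c)
    then show ?thesis unfolding flux_def
      by (intro integral_continuous_on_param) (simp add: split_beta)
  qed
  have "continuous_on {0..s0} D"
    unfolding D_def
  proof (intro continuous_intros area_e area_f flux_c l' r')
    show "continuous_on ({0..s0} \<times> {0..\<Gamma>}) (\<lambda>p. rs (fst p) (snd p))"
      "continuous_on ({0..s0} \<times> {0..\<Gamma>}) (\<lambda>p. ls (fst p) (snd p))"
      unfolding ls_def rs_def
      by (intro continuous_intros continuous_on_compose2[OF lc] continuous_on_compose2[OF rc]; auto)+
    fix s x assume "s \<in> {0..s0}" "0 \<le> x" "x \<le> \<Gamma>"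
    then show "(x, rs s x) \<in> ?K" "(x, ls s x) \<in> ?K"
      using s0(2)[of x] by (auto simp: region_def ls_def rs_def)
  qed (use ab in auto)
  moreover have "closure {0<..s0} = {0..s0}" using s0(1) by (rule closure_greaterThanAtMost)
  ultimately have "D 0 = 0"
    using continuous_constant_on_closure[of "{0<..s0}" D 0 0] D0 s0(1) by auto
  moreover have "ls 0 = l" "rs 0 = r" by (auto simp: ls_def rs_def)
  ultimately show ?thesis by (simp add: D_def)
qed

section \<open>Integration by parts against a Lipschitz function\<close>

text \<open>A representative of the derivative that is Borel measurable and bounded everywhere: the limit of
difference quotients, truncated to the interval between \<open>- L\<close> and \<open>L\<close>.\<close>

lemma lipschitz_obtains_derivative:
  fixes g :: "real \<Rightarrow> real"
  assumes g: "L-lipschitz_on UNIV g"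
  obtains g' where "g' \<in> borel_measurable borel" "\<And>x. \<bar>g' x\<bar> \<le> L"
    "AE x in lborel. (g has_real_derivative g' x) (at x)"
proof -
  have L: "0 \<le> L" using g by (rule lipschitz_on_nonneg)
  have gm: "g \<in> borel_measurable borel"
    using lipschitz_on_continuous_on[OF g] by (rule borel_measurable_continuous_onI)
  define q where "q n x = (g (x + 1 / Suc n) - g x) / (1 / Suc n)" for n x
  define g' where "g' x = max (- L) (min L (lim (\<lambda>n. q n x)))" for x
  have "q n \<in> borel_measurable borel" for n
    unfolding q_def using gm by measurable
  then have "g' \<in> borel_measurable borel"
    unfolding g'_def by (intro borel_measurable_max borel_measurable_min borel_measurable_lim_metric) auto
  moreover have "\<bar>g' x\<bar> \<le> L" for x using L by (auto simp: g'_def)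
  moreover have "AE x in lborel. (g has_real_derivative g' x) (at x)"
    using lipschitz_differentiable_AE[OF g]
  proof eventually_elim
    fix x assume "g differentiable (at x)"
    then obtain D where D: "(g has_real_derivative D) (at x)"
      using real_differentiable_def by blast
    have inv0: "filterlim (\<lambda>n. 1 / real (Suc n)) (at 0) sequentially"
      unfolding filterlim_at using LIMSEQ_inverse_real_of_nat by (simp add: inverse_eq_divide)
    have "(\<lambda>n. q n x) \<longlonglongrightarrow> D"
      using filterlim_compose[OF D[unfolded DERIV_def] inv0] by (simp add: q_def)
    moreover have "\<bar>q n x\<bar> \<le> L" for n
    proof -
      have "\<bar>d / c\<bar> \<le> L" if "\<bar>d\<bar> \<le> L * c" "0 < c" for c d :: real
        using that by (simp add: field_simps)
      from this[of "g (x + 1 / Suc n) - g x" "1 / Suc n"] show ?thesis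
        using lipschitz_onD[OF g, of "x + 1 / Suc n" x] by (simp add: q_def dist_real_def)
    qed
    ultimately have "\<bar>D\<bar> \<le> L"
      by (intro tendsto_upperbound[OF tendsto_rabs]) auto
    then have "g' x = D"
      using limI[OF \<open>(\<lambda>n. q n x) \<longlonglongrightarrow> D\<close>] by (auto simp: g'_def)
    then show "(g has_real_derivative g' x) (at x)" using D by simp
  qed
  ultimately show ?thesis using that by blast
qed

text \<open>Difference quotients of a periodic function integrate to zero over a period; for a Lipschitz
function they converge dominatedly to the derivative.\<close>

lemma integral_derivative_periodic_lipschitz:
  fixes F f :: "real \<Rightarrow> real"
  assumes \<Gamma>: "0 < \<Gamma>" and cont: "continuous_on UNIV F"
    and lip: "K-lipschitz_on {0..\<Gamma> + 1} F" and per: "\<And>x. F (x + \<Gamma>) = F x"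
    and f: "f \<in> borel_measurable borel" "AE x in lborel. (F has_real_derivative f x) (at x)"
  shows "(LINT x:{0..\<Gamma>}|lborel. f x) = 0"
proof -
  define c where "c n = 1 / real (Suc n)" for n
  have c: "0 < c n" "c n \<le> 1" for n by (auto simp: c_def)
  define q where "q n x = (F (x + c n) - F x) / c n" for n x
  have Fint: "F integrable_on {x..y}" for x y
    by (intro integrable_continuous_real continuous_on_subset[OF cont]) auto
  have qc: "continuous_on UNIV (q n)" for n
    unfolding q_def using c[of n] by (intro continuous_intros continuous_on_compose2[OF cont]) auto
  have zero: "(LINT x:{0..\<Gamma>}|lborel. q n x) = 0" for n
  proof -
    have "(LINT x:{0..\<Gamma>}|lborel. q n x) = integral {0..\<Gamma>} (q n)"
      by (intro set_borel_integral_eq_integral borel_integrable_atLeastAtMost' continuous_on_subset[OF qc]) auto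
    also have "\<dots> = (integral {0..\<Gamma>} (\<lambda>x. F (x + c n)) - integral {0..\<Gamma>} F) / c n"
      unfolding q_def
      by (subst integral_divide, subst integral_diff)
         (auto intro!: integrable_continuous_real continuous_on_compose2[OF cont] continuous_intros Fint)
    also have "integral {0..\<Gamma>} (\<lambda>x. F (x + c n)) = integral {0 + c n..\<Gamma> + c n} F"
      using integral_shift[of 0 "c n" \<Gamma> F] continuous_on_subset[OF cont] by (auto simp: o_def)
    also have "\<dots> = integral {0..\<Gamma>} F"
    proof -
      have "integral {0..c n} F + integral {c n..\<Gamma> + c n} F = integral {0..\<Gamma> + c n} F"
        using \<Gamma> c[of n] by (intro Henstock_Kurzweil_Integration.integral_combine Fint) auto
      moreover have "integral {0..\<Gamma>} F + integral {\<Gamma>..\<Gamma> + c n} F = integral {0..\<Gamma> + c n} F"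
        using \<Gamma> c[of n] by (intro Henstock_Kurzweil_Integration.integral_combine Fint) auto
      moreover have "integral {\<Gamma>..\<Gamma> + c n} F = integral {0..c n} F"
        using integral_shift[of 0 \<Gamma> "c n" F] continuous_on_subset[OF cont]
        by (auto simp: o_def per add.commute)
      ultimately show ?thesis by simp
    qed
    finally show ?thesis by simp
  qed
  have "(\<lambda>n. LINT x|lborel. indicator {0..\<Gamma>} x *\<^sub>R q n x) \<longlonglongrightarrow> (LINT x|lborel. indicator {0..\<Gamma>} x *\<^sub>R f x)"
  proof (rule integral_dominated_convergence[where w = "\<lambda>x. indicator {0..\<Gamma>} x *\<^sub>R K"])
    show "(\<lambda>x. indicator {0..\<Gamma>} x *\<^sub>R q n x) \<in> borel_measurable lborel" for n
      using borel_measurable_continuous_onI[OF qc[of n]] by measurable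
    show "(\<lambda>x. indicator {0..\<Gamma>} x *\<^sub>R f x) \<in> borel_measurable lborel" using f(1) by measurable
    have "integrable lborel (indicator {0..\<Gamma>} :: real \<Rightarrow> real)"
      using \<Gamma> by (intro integrable_real_indicator) auto
    then show "integrable lborel (\<lambda>x. indicator {0..\<Gamma>} x *\<^sub>R K)" by simp
    show "AE x in lborel. (\<lambda>n. indicator {0..\<Gamma>} x *\<^sub>R q n x) \<longlonglongrightarrow> indicator {0..\<Gamma>} x *\<^sub>R f x"
      using f(2)
    proof eventually_elim
      fix x assume D: "(F has_real_derivative f x) (at x)"
      have c0: "filterlim c (at 0) sequentially"
        unfolding filterlim_at c_def using LIMSEQ_inverse_real_of_nat by (simp add: inverse_eq_divide)
      have "(\<lambda>n. q n x) \<longlonglongrightarrow> f x"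
        using filterlim_compose[OF D[unfolded DERIV_def] c0] by (simp add: q_def)
      then show "(\<lambda>n. indicator {0..\<Gamma>} x *\<^sub>R q n x) \<longlonglongrightarrow> indicator {0..\<Gamma>} x *\<^sub>R f x"
        by (intro tendsto_intros)
    qed
    show "AE x in lborel. norm (indicator {0..\<Gamma>} x *\<^sub>R q n x) \<le> indicator {0..\<Gamma>} x *\<^sub>R K" for n
    proof (rule AE_I2)
      fix x
      show "norm (indicator {0..\<Gamma>} x *\<^sub>R q n x) \<le> indicator {0..\<Gamma>} x *\<^sub>R K"
        using lipschitz_onD[OF lip, of "x + c n" x] c[of n]
        by (auto simp: q_def dist_real_def field_simps indicator_def)
    qed
  qed
  then have "(\<lambda>n. 0) \<longlonglongrightarrow> (LINT x:{0..\<Gamma>}|lborel. f x)"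
    using zero by (simp add: set_lebesgue_integral_def)
  then show ?thesis by (simp add: LIMSEQ_const_iff)
qed

lemma integral_by_parts_lipschitz_periodic:
  fixes g g' w w' :: "real \<Rightarrow> real"
  assumes \<Gamma>: "0 < \<Gamma>" and g: "L-lipschitz_on UNIV g" "\<And>x. g (x + \<Gamma>) = g x"
    and g': "g' \<in> borel_measurable borel" "\<And>x. \<bar>g' x\<bar> \<le> L" "AE x in lborel. (g has_real_derivative g' x) (at x)"
    and w: "\<And>x. (w has_real_derivative w' x) (at x)" "continuous_on UNIV w'" "\<And>x. w (x + \<Gamma>) = w x"
  shows "(LINT x:{0..\<Gamma>}|lborel. g' x * w x) = - integral {0..\<Gamma>} (\<lambda>x. g x * w' x)"
proof -
  have gc: "continuous_on UNIV g" using lipschitz_on_continuous_on[OF g(1)] .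
  have wc: "continuous_on UNIV w"
    using w(1) by (auto intro!: continuous_at_imp_continuous_on DERIV_isCont)
  have [measurable]: "g \<in> borel_measurable borel" "w \<in> borel_measurable borel" "w' \<in> borel_measurable borel"
    "g' \<in> borel_measurable borel"
    using gc wc w(2) g'(1) by (auto intro: borel_measurable_continuous_onI)
  let ?I = "{0..\<Gamma> + 1}"
  have bd: "\<exists>B\<ge>0. \<forall>x\<in>?I. \<bar>h x\<bar> \<le> B" if "continuous_on UNIV h" for h :: "real \<Rightarrow> real"
  proof -
    have "compact (h ` ?I)" by (intro compact_continuous_image continuous_on_subset[OF that]) auto
    then obtain B where "\<forall>x\<in>?I. \<bar>h x\<bar> \<le> B"
      by (auto dest!: compact_imp_bounded simp: bounded_iff)
    then show ?thesis by (intro exI[of _ "max 0 B"]) auto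
  qed
  obtain Bg where Bg: "Bg \<ge> 0" "\<And>x. x \<in> ?I \<Longrightarrow> \<bar>g x\<bar> \<le> Bg" using bd[OF gc] by auto
  obtain Bw where Bw: "Bw \<ge> 0" "\<And>x. x \<in> ?I \<Longrightarrow> \<bar>w x\<bar> \<le> Bw" using bd[OF wc] by auto
  obtain Bd where Bd: "Bd \<ge> 0" "\<And>x. x \<in> ?I \<Longrightarrow> \<bar>w' x\<bar> \<le> Bd" using bd[OF w(2)] by auto
  have wl: "\<bar>w x - w y\<bar> \<le> Bd * \<bar>x - y\<bar>" if "x \<in> ?I" "y \<in> ?I" for x y
    using field_differentiable_bound[of ?I w w' Bd x y] w(1) Bd that
    by (auto intro: has_field_derivative_at_within)
  have L: "0 \<le> L" using g(1) by (rule lipschitz_on_nonneg)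
  have "(Bg * Bd + Bw * L)-lipschitz_on ?I (\<lambda>x. g x * w x)"
  proof (rule lipschitz_onI)
    fix x y assume xy: "x \<in> ?I" "y \<in> ?I"
    have "\<bar>g x * w x - g y * w y\<bar> = \<bar>g x * (w x - w y) + w y * (g x - g y)\<bar>" by (simp add: algebra_simps)
    also have "\<dots> \<le> \<bar>g x\<bar> * \<bar>w x - w y\<bar> + \<bar>w y\<bar> * \<bar>g x - g y\<bar>"
      by (rule order_trans[OF abs_triangle_ineq]) (simp add: abs_mult)
    also have "\<dots> \<le> Bg * (Bd * \<bar>x - y\<bar>) + Bw * (L * \<bar>x - y\<bar>)"
      using wl[OF xy] lipschitz_onD[OF g(1), of x y] Bg Bw xy
      by (intro add_mono mult_mono) (auto simp: dist_real_def)
    finally show "dist (g x * w x) (g y * w y) \<le> (Bg * Bd + Bw * L) * dist x y"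
      by (simp add: dist_real_def algebra_simps)
  qed (use Bg Bw Bd L in auto)
  then have 0: "(LINT x:{0..\<Gamma>}|lborel. g' x * w x + g x * w' x) = 0"
  proof (rule integral_derivative_periodic_lipschitz[OF \<Gamma>, rotated])
    show "AE x in lborel. ((\<lambda>x. g x * w x) has_real_derivative g' x * w x + g x * w' x) (at x)"
      using g'(3) by eventually_elim (auto intro!: derivative_eq_intros w(1))
  qed (use gc wc g(2) w(3) in \<open>auto intro!: continuous_intros\<close>)
  have i2: "set_integrable lborel {0..\<Gamma>} (\<lambda>x. g x * w' x)"
    by (intro borel_integrable_atLeastAtMost' continuous_intros continuous_on_subset[OF gc] continuous_on_subset[OF w(2)]) auto
  have i1: "set_integrable lborel {0..\<Gamma>} (\<lambda>x. g' x * w x)"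
    unfolding set_integrable_def
  proof (rule Bochner_Integration.integrable_bound[where f = "\<lambda>x. indicator {0..\<Gamma>} x *\<^sub>R (L * Bw)"])
    show "AE x in lborel. norm (indicator {0..\<Gamma>} x *\<^sub>R (g' x * w x)) \<le> norm (indicator {0..\<Gamma>} x *\<^sub>R (L * Bw))"
      using g'(2) Bw L by (auto simp: indicator_def abs_mult intro!: mult_mono)
    have "integrable lborel (indicator {0..\<Gamma>} :: real \<Rightarrow> real)"
      using \<Gamma> by (intro integrable_real_indicator) auto
    then show "integrable lborel (\<lambda>x. indicator {0..\<Gamma>} x *\<^sub>R (L * Bw))" by simp
  qed auto
  have "(LINT x:{0..\<Gamma>}|lborel. g' x * w x) + (LINT x:{0..\<Gamma>}|lborel. g x * w' x) = 0"
    using 0 set_integral_add(2)[OF i1 i2] by simp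
  moreover have "(LINT x:{0..\<Gamma>}|lborel. g x * w' x) = integral {0..\<Gamma>} (\<lambda>x. g x * w' x)"
    using i2 by (rule set_borel_integral_eq_integral)
  ultimately show ?thesis by simp
qed

section \<open>Area integrals and planar Lebesgue measure\<close>

lemma region_closed:
  assumes "continuous_on UNIV l" "continuous_on UNIV r"
  shows "closed (region \<Gamma> l r)"
proof -
  have "region \<Gamma> l r = {x. 0 \<le> fst x} \<inter> {x. fst x \<le> \<Gamma>} \<inter> {x. l (fst x) \<le> snd x} \<inter> {x. snd x \<le> r (fst x)}"
    by (auto simp: region_def)
  moreover have "closed \<dots>"
    by (intro closed_Int closed_Collect_le continuous_intros continuous_on_compose2[OF assms(1)]
        continuous_on_compose2[OF assms(2)]) auto
  ultimately show ?thesis by simp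
qed

text \<open>At fixed \<open>x\<close> the inner integral is an area integral over a rectangle of unit width, so that
continuous dependence of area integrals on parameters applies.\<close>

lemma iterated_integral_continuous:
  fixes l r :: "real \<Rightarrow> real" and f :: "point \<Rightarrow> real"
  assumes f: "continuous_on (region \<Gamma> l r) f"
    and lr: "continuous_on {0..\<Gamma>} l" "continuous_on {0..\<Gamma>} r"
    and le: "\<And>x. 0 \<le> x \<Longrightarrow> x \<le> \<Gamma> \<Longrightarrow> l x \<le> r x"
  shows "continuous_on {0..\<Gamma>} (\<lambda>x. integral {l x..r x} (\<lambda>y. f (x, y)))"
proof -
  have "continuous_on {0..\<Gamma>} (\<lambda>x. area 1 (\<lambda>_. l x) (\<lambda>_. r x) (\<lambda>y. f (x, snd y)))"
  proof (rule area_continuous_on_param)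
    show "continuous_on ({0..\<Gamma>} \<times> {0..1}) (\<lambda>(x, _). l x)" "continuous_on ({0..\<Gamma>} \<times> {0..1}) (\<lambda>(x, _). r x)"
      unfolding split_beta
      by (intro continuous_on_compose2[OF lr(1)] continuous_on_compose2[OF lr(2)] continuous_intros; auto)+
    show "continuous_on (SIGMA x:{0..\<Gamma>}. region 1 (\<lambda>_. l x) (\<lambda>_. r x)) (\<lambda>(x, y). f (x, snd y))"
      unfolding split_beta
      by (intro continuous_on_compose2[OF f] continuous_intros) (auto simp: region_def)
  qed (use le in auto)
  moreover have "area 1 (\<lambda>_. l x) (\<lambda>_. r x) (\<lambda>y. f (x, snd y)) = integral {l x..r x} (\<lambda>y. f (x, y))"
    if "x \<in> {0..\<Gamma>}" for x
    using that le[of x]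
    by (subst area_eq_iterated) (auto simp: region_def intro!: continuous_on_compose2[OF f] continuous_intros)
  ultimately show ?thesis
    by (subst (asm) continuous_on_cong[OF refl]) auto
qed

lemma area_eq_nn_integral:
  assumes f: "continuous_on (region \<Gamma> l r) f" and nn: "\<And>x. x \<in> region \<Gamma> l r \<Longrightarrow> 0 \<le> f x"
    and lr: "continuous_on UNIV l" "continuous_on UNIV r"
    and le: "\<And>x. 0 \<le> x \<Longrightarrow> x \<le> \<Gamma> \<Longrightarrow> l x \<le> r x"
  shows "ennreal (area \<Gamma> l r f) = (\<integral>\<^sup>+x\<in>region \<Gamma> l r. ennreal (f x) \<partial>lborel)"
proof -
  let ?K = "region \<Gamma> l r"
  define F where "F x = indicator ?K x *\<^sub>R f x" for x
  have K: "?K \<in> sets borel" using region_closed[OF lr] by auto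
  have Fm: "F \<in> borel_measurable borel"
    unfolding F_def using borel_measurable_continuous_on_indicator[OF K f] by simp
  have Fnn: "0 \<le> F x" for x using nn by (simp add: F_def indicator_def)
  have slice: "\<integral>\<^sup>+y. ennreal (F (x, y)) \<partial>lborel =
      ennreal (indicator {0..\<Gamma>} x * integral {l x..r x} (\<lambda>y. f (x, y)))" for x
  proof (cases "0 \<le> x \<and> x \<le> \<Gamma>")
    case True
    have c: "continuous_on {l x..r x} (\<lambda>y. f (x, y))"
      using True by (intro continuous_on_compose2[OF f] continuous_intros) (auto simp: region_def)
    have i: "set_integrable lborel {l x..r x} (\<lambda>y. f (x, y))"
      by (rule borel_integrable_atLeastAtMost'[OF c])
    have eq: "F (x, y) = indicator {l x..r x} y *\<^sub>R f (x, y)" for y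
      using True by (auto simp: F_def indicator_def region_def)
    have "\<integral>\<^sup>+y. ennreal (F (x, y)) \<partial>lborel = ennreal (LINT y|lborel. F (x, y))"
    proof (rule nn_integral_eq_integral)
      show "integrable lborel (\<lambda>y. F (x, y))" using i unfolding set_integrable_def eq .
      show "AE y in lborel. 0 \<le> F (x, y)" using Fnn by simp
    qed
    also have "(LINT y|lborel. F (x, y)) = integral {l x..r x} (\<lambda>y. f (x, y))"
      using set_borel_integral_eq_integral(2)[OF i] unfolding set_lebesgue_integral_def eq .
    finally show ?thesis using True by simp
  next
    case False
    then have "F (x, y) = 0" for y by (auto simp: F_def indicator_def region_def)
    then show ?thesis using False by (auto simp: indicator_def)
  qed
  have Ic: "continuous_on {0..\<Gamma>} (\<lambda>x. integral {l x..r x} (\<lambda>y. f (x, y)))"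
    by (intro iterated_integral_continuous f continuous_on_subset[OF lr(1)] continuous_on_subset[OF lr(2)] le) auto
  have Ii: "set_integrable lborel {0..\<Gamma>} (\<lambda>x. integral {l x..r x} (\<lambda>y. f (x, y)))"
    by (rule borel_integrable_atLeastAtMost'[OF Ic])
  have "(\<integral>\<^sup>+x\<in>?K. ennreal (f x) \<partial>lborel) = (\<integral>\<^sup>+z. ennreal (F z) \<partial>(lborel \<Otimes>\<^sub>M lborel))"
    unfolding lborel_prod by (intro nn_integral_cong) (auto simp: F_def indicator_def)
  also have "\<dots> = (\<integral>\<^sup>+x. \<integral>\<^sup>+y. ennreal (F (x, y)) \<partial>lborel \<partial>lborel)"
    by (rule lborel.nn_integral_fst[symmetric]) (use Fm in \<open>simp add: lborel_prod\<close>)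
  also have "\<dots> = (\<integral>\<^sup>+x. ennreal (indicator {0..\<Gamma>} x * integral {l x..r x} (\<lambda>y. f (x, y))) \<partial>lborel)"
    by (simp add: slice)
  also have "\<dots> = ennreal (LINT x|lborel. indicator {0..\<Gamma>} x * integral {l x..r x} (\<lambda>y. f (x, y)))"
  proof (rule nn_integral_eq_integral)
    show "AE x in lborel. 0 \<le> indicator {0..\<Gamma>} x * integral {l x..r x} (\<lambda>y. f (x, y))"
      using nn by (auto simp: indicator_def region_def intro!: integral_nonneg integrable_continuous_real
          continuous_on_compose2[OF f] continuous_intros)
  qed (use Ii in \<open>simp add: set_integrable_def\<close>)
  also have "(LINT x|lborel. indicator {0..\<Gamma>} x * integral {l x..r x} (\<lambda>y. f (x, y))) =
      integral {0..\<Gamma>} (\<lambda>x. integral {l x..r x} (\<lambda>y. f (x, y)))"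
    using set_borel_integral_eq_integral(2)[OF Ii] by (simp add: set_lebesgue_integral_def)
  also have "\<dots> = area \<Gamma> l r f"
    using lr le by (intro area_eq_iterated[symmetric] f) (auto intro: continuous_on_subset)
  finally show ?thesis ..
qed

lemma area_mono:
  assumes "continuous_on (region \<Gamma> l r) f" "continuous_on (region \<Gamma> l r) g"
    and "\<And>x. x \<in> region \<Gamma> l r \<Longrightarrow> f x \<le> g x"
    and lr: "continuous_on {0..\<Gamma>} l" "continuous_on {0..\<Gamma>} r"
    and le: "\<And>x. 0 \<le> x \<Longrightarrow> x \<le> \<Gamma> \<Longrightarrow> l x \<le> r x"
  shows "area \<Gamma> l r f \<le> area \<Gamma> l r g"
  unfolding area_def
proof (rule integral_le)
  let ?B = "cbox (0, 0) (\<Gamma>, 1) :: point set"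
  have G: "(fst w, (1 - snd w) * l (fst w) + snd w * r (fst w)) \<in> region \<Gamma> l r" if "w \<in> ?B" for w
    using straightened_in_region[OF le that] .
  have c: "continuous_on ?B (\<lambda>w. f (fst w, (1 - snd w) * l (fst w) + snd w * r (fst w)) * (r (fst w) - l (fst w)))"
    if "continuous_on (region \<Gamma> l r) f" for f :: "point \<Rightarrow> real"
    using G
    by (intro continuous_intros continuous_on_compose2[OF that] continuous_on_compose2[OF lr(1)]
          continuous_on_compose2[OF lr(2)]) (auto simp: cbox_Pair_eq)
  show "(\<lambda>w. f (fst w, (1 - snd w) * l (fst w) + snd w * r (fst w)) * (r (fst w) - l (fst w))) integrable_on ?B"
    "(\<lambda>w. g (fst w, (1 - snd w) * l (fst w) + snd w * r (fst w)) * (r (fst w) - l (fst w))) integrable_on ?B"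
    using c assms by (auto intro!: integrable_continuous)
  fix w assume w: "w \<in> ?B"
  then show "f (fst w, (1 - snd w) * l (fst w) + snd w * r (fst w)) * (r (fst w) - l (fst w))
    \<le> g (fst w, (1 - snd w) * l (fst w) + snd w * r (fst w)) * (r (fst w) - l (fst w))"
    using assms(3)[OF G[OF w]] le[of "fst w"] by (intro mult_right_mono) (auto simp: cbox_Pair_eq)
qed

lemma area_linear:
  assumes "continuous_on (region \<Gamma> l r) f" "continuous_on (region \<Gamma> l r) g"
    and lr: "continuous_on {0..\<Gamma>} l" "continuous_on {0..\<Gamma>} r"
    and le: "\<And>x. 0 \<le> x \<Longrightarrow> x \<le> \<Gamma> \<Longrightarrow> l x \<le> r x"
  shows "area \<Gamma> l r (\<lambda>x. c * f x + d * g x) = c * area \<Gamma> l r f + d * area \<Gamma> l r g"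
proof -
  let ?B = "cbox (0, 0) (\<Gamma>, 1) :: point set"
  let ?G = "\<lambda>w. (fst w, (1 - snd w) * l (fst w) + snd w * r (fst w))" and ?J = "\<lambda>w. r (fst w) - l (fst w)"
  have G: "?G w \<in> region \<Gamma> l r" if "w \<in> ?B" for w
    using straightened_in_region[OF le that] .
  have c: "(\<lambda>w. f (?G w) * ?J w) integrable_on ?B"
    if "continuous_on (region \<Gamma> l r) f" for f :: "point \<Rightarrow> real"
    using G
    by (intro integrable_continuous continuous_intros continuous_on_compose2[OF that] continuous_on_compose2[OF lr(1)]
          continuous_on_compose2[OF lr(2)]) (auto simp: cbox_Pair_eq)
  have "area \<Gamma> l r (\<lambda>x. c * f x + d * g x) = integral ?B (\<lambda>w. c * (f (?G w) * ?J w) + d * (g (?G w) * ?J w))"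
    unfolding area_def by (intro integral_cong) (simp add: algebra_simps)
  also have "\<dots> = integral ?B (\<lambda>w. c * (f (?G w) * ?J w)) + integral ?B (\<lambda>w. d * (g (?G w) * ?J w))"
    using c[OF assms(1)] c[OF assms(2)] by (intro integral_add integrable_on_mult_right)
  finally show ?thesis by (simp add: area_def)
qed

lemma area_nonneg:
  assumes "continuous_on (region \<Gamma> l r) f" "\<And>x. x \<in> region \<Gamma> l r \<Longrightarrow> 0 \<le> f x"
    and "continuous_on {0..\<Gamma>} l" "continuous_on {0..\<Gamma>} r"
    and "\<And>x. 0 \<le> x \<Longrightarrow> x \<le> \<Gamma> \<Longrightarrow> l x \<le> r x"
  shows "0 \<le> area \<Gamma> l r f"
  using area_mono[of \<Gamma> l r "\<lambda>_. 0" f] assms by (auto simp: area_def)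

section \<open>The channel and the solution\<close>

locale rb_channel =
  fixes \<Gamma> :: real and hm hp :: "real \<Rightarrow> real" and L :: real
  assumes channel: "channel \<Gamma> hm hp"
    and C11: "class_Ck1 1 hm" "class_Ck1 1 hp"
    and lip: "L-lipschitz_on UNIV hm" "L-lipschitz_on UNIV hp"
begin

lemma \<Gamma>_pos: "0 < \<Gamma>" using channel by (simp add: channel_def)

lemma hm_less_hp: "hm x < hp x" using channel by (simp add: channel_def)

lemma periodic_walls: "hm (x + \<Gamma>) = hm x" "hp (x + \<Gamma>) = hp x"
  using channel by (auto simp: channel_def)

lemma DERIV_walls: "(hm has_real_derivative deriv hm x) (at x)" "(hp has_real_derivative deriv hp x) (at x)"
proof -
  have "h field_differentiable (at x)" if "class_Ck1 1 h" for h
    using that unfolding class_Ck1_def by (metis funpow_0 less_numeral_extra(1))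
  then show "(hm has_real_derivative deriv hm x) (at x)" "(hp has_real_derivative deriv hp x) (at x)"
    using C11 DERIV_deriv_iff_field_differentiable by blast+
qed

lemma deriv_walls_lipschitz: "\<exists>K. K-lipschitz_on UNIV (deriv hm)" "\<exists>K. K-lipschitz_on UNIV (deriv hp)"
proof -
  have "\<exists>K. K-lipschitz_on UNIV (deriv h)" if "class_Ck1 1 h" for h
  proof -
    have "\<exists>K. K-lipschitz_on UNIV ((deriv ^^ 1) h)"
      using that unfolding class_Ck1_def by (metis order_refl)
    then show ?thesis by simp
  qed
  then show "\<exists>K. K-lipschitz_on UNIV (deriv hm)" "\<exists>K. K-lipschitz_on UNIV (deriv hp)" using C11 by auto
qed

lemma continuous_walls: "continuous_on X hm" "continuous_on X hp"
  "continuous_on X (deriv hm)" "continuous_on X (deriv hp)"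
  using lip deriv_walls_lipschitz
  by (auto intro: continuous_on_subset[OF lipschitz_on_continuous_on])

lemma L_nonneg: "0 \<le> L" using lip(1) by (rule lipschitz_on_nonneg)

lemma deriv_walls_periodic: "deriv hm (x + \<Gamma>) = deriv hm x" "deriv hp (x + \<Gamma>) = deriv hp x"
proof -
  have "(h has_real_derivative deriv h (x + \<Gamma>)) (at x)"
    if "\<And>x. (h has_real_derivative deriv h x) (at x)" "\<And>x. h (x + \<Gamma>) = h x" for h
    using DERIV_shift[of h "deriv h (x + \<Gamma>)" x \<Gamma>] that by simp
  then show "deriv hm (x + \<Gamma>) = deriv hm x" "deriv hp (x + \<Gamma>) = deriv hp x"
    using DERIV_walls periodic_walls DERIV_imp_deriv by metis+
qed

lemma deriv_walls_bound: "\<bar>deriv hm x\<bar> \<le> L" "\<bar>deriv hp x\<bar> \<le> L"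
proof -
  have "\<bar>deriv h x\<bar> \<le> L" if h: "L-lipschitz_on UNIV h" "(h has_real_derivative deriv h x) (at x)" for h
  proof (rule tendsto_upperbound[OF tendsto_rabs[OF h(2)[unfolded DERIV_def]]])
    show "\<forall>\<^sub>F s in at 0. \<bar>(h (x + s) - h x) / s\<bar> \<le> L"
      unfolding eventually_at
      using lipschitz_onD[OF h(1), of "x + s" x for s]
      by (intro exI[of _ 1]) (auto simp: dist_real_def divide_le_eq)
  qed simp
  then show "\<bar>deriv hm x\<bar> \<le> L" "\<bar>deriv hp x\<bar> \<le> L" using lip DERIV_walls by auto
qed

lemma open_strip: "open (strip hm hp)"
proof -
  have "strip hm hp = {x. hm (fst x) < snd x} \<inter> {x. snd x < hp (fst x)}" by (auto simp: strip_def)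
  moreover have "open \<dots>"
    by (intro open_Int open_Collect_less continuous_intros continuous_on_compose2[OF continuous_walls(1)]
        continuous_on_compose2[OF continuous_walls(2)]) auto
  ultimately show ?thesis by simp
qed

lemma cell_eq_region: "cell \<Gamma> hm hp = region \<Gamma> hm hp"
  by (simp add: cell_def region_def)

lemma region_subset_closed_strip:
  "(\<And>x. 0 \<le> x \<Longrightarrow> x \<le> \<Gamma> \<Longrightarrow> hm x \<le> l x \<and> r x \<le> hp x) \<Longrightarrow> region \<Gamma> l r \<subseteq> closed_strip hm hp"
  unfolding region_def closed_strip_def by force

lemma open_region_subset_strip:
  "(\<And>x. 0 \<le> x \<Longrightarrow> x \<le> \<Gamma> \<Longrightarrow> hm x \<le> l x \<and> r x \<le> hp x) \<Longrightarrow> open_region \<Gamma> l r \<subseteq> strip hm hp"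
  unfolding open_region_def strip_def by force

lemma area_one: "area \<Gamma> hm hp (\<lambda>_. 1) = \<Gamma>"
proof -
  have nn: "0 \<le> area \<Gamma> hm hp (\<lambda>_. 1)"
    by (intro area_nonneg continuous_walls) (auto intro: less_imp_le[OF hm_less_hp])
  have "ennreal (area \<Gamma> hm hp (\<lambda>_. 1)) = (\<integral>\<^sup>+x\<in>region \<Gamma> hm hp. ennreal 1 \<partial>lborel)"
    by (intro area_eq_nn_integral continuous_walls) (auto intro: less_imp_le[OF hm_less_hp])
  also have "\<dots> = emeasure lborel (cell \<Gamma> hm hp)"
    using region_closed[OF continuous_walls(1,2)] by (simp add: cell_eq_region)
  also have "\<dots> = ennreal \<Gamma>" using channel by (simp add: channel_def)
  finally show ?thesis using nn \<Gamma>_pos by simp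
qed

text \<open>The average height of the channel is one, so its height is at most one at some abscissa.  The
Lipschitz bound carries this over to any two points of the walls.\<close>

lemma wall_oscillation:
  assumes "0 \<le> x" "x \<le> \<Gamma>" "0 \<le> y" "y \<le> \<Gamma>"
  shows "hp x - hm y \<le> 1 + 2 * L * \<Gamma>"
proof -
  have "\<exists>z\<in>{0..\<Gamma>}. hp z - hm z \<le> 1"
  proof (rule ccontr)
    assume "\<not> ?thesis"
    then have gt: "1 < hp z - hm z" if "z \<in> {0..\<Gamma>}" for z using that by (meson not_le)
    have "continuous_on {0..\<Gamma>} (\<lambda>z. hp z - hm z)" by (intro continuous_intros continuous_walls)
    then obtain z0 where z0: "z0 \<in> {0..\<Gamma>}" "\<And>z. z \<in> {0..\<Gamma>} \<Longrightarrow> hp z0 - hm z0 \<le> hp z - hm z"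
      using continuous_attains_inf[of "{0..\<Gamma>}" "\<lambda>z. hp z - hm z"] \<Gamma>_pos by auto
    have "integral {0..\<Gamma>} (\<lambda>z. hp z0 - hm z0) \<le> integral {0..\<Gamma>} (\<lambda>z. hp z - hm z)"
      by (intro integral_le integrable_continuous_real continuous_intros continuous_walls z0(2))
    also have "\<dots> = integral {0..\<Gamma>} (\<lambda>z. integral {hm z..hp z} (\<lambda>y. 1))"
      by (intro integral_cong) (simp add: less_imp_le[OF hm_less_hp])
    also have "\<dots> = area \<Gamma> hm hp (\<lambda>_. 1)"
      by (intro area_eq_iterated[symmetric] continuous_walls) (auto intro: less_imp_le[OF hm_less_hp])
    also have "\<dots> = \<Gamma>" by (rule area_one)
    finally have "(hp z0 - hm z0) * \<Gamma> \<le> \<Gamma>" using \<Gamma>_pos by (simp add: mult.commute)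
    moreover have "1 * \<Gamma> < (hp z0 - hm z0) * \<Gamma>"
      using gt[OF z0(1)] \<Gamma>_pos by (intro mult_strict_right_mono) auto
    ultimately show False by simp
  qed
  then obtain z where z: "0 \<le> z" "z \<le> \<Gamma>" "hp z - hm z \<le> 1" by auto
  have "hp x - hp z \<le> L * \<bar>x - z\<bar>" "hm z - hm y \<le> L * \<bar>z - y\<bar>"
    using lipschitz_onD[OF lip(2), of x z] lipschitz_onD[OF lip(1), of z y] by (auto simp: dist_real_def)
  moreover have "L * \<bar>x - z\<bar> \<le> L * \<Gamma>" "L * \<bar>z - y\<bar> \<le> L * \<Gamma>"
    using assms z L_nonneg by (auto intro!: mult_left_mono)
  ultimately show ?thesis using z(3) by simp
qed

end

text \<open>The field \<open>q\<close> is the temperature gradient, continuously extended to the walls.\<close>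

locale rb_solution = rb_channel +
  fixes \<alpha> :: "point \<Rightarrow> real" and Pr Ra :: real and u0 :: "point \<Rightarrow> point" and \<theta>0 :: "point \<Rightarrow> real"
    and u :: "real \<Rightarrow> point \<Rightarrow> point" and p \<theta> :: "real \<Rightarrow> point \<Rightarrow> real" and q :: "real \<Rightarrow> point \<Rightarrow> point"
  assumes Pr_pos: "0 < Pr" and Ra_ge_1: "1 \<le> Ra"
    and solution: "rayleigh_benard_solution \<Gamma> hm hp \<alpha> Pr Ra u0 \<theta>0 u p \<theta>"
    and \<theta>0_measurable: "set_borel_measurable lborel (cell \<Gamma> hm hp) \<theta>0"
    and \<theta>0_range: "AE x in lborel. x \<in> cell \<Gamma> hm hp \<longrightarrow> 0 \<le> \<theta>0 x \<and> \<theta>0 x \<le> 1"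
    and q_continuous: "continuous_on ({0<..} \<times> closed_strip hm hp) (\<lambda>(t, x). q t x)"
    and q_grad: "\<And>t x. 0 < t \<Longrightarrow> x \<in> strip hm hp \<Longrightarrow> q t x = grad (\<theta> t) x"
begin

abbreviation "S \<equiv> strip hm hp"
abbreviation "cS \<equiv> closed_strip hm hp"

lemma regular: "regular_solution \<Gamma> hm hp u p \<theta>"
  using solution by (simp add: rayleigh_benard_solution_def)

lemma S_subset_cS: "S \<subseteq> cS" by (auto simp: strip_def closed_strip_def)

lemma smooth: "C1_C2 S u" "C1_in_space S p" "C1_C2 S \<theta>"
  using regular by (auto simp: regular_solution_def)

lemma u_continuous: "continuous_on ({0<..} \<times> cS) (\<lambda>(t, x). u t x)"
  and \<theta>_continuous: "continuous_on ({0<..} \<times> cS) (\<lambda>(t, x). \<theta> t x)"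
  using regular by (auto simp: regular_solution_def)

lemma periodic: "0 < t \<Longrightarrow> x \<in> cS \<Longrightarrow> u t (fst x + \<Gamma>, snd x) = u t x"
  "0 < t \<Longrightarrow> x \<in> S \<Longrightarrow> p t (fst x + \<Gamma>, snd x) = p t x"
  "0 < t \<Longrightarrow> x \<in> cS \<Longrightarrow> \<theta> t (fst x + \<Gamma>, snd x) = \<theta> t x"
  using regular by (auto simp: regular_solution_def periodic_in_def)

lemma strip_shift: "x \<in> S \<Longrightarrow> (fst x + \<Gamma>, snd x) \<in> S"
  by (simp add: strip_def periodic_walls)

lemma \<theta>_spatial:
  assumes "0 < t" "x \<in> S"
  shows "plane_deriv (\<theta> t) (dx1 (\<theta> t) x) (dx2 (\<theta> t) x) x"
    "plane_deriv (dx1 (\<theta> t)) (dx1 (dx1 (\<theta> t)) x) (dx2 (dx1 (\<theta> t)) x) x"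
    "plane_deriv (dx2 (\<theta> t)) (dx1 (dx2 (\<theta> t)) x) (dx2 (dx2 (\<theta> t)) x) x"
  using C1_in_space_plane_deriv[OF _ assms] smooth(3) unfolding C1_C2_def by blast+

lemma \<theta>_temporal:
  assumes "0 < t" "x \<in> S"
  shows "((\<lambda>s. \<theta> s x) has_real_derivative dt \<theta> t x) (at t)"
  using smooth(3) assms unfolding C1_C2_def C1_in_time_def dt_def
  by (auto simp: has_real_derivative_iff_has_vector_derivative vector_derivative_works[symmetric])

lemma u_spatial:
  assumes "0 < t" "x \<in> S"
  shows "plane_deriv (u t) (dx1 (u t) x) (dx2 (u t) x) x"
    "plane_deriv (dx1 (u t)) (dx1 (dx1 (u t)) x) (dx2 (dx1 (u t)) x) x"
    "plane_deriv (dx2 (u t)) (dx1 (dx2 (u t)) x) (dx2 (dx2 (u t)) x) x"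
  using C1_in_space_plane_deriv[OF _ assms] smooth(1) unfolding C1_C2_def by blast+

lemma equations:
  assumes "0 < t" "x \<in> S"
  shows "(1 / Pr) *\<^sub>R (dt u t x + advect (u t x) (u t) x) + grad (p t) x - laplace (u t) x
          = (Ra * \<theta> t x) *\<^sub>R (0, 1)"
    "fst (dx1 (u t) x) + snd (dx2 (u t) x) = 0"
    "dt \<theta> t x + fst (u t x) * dx1 (\<theta> t) x + snd (u t x) * dx2 (\<theta> t) x =
       dx1 (dx1 (\<theta> t)) x + dx2 (dx2 (\<theta> t)) x"
  using solution assms
  by (auto simp: rayleigh_benard_solution_def advect_def laplace_def divergence_def algebra_simps)

lemma wall_values:
  assumes "0 < t" "0 \<le> x" "x \<le> \<Gamma>"
  shows "\<theta> t (x, hp x) = 0" "\<theta> t (x, hm x) = 1"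
    "snd (u t (x, hm x)) = deriv hm x * fst (u t (x, hm x))"
    "snd (u t (x, hp x)) = deriv hp x * fst (u t (x, hp x))"
proof -
  have w: "(x, hm x) \<in> wall \<Gamma> hm" "(x, hp x) \<in> wall \<Gamma> hp" using assms by (auto simp: wall_def)
  show "\<theta> t (x, hp x) = 0" "\<theta> t (x, hm x) = 1"
    using solution w assms(1) by (auto simp: rayleigh_benard_solution_def)
  have "outer_normal hm hp (x, hm x) \<bullet> u t (x, hm x) = 0" "outer_normal hm hp (x, hp x) \<bullet> u t (x, hp x) = 0"
    using solution w assms(1) unfolding rayleigh_benard_solution_def by blast+
  moreover have "sqrt (1 + d\<^sup>2) \<noteq> 0" for d :: real
    using sum_power2_ge_zero[of 1 d] by (auto simp: add_nonneg_eq_0_iff)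
  ultimately show "snd (u t (x, hm x)) = deriv hm x * fst (u t (x, hm x))"
    "snd (u t (x, hp x)) = deriv hp x * fst (u t (x, hp x))"
    using hm_less_hp[of x] by (auto simp: outer_normal_def inner_prod_def field_simps)
qed

section \<open>Balances for the temperature\<close>

text \<open>Up to the arc length element, these are the outward normal derivative of the temperature at the
bottom and the inward one at the top, that is the heat entering through the bottom and the heat
leaving through the top.\<close>

definition wall_flux_bottom :: "real \<Rightarrow> real \<Rightarrow> real" where
  "wall_flux_bottom t x = deriv hm x * fst (q t (x, hm x)) - snd (q t (x, hm x))"

definition wall_flux_top :: "real \<Rightarrow> real \<Rightarrow> real" where
  "wall_flux_top t x = deriv hp x * fst (q t (x, hp x)) - snd (q t (x, hp x))"

text \<open>The heat equation multiplied by \<open>\<omega> F'(\<theta>)\<close>, together with the divergence of the field \<open>(0, c \<theta>)\<close>.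
The latter is of use when \<open>\<omega>\<close> is the height: then it cancels the conductive term \<open>\<partial>\<^sub>2\<theta>\<close>.\<close>

lemma temperature_balance:
  fixes F F' F'' l r l' r' :: "real \<Rightarrow> real" and \<omega> \<omega>1 \<omega>2 :: "point \<Rightarrow> real" and c :: real
  assumes ab: "0 < a" "a \<le> b"
    and l: "\<And>x. 0 \<le> x \<Longrightarrow> x \<le> \<Gamma> \<Longrightarrow> (l has_real_derivative l' x) (at x)"
    and r: "\<And>x. 0 \<le> x \<Longrightarrow> x \<le> \<Gamma> \<Longrightarrow> (r has_real_derivative r' x) (at x)"
    and l': "continuous_on {0..\<Gamma>} l'" and r': "continuous_on {0..\<Gamma>} r'"
    and less: "\<And>x. 0 \<le> x \<Longrightarrow> x \<le> \<Gamma> \<Longrightarrow> l x < r x"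
    and inside: "\<And>x. 0 \<le> x \<Longrightarrow> x \<le> \<Gamma> \<Longrightarrow> hm x \<le> l x \<and> r x \<le> hp x"
    and lr_per: "l 0 = l \<Gamma>" "r 0 = r \<Gamma>"
    and F: "\<And>s. (F has_real_derivative F' s) (at s)" "\<And>s. (F' has_real_derivative F'' s) (at s)"
      "continuous_on UNIV F''"
    and \<omega>: "\<And>x. x \<in> open_region \<Gamma> l r \<Longrightarrow> plane_deriv \<omega> (\<omega>1 x) (\<omega>2 x) x"
      "continuous_on (region \<Gamma> l r) \<omega>" "continuous_on (region \<Gamma> l r) \<omega>1" "continuous_on (region \<Gamma> l r) \<omega>2"
      "\<And>y. \<omega> (0, y) = \<omega> (\<Gamma>, y)"
  defines "V1 \<equiv> \<lambda>t x. \<omega> x * (fst (u t x) * F (\<theta> t x) - F' (\<theta> t x) * fst (q t x))"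
    and "V2 \<equiv> \<lambda>t x. \<omega> x * (snd (u t x) * F (\<theta> t x) - F' (\<theta> t x) * snd (q t x)) + c * \<theta> t x"
  shows "area \<Gamma> l r (\<lambda>x. \<omega> x * F (\<theta> b x)) - area \<Gamma> l r (\<lambda>x. \<omega> x * F (\<theta> a x)) +
      flux a b \<Gamma> r r' V1 V2 - flux a b \<Gamma> l l' V1 V2 =
    integral {a..b} (\<lambda>t. area \<Gamma> l r (\<lambda>x.
      \<omega>1 x * (fst (u t x) * F (\<theta> t x) - F' (\<theta> t x) * fst (q t x)) +
      \<omega>2 x * (snd (u t x) * F (\<theta> t x) - F' (\<theta> t x) * snd (q t x)) -
      \<omega> x * F'' (\<theta> t x) * ((fst (q t x))\<^sup>2 + (snd (q t x))\<^sup>2) + c * snd (q t x)))"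
proof -
  let ?K = "region \<Gamma> l r" and ?O = "open_region \<Gamma> l r"
  have K: "?K \<subseteq> cS" by (rule region_subset_closed_strip[OF inside])
  have O: "?O \<subseteq> S" by (rule open_region_subset_strip[OF inside])
  have OK: "?O \<subseteq> ?K" by (auto simp: open_region_def region_def)
  have tpos: "0 < t" if "t \<in> {a..b}" for t using that ab by auto
  have clK: "continuous_on ({a..b} \<times> ?K) (\<lambda>z. f (fst z) (snd z))"
    if "continuous_on ({0<..} \<times> cS) (\<lambda>(t, x). f t x)" for f :: "real \<Rightarrow> point \<Rightarrow> 'z::topological_space"
    using continuous_on_subset[OF that, of "{a..b} \<times> ?K"] K ab by (fastforce simp: split_beta)
  have clO: "continuous_on ({a..b} \<times> ?O) (\<lambda>z. f (fst z) (snd z))"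
    if "continuous_on ({0<..} \<times> S) (\<lambda>(t, x). f t x)" for f :: "real \<Rightarrow> point \<Rightarrow> 'z::topological_space"
    using continuous_on_subset[OF that, of "{a..b} \<times> ?O"] O ab by (fastforce simp: split_beta)
  have Fc: "continuous_on UNIV F" "continuous_on UNIV F'"
    using F(1,2) by (auto intro!: continuous_at_imp_continuous_on DERIV_isCont)
  note cK = clK[OF u_continuous] clK[OF \<theta>_continuous] clK[OF q_continuous]
  note cK' = continuous_on_compose2[OF Fc(1) cK(2) subset_UNIV] continuous_on_compose2[OF Fc(2) cK(2) subset_UNIV]
    continuous_on_compose2[OF F(3) cK(2) subset_UNIV]
  have \<omega>K: "continuous_on ({a..b} \<times> ?K) (\<lambda>z. \<omega> (snd z))" "continuous_on ({a..b} \<times> ?K) (\<lambda>z. \<omega>1 (snd z))"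
      "continuous_on ({a..b} \<times> ?K) (\<lambda>z. \<omega>2 (snd z))"
    by (intro continuous_on_compose2[OF \<omega>(2)] continuous_on_compose2[OF \<omega>(3)]
          continuous_on_compose2[OF \<omega>(4)] continuous_intros; auto)+
  have KO: "continuous_on ({a..b} \<times> ?O) f" if "continuous_on ({a..b} \<times> ?K) f" for f :: "real \<times> point \<Rightarrow> 'z::topological_space"
    by (rule continuous_on_subset[OF that]) (use OK in auto)
  have s\<theta>: "C1_in_space S \<theta>" "C1_in_space S (\<lambda>t. dx1 (\<theta> t))" "C1_in_space S (\<lambda>t. dx2 (\<theta> t))"
    and su: "C1_in_space S u"
    using smooth unfolding C1_C2_def by auto
  note cO = clO[OF C1_in_space_continuous(2)[OF su]] clO[OF C1_in_space_continuous(3)[OF su]]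
    clO[OF C1_in_space_continuous(2)[OF s\<theta>(1)]] clO[OF C1_in_space_continuous(3)[OF s\<theta>(1)]]
    clO[OF C1_in_space_continuous(2)[OF s\<theta>(2)]] clO[OF C1_in_space_continuous(3)[OF s\<theta>(2)]]
    clO[OF C1_in_space_continuous(2)[OF s\<theta>(3)]] clO[OF C1_in_space_continuous(3)[OF s\<theta>(3)]]
  have dtO: "continuous_on ({a..b} \<times> ?O) (\<lambda>z. dt \<theta> (fst z) (snd z))"
    using smooth(3) by (intro clO) (simp add: C1_C2_def C1_in_time_def)
  note cont_simps = KO[OF cK(1)] KO[OF cK(2)] KO[OF cK(3)] KO[OF cK'(1)] KO[OF cK'(2)] KO[OF cK'(3)]
    KO[OF \<omega>K(1)] KO[OF \<omega>K(2)] KO[OF \<omega>K(3)] cO dtO cK cK' \<omega>K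
  have qd: "plane_deriv (\<lambda>x. fst (q t x)) (dx1 (dx1 (\<theta> t)) x) (dx2 (dx1 (\<theta> t)) x) x"
    "plane_deriv (\<lambda>x. snd (q t x)) (dx1 (dx2 (\<theta> t)) x) (dx2 (dx2 (\<theta> t)) x) x"
    "fst (q t x) = dx1 (\<theta> t) x" "snd (q t x) = dx2 (\<theta> t) x" if "0 < t" "x \<in> S" for t x
    using plane_deriv_transform_open[OF \<theta>_spatial(2)[OF that] open_strip that(2)]
      plane_deriv_transform_open[OF \<theta>_spatial(3)[OF that] open_strip that(2)] q_grad that
    by (auto simp: grad_def)
  define U1 where "U1 t x = fst (u t x) * F (\<theta> t x) - F' (\<theta> t x) * fst (q t x)" for t x
  define U2 where "U2 t x = snd (u t x) * F (\<theta> t x) - F' (\<theta> t x) * snd (q t x)" for t x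
  define B11 where "B11 t x = fst (dx1 (u t) x) * F (\<theta> t x) + fst (u t x) * (F' (\<theta> t x) * dx1 (\<theta> t) x)
      - (F'' (\<theta> t x) * dx1 (\<theta> t) x * fst (q t x) + F' (\<theta> t x) * dx1 (dx1 (\<theta> t)) x)" for t x
  define B12 where "B12 t x = fst (dx2 (u t) x) * F (\<theta> t x) + fst (u t x) * (F' (\<theta> t x) * dx2 (\<theta> t) x)
      - (F'' (\<theta> t x) * dx2 (\<theta> t) x * fst (q t x) + F' (\<theta> t x) * dx2 (dx1 (\<theta> t)) x)" for t x
  define B21 where "B21 t x = snd (dx1 (u t) x) * F (\<theta> t x) + snd (u t x) * (F' (\<theta> t x) * dx1 (\<theta> t) x)
      - (F'' (\<theta> t x) * dx1 (\<theta> t) x * snd (q t x) + F' (\<theta> t x) * dx1 (dx2 (\<theta> t)) x)" for t x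
  define B22 where "B22 t x = snd (dx2 (u t) x) * F (\<theta> t x) + snd (u t x) * (F' (\<theta> t x) * dx2 (\<theta> t) x)
      - (F'' (\<theta> t x) * dx2 (\<theta> t) x * snd (q t x) + F' (\<theta> t x) * dx2 (dx2 (\<theta> t)) x)" for t x
  have dU: "plane_deriv (U1 t) (B11 t x) (B12 t x) x" "plane_deriv (U2 t) (B21 t x) (B22 t x) x"
    if tx: "0 < t" "x \<in> S" for t x
  proof -
    note d = plane_deriv_diff[OF plane_deriv_mult[OF plane_deriv_fst_comp[OF u_spatial(1)[OF tx]]
             plane_deriv_compose[OF \<theta>_spatial(1)[OF tx] F(1)]]
           plane_deriv_mult[OF plane_deriv_compose[OF \<theta>_spatial(1)[OF tx] F(2)] qd(1)[OF tx]]]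
    show "plane_deriv (U1 t) (B11 t x) (B12 t x) x"
      using d unfolding U1_def B11_def B12_def by simp
    note d = plane_deriv_diff[OF plane_deriv_mult[OF plane_deriv_snd_comp[OF u_spatial(1)[OF tx]]
             plane_deriv_compose[OF \<theta>_spatial(1)[OF tx] F(1)]]
           plane_deriv_mult[OF plane_deriv_compose[OF \<theta>_spatial(1)[OF tx] F(2)] qd(2)[OF tx]]]
    show "plane_deriv (U2 t) (B21 t x) (B22 t x) x"
      using d unfolding U2_def B21_def B22_def by simp
  qed
  show ?thesis
  proof (rule spacetime_divergence_up_to_boundary[OF ab(2) less_imp_le[OF \<Gamma>_pos] l r l' r' less lr_per,
        where e' = "\<lambda>t x. \<omega> x * (F' (\<theta> t x) * dt \<theta> t x)"
         and ?A11.0 = "\<lambda>t x. \<omega>1 x * U1 t x + \<omega> x * B11 t x" and ?A12.0 = "\<lambda>t x. \<omega>2 x * U1 t x + \<omega> x * B12 t x"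
         and ?A21.0 = "\<lambda>t x. \<omega>1 x * U2 t x + \<omega> x * B21 t x + c * dx1 (\<theta> t) x"
         and ?A22.0 = "\<lambda>t x. \<omega>2 x * U2 t x + \<omega> x * B22 t x + c * dx2 (\<theta> t) x"])
    fix t y assume t: "t \<in> {a..b}" and y: "l 0 < y" "y < r 0"
    then have y': "(0, y) \<in> S" using inside[of 0] \<Gamma>_pos by (auto simp: strip_def)
    note t = tpos[OF t]
    have sh: "(\<Gamma>, y) \<in> S" using strip_shift[OF y'] by simp
    have diff: "\<theta> t differentiable (at (\<Gamma>, y))"
      using \<theta>_spatial(1)[OF t sh] unfolding plane_deriv_def differentiable_def by blast
    have per: "\<theta> t (fst x + \<Gamma>, snd x) = \<theta> t x" if "x \<in> S" for x
      using periodic(3)[OF t, of x] that S_subset_cS by auto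
    have g: "dx1 (\<theta> t) (\<Gamma>, y) = dx1 (\<theta> t) (0, y)"
      using gradient_periodic(1)[OF open_strip y', of "\<theta> t" \<Gamma>] diff per by simp
    have "q t (\<Gamma>, y) = (dx1 (\<theta> t) (\<Gamma>, y), dx2 (\<theta> t) (\<Gamma>, y))" "q t (0, y) = (dx1 (\<theta> t) (0, y), dx2 (\<theta> t) (0, y))"
      using q_grad[OF t] y' sh by (auto simp: grad_def)
    then show "V1 t (0, y) = V1 t (\<Gamma>, y)"
      using g per[OF y'] periodic(1)[OF t, of "(0, y)"] y' S_subset_cS \<omega>(5)[of y]
      by (auto simp: V1_def subset_iff)
  next
    fix t x assume t: "t \<in> {a..b}" and x: "x \<in> ?O"
    note tx = tpos[OF t] subsetD[OF O x]
    show "((\<lambda>s. \<omega> x * F (\<theta> s x)) has_real_derivative \<omega> x * (F' (\<theta> t x) * dt \<theta> t x)) (at t)"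
      by (intro DERIV_cmult DERIV_chain2[OF F(1)] \<theta>_temporal tx)
    show "plane_deriv (V1 t) (\<omega>1 x * U1 t x + \<omega> x * B11 t x) (\<omega>2 x * U1 t x + \<omega> x * B12 t x) x"
      using plane_deriv_mult[OF \<omega>(1)[OF x] dU(1)[OF tx]] by (simp add: V1_def U1_def)
    show "plane_deriv (V2 t) (\<omega>1 x * U2 t x + \<omega> x * B21 t x + c * dx1 (\<theta> t) x)
        (\<omega>2 x * U2 t x + \<omega> x * B22 t x + c * dx2 (\<theta> t) x) x"
      using plane_deriv_add[OF plane_deriv_mult[OF \<omega>(1)[OF x] dU(2)[OF tx]] plane_deriv_cmult[OF \<theta>_spatial(1)[OF tx], of c]]
      by (simp add: V2_def U2_def)
    have dt: "dt \<theta> t x = dx1 (dx1 (\<theta> t)) x + dx2 (dx2 (\<theta> t)) x - fst (u t x) * dx1 (\<theta> t) x - snd (u t x) * dx2 (\<theta> t) x"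
      using equations(3)[OF tx] by simp
    have div: "snd (dx2 (u t) x) = - fst (dx1 (u t) x)" using equations(2)[OF tx] by simp
    show "\<omega> x * (F' (\<theta> t x) * dt \<theta> t x) + (\<omega>1 x * U1 t x + \<omega> x * B11 t x) +
        (\<omega>2 x * U2 t x + \<omega> x * B22 t x + c * dx2 (\<theta> t) x) =
      \<omega>1 x * (fst (u t x) * F (\<theta> t x) - F' (\<theta> t x) * fst (q t x)) +
      \<omega>2 x * (snd (u t x) * F (\<theta> t x) - F' (\<theta> t x) * snd (q t x)) -
      \<omega> x * F'' (\<theta> t x) * ((fst (q t x))\<^sup>2 + (snd (q t x))\<^sup>2) + c * snd (q t x)"
      unfolding U1_def U2_def B11_def B22_def dt div qd(3,4)[OF tx]
      by (simp add: power2_eq_square algebra_simps)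
  qed (assumption | (simp only: split_beta' V1_def V2_def U1_def U2_def B11_def B12_def B22_def fst_conv snd_conv,
       intro continuous_intros cont_simps))+
qed

lemma flux_cong:
  assumes "\<And>t x. a \<le> t \<Longrightarrow> t \<le> b \<Longrightarrow> 0 \<le> x \<Longrightarrow> x \<le> \<Gamma> \<Longrightarrow>
     V2 t (x, h x) - h' x * V1 t (x, h x) = f t x"
  shows "flux a b \<Gamma> h h' V1 V2 = integral (cbox (a, 0) (b, \<Gamma>)) (\<lambda>w. f (fst w) (snd w))"
  unfolding flux_def using assms by (intro integral_cong) (auto simp: cbox_Pair_eq)

lemma flux_bottom:
  assumes "0 < a"
  shows "flux a b \<Gamma> hm (deriv hm)
      (\<lambda>t x. \<omega> x * (fst (u t x) * F (\<theta> t x) - F' (\<theta> t x) * fst (q t x)))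
      (\<lambda>t x. \<omega> x * (snd (u t x) * F (\<theta> t x) - F' (\<theta> t x) * snd (q t x)) + c * \<theta> t x) =
    integral (cbox (a, 0) (b, \<Gamma>)) (\<lambda>w. \<omega> (snd w, hm (snd w)) * F' 1 * wall_flux_bottom (fst w) (snd w) + c)"
  using assms by (intro flux_cong) (simp add: wall_values wall_flux_bottom_def algebra_simps)

lemma flux_top:
  assumes "0 < a"
  shows "flux a b \<Gamma> hp (deriv hp)
      (\<lambda>t x. \<omega> x * (fst (u t x) * F (\<theta> t x) - F' (\<theta> t x) * fst (q t x)))
      (\<lambda>t x. \<omega> x * (snd (u t x) * F (\<theta> t x) - F' (\<theta> t x) * snd (q t x)) + c * \<theta> t x) =
    integral (cbox (a, 0) (b, \<Gamma>)) (\<lambda>w. \<omega> (snd w, hp (snd w)) * F' 0 * wall_flux_top (fst w) (snd w))"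
  using assms by (intro flux_cong) (simp add: wall_values wall_flux_top_def algebra_simps)

lemma wall_flux_continuous:
  assumes "T \<subseteq> {0<..}"
  shows "continuous_on (T \<times> {0..\<Gamma>}) (\<lambda>w. wall_flux_bottom (fst w) (snd w))"
    "continuous_on (T \<times> {0..\<Gamma>}) (\<lambda>w. wall_flux_top (fst w) (snd w))"
proof -
  have q: "continuous_on (T \<times> cS) (\<lambda>(t, x). q t x)"
    by (rule continuous_on_subset[OF q_continuous]) (use assms in auto)
  have b: "continuous_on (T \<times> {0..\<Gamma>}) (\<lambda>w. q (fst w) (snd w, h (snd w)))"
    if "continuous_on {0..\<Gamma>} h" "\<And>x. hm x \<le> h x \<and> h x \<le> hp x" for h
    by (rule continuous_on_along_graph[OF q that(1)]) (use that(2) in \<open>auto simp: closed_strip_def\<close>)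
  have c: "continuous_on (T \<times> {0..\<Gamma>}) (\<lambda>w. deriv hm (snd w))" "continuous_on (T \<times> {0..\<Gamma>}) (\<lambda>w. deriv hp (snd w))"
    by (intro continuous_on_compose2[OF continuous_walls(3)[of UNIV]] continuous_on_compose2[OF continuous_walls(4)[of UNIV]]
        continuous_intros subset_UNIV)+
  show "continuous_on (T \<times> {0..\<Gamma>}) (\<lambda>w. wall_flux_bottom (fst w) (snd w))"
    unfolding wall_flux_bottom_def
    by (intro continuous_intros c b continuous_walls) (auto intro: less_imp_le[OF hm_less_hp])
  show "continuous_on (T \<times> {0..\<Gamma>}) (\<lambda>w. wall_flux_top (fst w) (snd w))"
    unfolding wall_flux_top_def
    by (intro continuous_intros c b continuous_walls) (auto intro: less_imp_le[OF hm_less_hp])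
qed

lemma region_slice_continuous:
  assumes "continuous_on ({0<..} \<times> cS) (\<lambda>(t, x). f t x)" "0 < t"
    and "\<And>x. 0 \<le> x \<Longrightarrow> x \<le> \<Gamma> \<Longrightarrow> hm x \<le> l x \<and> r x \<le> hp x"
  shows "continuous_on (region \<Gamma> l r) (f t)"
  by (rule continuous_on_compose_pair[OF assms(1), of _ "\<lambda>_. t" "\<lambda>x. x"])
     (use assms(2) region_subset_closed_strip[OF assms(3)] in \<open>auto intro!: continuous_intros\<close>)

end

section \<open>The maximum principle and the sign of the wall fluxes\<close>

lemma DERIV_glue_zero:
  fixes g g' :: "real \<Rightarrow> real"
  assumes g: "\<And>r. 0 < r \<Longrightarrow> (g has_real_derivative g' r) (at r)"
    and small: "\<And>r. 0 < r \<Longrightarrow> \<bar>g r\<bar> \<le> C * r\<^sup>2"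
  shows "((\<lambda>r. if 0 < r then g r else 0) has_real_derivative (if 0 < r then g' r else 0)) (at r)"
proof -
  consider "0 < r" | "r < 0" | "r = 0" by linarith
  then show ?thesis
  proof cases
    case 1
    have "((\<lambda>r. if 0 < r then g r else 0) has_real_derivative g' r) (at r)"
      by (rule has_field_derivative_transform_within_open[OF g[OF 1], of "{0<..}"]) (use 1 in auto)
    then show ?thesis using 1 by simp
  next
    case 2
    have "((\<lambda>r. if 0 < r then g r else 0) has_real_derivative 0) (at r)"
      by (rule has_field_derivative_transform_within_open[OF DERIV_const, of "{..<0}"]) (use 2 in auto)
    then show ?thesis using 2 by simp
  next
    case 3
    have C: "0 \<le> C" using small[of 1] by simp
    have "((\<lambda>h. (if 0 < h then g h else 0) / h) \<longlongrightarrow> 0) (at 0)"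
    proof (rule Lim_null_comparison)
      show "\<forall>\<^sub>F h in at 0. norm ((if 0 < h then g h else 0) / h) \<le> C * \<bar>h\<bar>"
      proof (intro always_eventually allI)
        fix h :: real
        have "\<bar>g h\<bar> / \<bar>h\<bar> \<le> C * \<bar>h\<bar>" if "0 < h"
          using small[OF that] that by (simp add: divide_le_eq power2_eq_square mult.assoc)
        moreover have "0 \<le> C * \<bar>h\<bar>" using C by (intro mult_nonneg_nonneg) auto
        ultimately show "norm ((if 0 < h then g h else 0) / h) \<le> C * \<bar>h\<bar>" by auto
      qed
      show "((\<lambda>h. C * \<bar>h\<bar>) \<longlongrightarrow> 0) (at 0)" by (auto intro!: tendsto_eq_intros)
    qed
    then show ?thesis using 3 by (simp add: DERIV_def cong: if_cong)
  qed
qed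

text \<open>Away from the left half line, where it vanishes, this is a positive convex function.  The cube makes
the second derivative continuous at the origin; the denominator keeps the growth quadratic, as
required by initial values that are attained in \<open>L\<^sup>2\<close> only.\<close>

definition excess :: "real \<Rightarrow> real" where
  "excess r = (if 0 < r then r ^ 3 / (1 + r) else 0)"

definition excess' :: "real \<Rightarrow> real" where
  "excess' r = (if 0 < r then r\<^sup>2 * (2 * r + 3) / (1 + r)\<^sup>2 else 0)"

definition excess'' :: "real \<Rightarrow> real" where
  "excess'' r = 2 - 2 / (1 + max 0 r) ^ 3"

lemma excess_DERIV: "(excess has_real_derivative excess' r) (at r)"
  unfolding excess_def[abs_def] excess'_def
proof (rule DERIV_glue_zero[where C = 1])
  fix r :: real assume r: "0 < r"
  show "((\<lambda>r. r ^ 3 / (1 + r)) has_real_derivative r\<^sup>2 * (2 * r + 3) / (1 + r)\<^sup>2) (at r)"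
    using r by (auto intro!: derivative_eq_intros simp: field_simps power2_eq_square power3_eq_cube)
  show "\<bar>r ^ 3 / (1 + r)\<bar> \<le> 1 * r\<^sup>2"
    using r by (simp add: field_simps power2_eq_square power3_eq_cube)
qed

lemma excess'_DERIV: "(excess' has_real_derivative excess'' r) (at r)"
proof -
  have "(excess' has_real_derivative (if 0 < r then 2 - 2 / (1 + r) ^ 3 else 0)) (at r)"
    unfolding excess'_def[abs_def]
  proof (rule DERIV_glue_zero[where C = 3])
    fix r :: real assume r: "0 < r"
    have *: "((\<lambda>r. 2 * r - 1 + 1 / (1 + r)\<^sup>2) has_real_derivative 2 - 2 / (1 + r) ^ 3) (at r)"
    proof -
      have "(1 + r)\<^sup>2 \<noteq> 0" using r by simp
      then have "((\<lambda>r. 2 * r - 1 + 1 / (1 + r)\<^sup>2) has_real_derivative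
          2 + (0 * (1 + r)\<^sup>2 - 1 * (2 * (1 + r))) / ((1 + r)\<^sup>2 * (1 + r)\<^sup>2)) (at r)"
        using r by (auto intro!: derivative_eq_intros)
      moreover have "2 + (0 * (1 + r)\<^sup>2 - 1 * (2 * (1 + r))) / ((1 + r)\<^sup>2 * (1 + r)\<^sup>2) = 2 - 2 / (1 + r) ^ 3"
        using r by (simp add: divide_simps power2_eq_square power3_eq_cube) (simp add: algebra_simps)
      ultimately show ?thesis by simp
    qed
    show "((\<lambda>r. r\<^sup>2 * (2 * r + 3) / (1 + r)\<^sup>2) has_real_derivative 2 - 2 / (1 + r) ^ 3) (at r)"
    proof (rule has_field_derivative_transform_within_open[OF *, of "{0<..}"])
        fix x :: real assume "x \<in> {0<..}"
        then have "(1 + x)\<^sup>2 \<noteq> 0" by simp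
        moreover have "(2 * x - 1) * (1 + x)\<^sup>2 + 1 = x\<^sup>2 * (2 * x + 3)"
          by (simp add: power2_eq_square algebra_simps)
        ultimately show "2 * x - 1 + 1 / (1 + x)\<^sup>2 = x\<^sup>2 * (2 * x + 3) / (1 + x)\<^sup>2"
          by (simp add: nonzero_eq_divide_eq ring_distribs)
      qed (use r in auto)
    have "r\<^sup>2 * (2 * r + 3) \<le> r\<^sup>2 * (3 * (1 + r)\<^sup>2)"
      using r by (intro mult_left_mono) (auto simp: power2_eq_square algebra_simps)
    then show "\<bar>r\<^sup>2 * (2 * r + 3) / (1 + r)\<^sup>2\<bar> \<le> 3 * r\<^sup>2"
      using r by (simp add: pos_divide_le_eq mult_ac)
  qed
  then show ?thesis by (auto simp: excess''_def max_def split: if_splits)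
qed

lemma excess''_nonneg: "0 \<le> excess'' r"
proof -
  have "1 \<le> (1 + max 0 r) ^ 3" by (intro one_le_power) auto
  then show ?thesis by (simp add: excess''_def divide_le_eq)
qed

lemma excess''_continuous: "continuous_on UNIV excess''"
  unfolding excess''_def[abs_def]
  by (intro continuous_intros ballI) (simp add: add_nonneg_eq_0_iff)

lemma excess_bounds: "0 \<le> excess r" "excess r \<le> r\<^sup>2" "r \<le> 0 \<Longrightarrow> excess r = 0" "0 < r \<Longrightarrow> 0 < excess r"
  by (auto simp: excess_def field_simps power2_eq_square power3_eq_cube)

definition clipping :: "real \<Rightarrow> real" where
  "clipping s = excess (s - 1) + excess (- s)"

definition clipping' :: "real \<Rightarrow> real" where
  "clipping' s = excess' (s - 1) - excess' (- s)"

definition clipping'' :: "real \<Rightarrow> real" where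
  "clipping'' s = excess'' (s - 1) + excess'' (- s)"

lemma clipping_DERIV:
  "(clipping has_real_derivative clipping' s) (at s)"
  "(clipping' has_real_derivative clipping'' s) (at s)"
proof -
  have a: "((\<lambda>s::real. s - 1) has_real_derivative 1) (at s)" and b: "((\<lambda>s::real. - s) has_real_derivative -1) (at s)"
    by (auto intro!: derivative_eq_intros)
  show "(clipping has_real_derivative clipping' s) (at s)"
    using DERIV_add[OF DERIV_chain2[OF excess_DERIV a] DERIV_chain2[OF excess_DERIV b]]
    by (simp add: clipping_def[abs_def] clipping'_def)
  show "(clipping' has_real_derivative clipping'' s) (at s)"
    using DERIV_diff[OF DERIV_chain2[OF excess'_DERIV a] DERIV_chain2[OF excess'_DERIV b]]
    by (simp add: clipping'_def[abs_def] clipping''_def)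
qed

lemma clipping''_continuous: "continuous_on UNIV clipping''"
  unfolding clipping''_def[abs_def]
  by (intro continuous_intros continuous_on_compose2[OF excess''_continuous]) auto

text \<open>Clipping penalizes values outside the unit interval.  It is dominated by the squared distance to
any point of this interval, and its derivative vanishes at both wall temperatures.\<close>

lemma clipping_properties:
  "0 \<le> clipping s" "clipping s = 0 \<Longrightarrow> 0 \<le> s \<and> s \<le> 1" "clipping' 0 = 0" "clipping' 1 = 0" "0 \<le> clipping'' s"
  "0 \<le> y \<Longrightarrow> y \<le> 1 \<Longrightarrow> clipping s \<le> (s - y)\<^sup>2"
proof -
  show "0 \<le> clipping s" using excess_bounds(1) by (simp add: clipping_def)
  show "0 \<le> s \<and> s \<le> 1" if "clipping s = 0"
  proof (rule ccontr)
    assume "\<not> (0 \<le> s \<and> s \<le> 1)"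
    then have "0 < excess (s - 1) \<or> 0 < excess (- s)" using excess_bounds(4) by auto
    then show False using that excess_bounds(1)[of "s - 1"] excess_bounds(1)[of "- s"] by (auto simp: clipping_def)
  qed
  show "clipping' 0 = 0" "clipping' 1 = 0" by (auto simp: clipping'_def excess'_def)
  show "0 \<le> clipping'' s" using excess''_nonneg by (simp add: clipping''_def)
  show "clipping s \<le> (s - y)\<^sup>2" if y: "0 \<le> y" "y \<le> 1"
  proof -
    consider "s < 0" | "0 \<le> s" "s \<le> 1" | "1 < s" by linarith
    then show ?thesis
    proof cases
      case 1
      then have "clipping s \<le> (- s)\<^sup>2"
        using excess_bounds(2)[of "- s"] excess_bounds(3)[of "s - 1"] by (simp add: clipping_def)
      also have "\<dots> \<le> (y - s)\<^sup>2" using 1 y by (intro power_mono) auto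
      finally show ?thesis by (simp add: power2_commute)
    next
      case 2
      then show ?thesis using excess_bounds(3)[of "- s"] excess_bounds(3)[of "s - 1"] by (simp add: clipping_def)
    next
      case 3
      then have "clipping s \<le> (s - 1)\<^sup>2"
        using excess_bounds(2)[of "s - 1"] excess_bounds(3)[of "- s"] by (simp add: clipping_def)
      also have "\<dots> \<le> (s - y)\<^sup>2" using 3 y by (intro power_mono) auto
      finally show ?thesis .
    qed
  qed
qed

lemma area_zero_imp_zero:
  assumes f: "continuous_on (region \<Gamma> l r) f" "\<And>x. x \<in> region \<Gamma> l r \<Longrightarrow> 0 \<le> f x"
    and lr: "continuous_on {0..\<Gamma>} l" "continuous_on {0..\<Gamma>} r"
    and less: "\<And>x. 0 \<le> x \<Longrightarrow> x \<le> \<Gamma> \<Longrightarrow> l x < r x" and "0 < \<Gamma>"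
    and zero: "area \<Gamma> l r f = 0" and x: "x \<in> region \<Gamma> l r"
  shows "f x = 0"
proof -
  let ?B = "cbox (0, 0) (\<Gamma>, 1) :: point set"
  let ?G = "\<lambda>w. (fst w, (1 - snd w) * l (fst w) + snd w * r (fst w))"
  let ?F = "\<lambda>w. f (?G w) * (r (fst w) - l (fst w))"
  have G: "?G w \<in> region \<Gamma> l r" if "w \<in> ?B" for w
    using straightened_in_region[OF less_imp_le[OF less] that] .
  have c: "continuous_on ?B ?F"
    using G
    by (intro continuous_intros continuous_on_compose2[OF f(1)] continuous_on_compose2[OF lr(1)]
          continuous_on_compose2[OF lr(2)]) (auto simp: cbox_Pair_eq)
  have nn: "0 \<le> ?F w" if "w \<in> ?B" for w
    using f(2)[OF G[OF that]] less[of "fst w"] that by (intro mult_nonneg_nonneg) (auto simp: cbox_Pair_eq)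
  have "box (0, 0) (\<Gamma>, 1 :: real) \<noteq> {}" using \<open>0 < \<Gamma>\<close> by (auto simp: box_ne_empty Basis_prod_def)
  then have all0: "\<forall>w\<in>?B. ?F w = 0"
    using integral_cbox_eq_0_iff[OF c _ nn] zero by (simp add: area_def)
  obtain a b where ab: "x = (a, b)" by (cases x)
  have a: "0 \<le> a" "a \<le> \<Gamma>" "l a \<le> b" "b \<le> r a" using x by (auto simp: ab region_def)
  define z where "z = (b - l a) / (r a - l a)"
  have z: "0 \<le> z" "z \<le> 1" using less[OF a(1,2)] a by (auto simp: z_def)
  have "(a, z) \<in> ?B" using z a by (auto simp: cbox_Pair_eq)
  then have "?F (a, z) = 0" using all0 by blast
  moreover have "z * (r a - l a) = b - l a" using less[OF a(1,2)] by (simp add: z_def)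
  then have "?G (a, z) = x" by (simp add: ab algebra_simps)
  ultimately show ?thesis using less[OF a(1,2)] by simp
qed

context rb_solution
begin

lemma hm_le_hp: "hm x \<le> hp x" using hm_less_hp[of x] by simp

lemma cell_slice_continuous:
  "0 < t \<Longrightarrow> continuous_on (region \<Gamma> hm hp) (\<theta> t)"
  "0 < t \<Longrightarrow> continuous_on (region \<Gamma> hm hp) (u t)"
  "0 < t \<Longrightarrow> continuous_on (region \<Gamma> hm hp) (q t)"
  using region_slice_continuous[OF \<theta>_continuous] region_slice_continuous[OF u_continuous]
    region_slice_continuous[OF q_continuous] by auto

lemma time_area_continuous:
  fixes f :: "real \<Rightarrow> point \<Rightarrow> real"
  assumes f: "continuous_on ({0<..} \<times> cS) (\<lambda>(t, x). f t x)" and "0 < a"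
    and "\<And>x. 0 \<le> x \<Longrightarrow> x \<le> \<Gamma> \<Longrightarrow> hm x \<le> l x \<and> l x \<le> r x \<and> r x \<le> hp x"
    and lr: "continuous_on {0..\<Gamma>} l" "continuous_on {0..\<Gamma>} r"
  shows "continuous_on {a..b} (\<lambda>t. area \<Gamma> l r (f t))"
proof (rule area_continuous_on_param)
  show "continuous_on ({a..b} \<times> {0..\<Gamma>}) (\<lambda>(p, x). l x)" "continuous_on ({a..b} \<times> {0..\<Gamma>}) (\<lambda>(p, x). r x)"
    unfolding split_beta'
    by (intro continuous_on_compose2[OF lr(1)] continuous_on_compose2[OF lr(2)] continuous_intros; auto)+
  have "region \<Gamma> l r \<subseteq> cS" using assms(3) by (intro region_subset_closed_strip) auto
  then show "continuous_on ({a..b} \<times> region \<Gamma> l r) (\<lambda>(p, x). f p x)"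
    by (intro continuous_on_subset[OF f] Sigma_mono) (use \<open>0 < a\<close> in auto)
qed (use assms(3) in auto)

text \<open>Apply the balance with weight \<open>\<omega> = 1\<close> and \<open>F\<close> the clipping function.  Both wall fluxes vanish, since
\<open>F'\<close> is zero at the wall temperatures, and \<open>F'' \<ge> 0\<close>, so the integral of \<open>F(\<theta>)\<close> does not increase.
It tends to zero for \<open>t \<down> 0\<close>, being bounded by \<open>\<parallel>\<theta>(t) - \<theta>\<^sub>0\<parallel>\<^sup>2\<close> because \<open>0 \<le> \<theta>\<^sub>0 \<le> 1\<close>.  Hence it is
zero for all times.\<close>

theorem temperature_range:
  assumes t: "0 < t" and x: "x \<in> region \<Gamma> hm hp"
  shows "0 \<le> \<theta> t x" "\<theta> t x \<le> 1"
proof -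
  let ?I = "\<lambda>t. area \<Gamma> hm hp (\<lambda>x. clipping (\<theta> t x))"
  have clip_cont: "continuous_on UNIV clipping"
    using clipping_DERIV(1) by (auto intro!: continuous_at_imp_continuous_on DERIV_isCont)
  have c: "continuous_on (region \<Gamma> hm hp) (\<lambda>x. clipping (\<theta> t x))" if "0 < t" for t
    by (intro continuous_on_compose2[OF clip_cont] cell_slice_continuous that subset_UNIV)
  have nn: "0 \<le> ?I t" if "0 < t" for t
    by (intro area_nonneg c[OF that] continuous_walls clipping_properties hm_le_hp)
  have decay: "?I t \<le> ?I a" if a: "0 < a" "a \<le> t" for a
  proof -
    have fb: "flux a t \<Gamma> hm (deriv hm)
      (\<lambda>t x. 1 * (fst (u t x) * clipping (\<theta> t x) - clipping' (\<theta> t x) * fst (q t x)))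
      (\<lambda>t x. 1 * (snd (u t x) * clipping (\<theta> t x) - clipping' (\<theta> t x) * snd (q t x)) + 0 * \<theta> t x) = 0"
      using flux_bottom[OF a(1), of t "\<lambda>_. 1" clipping clipping' 0] by (simp add: clipping_properties)
    have ft: "flux a t \<Gamma> hp (deriv hp)
      (\<lambda>t x. 1 * (fst (u t x) * clipping (\<theta> t x) - clipping' (\<theta> t x) * fst (q t x)))
      (\<lambda>t x. 1 * (snd (u t x) * clipping (\<theta> t x) - clipping' (\<theta> t x) * snd (q t x)) + 0 * \<theta> t x) = 0"
      using flux_top[OF a(1), of t "\<lambda>_. 1" clipping clipping' 0] by (simp add: clipping_properties)
    have "area \<Gamma> hm hp (\<lambda>x. 1 * clipping (\<theta> t x)) - area \<Gamma> hm hp (\<lambda>x. 1 * clipping (\<theta> a x)) + 0 - 0 =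
      integral {a..t} (\<lambda>t. area \<Gamma> hm hp (\<lambda>x.
        0 * (fst (u t x) * clipping (\<theta> t x) - clipping' (\<theta> t x) * fst (q t x)) +
        0 * (snd (u t x) * clipping (\<theta> t x) - clipping' (\<theta> t x) * snd (q t x)) -
        1 * clipping'' (\<theta> t x) * ((fst (q t x))\<^sup>2 + (snd (q t x))\<^sup>2) + 0 * snd (q t x)))"
      using temperature_balance[OF a, of hm "deriv hm" hp "deriv hp" clipping clipping' clipping'' "\<lambda>_. 1" "\<lambda>_. 0" "\<lambda>_. 0" 0]
        fb ft
      by (simp add: DERIV_walls continuous_walls hm_less_hp clipping_DERIV clipping''_continuous
          plane_deriv_const periodic_walls[of 0, simplified])
    also have "\<dots> = - integral {a..t} (\<lambda>t. area \<Gamma> hm hp (\<lambda>x. clipping'' (\<theta> t x) * ((fst (q t x))\<^sup>2 + (snd (q t x))\<^sup>2)))"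
      by (simp add: area_def)
    also have "\<dots> \<le> 0"
    proof -
      have cc: "continuous_on ({0<..} \<times> cS) (\<lambda>(t, x). clipping'' (\<theta> t x) * ((fst (q t x))\<^sup>2 + (snd (q t x))\<^sup>2))"
        using q_continuous \<theta>_continuous unfolding split_beta'
        by (intro continuous_intros continuous_on_compose2[OF clipping''_continuous]) auto
      have "0 \<le> integral {a..t} (\<lambda>t. area \<Gamma> hm hp (\<lambda>x. clipping'' (\<theta> t x) * ((fst (q t x))\<^sup>2 + (snd (q t x))\<^sup>2)))"
      proof (rule integral_nonneg)
        show "(\<lambda>t. area \<Gamma> hm hp (\<lambda>x. clipping'' (\<theta> t x) * ((fst (q t x))\<^sup>2 + (snd (q t x))\<^sup>2))) integrable_on {a..t}"
          by (intro integrable_continuous_real time_area_continuous[OF cc a(1)] continuous_walls)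
             (auto simp: hm_le_hp)
        fix s assume "s \<in> {a..t}"
        then have "0 < s" using a by auto
        then show "0 \<le> area \<Gamma> hm hp (\<lambda>x. clipping'' (\<theta> s x) * ((fst (q s x))\<^sup>2 + (snd (q s x))\<^sup>2))"
          using region_slice_continuous[OF cc, of s hm hp]
          by (intro area_nonneg continuous_walls hm_le_hp mult_nonneg_nonneg clipping_properties) (auto simp: hm_le_hp)
      qed
      then show ?thesis by simp
    qed
    finally show ?thesis by simp
  qed
  define D where "D a = (\<integral>\<^sup>+x\<in>cell \<Gamma> hm hp. ennreal ((norm (\<theta> a x - \<theta>0 x))\<^sup>2) \<partial>lborel)" for a
  have D0: "(D \<longlongrightarrow> 0) (at_right 0)"
    using solution unfolding rayleigh_benard_solution_def initial_value_def D_def by blast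
  have le: "ennreal (?I t) \<le> D a" if a: "0 < a" "a \<le> t" for a
  proof -
    have "ennreal (?I t) \<le> ennreal (?I a)" using decay[OF a] by (rule ennreal_leI)
    also have "\<dots> = (\<integral>\<^sup>+x\<in>region \<Gamma> hm hp. ennreal (clipping (\<theta> a x)) \<partial>lborel)"
      by (intro area_eq_nn_integral c a continuous_walls clipping_properties hm_le_hp)
    also have "\<dots> \<le> D a"
      unfolding D_def cell_eq_region
    proof (rule nn_integral_mono_AE)
      show "AE x in lborel. ennreal (clipping (\<theta> a x)) * indicator (region \<Gamma> hm hp) x
        \<le> ennreal ((norm (\<theta> a x - \<theta>0 x))\<^sup>2) * indicator (region \<Gamma> hm hp) x"
        using \<theta>0_range
        by eventually_elim
          (auto simp: cell_eq_region indicator_def intro!: ennreal_leI clipping_properties(6))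
    qed
    finally show ?thesis .
  qed
  have "ennreal (?I t) \<le> 0"
  proof (rule tendsto_lowerbound[OF D0])
    show "\<forall>\<^sub>F a in at_right 0. ennreal (?I t) \<le> D a"
      unfolding eventually_at_right_field using le t by (intro exI[of _ t]) auto
  qed simp
  then have "?I t = 0" using nn[OF t] by (simp add: ennreal_eq_0_iff)
  then have "clipping (\<theta> t x) = 0"
    using area_zero_imp_zero[OF c[OF t] _ _ _ _ \<Gamma>_pos _ x] clipping_properties(1) hm_less_hp continuous_walls
    by blast
  then show "0 \<le> \<theta> t x" "\<theta> t x \<le> 1" using clipping_properties(2) by auto
qed

text \<open>Otherwise the derivative of \<open>\<theta>\<close> along the ray would have the wrong sign on an initial segment, by
continuity of \<open>q\<close> up to the wall, contrary to the mean value theorem.\<close>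

lemma inward_derivative_sign:
  assumes t: "0 < t" and P: "P \<in> cS" and b: "0 < b"
    and ray: "\<And>s. 0 < s \<Longrightarrow> s < b \<Longrightarrow> P + s *\<^sub>R d \<in> S \<and> 0 \<le> \<sigma> * (\<theta> t (P + s *\<^sub>R d) - \<theta> t P)"
  shows "0 \<le> \<sigma> * (fst d * fst (q t P) + snd d * snd (q t P))"
proof (rule ccontr)
  define \<phi> where "\<phi> s = \<sigma> * (fst d * fst (q t (P + s *\<^sub>R d)) + snd d * snd (q t (P + s *\<^sub>R d)))" for s
  assume "\<not> ?thesis"
  then have neg: "\<phi> 0 < 0" by (simp add: \<phi>_def)
  have in_cS: "P + s *\<^sub>R d \<in> cS" if "s \<in> {0..<b}" for s
    using that P ray[of s] S_subset_cS by (cases "s = 0") auto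
  have qc: "continuous_on {0..<b} (\<lambda>s. q t (P + s *\<^sub>R d))" "continuous_on {0..<b} (\<lambda>s. \<theta> t (P + s *\<^sub>R d))"
    using in_cS t
    by (intro continuous_on_compose_pair[OF q_continuous] continuous_on_compose_pair[OF \<theta>_continuous]
        continuous_intros; auto)+
  have "continuous_on {0..<b} \<phi>" unfolding \<phi>_def by (intro continuous_intros qc)
  then have "(\<phi> \<longlongrightarrow> \<phi> 0) (at 0 within {0..<b})" using b by (auto simp: continuous_on_def)
  then have "\<forall>\<^sub>F s in at 0 within {0..<b}. \<phi> s < 0" using neg by (rule order_tendstoD)
  then obtain e where e: "0 < e" "\<And>s. s \<in> {0..<b} \<Longrightarrow> s \<noteq> 0 \<Longrightarrow> \<bar>s\<bar> < e \<Longrightarrow> \<phi> s < 0"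
    by (auto simp: eventually_at dist_real_def)
  define s where "s = min b e / 2"
  have s: "0 < s" "s < b" "s < e" using b e by (auto simp: s_def)
  have der: "((\<lambda>s. \<theta> t (P + s *\<^sub>R d)) has_real_derivative
       fst d * fst (q t (P + z *\<^sub>R d)) + snd d * snd (q t (P + z *\<^sub>R d))) (at z)"
    if "0 < z" "z < b" for z
  proof -
    have inS: "P + z *\<^sub>R d \<in> S" using ray that by auto
    have eq: "P + s *\<^sub>R d = (fst P + s * fst d, snd P + s * snd d)" for s
      by (simp add: prod_eq_iff)
    have "((\<lambda>s. \<theta> t (fst P + s * fst d, snd P + s * snd d)) has_vector_derivative
       fst d *\<^sub>R fst (q t (P + z *\<^sub>R d)) + snd d *\<^sub>R snd (q t (P + z *\<^sub>R d))) (at z)"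
      using \<theta>_spatial(1)[OF t inS] q_grad[OF t inS] unfolding eq
      by (intro plane_deriv_curve) (auto intro!: derivative_eq_intros simp: grad_def)
    then show ?thesis unfolding eq by (simp add: has_real_derivative_iff_has_vector_derivative)
  qed
  define g where "g s = \<theta> t (P + s *\<^sub>R d)" for s
  have "continuous_on {0..s} g"
    unfolding g_def by (rule continuous_on_subset[OF qc(2)]) (use s in auto)
  then obtain z where z: "0 < z" "z < s" "g s - g 0 =
     (\<lambda>h. (fst d * fst (q t (P + z *\<^sub>R d)) + snd d * snd (q t (P + z *\<^sub>R d))) * h) (s - 0)"
  proof (rule mvt[OF s(1)])
    fix z assume "0 < z" "z < s"
    then show "(g has_derivative (\<lambda>h. (fst d * fst (q t (P + z *\<^sub>R d)) + snd d * snd (q t (P + z *\<^sub>R d))) * h)) (at z)"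
      using der[of z] s unfolding g_def has_field_derivative_def by simp
  qed blast
  then have z3: "\<sigma> * (\<theta> t (P + s *\<^sub>R d) - \<theta> t P) = s * \<phi> z"
    by (simp add: g_def \<phi>_def)
  have "s * \<phi> z < 0" using e(2)[of z] z s by (intro mult_pos_neg) auto
  then show False using ray[of s] s z3 by simp
qed

end

text \<open>The ray in the direction \<open>(- D, 1)\<close>, normal to the graph, runs above the graph at first.\<close>

lemma eventually_right_of_graph:
  fixes h :: "real \<Rightarrow> real"
  assumes "(h has_real_derivative D) (at x)"
  shows "\<forall>\<^sub>F s in at_right 0. h (x - s * D) < h x + s"
proof -
  have "((\<lambda>s. x - s * D) has_real_derivative - D) (at 0)"
    by (auto intro!: derivative_eq_intros)
  then have "((\<lambda>s. h (x - s * D)) has_real_derivative D * - D) (at 0)"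
    using assms by (intro DERIV_chain2[of h D "\<lambda>s. x - s * D" 0]) auto
  then have "((\<lambda>s. h x + s - h (x - s * D)) has_real_derivative 1 + D * D) (at 0)"
    by (auto intro!: derivative_eq_intros)
  moreover have "0 < 1 + D * D" using zero_le_square[of D] by linarith
  ultimately obtain e where "0 < e" "\<And>s. 0 < s \<Longrightarrow> s < e \<Longrightarrow> h x + 0 - h (x - 0 * D) < h x + (0 + s) - h (x - (0 + s) * D)"
    using DERIV_pos_inc_right[of "\<lambda>s. h x + s - h (x - s * D)" "1 + D * D" 0] by blast
  then show ?thesis
    unfolding eventually_at_right_field by (intro exI[of _ e]) auto
qed

context rb_solution
begin

text \<open>The temperature is maximal on the bottom wall and minimal on the top wall, so its derivative along
the inward normals has a sign.  At the end points of the period, where the normal ray may leave the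
region \<open>0 \<le> x \<le> \<Gamma>\<close> at once, the claim follows by continuity.\<close>

lemma wall_flux_nonneg:
  assumes t: "0 < t" and x: "0 \<le> x" "x \<le> \<Gamma>"
  shows "0 \<le> wall_flux_bottom t x" "0 \<le> wall_flux_top t x"
proof -
  have lim: "\<forall>\<^sub>F s in at_right 0. 0 \<le> x + s * D \<and> x + s * D \<le> \<Gamma>" if "0 < x" "x < \<Gamma>" for x D
  proof -
    have "((\<lambda>s. x + s * D) \<longlongrightarrow> x + 0 * D) (at_right 0)" by (intro tendsto_intros)
    then have "\<forall>\<^sub>F s in at_right 0. 0 < x + s * D" "\<forall>\<^sub>F s in at_right 0. x + s * D < \<Gamma>"
      using order_tendstoD that by auto
    then show ?thesis by eventually_elim auto
  qed
  have bot: "0 \<le> wall_flux_bottom t x" if x: "0 < x" "x < \<Gamma>" for x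
  proof -
    let ?D = "deriv hm x"
    have "((\<lambda>s. hp (x - s * ?D) - (hm x + s)) \<longlongrightarrow> hp (x - 0 * ?D) - (hm x + 0)) (at_right 0)"
      by (intro tendsto_intros isCont_tendsto_compose[OF DERIV_isCont[OF DERIV_walls(2)]])
    then have "\<forall>\<^sub>F s in at_right 0. 0 < hp (x - s * ?D) - (hm x + s)"
      by (rule order_tendstoD) (simp add: hm_less_hp)
    then have "\<forall>\<^sub>F s in at_right 0. hm (x - s * ?D) < hm x + s \<and> hm x + s < hp (x - s * ?D) \<and>
        0 \<le> x - s * ?D \<and> x - s * ?D \<le> \<Gamma>"
      using eventually_right_of_graph[OF DERIV_walls(1)[of x]] lim[OF x, of "- ?D"]
      by eventually_elim auto
    then obtain b where b: "0 < b" "\<And>s. 0 < s \<Longrightarrow> s < b \<Longrightarrow> hm (x - s * ?D) < hm x + s \<and> hm x + s < hp (x - s * ?D) \<and>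
        0 \<le> x - s * ?D \<and> x - s * ?D \<le> \<Gamma>"
      unfolding eventually_at_right_field by auto
    have "0 \<le> -1 * (fst (- ?D, 1::real) * fst (q t (x, hm x)) + snd (- ?D, 1::real) * snd (q t (x, hm x)))"
    proof (rule inward_derivative_sign[OF t _ b(1)])
      show "(x, hm x) \<in> cS" by (simp add: closed_strip_def hm_le_hp)
      fix s assume s: "0 < s" "s < b"
      have "\<theta> t (x - s * ?D, hm x + s) \<le> 1"
        using b(2)[OF s] by (intro temperature_range[OF t]) (simp add: region_def)
      then show "(x, hm x) + s *\<^sub>R (- ?D, 1) \<in> S \<and> 0 \<le> -1 * (\<theta> t ((x, hm x) + s *\<^sub>R (- ?D, 1)) - \<theta> t (x, hm x))"
        using b(2)[OF s] wall_values(2)[OF t, of x] x by (simp add: strip_def)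
    qed
    then show ?thesis by (simp add: wall_flux_bottom_def)
  qed
  have top: "0 \<le> wall_flux_top t x" if x: "0 < x" "x < \<Gamma>" for x
  proof -
    let ?D = "deriv hp x"
    have "((\<lambda>s. hp x - s - hm (x + s * ?D)) \<longlongrightarrow> hp x - 0 - hm (x + 0 * ?D)) (at_right 0)"
      by (intro tendsto_intros isCont_tendsto_compose[OF DERIV_isCont[OF DERIV_walls(1)]])
    then have "\<forall>\<^sub>F s in at_right 0. 0 < hp x - s - hm (x + s * ?D)"
      by (rule order_tendstoD) (simp add: hm_less_hp)
    moreover have "\<forall>\<^sub>F s in at_right 0. - hp (x - s * - ?D) < - hp x + s"
      by (intro eventually_right_of_graph derivative_intros DERIV_walls)
    ultimately have "\<forall>\<^sub>F s in at_right 0. hm (x + s * ?D) < hp x - s \<and> hp x - s < hp (x + s * ?D) \<and>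
        0 \<le> x + s * ?D \<and> x + s * ?D \<le> \<Gamma>"
      using lim[OF x, of "?D"] by eventually_elim auto
    then obtain b where b: "0 < b" "\<And>s. 0 < s \<Longrightarrow> s < b \<Longrightarrow> hm (x + s * ?D) < hp x - s \<and> hp x - s < hp (x + s * ?D) \<and>
        0 \<le> x + s * ?D \<and> x + s * ?D \<le> \<Gamma>"
      unfolding eventually_at_right_field by auto
    have "0 \<le> 1 * (fst (?D, - 1::real) * fst (q t (x, hp x)) + snd (?D, - 1::real) * snd (q t (x, hp x)))"
    proof (rule inward_derivative_sign[OF t _ b(1)])
      show "(x, hp x) \<in> cS" by (simp add: closed_strip_def hm_le_hp)
      fix s assume s: "0 < s" "s < b"
      have "0 \<le> \<theta> t (x + s * ?D, hp x - s)"
        using b(2)[OF s] by (intro temperature_range[OF t]) (simp add: region_def)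
      then show "(x, hp x) + s *\<^sub>R (?D, - 1) \<in> S \<and> 0 \<le> 1 * (\<theta> t ((x, hp x) + s *\<^sub>R (?D, - 1)) - \<theta> t (x, hp x))"
        using b(2)[OF s] wall_values(1)[OF t, of x] x by (simp add: strip_def)
    qed
    then show ?thesis by (simp add: wall_flux_top_def)
  qed
  have cl: "closure {0<..<\<Gamma>} = {0..\<Gamma>}" using \<Gamma>_pos by (rule closure_greaterThanLessThan)
  have "continuous_on {0..\<Gamma>} (\<lambda>x. f t x)" if "continuous_on ({t} \<times> {0..\<Gamma>}) (\<lambda>w. f (fst w) (snd w))"
    for f :: "real \<Rightarrow> real \<Rightarrow> real"
    using continuous_on_compose2[OF that, of "{0..\<Gamma>}" "\<lambda>x. (t, x)"] by (simp add: image_subset_iff continuous_on_Pair)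
  then have c: "continuous_on {0..\<Gamma>} (wall_flux_bottom t)" "continuous_on {0..\<Gamma>} (wall_flux_top t)"
    using wall_flux_continuous[of "{t}"] t by auto
  show "0 \<le> wall_flux_bottom t x" "0 \<le> wall_flux_top t x"
    using continuous_ge_on_closure[of "{0<..<\<Gamma>}" "wall_flux_bottom t" x 0]
      continuous_ge_on_closure[of "{0<..<\<Gamma>}" "wall_flux_top t" x 0] c x bot top unfolding cl by auto
qed

end

section \<open>Heat flux, buoyancy and boundary layer\<close>

lemma area_mono_region:
  assumes f: "continuous_on (region \<Gamma> l' r') f" "\<And>x. x \<in> region \<Gamma> l' r' \<Longrightarrow> 0 \<le> f x"
    and lr: "continuous_on {0..\<Gamma>} l" "continuous_on {0..\<Gamma>} r" "continuous_on {0..\<Gamma>} l'" "continuous_on {0..\<Gamma>} r'"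
    and le: "\<And>x. 0 \<le> x \<Longrightarrow> x \<le> \<Gamma> \<Longrightarrow> l' x \<le> l x \<and> l x \<le> r x \<and> r x \<le> r' x"
  shows "area \<Gamma> l r f \<le> area \<Gamma> l' r' f"
proof -
  have le': "l x \<le> r x" "l' x \<le> r' x" if "0 \<le> x" "x \<le> \<Gamma>" for x using le[OF that] by auto
  have sub: "region \<Gamma> l r \<subseteq> region \<Gamma> l' r'" using le by (force simp: region_def)
  have slice: "(\<lambda>y. f (x, y)) integrable_on {a..b}" if "0 \<le> x" "x \<le> \<Gamma>" "l' x \<le> a" "b \<le> r' x" for x a b
    using that by (intro integrable_continuous_real continuous_on_compose2[OF f(1)] continuous_intros) (auto simp: region_def)
  have "area \<Gamma> l r f = integral {0..\<Gamma>} (\<lambda>x. integral {l x..r x} (\<lambda>y. f (x, y)))"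
    by (intro area_eq_iterated continuous_on_subset[OF f(1) sub] lr le')
  also have "\<dots> \<le> integral {0..\<Gamma>} (\<lambda>x. integral {l' x..r' x} (\<lambda>y. f (x, y)))"
  proof (rule integral_le)
    show "(\<lambda>x. integral {l x..r x} (\<lambda>y. f (x, y))) integrable_on {0..\<Gamma>}"
      "(\<lambda>x. integral {l' x..r' x} (\<lambda>y. f (x, y))) integrable_on {0..\<Gamma>}"
      by (intro integrable_continuous_real iterated_integral_continuous continuous_on_subset[OF f(1) sub] f(1) lr le'; simp)+
    fix x assume x: "x \<in> {0..\<Gamma>}"
    then show "integral {l x..r x} (\<lambda>y. f (x, y)) \<le> integral {l' x..r' x} (\<lambda>y. f (x, y))"
      using le[of x] f(2) by (intro integral_subset_le slice) (auto simp: region_def)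
  qed
  also have "\<dots> = area \<Gamma> l' r' f"
    by (intro area_eq_iterated[symmetric] f(1) lr le')
  finally show ?thesis .
qed

lemma area_one_vertical:
  "0 \<le> \<Gamma> \<Longrightarrow> area \<Gamma> l (\<lambda>x. l x + \<delta>) (\<lambda>_. c) = c * \<delta> * \<Gamma>"
  by (simp add: area_def content_Pair)

context rb_solution
begin

definition heat_in :: "real \<Rightarrow> real \<Rightarrow> real" where
  "heat_in a b = integral (cbox (a, 0) (b, \<Gamma>)) (\<lambda>w. wall_flux_bottom (fst w) (snd w))"

definition heat_out :: "real \<Rightarrow> real \<Rightarrow> real" where
  "heat_out a b = integral (cbox (a, 0) (b, \<Gamma>)) (\<lambda>w. wall_flux_top (fst w) (snd w))"

text \<open>A bound for the vertical extent of the whole channel.\<close>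

definition oscillation :: real where
  "oscillation = 1 + 2 * L * \<Gamma>"

lemma oscillation_ge_1: "1 \<le> oscillation"
  using L_nonneg \<Gamma>_pos by (simp add: oscillation_def)

lemma wall_flux_continuous_box:
  assumes "0 < a"
  shows "continuous_on (cbox (a, 0) (b, \<Gamma>)) (\<lambda>w. wall_flux_bottom (fst w) (snd w))"
    "continuous_on (cbox (a, 0) (b, \<Gamma>)) (\<lambda>w. wall_flux_top (fst w) (snd w))"
proof -
  have "{a..b} \<subseteq> {0<..}" using assms by auto
  from wall_flux_continuous[OF this]
  show "continuous_on (cbox (a, 0) (b, \<Gamma>)) (\<lambda>w. wall_flux_bottom (fst w) (snd w))"
    "continuous_on (cbox (a, 0) (b, \<Gamma>)) (\<lambda>w. wall_flux_top (fst w) (snd w))"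
    by (simp_all add: cbox_Pair_eq)
qed

lemma area_temperature_bounds:
  assumes "0 < t"
  shows "0 \<le> area \<Gamma> hm hp (\<theta> t)" "area \<Gamma> hm hp (\<theta> t) \<le> \<Gamma>"
    "0 \<le> area \<Gamma> hm hp (\<lambda>x. (\<theta> t x)\<^sup>2 / 2)" "area \<Gamma> hm hp (\<lambda>x. (\<theta> t x)\<^sup>2 / 2) \<le> \<Gamma>"
proof -
  note c = cell_slice_continuous(1)[OF assms] and r = temperature_range[OF assms]
  show "0 \<le> area \<Gamma> hm hp (\<theta> t)" "0 \<le> area \<Gamma> hm hp (\<lambda>x. (\<theta> t x)\<^sup>2 / 2)"
    using r by (auto intro!: area_nonneg c continuous_intros continuous_walls hm_le_hp)
  have "area \<Gamma> hm hp (\<theta> t) \<le> area \<Gamma> hm hp (\<lambda>_. 1)"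
    using r by (auto intro!: area_mono c continuous_intros continuous_walls hm_le_hp)
  then show "area \<Gamma> hm hp (\<theta> t) \<le> \<Gamma>" by (simp add: area_one)
  have "(\<theta> t x)\<^sup>2 / 2 \<le> 1" if "x \<in> region \<Gamma> hm hp" for x
  proof -
    have "(\<theta> t x)\<^sup>2 \<le> 1" using r[OF that] by (simp add: power_le_one)
    then show ?thesis by simp
  qed
  then have "area \<Gamma> hm hp (\<lambda>x. (\<theta> t x)\<^sup>2 / 2) \<le> area \<Gamma> hm hp (\<lambda>_. 1)"
    by (auto intro!: area_mono c continuous_intros continuous_walls hm_le_hp)
  then show "area \<Gamma> hm hp (\<lambda>x. (\<theta> t x)\<^sup>2 / 2) \<le> \<Gamma>" by (simp add: area_one)
qed

text \<open>The heat content of the channel is between \<open>0\<close> and \<open>\<Gamma>\<close>.\<close>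

lemma heat_out_le:
  assumes "0 < a" "a \<le> b"
  shows "heat_out a b \<le> heat_in a b + \<Gamma>"
proof -
  have "area \<Gamma> hm hp (\<lambda>x. 1 * \<theta> b x) - area \<Gamma> hm hp (\<lambda>x. 1 * \<theta> a x) + heat_out a b - heat_in a b =
    integral {a..b} (\<lambda>t. area \<Gamma> hm hp (\<lambda>x.
        0 * (fst (u t x) * \<theta> t x - 1 * fst (q t x)) + 0 * (snd (u t x) * \<theta> t x - 1 * snd (q t x)) -
        1 * 0 * ((fst (q t x))\<^sup>2 + (snd (q t x))\<^sup>2) + 0 * snd (q t x)))"
    using temperature_balance[OF assms, of hm "deriv hm" hp "deriv hp" "\<lambda>s. s" "\<lambda>_. 1" "\<lambda>_. 0" "\<lambda>_. 1" "\<lambda>_. 0" "\<lambda>_. 0" 0]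
      flux_bottom[OF assms(1), of b "\<lambda>_. 1" "\<lambda>s. s" "\<lambda>_. 1" 0] flux_top[OF assms(1), of b "\<lambda>_. 1" "\<lambda>s. s" "\<lambda>_. 1" 0]
    by (simp add: DERIV_walls continuous_walls hm_less_hp plane_deriv_const periodic_walls[of 0, simplified]
        heat_in_def heat_out_def)
  also have "\<dots> = 0" by (simp add: area_def)
  finally show ?thesis
    using area_temperature_bounds(1)[of b] area_temperature_bounds(2)[of a] assms by simp
qed

text \<open>The balance of \<open>\<theta>\<^sup>2 / 2\<close>: the temperature vanishes on the top wall, so no flux appears there.\<close>

lemma temperature_dissipation_le:
  assumes "0 < a" "a \<le> b"
  shows "integral {a..b} (\<lambda>t. area \<Gamma> hm hp (\<lambda>x. (fst (q t x))\<^sup>2 + (snd (q t x))\<^sup>2)) \<le> heat_in a b + \<Gamma>"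
proof -
  have d: "((\<lambda>s::real. s\<^sup>2 / 2) has_real_derivative s) (at s)" for s
    by (auto intro!: derivative_eq_intros)
  have "area \<Gamma> hm hp (\<lambda>x. 1 * ((\<theta> b x)\<^sup>2 / 2)) - area \<Gamma> hm hp (\<lambda>x. 1 * ((\<theta> a x)\<^sup>2 / 2)) + 0 - heat_in a b =
    integral {a..b} (\<lambda>t. area \<Gamma> hm hp (\<lambda>x.
        0 * (fst (u t x) * ((\<theta> t x)\<^sup>2 / 2) - \<theta> t x * fst (q t x)) + 0 * (snd (u t x) * ((\<theta> t x)\<^sup>2 / 2) - \<theta> t x * snd (q t x)) -
        1 * 1 * ((fst (q t x))\<^sup>2 + (snd (q t x))\<^sup>2) + 0 * snd (q t x)))"
    using temperature_balance[OF assms, of hm "deriv hm" hp "deriv hp" "\<lambda>s. s\<^sup>2 / 2" "\<lambda>s. s" "\<lambda>_. 1" "\<lambda>_. 1" "\<lambda>_. 0" "\<lambda>_. 0" 0]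
      flux_bottom[OF assms(1), of b "\<lambda>_. 1" "\<lambda>s. s\<^sup>2 / 2" "\<lambda>s. s" 0] flux_top[OF assms(1), of b "\<lambda>_. 1" "\<lambda>s. s\<^sup>2 / 2" "\<lambda>s. s" 0]
    by (simp add: d DERIV_walls continuous_walls hm_less_hp plane_deriv_const periodic_walls[of 0, simplified]
        heat_in_def heat_out_def)
  also have "\<dots> = - integral {a..b} (\<lambda>t. area \<Gamma> hm hp (\<lambda>x. (fst (q t x))\<^sup>2 + (snd (q t x))\<^sup>2))"
  proof -
    have "area \<Gamma> hm hp (\<lambda>x. - ((fst (q t x))\<^sup>2 + (snd (q t x))\<^sup>2)) =
      - area \<Gamma> hm hp (\<lambda>x. (fst (q t x))\<^sup>2 + (snd (q t x))\<^sup>2)" for t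
      unfolding area_def integral_neg[symmetric] by (intro integral_cong) (simp add: algebra_simps)
    then show ?thesis by (simp flip: integral_neg)
  qed
  finally show ?thesis
    using area_temperature_bounds(3)[of b] area_temperature_bounds(4)[of a] assms by simp
qed

text \<open>Multiply the heat equation by the height \<open>\<omega>\<close> above the lowest point of the bottom wall.  Convection
contributes the work \<open>\<theta> u\<^sub>2\<close> of the buoyancy; conduction contributes a boundary term only.  At the
walls, \<open>\<omega>\<close> times the heat flux is nonnegative at the bottom and at most \<open>oscillation\<close> times the
outgoing flux at the top.\<close>

lemma buoyancy_work_le:
  assumes "0 < a" "a \<le> b"
  shows "integral {a..b} (\<lambda>t. area \<Gamma> hm hp (\<lambda>x. \<theta> t x * snd (u t x))) \<le> oscillation * (heat_in a b + 2 * \<Gamma>)"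
proof -
  obtain x0 where x0: "x0 \<in> {0..\<Gamma>}" "\<And>x. x \<in> {0..\<Gamma>} \<Longrightarrow> hm x0 \<le> hm x"
    using continuous_attains_inf[of "{0..\<Gamma>}" hm] continuous_walls \<Gamma>_pos by auto
  define \<omega> where "\<omega> x = snd x - hm x0" for x :: point
  have osc: "hp x - hm x0 \<le> oscillation" if "0 \<le> x" "x \<le> \<Gamma>" for x
    using wall_oscillation[of x x0] that x0(1) by (simp add: oscillation_def)
  have \<omega>: "0 \<le> \<omega> x" "\<omega> x \<le> oscillation" if "x \<in> region \<Gamma> hm hp" for x
    using x0(2)[of "fst x"] osc[of "fst x"] that by (auto simp: \<omega>_def region_def)
  have \<omega>d: "plane_deriv \<omega> 0 1 x" for x
    using plane_deriv_diff[OF plane_deriv_snd plane_deriv_const[of "hm x0" x]] by (simp add: \<omega>_def[abs_def])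
  have \<omega>c: "continuous_on X \<omega>" for X unfolding \<omega>_def by (intro continuous_intros)
  let ?in = "integral (cbox (a, 0) (b, \<Gamma>)) (\<lambda>w. \<omega> (snd w, hm (snd w)) * 1 * wall_flux_bottom (fst w) (snd w) + 1)"
  let ?out = "integral (cbox (a, 0) (b, \<Gamma>)) (\<lambda>w. \<omega> (snd w, hp (snd w)) * 1 * wall_flux_top (fst w) (snd w))"
  have "area \<Gamma> hm hp (\<lambda>x. \<omega> x * \<theta> b x) - area \<Gamma> hm hp (\<lambda>x. \<omega> x * \<theta> a x) + ?out - ?in =
    integral {a..b} (\<lambda>t. area \<Gamma> hm hp (\<lambda>x.
        0 * (fst (u t x) * \<theta> t x - 1 * fst (q t x)) + 1 * (snd (u t x) * \<theta> t x - 1 * snd (q t x)) -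
        \<omega> x * 0 * ((fst (q t x))\<^sup>2 + (snd (q t x))\<^sup>2) + 1 * snd (q t x)))"
    using temperature_balance[OF assms, of hm "deriv hm" hp "deriv hp" "\<lambda>s. s" "\<lambda>_. 1" "\<lambda>_. 0" \<omega> "\<lambda>_. 0" "\<lambda>_. 1" 1]
      flux_bottom[OF assms(1), of b \<omega> "\<lambda>s. s" "\<lambda>_. 1" 1] flux_top[OF assms(1), of b \<omega> "\<lambda>s. s" "\<lambda>_. 1" 1]
    by (simp add: DERIV_walls continuous_walls hm_less_hp \<omega>d \<omega>c periodic_walls[of 0, simplified])
       (simp add: \<omega>_def)
  also have "\<dots> = integral {a..b} (\<lambda>t. area \<Gamma> hm hp (\<lambda>x. \<theta> t x * snd (u t x)))"
    by (simp add: mult.commute)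
  finally have eq: "integral {a..b} (\<lambda>t. area \<Gamma> hm hp (\<lambda>x. \<theta> t x * snd (u t x))) =
     area \<Gamma> hm hp (\<lambda>x. \<omega> x * \<theta> b x) - area \<Gamma> hm hp (\<lambda>x. \<omega> x * \<theta> a x) + ?out - ?in" by simp
  have tpos: "0 < fst w" "0 \<le> snd w" "snd w \<le> \<Gamma>" if "w \<in> cbox (a, 0) (b, \<Gamma>)" for w
    using that assms by (auto simp: cbox_Pair_eq)
  have c: "continuous_on (cbox (a, 0) (b, \<Gamma>)) (\<lambda>w. \<omega> (snd w, h (snd w)))" if "continuous_on UNIV h" for h
    unfolding \<omega>_def by (simp, intro continuous_intros continuous_on_compose2[OF that]) auto
  have "0 \<le> ?in"
  proof (rule integral_nonneg)
    show "(\<lambda>w. \<omega> (snd w, hm (snd w)) * 1 * wall_flux_bottom (fst w) (snd w) + 1) integrable_on cbox (a, 0) (b, \<Gamma>)"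
      by (intro integrable_continuous continuous_intros c continuous_walls wall_flux_continuous_box assms)
    fix w assume w: "w \<in> cbox (a, 0) (b, \<Gamma>)"
    have "0 \<le> \<omega> (snd w, hm (snd w)) * wall_flux_bottom (fst w) (snd w)"
      using tpos[OF w] by (intro mult_nonneg_nonneg \<omega>(1) wall_flux_nonneg) (auto simp: region_def hm_le_hp)
    then show "0 \<le> \<omega> (snd w, hm (snd w)) * 1 * wall_flux_bottom (fst w) (snd w) + 1" by simp
  qed
  moreover have "?out \<le> integral (cbox (a, 0) (b, \<Gamma>)) (\<lambda>w. oscillation * wall_flux_top (fst w) (snd w))"
  proof (rule integral_le)
    show "(\<lambda>w. \<omega> (snd w, hp (snd w)) * 1 * wall_flux_top (fst w) (snd w)) integrable_on cbox (a, 0) (b, \<Gamma>)"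
      "(\<lambda>w. oscillation * wall_flux_top (fst w) (snd w)) integrable_on cbox (a, 0) (b, \<Gamma>)"
      by (intro integrable_continuous continuous_intros c continuous_walls wall_flux_continuous_box assms)+
    fix w assume w: "w \<in> cbox (a, 0) (b, \<Gamma>)"
    show "\<omega> (snd w, hp (snd w)) * 1 * wall_flux_top (fst w) (snd w) \<le> oscillation * wall_flux_top (fst w) (snd w)"
      using tpos[OF w] unfolding mult_1_right
      by (intro mult_right_mono \<omega>(2) wall_flux_nonneg) (auto simp: region_def hm_le_hp)
  qed
  moreover have "integral (cbox (a, 0) (b, \<Gamma>)) (\<lambda>w. oscillation * wall_flux_top (fst w) (snd w)) = oscillation * heat_out a b"
    by (simp add: heat_out_def)
  moreover have "oscillation * heat_out a b \<le> oscillation * (heat_in a b + \<Gamma>)"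
    using heat_out_le[OF assms] oscillation_ge_1 by (intro mult_left_mono) auto
  moreover have "0 \<le> area \<Gamma> hm hp (\<lambda>x. \<omega> x * \<theta> a x)"
    using \<omega>(1) temperature_range assms
    by (intro area_nonneg continuous_intros \<omega>c cell_slice_continuous continuous_walls hm_le_hp) auto
  moreover have "area \<Gamma> hm hp (\<lambda>x. \<omega> x * \<theta> b x) \<le> area \<Gamma> hm hp (\<lambda>x. oscillation * 1 + 0 * 1)"
  proof (rule area_mono)
    fix x assume x: "x \<in> region \<Gamma> hm hp"
    have "\<omega> x * \<theta> b x \<le> oscillation * 1"
      using \<omega>[OF x] temperature_range[OF _ x, of b] assms oscillation_ge_1 by (intro mult_mono) auto
    then show "\<omega> x * \<theta> b x \<le> oscillation * 1 + 0 * 1" by simp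
  qed (use assms in \<open>auto intro!: continuous_intros \<omega>c cell_slice_continuous continuous_walls hm_le_hp\<close>)
  moreover have "area \<Gamma> hm hp (\<lambda>x. oscillation * 1 + 0 * 1) = oscillation * \<Gamma>"
    by (subst area_linear) (auto intro: continuous_walls hm_le_hp simp: area_one)
  ultimately show ?thesis unfolding eq distrib_left by linarith
qed

text \<open>Multiply the heat equation by the weight \<open>\<omega>\<close> that falls from one at the bottom wall to zero at height
\<open>\<delta>\<close> above it.  This isolates the incoming heat.  The convective term contains only the velocity
component \<open>u\<^sub>2 - h' u\<^sub>1\<close>, which vanishes on the wall.  In the conductive term the gradient is absorbed
into a quarter of the temperature dissipation, which \<open>temperature_dissipation_le\<close> bounds by the incoming heat.\<close>

lemma heat_in_boundary_layer:
  assumes ab: "0 < a" "a \<le> b" and \<delta>: "0 < \<delta>" "\<And>x. 0 \<le> x \<Longrightarrow> x \<le> \<Gamma> \<Longrightarrow> hm x + \<delta> \<le> hp x"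
  shows "heat_in a b \<le> \<delta> * \<Gamma> +
    (1 / \<delta>) * integral {a..b} (\<lambda>t. area \<Gamma> hm (\<lambda>x. hm x + \<delta>) (\<lambda>x. \<bar>snd (u t x) - deriv hm (fst x) * fst (u t x)\<bar>)) +
    (heat_in a b + \<Gamma>) / 4 + (1 + L\<^sup>2) / \<delta> * \<Gamma> * (b - a)"
proof -
  let ?r = "\<lambda>x. hm x + \<delta>"
  define \<omega> where "\<omega> x = 1 - (snd x - hm (fst x)) / \<delta>" for x :: point
  define v where "v t x = snd (u t x) - deriv hm (fst x) * fst (u t x)" for t and x :: point
  define n where "n t x = snd (q t x) - deriv hm (fst x) * fst (q t x)" for t and x :: point
  have rc: "continuous_on X ?r" for X by (intro continuous_intros continuous_walls)
  have le: "hm x \<le> ?r x" for x using \<delta> by simp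
  have R: "region \<Gamma> hm ?r \<subseteq> region \<Gamma> hm hp" using \<delta>(2) by (force simp: region_def)
  have in3: "hm x \<le> hm x \<and> hm x \<le> ?r x \<and> ?r x \<le> hp x" if "0 \<le> x" "x \<le> \<Gamma>" for x using \<delta> that by auto
  have \<omega>d: "plane_deriv \<omega> (deriv hm (fst x) / \<delta>) (- 1 / \<delta>) x" for x
  proof -
    have "plane_deriv (\<lambda>x. 1 - (1 / \<delta>) * (snd x - hm (fst x))) (0 - (1 / \<delta>) * (0 - deriv hm (fst x) * 1))
       (0 - (1 / \<delta>) * (1 - deriv hm (fst x) * 0)) x"
      by (intro plane_deriv_diff plane_deriv_cmult plane_deriv_const plane_deriv_snd
           plane_deriv_compose[OF plane_deriv_fst] DERIV_walls)
    then show ?thesis by (simp add: \<omega>_def[abs_def])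
  qed
  have hmc: "continuous_on X (\<lambda>x. deriv hm (fst x))" "continuous_on X (\<lambda>x. hm (fst x))" for X :: "point set"
    by (intro continuous_on_compose2[OF continuous_walls(3)[of UNIV]] continuous_on_compose2[OF continuous_walls(1)[of UNIV]]
        continuous_intros subset_UNIV)+
  have \<omega>c: "continuous_on X \<omega>" for X
    unfolding \<omega>_def using \<delta> by (intro continuous_intros hmc) auto
  have \<omega>01: "0 \<le> \<omega> x" "\<omega> x \<le> 1" if "x \<in> region \<Gamma> hm ?r" for x
    using that \<delta> by (auto simp: \<omega>_def region_def field_simps)
  have cc: "continuous_on ({0<..} \<times> cS) (\<lambda>(t, x). v t x)" "continuous_on ({0<..} \<times> cS) (\<lambda>(t, x). n t x)"
    unfolding v_def n_def using u_continuous q_continuous unfolding split_beta'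
    by (intro continuous_intros continuous_on_compose2[OF hmc(1)[of UNIV]]; simp)+
  have bal: "area \<Gamma> hm ?r (\<lambda>x. \<omega> x * \<theta> b x) - area \<Gamma> hm ?r (\<lambda>x. \<omega> x * \<theta> a x) + 0 - heat_in a b =
    integral {a..b} (\<lambda>t. area \<Gamma> hm ?r (\<lambda>x.
        deriv hm (fst x) / \<delta> * (fst (u t x) * \<theta> t x - 1 * fst (q t x)) + (- 1 / \<delta>) * (snd (u t x) * \<theta> t x - 1 * snd (q t x)) -
        \<omega> x * 0 * ((fst (q t x))\<^sup>2 + (snd (q t x))\<^sup>2) + 0 * snd (q t x)))"
  proof -
    have fb: "flux a b \<Gamma> hm (deriv hm)
      (\<lambda>t x. \<omega> x * (fst (u t x) * \<theta> t x - 1 * fst (q t x)))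
      (\<lambda>t x. \<omega> x * (snd (u t x) * \<theta> t x - 1 * snd (q t x)) + 0 * \<theta> t x) = heat_in a b"
      using flux_bottom[OF ab(1), of b \<omega> "\<lambda>s. s" "\<lambda>_. 1" 0] by (simp add: heat_in_def \<omega>_def)
    have ft: "flux a b \<Gamma> ?r (deriv hm)
      (\<lambda>t x. \<omega> x * (fst (u t x) * \<theta> t x - 1 * fst (q t x)))
      (\<lambda>t x. \<omega> x * (snd (u t x) * \<theta> t x - 1 * snd (q t x)) + 0 * \<theta> t x) = 0"
      using \<delta>(1) by (simp add: flux_def \<omega>_def)
    show ?thesis
    proof (subst ft[symmetric], subst fb[symmetric], rule temperature_balance[OF ab])
      show "(?r has_real_derivative deriv hm x) (at x)" for x
        using DERIV_walls(1)[of x] by (auto intro!: derivative_eq_intros)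
      show "continuous_on (region \<Gamma> hm ?r) (\<lambda>x. deriv hm (fst x) / \<delta>)"
        using \<delta> by (intro continuous_intros hmc) auto
      show "plane_deriv \<omega> (deriv hm (fst x) / \<delta>) (- 1 / \<delta>) x" for x by (rule \<omega>d)
      show "\<omega> (0, y) = \<omega> (\<Gamma>, y)" for y by (simp add: \<omega>_def periodic_walls[of 0, simplified])
    qed (use \<delta> in3 in \<open>auto intro!: DERIV_walls continuous_walls \<omega>d \<omega>c derivative_eq_intros simp: periodic_walls[of 0, simplified]\<close>)
  qed
  have cv: "continuous_on {a..b} (\<lambda>t. area \<Gamma> hm ?r (f t))" if "continuous_on ({0<..} \<times> cS) (\<lambda>(t, x). f t x)" for f
    by (rule time_area_continuous[OF that ab(1) in3]) (auto intro: continuous_walls rc)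
  have slice: "continuous_on (region \<Gamma> hm ?r) (f t)" if "continuous_on ({0<..} \<times> cS) (\<lambda>(t, x). f t x)" "0 < t" for f :: "real \<Rightarrow> point \<Rightarrow> real" and t
    by (rule region_slice_continuous[OF that]) (use in3 in auto)
  have absv: "continuous_on ({0<..} \<times> cS) (\<lambda>(t, x). \<bar>v t x\<bar>)"
    using cc(1) unfolding split_beta' by (intro continuous_intros)
  have qq: "continuous_on ({0<..} \<times> cS) (\<lambda>(t, x). (fst (q t x))\<^sup>2 + (snd (q t x))\<^sup>2)"
    using q_continuous unfolding split_beta' by (intro continuous_intros)
  let ?Q = "\<lambda>t x. (fst (q t x))\<^sup>2 + (snd (q t x))\<^sup>2"
  define k2 where "k2 = 1 + L\<^sup>2"
  \<comment> \<open>Young's inequality for the conductive term.\<close>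
  have pw: "v t x * \<theta> t x / \<delta> - n t x / \<delta> \<le> (1 / \<delta>) * \<bar>v t x\<bar> + (1 * (1/4 * ?Q t x + k2 / \<delta>\<^sup>2 * 1))"
    if t: "0 < t" and x: "x \<in> region \<Gamma> hm ?r" for t x
  proof -
    have "0 \<le> \<theta> t x" "\<theta> t x \<le> 1" using temperature_range[OF t, of x] R x by auto
    then have "\<bar>v t x\<bar> * \<bar>\<theta> t x\<bar> \<le> \<bar>v t x\<bar> * 1" by (intro mult_left_mono) auto
    then have "v t x * \<theta> t x \<le> \<bar>v t x\<bar> * 1"
      unfolding abs_mult[symmetric] using abs_ge_self[of "v t x * \<theta> t x"] by linarith
    then have 1: "v t x * \<theta> t x / \<delta> \<le> (1 / \<delta>) * \<bar>v t x\<bar>"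
      using \<delta> by (simp add: divide_right_mono)
    let ?d = "deriv hm (fst x)"
    have "(n t x)\<^sup>2 + (fst (q t x) + ?d * snd (q t x))\<^sup>2 = (1 + ?d\<^sup>2) * ?Q t x"
      unfolding n_def by (simp add: power2_eq_square algebra_simps)
    then have "(n t x)\<^sup>2 \<le> (1 + ?d\<^sup>2) * ?Q t x"
      using zero_le_power2[of "fst (q t x) + ?d * snd (q t x)"] by linarith
    also have "\<dots> \<le> k2 * ?Q t x"
      using power_mono[OF deriv_walls_bound(1)[of "fst x"], of 2] by (intro mult_right_mono) (auto simp: k2_def)
    finally have n2: "(n t x)\<^sup>2 \<le> k2 * ?Q t x" .
    have k2: "0 < k2" by (simp add: k2_def add_pos_nonneg)
    obtain k where k: "0 < k" "k\<^sup>2 = k2" using k2 by (intro that[of "sqrt k2"]) auto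
    have "0 \<le> (n t x / (2 * k) + k / \<delta>)\<^sup>2" by simp
    also have "\<dots> = (n t x)\<^sup>2 / (4 * k\<^sup>2) + n t x / \<delta> + k\<^sup>2 / \<delta>\<^sup>2"
      using k(1) \<delta>(1) by (simp add: power2_eq_square field_simps)
    also have "k\<^sup>2 = k2" by (rule k)
    finally have "- n t x / \<delta> \<le> (n t x)\<^sup>2 / (4 * k2) + k2 / \<delta>\<^sup>2" by simp
    also have "(n t x)\<^sup>2 / (4 * k2) \<le> 1/4 * ?Q t x"
      using n2 k2 by (simp add: field_simps)
    finally show ?thesis using 1 by simp
  qed
  have m1: "heat_in a b = area \<Gamma> hm ?r (\<lambda>x. \<omega> x * \<theta> b x) - area \<Gamma> hm ?r (\<lambda>x. \<omega> x * \<theta> a x) +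
      integral {a..b} (\<lambda>t. area \<Gamma> hm ?r (\<lambda>x. v t x * \<theta> t x / \<delta> - n t x / \<delta>))"
  proof -
    have "integral {a..b} (\<lambda>t. area \<Gamma> hm ?r (\<lambda>x.
        deriv hm (fst x) / \<delta> * (fst (u t x) * \<theta> t x - 1 * fst (q t x)) + (- 1 / \<delta>) * (snd (u t x) * \<theta> t x - 1 * snd (q t x)) -
        \<omega> x * 0 * ((fst (q t x))\<^sup>2 + (snd (q t x))\<^sup>2) + 0 * snd (q t x))) =
      - integral {a..b} (\<lambda>t. area \<Gamma> hm ?r (\<lambda>x. v t x * \<theta> t x / \<delta> - n t x / \<delta>))"
      unfolding area_def integral_neg[symmetric]
      by (intro integral_cong) (use \<delta> in \<open>simp add: v_def n_def field_simps\<close>)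
    then show ?thesis using bal by simp
  qed
  have m2: "integral {a..b} (\<lambda>t. area \<Gamma> hm ?r (\<lambda>x. v t x * \<theta> t x / \<delta> - n t x / \<delta>)) \<le>
     integral {a..b} (\<lambda>t. (1 / \<delta>) * area \<Gamma> hm ?r (\<lambda>x. \<bar>v t x\<bar>) + (1/4 * area \<Gamma> hm hp (?Q t) + k2 / \<delta> * \<Gamma>))"
  proof (rule integral_le)
    have "continuous_on ({0<..} \<times> cS) (\<lambda>(t, x). v t x * \<theta> t x / \<delta> - n t x / \<delta>)"
      using cc \<theta>_continuous \<delta> unfolding split_beta' by (intro continuous_intros) auto
    note vn = this
    show "(\<lambda>t. area \<Gamma> hm ?r (\<lambda>x. v t x * \<theta> t x / \<delta> - n t x / \<delta>)) integrable_on {a..b}"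
      by (intro integrable_continuous_real cv vn)
    show "(\<lambda>t. (1 / \<delta>) * area \<Gamma> hm ?r (\<lambda>x. \<bar>v t x\<bar>) + (1/4 * area \<Gamma> hm hp (?Q t) + k2 / \<delta> * \<Gamma>)) integrable_on {a..b}"
      by (intro integrable_continuous_real continuous_intros cv absv time_area_continuous[OF qq ab(1)] continuous_walls)
         (auto simp: hm_le_hp)
    fix t assume "t \<in> {a..b}"
    then have t: "0 < t" using ab by auto
    have p1: "area \<Gamma> hm ?r (\<lambda>x. v t x * \<theta> t x / \<delta> - n t x / \<delta>) \<le>
      area \<Gamma> hm ?r (\<lambda>x. (1 / \<delta>) * \<bar>v t x\<bar> + (1 * (1/4 * ?Q t x + k2 / \<delta>\<^sup>2 * 1)))"
      by (intro area_mono pw t continuous_intros slice[OF vn t] slice[OF absv t] slice[OF qq t] continuous_walls rc le)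
    have p2: "area \<Gamma> hm ?r (\<lambda>x. (1 / \<delta>) * \<bar>v t x\<bar> + (1 * (1/4 * ?Q t x + k2 / \<delta>\<^sup>2 * 1))) =
      (1 / \<delta>) * area \<Gamma> hm ?r (\<lambda>x. \<bar>v t x\<bar>) + 1 * (1/4 * area \<Gamma> hm ?r (?Q t) + k2 / \<delta>\<^sup>2 * area \<Gamma> hm ?r (\<lambda>_. 1))"
    proof -
      have "area \<Gamma> hm ?r (\<lambda>x. (1 / \<delta>) * \<bar>v t x\<bar> + (1 * (1/4 * ?Q t x + k2 / \<delta>\<^sup>2 * 1))) =
        (1 / \<delta>) * area \<Gamma> hm ?r (\<lambda>x. \<bar>v t x\<bar>) + 1 * area \<Gamma> hm ?r (\<lambda>x. 1/4 * ?Q t x + k2 / \<delta>\<^sup>2 * 1)"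
        by (rule area_linear) (intro continuous_intros slice[OF absv t] slice[OF qq t] continuous_walls rc le)+
      also have "area \<Gamma> hm ?r (\<lambda>x. 1/4 * ?Q t x + k2 / \<delta>\<^sup>2 * 1) =
        1/4 * area \<Gamma> hm ?r (?Q t) + k2 / \<delta>\<^sup>2 * area \<Gamma> hm ?r (\<lambda>_. 1)"
        by (rule area_linear) (intro continuous_intros slice[OF qq t] continuous_walls rc le)+
      finally show ?thesis .
    qed
    have p3: "k2 / \<delta>\<^sup>2 * area \<Gamma> hm ?r (\<lambda>_. 1) = k2 / \<delta> * \<Gamma>"
      using \<delta> \<Gamma>_pos by (simp add: area_one_vertical power2_eq_square)
    have p4: "area \<Gamma> hm ?r (?Q t) \<le> area \<Gamma> hm hp (?Q t)"
      by (rule area_mono_region)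
        (use in3 region_slice_continuous[OF qq t, of hm hp] in \<open>auto intro!: continuous_walls rc simp: hm_le_hp\<close>)
    show "area \<Gamma> hm ?r (\<lambda>x. v t x * \<theta> t x / \<delta> - n t x / \<delta>) \<le>
      (1 / \<delta>) * area \<Gamma> hm ?r (\<lambda>x. \<bar>v t x\<bar>) + (1/4 * area \<Gamma> hm hp (?Q t) + k2 / \<delta> * \<Gamma>)"
    proof -
      have "I \<le> A + (1/4 * Q + K)"
        if "I \<le> J" "J = A + 1 * (1/4 * Q' + K')" "K' = K" "Q' \<le> Q" for A I J K K' Q Q' :: real
        using that by argo
      from this[OF p1 p2 p3 p4] show ?thesis .
    qed
  qed
  have m3: "integral {a..b} (\<lambda>t. (1 / \<delta>) * area \<Gamma> hm ?r (\<lambda>x. \<bar>v t x\<bar>) + (1/4 * area \<Gamma> hm hp (?Q t) + k2 / \<delta> * \<Gamma>)) =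
      (1 / \<delta>) * integral {a..b} (\<lambda>t. area \<Gamma> hm ?r (\<lambda>x. \<bar>v t x\<bar>)) +
      (1/4 * integral {a..b} (\<lambda>t. area \<Gamma> hm hp (?Q t)) + k2 / \<delta> * \<Gamma> * (b - a))"
  proof -
    have i: "(\<lambda>t. area \<Gamma> hm ?r (\<lambda>x. \<bar>v t x\<bar>)) integrable_on {a..b}" "(\<lambda>t. area \<Gamma> hm hp (?Q t)) integrable_on {a..b}"
    proof -
      show "(\<lambda>t. area \<Gamma> hm ?r (\<lambda>x. \<bar>v t x\<bar>)) integrable_on {a..b}"
        by (rule integrable_continuous_real[OF cv[OF absv]])
      show "(\<lambda>t. area \<Gamma> hm hp (?Q t)) integrable_on {a..b}"
        by (rule integrable_continuous_real[OF time_area_continuous[OF qq ab(1)]])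
          (auto simp: hm_le_hp intro: continuous_walls)
    qed
    have "((\<lambda>t. k2 / \<delta> * \<Gamma>) has_integral (k2 / \<delta> * \<Gamma> * (b - a))) {a..b}"
      using has_integral_const_real[of "k2 / \<delta> * \<Gamma>" a b] ab by (simp add: mult.commute)
    then have "((\<lambda>t. (1 / \<delta>) * area \<Gamma> hm ?r (\<lambda>x. \<bar>v t x\<bar>) + (1/4 * area \<Gamma> hm hp (?Q t) + k2 / \<delta> * \<Gamma>)) has_integral
      ((1 / \<delta>) * integral {a..b} (\<lambda>t. area \<Gamma> hm ?r (\<lambda>x. \<bar>v t x\<bar>)) +
      (1/4 * integral {a..b} (\<lambda>t. area \<Gamma> hm hp (?Q t)) + k2 / \<delta> * \<Gamma> * (b - a)))) {a..b}"
      by (intro has_integral_add has_integral_mult_right integrable_integral i)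
    then show ?thesis by (rule integral_unique)
  qed
  have m4: "integral {a..b} (\<lambda>t. area \<Gamma> hm hp (?Q t)) \<le> heat_in a b + \<Gamma>"
    by (rule temperature_dissipation_le[OF ab])
  have main: "heat_in a b \<le> area \<Gamma> hm ?r (\<lambda>x. \<omega> x * \<theta> b x) - area \<Gamma> hm ?r (\<lambda>x. \<omega> x * \<theta> a x) +
     ((1 / \<delta>) * integral {a..b} (\<lambda>t. area \<Gamma> hm ?r (\<lambda>x. \<bar>v t x\<bar>)) + (1/4 * (heat_in a b + \<Gamma>) + k2 / \<delta> * \<Gamma> * (b - a)))"
  proof -
    have "h \<le> A - B + (C + (1/4 * (h + g) + D))"
      if "h = A - B + I" "I \<le> J" "J = C + (1/4 * Q + D)" "Q \<le> h + g" for h A B C D I J Q g :: real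
      using that by argo
    from this[OF m1 m2 m3 m4] show ?thesis .
  qed
  have \<omega>\<theta>: "continuous_on (region \<Gamma> hm ?r) (\<lambda>x. \<omega> x * \<theta> t x)" if "0 < t" for t
    by (intro continuous_intros \<omega>c slice[OF \<theta>_continuous that])
  have "0 \<le> area \<Gamma> hm ?r (\<lambda>x. \<omega> x * \<theta> a x)"
    using \<omega>01 temperature_range[OF ab(1)] R
    by (intro area_nonneg \<omega>\<theta> ab continuous_walls rc le mult_nonneg_nonneg) auto
  moreover have "area \<Gamma> hm ?r (\<lambda>x. \<omega> x * \<theta> b x) \<le> area \<Gamma> hm ?r (\<lambda>_. 1)"
    using \<omega>01 temperature_range[of b] ab R
    by (intro area_mono \<omega>\<theta> continuous_intros continuous_walls rc le mult_le_one) auto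
  moreover have "area \<Gamma> hm ?r (\<lambda>_. 1) = \<delta> * \<Gamma>" using \<Gamma>_pos by (simp add: area_one_vertical)
  ultimately show ?thesis
    using main unfolding v_def k2_def by simp
qed

end

section \<open>Traces\<close>

lemma uniform_in_parameter:
  fixes \<phi> :: "real \<Rightarrow> 'a::metric_space \<Rightarrow> real"
  assumes s0: "0 < s0" and B: "compact B" and \<phi>: "continuous_on ({0..s0} \<times> B) (\<lambda>(s, w). \<phi> s w)"
    and e: "0 < e"
  shows "\<forall>\<^sub>F s in at_right 0. \<forall>w\<in>B. \<bar>\<phi> s w - \<phi> 0 w\<bar> < e"
proof -
  have "uniformly_continuous_on ({0..s0} \<times> B) (\<lambda>(s, w). \<phi> s w)"
    using B by (intro compact_uniformly_continuous \<phi> compact_Times) auto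
  then obtain d where d: "0 < d" "\<And>x y. x \<in> {0..s0} \<times> B \<Longrightarrow> y \<in> {0..s0} \<times> B \<Longrightarrow> dist y x < d \<Longrightarrow>
      dist (\<phi> (fst y) (snd y)) (\<phi> (fst x) (snd x)) < e"
    using e unfolding uniformly_continuous_on_def split_beta by metis
  show ?thesis
    unfolding eventually_at_right_field
  proof (intro exI[of _ "min d s0"] conjI allI impI ballI)
    fix s w assume "0 < s" "s < min d s0" "w \<in> B"
    then show "\<bar>\<phi> s w - \<phi> 0 w\<bar> < e"
      using d(2)[of "(0, w)" "(s, w)"] by (auto simp: dist_Pair_Pair dist_real_def)
  qed (use d s0 in auto)
qed

text \<open>Continuity on a compact set makes the factor \<open>\<phi> s\<close> converge uniformly to \<open>\<phi> 0\<close>, while the other factor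
converges in \<open>L\<^sup>1\<close>.\<close>

lemma product_limit_L1:
  fixes \<phi> f :: "real \<Rightarrow> real \<times> real \<Rightarrow> real" and g :: "real \<times> real \<Rightarrow> real"
  defines "B \<equiv> \<lambda>a b :: real \<times> real. cbox a b"
  assumes s0: "0 < s0" and \<phi>: "continuous_on ({0..s0} \<times> B a b) (\<lambda>(s, w). \<phi> s w)"
    and f: "\<And>s. 0 < s \<Longrightarrow> s \<le> s0 \<Longrightarrow> set_integrable lborel (B a b) (f s)"
    and g: "g \<in> borel_measurable borel"
    and conv: "((\<lambda>s. \<integral>\<^sup>+w\<in>B a b. ennreal \<bar>f s w - g w\<bar> \<partial>lborel) \<longlongrightarrow> 0) (at_right 0)"
  shows "set_integrable lborel (B a b) (\<lambda>w. \<phi> 0 w * g w)"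
    "((\<lambda>s. LINT w:B a b|lborel. \<phi> s w * f s w) \<longlongrightarrow> (LINT w:B a b|lborel. \<phi> 0 w * g w)) (at_right 0)"
proof -
  let ?B = "B a b"
  have Bm: "?B \<in> sets borel" and Bc: "compact ?B" by (auto simp: B_def)
  have mult: "set_integrable lborel ?B (\<lambda>w. \<psi> w * h w)"
    if \<psi>: "continuous_on ?B \<psi>" and h: "set_integrable lborel ?B h" for \<psi> h :: "real \<times> real \<Rightarrow> real"
  proof -
    have "compact (\<psi> ` ?B)" by (intro compact_continuous_image \<psi> Bc)
    then have "\<exists>C. \<forall>w\<in>?B. \<bar>\<psi> w\<bar> \<le> C"
      by (auto dest!: compact_imp_bounded simp: bounded_iff)
    then obtain C where C: "\<And>w. w \<in> ?B \<Longrightarrow> \<bar>\<psi> w\<bar> \<le> C" by blast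
    have m: "(\<lambda>w. indicator ?B w *\<^sub>R \<psi> w) \<in> borel_measurable borel"
      using borel_measurable_continuous_on_indicator[OF Bm \<psi>] by simp
    have hm: "(\<lambda>w. indicator ?B w *\<^sub>R h w) \<in> borel_measurable borel"
      using h by (simp add: set_integrable_def borel_measurable_integrable)
    have eq: "(\<lambda>w. indicator ?B w *\<^sub>R (\<psi> w * h w)) = (\<lambda>w. (indicator ?B w *\<^sub>R \<psi> w) * (indicator ?B w *\<^sub>R h w))"
      by (auto simp: indicator_def)
    show ?thesis
      unfolding set_integrable_def
    proof (rule Bochner_Integration.integrable_bound[where f = "\<lambda>w. C * (indicator ?B w *\<^sub>R h w)"])
      show "integrable lborel (\<lambda>w. C * (indicator ?B w *\<^sub>R h w))"
        using h by (simp add: set_integrable_def)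
      show "(\<lambda>w. indicator ?B w *\<^sub>R (\<psi> w * h w)) \<in> borel_measurable lborel"
        unfolding eq using m hm by simp
      show "AE w in lborel. norm (indicator ?B w *\<^sub>R (\<psi> w * h w)) \<le> norm (C * (indicator ?B w *\<^sub>R h w))"
      proof (rule AE_I2)
        fix w
        have "\<bar>\<psi> w\<bar> * \<bar>h w\<bar> \<le> \<bar>C\<bar> * \<bar>h w\<bar>" if "w \<in> ?B" using C[OF that] by (intro mult_right_mono) auto
        then show "norm (indicator ?B w *\<^sub>R (\<psi> w * h w)) \<le> norm (C * (indicator ?B w *\<^sub>R h w))"
          by (auto simp: indicator_def abs_mult)
      qed
    qed
  qed
  have \<phi>c: "continuous_on ?B (\<phi> s)" if "0 \<le> s" "s \<le> s0" for s
    by (rule continuous_on_compose_pair[OF \<phi>, of ?B "\<lambda>_. s" "\<lambda>w. w"]) (use that in \<open>auto intro!: continuous_intros\<close>)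
  define N where "N s = (\<integral>\<^sup>+w\<in>?B. ennreal \<bar>f s w - g w\<bar> \<partial>lborel)" for s
  have small: "\<forall>\<^sub>F s in at_right 0. 0 < s \<and> s \<le> s0"
    using s0 unfolding eventually_at_right_field by (intro exI[of _ s0]) auto
  have N_conv: "(N \<longlongrightarrow> 0) (at_right 0)" unfolding N_def[abs_def] by (rule conv)
  then have "\<forall>\<^sub>F s in at_right 0. N s < 1" by (rule order_tendstoD) simp
  then have ev: "\<forall>\<^sub>F s in at_right 0. 0 < s \<and> s \<le> s0 \<and> N s < 1"
    using small by eventually_elim auto
  have diff_int: "set_integrable lborel ?B (\<lambda>w. f s w - g w)" if s: "0 < s" "s \<le> s0" "N s < 1" for s
  proof -
    have "(\<lambda>w. indicator ?B w *\<^sub>R (f s w - g w)) \<in> borel_measurable borel"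
    proof -
      have "(\<lambda>w. indicator ?B w *\<^sub>R f s w) \<in> borel_measurable borel"
        using f[OF s(1,2)] by (simp add: set_integrable_def borel_measurable_integrable)
      moreover have "(\<lambda>w. indicator ?B w *\<^sub>R g w) \<in> borel_measurable borel" using g Bm by simp
      ultimately show ?thesis by (simp add: algebra_simps)
    qed
    moreover have "(\<integral>\<^sup>+w. ennreal (norm (indicator ?B w *\<^sub>R (f s w - g w))) \<partial>lborel) = N s"
      unfolding N_def by (intro nn_integral_cong) (auto simp: indicator_def)
    then have "(\<integral>\<^sup>+w. ennreal (norm (indicator ?B w *\<^sub>R (f s w - g w))) \<partial>lborel) < \<infinity>"
      using s(3) by (simp add: order_less_trans[OF _ ennreal_one_less_top])
    ultimately show ?thesis unfolding set_integrable_def by (intro integrableI_bounded) auto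
  qed
  obtain s1 where s1: "0 < s1" "s1 \<le> s0" "N s1 < 1"
    using eventually_happens[OF ev] by auto
  have g_int: "set_integrable lborel ?B g"
    using set_integral_diff(1)[OF f[OF s1(1,2)] diff_int[OF s1]] by simp
  show "set_integrable lborel ?B (\<lambda>w. \<phi> 0 w * g w)"
    using s0 by (intro mult \<phi>c g_int) auto
  define G where "G = (LINT w:?B|lborel. \<bar>g w\<bar>)"
  have G: "0 \<le> G" unfolding G_def set_lebesgue_integral_def by (intro integral_nonneg_AE) (auto simp: indicator_def)
  have "compact (\<phi> 0 ` ?B)" using s0 by (intro compact_continuous_image \<phi>c Bc) auto
  then have "\<exists>C. \<forall>w\<in>?B. \<bar>\<phi> 0 w\<bar> \<le> C"
    by (auto dest!: compact_imp_bounded simp: bounded_iff)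
  then obtain C where C: "\<And>w. w \<in> ?B \<Longrightarrow> \<bar>\<phi> 0 w\<bar> \<le> C" by blast
  define C' where "C' = \<bar>C\<bar> + 1"
  show "((\<lambda>s. LINT w:?B|lborel. \<phi> s w * f s w) \<longlongrightarrow> (LINT w:?B|lborel. \<phi> 0 w * g w)) (at_right 0)"
  proof (rule tendstoI)
    fix e :: real assume e: "0 < e"
    define e1 where "e1 = min 1 (e / (2 * (G + 1)))"
    have e1: "0 < e1" "e1 \<le> 1" "e1 * G < e / 2"
    proof -
      show "0 < e1" "e1 \<le> 1" using e G by (auto simp: e1_def)
      have "e1 * G \<le> e / (2 * (G + 1)) * G" using G by (intro mult_right_mono) (auto simp: e1_def)
      also have "\<dots> < e / 2" using e G by (simp add: field_simps)
      finally show "e1 * G < e / 2" .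
    qed
    define e2 where "e2 = e / (2 * C')"
    have C': "0 < C'" by (simp add: C'_def)
    have e2: "0 < e2" using e C' by (simp add: e2_def)
    have "\<forall>\<^sub>F s in at_right 0. N s < ennreal e2"
      using N_conv e2 by (intro order_tendstoD) auto
    then show "\<forall>\<^sub>F s in at_right 0. dist (LINT w:?B|lborel. \<phi> s w * f s w) (LINT w:?B|lborel. \<phi> 0 w * g w) < e"
      using ev uniform_in_parameter[OF s0 Bc \<phi> e1(1)]
    proof eventually_elim
      case (elim s)
      then have s: "0 < s" "s \<le> s0" "N s < 1" by auto
      have i1: "set_integrable lborel ?B (\<lambda>w. \<phi> s w * (f s w - g w))"
        using s by (intro mult \<phi>c diff_int) auto
      have i2: "set_integrable lborel ?B (\<lambda>w. (\<phi> s w - \<phi> 0 w) * g w)"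
        using s s0 by (intro mult continuous_intros \<phi>c g_int) auto
      have i3: "set_integrable lborel ?B (\<lambda>w. \<phi> 0 w * g w)"
        using s0 by (intro mult \<phi>c g_int) auto
      have "(LINT w:?B|lborel. \<phi> s w * f s w) =
        (LINT w:?B|lborel. (\<phi> s w * (f s w - g w) + (\<phi> s w - \<phi> 0 w) * g w) + \<phi> 0 w * g w)"
        by (simp add: algebra_simps)
      also have "\<dots> = (LINT w:?B|lborel. \<phi> s w * (f s w - g w)) + (LINT w:?B|lborel. (\<phi> s w - \<phi> 0 w) * g w) +
         (LINT w:?B|lborel. \<phi> 0 w * g w)"
        using i1 i2 i3 by (simp add: set_integral_add)
      finally have split: "(LINT w:?B|lborel. \<phi> s w * f s w) - (LINT w:?B|lborel. \<phi> 0 w * g w) =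
        (LINT w:?B|lborel. \<phi> s w * (f s w - g w)) + (LINT w:?B|lborel. (\<phi> s w - \<phi> 0 w) * g w)" by simp
      have absd: "set_integrable lborel ?B (\<lambda>w. \<bar>f s w - g w\<bar>)" "set_integrable lborel ?B (\<lambda>w. \<bar>g w\<bar>)"
        using set_integrable_abs[OF diff_int[OF s]] set_integrable_abs[OF g_int] by auto
      have abs_le: "\<bar>LINT w:?B|lborel. h w\<bar> \<le> K * (LINT w:?B|lborel. k w)"
        if "set_integrable lborel ?B h" "set_integrable lborel ?B k" "\<And>w. w \<in> ?B \<Longrightarrow> \<bar>h w\<bar> \<le> K * k w"
        for h k :: "real \<times> real \<Rightarrow> real" and K
      proof -
        have "\<bar>LINT w:?B|lborel. h w\<bar> \<le> (LINT w:?B|lborel. \<bar>h w\<bar>)"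
          using set_integral_norm_bound[OF that(1)] by simp
        also have "\<dots> \<le> (LINT w:?B|lborel. K * k w)"
          using that by (intro set_integral_mono set_integrable_abs set_integrable_mult_right) auto
        also have "\<dots> = K * (LINT w:?B|lborel. k w)" by simp
        finally show ?thesis .
      qed
      have "N s = ennreal (LINT w:?B|lborel. \<bar>f s w - g w\<bar>)"
        unfolding N_def set_lebesgue_integral_def
        using absd(1) by (subst nn_integral_eq_integral[symmetric])
          (auto simp: set_integrable_def indicator_def intro!: nn_integral_cong)
      then have "(LINT w:?B|lborel. \<bar>f s w - g w\<bar>) < e2"
        using elim(1) ennreal_less_iff[of "LINT w:?B|lborel. \<bar>f s w - g w\<bar>" e2]
        by (simp add: set_lebesgue_integral_def integral_nonneg_AE)
      then have "C' * (LINT w:?B|lborel. \<bar>f s w - g w\<bar>) < C' * e2"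
        using C' by (intro mult_strict_left_mono)
      moreover have "C' * e2 = e / 2" using C' by (simp add: e2_def)
      moreover have "\<bar>LINT w:?B|lborel. \<phi> s w * (f s w - g w)\<bar> \<le> C' * (LINT w:?B|lborel. \<bar>f s w - g w\<bar>)"
      proof (rule abs_le[OF i1 absd(1)])
        fix w assume w: "w \<in> ?B"
        have "\<bar>\<phi> s w\<bar> \<le> C'"
          using C[OF w] elim(3) w e1(2) unfolding C'_def by (smt (verit))
        then show "\<bar>\<phi> s w * (f s w - g w)\<bar> \<le> C' * \<bar>f s w - g w\<bar>"
          unfolding abs_mult by (intro mult_right_mono) auto
      qed
      moreover have "\<bar>LINT w:?B|lborel. (\<phi> s w - \<phi> 0 w) * g w\<bar> \<le> e1 * G"
        unfolding G_def
      proof (rule abs_le[OF i2 absd(2)])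
        fix w assume w: "w \<in> ?B"
        then show "\<bar>(\<phi> s w - \<phi> 0 w) * g w\<bar> \<le> e1 * \<bar>g w\<bar>"
          using elim(3) unfolding abs_mult by (intro mult_right_mono) (auto intro: less_imp_le)
      qed
      ultimately show ?case using e1(3) unfolding dist_real_def split by argo
    qed
  qed
qed

lemma arc_measure_AE:
  assumes h: "continuous_on UNIV h" "continuous_on UNIV (deriv h)" and P: "AE x in arc_measure \<Gamma> h. P x"
  shows "AE y in lborel. 0 \<le> y \<longrightarrow> y \<le> \<Gamma> \<longrightarrow> P (y, h y)"
proof -
  have [measurable]: "h \<in> borel_measurable borel" "deriv h \<in> borel_measurable borel"
    using h by (auto intro: borel_measurable_continuous_onI)
  have "AE y in density lborel (\<lambda>s. indicator {0..\<Gamma>} s * ennreal (sqrt (1 + (deriv h s)\<^sup>2))). P (y, h y)"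
    using P unfolding arc_measure_def by (rule AE_distrD[rotated]) measurable
  then have "AE y in lborel. 0 < indicator {0..\<Gamma>} y * ennreal (sqrt (1 + (deriv h y)\<^sup>2)) \<longrightarrow> P (y, h y)"
    by (subst (asm) AE_density) measurable
  then show ?thesis
  proof eventually_elim
    fix y assume a: "0 < indicator {0..\<Gamma>} y * ennreal (sqrt (1 + (deriv h y)\<^sup>2)) \<longrightarrow> P (y, h y)"
    have "0 < sqrt (1 + (deriv h y)\<^sup>2)" by (simp add: add_pos_nonneg)
    then show "0 \<le> y \<longrightarrow> y \<le> \<Gamma> \<longrightarrow> P (y, h y)" using a by (auto simp: indicator_def)
  qed
qed

text \<open>The arc length element is at least one.  Measurability is assumed along the graph, which carries the
arc length measure.\<close>

lemma arc_measure_nn_integral_ge: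
  fixes \<psi> :: "point \<Rightarrow> ennreal"
  assumes h: "continuous_on UNIV h" "continuous_on UNIV (deriv h)"
    and \<psi>: "(\<lambda>y. indicator {0..\<Gamma>} y * \<psi> (y, h y)) \<in> borel_measurable borel"
  shows "(\<integral>\<^sup>+y. indicator {0..\<Gamma>} y * \<psi> (y, h y) \<partial>lborel) \<le> (\<integral>\<^sup>+x. \<psi> x \<partial>arc_measure \<Gamma> h)"
proof -
  have [measurable]: "h \<in> borel_measurable borel" "deriv h \<in> borel_measurable borel"
    using h by (auto intro: borel_measurable_continuous_onI)
  define \<psi>' where "\<psi>' x = indicator {0..\<Gamma>} (fst x) * \<psi> (fst x, h (fst x))" for x :: point
  have \<psi>'m: "\<psi>' \<in> borel_measurable borel"
  proof -
    have "(fst :: point \<Rightarrow> real) \<in> borel_measurable borel"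
      by (intro borel_measurable_continuous_onI continuous_intros)
    from measurable_compose[OF this \<psi>] show ?thesis unfolding \<psi>'_def[abs_def] .
  qed
  let ?w = "\<lambda>s. indicator {0..\<Gamma>} s * ennreal (sqrt (1 + (deriv h s)\<^sup>2))"
  have wm: "?w \<in> borel_measurable lborel" by measurable
  have \<gamma>: "(\<lambda>s. (s, h s)) \<in> density lborel ?w \<rightarrow>\<^sub>M borel" by measurable
  have cl: "closed {x::point. snd x = h (fst x)}" "closed {x::point. 0 \<le> fst x}" "closed {x::point. fst x \<le> \<Gamma>}"
    by (intro closed_Collect_eq closed_Collect_le continuous_intros continuous_on_compose2[OF h(1)]; simp)+
  have "AE x in arc_measure \<Gamma> h. x \<in> {x. snd x = h (fst x)} \<inter> ({x. 0 \<le> fst x} \<inter> {x. fst x \<le> \<Gamma>})"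
    unfolding arc_measure_def
  proof (subst AE_distr_iff[OF \<gamma>])
    have "{x::point. snd x = h (fst x)} \<inter> ({x. 0 \<le> fst x} \<inter> {x. fst x \<le> \<Gamma>}) \<in> sets borel"
      by (intro borel_closed closed_Int cl)
    then show "{x \<in> space borel. x \<in> {x::point. snd x = h (fst x)} \<inter> ({x. 0 \<le> fst x} \<inter> {x. fst x \<le> \<Gamma>})} \<in> sets borel"
      by (simp only: space_borel UNIV_I simp_thms Collect_mem_eq)
    show "AE s in density lborel ?w. (s, h s) \<in> {x. snd x = h (fst x)} \<inter> ({x. 0 \<le> fst x} \<inter> {x. fst x \<le> \<Gamma>})"
      by (subst AE_density[OF wm]) (auto simp: indicator_def)
  qed
  then have "AE x in arc_measure \<Gamma> h. \<psi> x = \<psi>' x"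
    by eventually_elim (auto simp: \<psi>'_def)
  then have "(\<integral>\<^sup>+x. \<psi> x \<partial>arc_measure \<Gamma> h) = (\<integral>\<^sup>+x. \<psi>' x \<partial>arc_measure \<Gamma> h)"
    by (rule nn_integral_cong_AE)
  also have "\<dots> = (\<integral>\<^sup>+s. \<psi>' (s, h s) \<partial>density lborel ?w)"
    unfolding arc_measure_def using \<gamma> \<psi>'m by (intro nn_integral_distr) auto
  also have "\<dots> = (\<integral>\<^sup>+s. ?w s * \<psi>' (s, h s) \<partial>lborel)"
    using wm \<psi> by (intro nn_integral_density) (auto simp: \<psi>'_def)
  also have "\<dots> \<ge> (\<integral>\<^sup>+y. indicator {0..\<Gamma>} y * \<psi> (y, h y) \<partial>lborel)"
  proof (rule nn_integral_mono)
    fix y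
    have "1 \<le> sqrt (1 + (deriv h y)\<^sup>2)" by simp
    then have "1 \<le> ennreal (sqrt (1 + (deriv h y)\<^sup>2))" by (simp add: ennreal_le_1 flip: ennreal_1)
    then have "1 * \<psi> (y, h y) \<le> ennreal (sqrt (1 + (deriv h y)\<^sup>2)) * \<psi> (y, h y)" by (intro mult_right_mono) auto
    then show "indicator {0..\<Gamma>} y * \<psi> (y, h y) \<le> ?w y * \<psi>' (y, h y)"
      by (auto simp: \<psi>'_def indicator_def)
  qed
  finally show ?thesis .
qed

text \<open>\<open>L\<^sup>2\<close> convergence for the arc length measure implies \<open>L\<^sup>1\<close> convergence in the coordinates \<open>(t, x)\<close>, by
\<open>r \<le> e + r\<^sup>2 / e\<close> on a box of finite measure.\<close>

lemma trace_limit_L1: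
  fixes f g :: "real \<Rightarrow> point \<Rightarrow> 'a::euclidean_space"
  assumes h: "continuous_on UNIV h" "continuous_on UNIV (deriv h)"
    and g: "(\<lambda>(t, x). g t x) \<in> borel_measurable borel"
    and tr: "((\<lambda>s. \<integral>\<^sup>+t\<in>{a..b}. (\<integral>\<^sup>+x. ennreal ((norm (f t (x + (0, \<sigma> * s)) - g t x))\<^sup>2)
                 \<partial>arc_measure \<Gamma> h) \<partial>lborel) \<longlongrightarrow> 0) (at_right 0)"
    and cont: "\<forall>\<^sub>F s in at_right 0. continuous_on (cbox (a, 0) (b, \<Gamma>)) (\<lambda>w. f (fst w) (snd w, h (snd w) + \<sigma> * s))"
  shows "((\<lambda>s. \<integral>\<^sup>+w\<in>cbox (a, 0) (b, \<Gamma>). ennreal (norm (f (fst w) (snd w, h (snd w) + \<sigma> * s) - g (fst w) (snd w, h (snd w))))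
      \<partial>lborel) \<longlongrightarrow> 0) (at_right 0)"
proof -
  let ?B = "cbox (a, 0) (b, \<Gamma>) :: (real \<times> real) set"
  define D where "D s w = norm (f (fst w) (snd w, h (snd w) + \<sigma> * s) - g (fst w) (snd w, h (snd w)))" for s w
  define X where "X s = (\<integral>\<^sup>+t\<in>{a..b}. (\<integral>\<^sup>+x. ennreal ((norm (f t (x + (0, \<sigma> * s)) - g t x))\<^sup>2)
                 \<partial>arc_measure \<Gamma> h) \<partial>lborel)" for s
  have hm[measurable]: "h \<in> borel_measurable borel" using h by (auto intro: borel_measurable_continuous_onI)
  have gm: "(\<lambda>w. g (fst w) (snd w, h (snd w))) \<in> borel_measurable borel"
  proof -
    have "(\<lambda>w::real \<times> real. (fst w, (snd w, h (snd w)))) \<in> borel \<rightarrow>\<^sub>M borel"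
      by (intro borel_measurable_continuous_onI continuous_intros continuous_on_compose2[OF h(1)]) auto
    from measurable_compose[OF this g] show ?thesis by simp
  qed
  have Dm: "(\<lambda>w. indicator ?B w *\<^sub>R D s w) \<in> borel_measurable borel"
    if c: "continuous_on ?B (\<lambda>w. f (fst w) (snd w, h (snd w) + \<sigma> * s))" for s
  proof -
    have "(\<lambda>w. indicator ?B w *\<^sub>R f (fst w) (snd w, h (snd w) + \<sigma> * s)) \<in> borel_measurable borel"
      by (rule borel_measurable_continuous_on_indicator[OF _ c]) simp
    moreover have "(\<lambda>w. indicator ?B w *\<^sub>R g (fst w) (snd w, h (snd w))) \<in> borel_measurable borel"
      using gm by simp
    ultimately have "(\<lambda>w. norm (indicator ?B w *\<^sub>R f (fst w) (snd w, h (snd w) + \<sigma> * s) -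
        indicator ?B w *\<^sub>R g (fst w) (snd w, h (snd w)))) \<in> borel_measurable borel" by simp
    moreover have "(\<lambda>w. norm (indicator ?B w *\<^sub>R f (fst w) (snd w, h (snd w) + \<sigma> * s) -
        indicator ?B w *\<^sub>R g (fst w) (snd w, h (snd w)))) = (\<lambda>w. indicator ?B w *\<^sub>R D s w)"
      by (auto simp: D_def indicator_def)
    ultimately show ?thesis by simp
  qed
  have D2m: "(\<lambda>w. ennreal ((D s w)\<^sup>2) * indicator ?B w) \<in> borel_measurable borel"
    if c: "continuous_on ?B (\<lambda>w. f (fst w) (snd w, h (snd w) + \<sigma> * s))" for s
  proof -
    have "(\<lambda>w. ennreal ((D s w)\<^sup>2) * indicator ?B w) = (\<lambda>w. ennreal ((indicator ?B w *\<^sub>R D s w)\<^sup>2))"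
      by (auto simp: indicator_def)
    moreover have "(\<lambda>w. ennreal ((indicator ?B w *\<^sub>R D s w)\<^sup>2)) \<in> borel_measurable borel"
      by (intro measurable_compose[OF _ measurable_ennreal] borel_measurable_power Dm[OF c])
    ultimately show ?thesis by (simp only:)
  qed
  have L2: "(\<integral>\<^sup>+w\<in>?B. ennreal ((D s w)\<^sup>2) \<partial>lborel) \<le> X s"
    if c: "continuous_on ?B (\<lambda>w. f (fst w) (snd w, h (snd w) + \<sigma> * s))" for s
  proof -
    note m = D2m[OF c]
    have "(\<integral>\<^sup>+w\<in>?B. ennreal ((D s w)\<^sup>2) \<partial>lborel) = (\<integral>\<^sup>+w. ennreal ((D s w)\<^sup>2) * indicator ?B w \<partial>(lborel \<Otimes>\<^sub>M lborel))"
      by (simp add: lborel_prod)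
    also have "\<dots> = (\<integral>\<^sup>+t. \<integral>\<^sup>+y. ennreal ((D s (t, y))\<^sup>2) * indicator ?B (t, y) \<partial>lborel \<partial>lborel)"
      by (rule lborel.nn_integral_fst[symmetric]) (use m in \<open>simp add: lborel_prod\<close>)
    also have "\<dots> \<le> X s"
      unfolding X_def
    proof (rule nn_integral_mono)
      fix t
      show "(\<integral>\<^sup>+y. ennreal ((D s (t, y))\<^sup>2) * indicator ?B (t, y) \<partial>lborel) \<le>
        (\<integral>\<^sup>+x. ennreal ((norm (f t (x + (0, \<sigma> * s)) - g t x))\<^sup>2) \<partial>arc_measure \<Gamma> h) * indicator {a..b} t"
      proof (cases "t \<in> {a..b}")
        case True
        have eq: "ennreal ((D s (t, y))\<^sup>2) * indicator ?B (t, y) =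
           indicator {0..\<Gamma>} y * ennreal ((norm (f t ((y, h y) + (0, \<sigma> * s)) - g t (y, h y)))\<^sup>2)" for y
          using True by (auto simp: D_def indicator_def cbox_Pair_eq)
        have "(\<lambda>y. ennreal ((D s (t, y))\<^sup>2) * indicator ?B (t, y)) \<in> borel_measurable borel"
          using measurable_compose[OF _ m, of "\<lambda>y. (t, y)" borel]
          by (simp add: borel_measurable_continuous_onI continuous_on_Pair)
        then show ?thesis
          using arc_measure_nn_integral_ge[OF h, of \<Gamma> "\<lambda>x. ennreal ((norm (f t (x + (0, \<sigma> * s)) - g t x))\<^sup>2)"] True
          unfolding eq by simp
      next
        case False
        then have "(t, y) \<notin> ?B" for y by (auto simp: cbox_Pair_eq)
        then show ?thesis by simp
      qed
    qed
    finally show ?thesis .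
  qed
  define m where "m = measure lborel ?B"
  have bound: "(\<integral>\<^sup>+w\<in>?B. ennreal (D s w) \<partial>lborel) \<le> ennreal (e * m) + ennreal (1 / e) * X s"
    if c: "continuous_on ?B (\<lambda>w. f (fst w) (snd w, h (snd w) + \<sigma> * s))" and e: "0 < e" for s e
  proof -
    have pw: "D s w \<le> e + 1 / e * (D s w)\<^sup>2" for w
    proof (cases "D s w \<le> e")
      case True then show ?thesis using e by (simp add: add_increasing2)
    next
      case False
      then have "e * D s w \<le> D s w * D s w" using e by (intro mult_right_mono) auto
      then have "D s w \<le> 1 / e * (D s w)\<^sup>2" using e by (simp add: power2_eq_square field_simps)
      then show ?thesis using e by simp
    qed
    have "(\<integral>\<^sup>+w\<in>?B. ennreal (D s w) \<partial>lborel) \<le>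
      (\<integral>\<^sup>+w. ennreal e * indicator ?B w + ennreal (1 / e) * (ennreal ((D s w)\<^sup>2) * indicator ?B w) \<partial>lborel)"
    proof (rule nn_integral_mono)
      fix w
      have "ennreal (D s w) \<le> ennreal (e + 1 / e * (D s w)\<^sup>2)" using pw by (rule ennreal_leI)
      also have "\<dots> = ennreal e + ennreal (1 / e) * ennreal ((D s w)\<^sup>2)"
      proof -
        have "ennreal (1 / e * (D s w)\<^sup>2) = ennreal (1 / e) * ennreal ((D s w)\<^sup>2)"
          using e by (intro ennreal_mult) auto
        then show ?thesis using e by (simp add: ennreal_plus del: times_divide_eq_left)
      qed
      finally show "ennreal (D s w) * indicator ?B w \<le>
        ennreal e * indicator ?B w + ennreal (1 / e) * (ennreal ((D s w)\<^sup>2) * indicator ?B w)"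
        by (auto simp: indicator_def)
    qed
    also have "\<dots> = (\<integral>\<^sup>+w. ennreal e * indicator ?B w \<partial>lborel) +
       (\<integral>\<^sup>+w. ennreal (1 / e) * (ennreal ((D s w)\<^sup>2) * indicator ?B w) \<partial>lborel)"
      using D2m[OF c] by (intro nn_integral_add) simp_all
    also have "(\<integral>\<^sup>+w. ennreal e * indicator ?B w \<partial>lborel) = ennreal (e * m)"
    proof -
      have "emeasure lborel ?B = ennreal m"
        unfolding m_def by (rule emeasure_eq_ennreal_measure) (simp add: emeasure_lborel_cbox_eq)
      then show ?thesis using e by (simp add: nn_integral_cmult_indicator ennreal_mult m_def)
    qed
    also have "(\<integral>\<^sup>+w. ennreal (1 / e) * (ennreal ((D s w)\<^sup>2) * indicator ?B w) \<partial>lborel) \<le> ennreal (1 / e) * X s"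
    proof -
      have "(\<integral>\<^sup>+w. ennreal (1 / e) * (ennreal ((D s w)\<^sup>2) * indicator ?B w) \<partial>lborel) =
        ennreal (1 / e) * (\<integral>\<^sup>+w. ennreal ((D s w)\<^sup>2) * indicator ?B w \<partial>lborel)"
        using D2m[OF c] by (intro nn_integral_cmult) simp
      then show ?thesis using L2[OF c] by (simp add: mult_left_mono)
    qed
    finally show ?thesis by (simp add: add_left_mono)
  qed
  have X0: "(X \<longlongrightarrow> 0) (at_right 0)" unfolding X_def[abs_def] by (rule tr)
  show ?thesis
    unfolding D_def[symmetric]
  proof (rule order_tendstoI)
    fix y :: ennreal assume "0 < y"
    then obtain c where c: "0 < c" "c < y" using dense by blast
    then have "c < top" by (simp add: order_less_le_trans)
    then obtain z :: real where z: "0 < z" "ennreal z < y"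
      using c by (cases c) auto
    have m0: "0 \<le> m" by (simp add: m_def)
    define e where "e = z / (2 * (m + 1))"
    have e: "0 < e" "e * m \<le> z / 2" using z m0 by (auto simp: e_def field_simps)
    have "\<forall>\<^sub>F s in at_right 0. X s < ennreal (e * z / 2)"
      using X0 e z by (intro order_tendstoD) auto
    then show "\<forall>\<^sub>F s in at_right 0. (\<integral>\<^sup>+w\<in>?B. ennreal (D s w) \<partial>lborel) < y"
      using cont
    proof eventually_elim
      case (elim s)
      have "(\<integral>\<^sup>+w\<in>?B. ennreal (D s w) \<partial>lborel) \<le> ennreal (e * m) + ennreal (1 / e) * X s"
        by (rule bound[OF elim(2) e(1)])
      also have "\<dots> \<le> ennreal (z / 2) + ennreal (1 / e) * ennreal (e * z / 2)"
        using elim(1) e by (intro add_mono mult_left_mono ennreal_leI) auto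
      also have "ennreal (1 / e) * ennreal (e * z / 2) = ennreal (z / 2)"
        using e z by (simp add: ennreal_mult[symmetric])
      also have "ennreal (z / 2) + ennreal (z / 2) = ennreal z"
        using z by (simp flip: ennreal_plus)
      finally show ?case using z(2) by (rule le_less_trans)
    qed
  qed simp
qed

section \<open>The energy balance of the velocity\<close>

lemma plane_deriv_eqI:
  "plane_deriv f A B x \<Longrightarrow> A = A' \<Longrightarrow> B = B' \<Longrightarrow> plane_deriv f A' B' x"
  by simp

lemmas plane_deriv_intros = plane_deriv_add plane_deriv_diff plane_deriv_mult plane_deriv_const

text \<open>The pointwise energy identity with the partial derivatives as independent variables: \<open>a\<^sub>i\<^sub>j\<close> stands
for \<open>\<partial>\<^sub>j u\<^sub>i\<close> and \<open>b\<^sub>i\<^sub>j\<^sub>k\<close> for \<open>\<partial>\<^sub>k \<partial>\<^sub>j u\<^sub>i\<close>.  Besides the momentum equation it uses incompressibility,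
which turns the divergence of \<open>(u \<cdot> \<nabla>) u\<close> into \<open>\<partial>\<^sub>i u\<^sub>j \<partial>\<^sub>j u\<^sub>i\<close>, the difference between \<open>2 |D u|\<^sup>2\<close> and
\<open>|\<nabla> u|\<^sup>2\<close>.\<close>

lemma momentum_algebra:
  fixes u1 u2 ut1 ut2 a11 a12 a21 a22 P1 P2 \<theta> R r c K :: real
  assumes m1: "2 * r * (ut1 + (u1 * a11 + u2 * a12)) + P1 - (b111 + b122) = 0"
    and m2: "2 * r * (ut2 + (u1 * a21 + u2 * a22)) + P2 - (b211 + b222) = R * \<theta>"
    and d: "a11 + a22 = 0" "b111 + b221 = 0" "b112 + b222 = 0" "b112 = b121" "b212 = b221"
  shows "c * (r * (2 * u1 * ut1 + 2 * u2 * ut2)) +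
      (a11 * K + u1 * (c * (r * (2 * u1 * a11 + 2 * u2 * a21) + P1))
        - c * (2 * (b111 * u1 + a11 * a11) + ((b121 + b211) * u2 + (a12 + a21) * a21))
        + (a11 * a11 + u1 * b111 + (a21 * a12 + u2 * b121))) +
      (a22 * K + u2 * (c * (r * (2 * u1 * a12 + 2 * u2 * a22) + P2))
        - c * ((b122 + b212) * u1 + (a12 + a21) * a12 + 2 * (b222 * u2 + a22 * a22))
        + (a12 * a21 + u1 * b212 + (a22 * a22 + u2 * b222))) =
    c * R * (\<theta> * u2) - (c - 1) * (2 * a11\<^sup>2 + 2 * a22\<^sup>2 + (a12 + a21)\<^sup>2) - (a11\<^sup>2 + a12\<^sup>2 + a21\<^sup>2 + a22\<^sup>2)"
proof -
  have s: "a22 = - a11" "b221 = - b111" "b222 = - b112" "b121 = b112" "b212 = - b111" using d by auto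
  have P: "P1 = b111 + b122 - 2 * r * (ut1 + (u1 * a11 + u2 * a12))"
    "P2 = R * \<theta> + (b211 - b112) - 2 * r * (ut2 + (u1 * a21 - u2 * a11))"
    using m1 m2 by (simp_all add: s algebra_simps)
  show ?thesis unfolding P s by (simp add: power2_eq_square algebra_simps)
qed

context rb_solution
begin

definition grad_sq :: "real \<Rightarrow> point \<Rightarrow> real" where
  "grad_sq t x = (fst (dx1 (u t) x))\<^sup>2 + (fst (dx2 (u t) x))\<^sup>2 + (snd (dx1 (u t) x))\<^sup>2 + (snd (dx2 (u t) x))\<^sup>2"

definition kinetic :: "real \<Rightarrow> real \<Rightarrow> point \<Rightarrow> real" where
  "kinetic c t x = c * (1 / (2 * Pr) * (fst (u t x) * fst (u t x) + snd (u t x) * snd (u t x)))"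

definition head :: "real \<Rightarrow> real \<Rightarrow> point \<Rightarrow> real" where
  "head c t x = c * (1 / (2 * Pr) * (fst (u t x) * fst (u t x) + snd (u t x) * snd (u t x)) + p t x)"

text \<open>The energy flux \<open>c (|u|\<^sup>2 / (2 Pr) + p) u - 2 c (D u) u + (u \<cdot> \<nabla>) u\<close>.  The symmetric gradient is what
the slip condition controls at the walls.  The last term converts one of the \<open>c\<close> copies of
\<open>2 |D u|\<^sup>2\<close> into the full dissipation \<open>|\<nabla> u|\<^sup>2\<close>; its normal component at a wall is, up to the sign,
the curvature times \<open>|u|\<^sup>2\<close>, to be absorbed by the friction, which carries the factor \<open>c\<close>.\<close>

definition energy_flux1 :: "real \<Rightarrow> real \<Rightarrow> point \<Rightarrow> real" where
  "energy_flux1 c t x = fst (u t x) * head c t x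
     - c * (2 * (fst (dx1 (u t) x) * fst (u t x)) + (fst (dx2 (u t) x) + snd (dx1 (u t) x)) * snd (u t x))
     + (fst (u t x) * fst (dx1 (u t) x) + snd (u t x) * fst (dx2 (u t) x))"

definition energy_flux2 :: "real \<Rightarrow> real \<Rightarrow> point \<Rightarrow> real" where
  "energy_flux2 c t x = snd (u t x) * head c t x
     - c * ((fst (dx2 (u t) x) + snd (dx1 (u t) x)) * fst (u t x) + 2 * (snd (dx2 (u t) x) * snd (u t x)))
     + (fst (u t x) * snd (dx1 (u t) x) + snd (u t x) * snd (dx2 (u t) x))"

lemma u_components:
  assumes tx: "0 < t" "x \<in> S"
  shows "plane_deriv (\<lambda>x. fst (u t x)) (fst (dx1 (u t) x)) (fst (dx2 (u t) x)) x"
    "plane_deriv (\<lambda>x. snd (u t x)) (snd (dx1 (u t) x)) (snd (dx2 (u t) x)) x"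
    "plane_deriv (\<lambda>x. fst (dx1 (u t) x)) (fst (dx1 (dx1 (u t)) x)) (fst (dx2 (dx1 (u t)) x)) x"
    "plane_deriv (\<lambda>x. snd (dx1 (u t) x)) (snd (dx1 (dx1 (u t)) x)) (snd (dx2 (dx1 (u t)) x)) x"
    "plane_deriv (\<lambda>x. fst (dx2 (u t) x)) (fst (dx1 (dx2 (u t)) x)) (fst (dx2 (dx2 (u t)) x)) x"
    "plane_deriv (\<lambda>x. snd (dx2 (u t) x)) (snd (dx1 (dx2 (u t)) x)) (snd (dx2 (dx2 (u t)) x)) x"
    "plane_deriv (p t) (dx1 (p t) x) (dx2 (p t) x) x"
  using u_spatial[OF tx] C1_in_space_plane_deriv[OF smooth(2) tx]
  by (auto intro: plane_deriv_fst_comp plane_deriv_snd_comp)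

lemma second_derivatives:
  assumes tx: "0 < t" "x \<in> S"
  shows "fst (dx2 (dx1 (u t)) x) = fst (dx1 (dx2 (u t)) x)"
    "snd (dx2 (dx1 (u t)) x) = snd (dx1 (dx2 (u t)) x)"
    "fst (dx1 (dx1 (u t)) x) + snd (dx1 (dx2 (u t)) x) = 0"
    "fst (dx2 (dx1 (u t)) x) + snd (dx2 (dx2 (u t)) x) = 0"
proof -
  have sm: "C1_in_space S (\<lambda>t. dx1 (u t))" "C1_in_space S (\<lambda>t. dx2 (u t))"
    using smooth(1) by (auto simp: C1_C2_def)
  have c: "continuous_on S (\<lambda>x. fst (dx2 (dx1 (u t)) x))" "continuous_on S (\<lambda>x. snd (dx2 (dx1 (u t)) x))"
     "continuous_on S (\<lambda>x. fst (dx1 (dx2 (u t)) x))" "continuous_on S (\<lambda>x. snd (dx1 (dx2 (u t)) x))"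
  proof -
    have "continuous_on S (f t)" if "continuous_on ({0<..} \<times> S) (\<lambda>(t, x). f t x)" for f :: "real \<Rightarrow> point \<Rightarrow> point"
      by (rule continuous_on_compose_pair[OF that, of S "\<lambda>_. t" "\<lambda>x. x"]) (use tx in \<open>auto intro!: continuous_intros\<close>)
    from this[OF C1_in_space_continuous(3)[OF sm(1)]] this[OF C1_in_space_continuous(2)[OF sm(2)]]
    show "continuous_on S (\<lambda>x. fst (dx2 (dx1 (u t)) x))" "continuous_on S (\<lambda>x. snd (dx2 (dx1 (u t)) x))"
     "continuous_on S (\<lambda>x. fst (dx1 (dx2 (u t)) x))" "continuous_on S (\<lambda>x. snd (dx1 (dx2 (u t)) x))"
      by (auto intro!: continuous_intros)
  qed
  show "fst (dx2 (dx1 (u t)) x) = fst (dx1 (dx2 (u t)) x)"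
    by (rule symmetric_second_derivatives[OF open_strip tx(2) u_components(1) u_components(3) u_components(5) c(1) c(3)])
      (use tx in auto)
  show "snd (dx2 (dx1 (u t)) x) = snd (dx1 (dx2 (u t)) x)"
    by (rule symmetric_second_derivatives[OF open_strip tx(2) u_components(2) u_components(4) u_components(6) c(2) c(4)])
      (use tx in auto)
  have "plane_deriv (\<lambda>x. fst (dx1 (u t) x) + snd (dx2 (u t) x))
      (fst (dx1 (dx1 (u t)) x) + snd (dx1 (dx2 (u t)) x)) (fst (dx2 (dx1 (u t)) x) + snd (dx2 (dx2 (u t)) x)) x"
    by (intro plane_deriv_add u_components tx)
  then have "plane_deriv (\<lambda>_. 0 :: real)
      (fst (dx1 (dx1 (u t)) x) + snd (dx1 (dx2 (u t)) x)) (fst (dx2 (dx1 (u t)) x) + snd (dx2 (dx2 (u t)) x)) x"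
    by (rule plane_deriv_transform_open[OF _ open_strip tx(2)]) (use equations(2) tx in auto)
  from plane_deriv_dx[OF this] plane_deriv_dx[OF plane_deriv_const[of "0::real" x]]
  show "fst (dx1 (dx1 (u t)) x) + snd (dx1 (dx2 (u t)) x) = 0"
    "fst (dx2 (dx1 (u t)) x) + snd (dx2 (dx2 (u t)) x) = 0" by simp_all
qed

lemma kinetic_temporal:
  assumes tx: "0 < t" "x \<in> S"
  shows "((\<lambda>s. kinetic c s x) has_real_derivative
    c * (1 / (2 * Pr) * (2 * fst (u t x) * fst (dt u t x) + 2 * snd (u t x) * snd (dt u t x)))) (at t)"
proof -
  have "(\<lambda>s. u s x) differentiable (at t)"
    using smooth(1) tx unfolding C1_C2_def C1_in_time_def by blast
  then have "((\<lambda>s. u s x) has_vector_derivative dt u t x) (at t)"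
    unfolding dt_def by (simp add: vector_derivative_works[symmetric])
  then have d: "((\<lambda>s. fst (u s x)) has_real_derivative fst (dt u t x)) (at t)"
    "((\<lambda>s. snd (u s x)) has_real_derivative snd (dt u t x)) (at t)"
    unfolding has_real_derivative_iff_has_vector_derivative has_vector_derivative_def
    by (auto intro!: derivative_eq_intros)
  show ?thesis unfolding kinetic_def
    by (rule DERIV_cong[OF DERIV_cmult[OF DERIV_cmult[OF DERIV_add[OF DERIV_mult[OF d(1) d(1)] DERIV_mult[OF d(2) d(2)]]]]])
      (simp add: algebra_simps)
qed

abbreviation "kinetic_dt c t x \<equiv> c * (1 / (2 * Pr) * (2 * fst (u t x) * fst (dt u t x) + 2 * snd (u t x) * snd (dt u t x)))"

definition flux1_d1 where
  "flux1_d1 c t x = fst (dx1 (u t) x) * head c t x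
     + fst (u t x) * (c * (1 / (2 * Pr) * (2 * fst (u t x) * fst (dx1 (u t) x) + 2 * snd (u t x) * snd (dx1 (u t) x)) + dx1 (p t) x))
     - c * (2 * (fst (dx1 (dx1 (u t)) x) * fst (u t x) + fst (dx1 (u t) x) * fst (dx1 (u t) x))
        + ((fst (dx1 (dx2 (u t)) x) + snd (dx1 (dx1 (u t)) x)) * snd (u t x) + (fst (dx2 (u t) x) + snd (dx1 (u t) x)) * snd (dx1 (u t) x)))
     + (fst (dx1 (u t) x) * fst (dx1 (u t) x) + fst (u t x) * fst (dx1 (dx1 (u t)) x)
        + (snd (dx1 (u t) x) * fst (dx2 (u t) x) + snd (u t x) * fst (dx1 (dx2 (u t)) x)))"

definition flux1_d2 where
  "flux1_d2 c t x = fst (dx2 (u t) x) * head c t x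
     + fst (u t x) * (c * (1 / (2 * Pr) * (2 * fst (u t x) * fst (dx2 (u t) x) + 2 * snd (u t x) * snd (dx2 (u t) x)) + dx2 (p t) x))
     - c * (2 * (fst (dx2 (dx1 (u t)) x) * fst (u t x) + fst (dx1 (u t) x) * fst (dx2 (u t) x))
        + ((fst (dx2 (dx2 (u t)) x) + snd (dx2 (dx1 (u t)) x)) * snd (u t x) + (fst (dx2 (u t) x) + snd (dx1 (u t) x)) * snd (dx2 (u t) x)))
     + (fst (dx2 (u t) x) * fst (dx1 (u t) x) + fst (u t x) * fst (dx2 (dx1 (u t)) x)
        + (snd (dx2 (u t) x) * fst (dx2 (u t) x) + snd (u t x) * fst (dx2 (dx2 (u t)) x)))"

definition flux2_d1 where
  "flux2_d1 c t x = snd (dx1 (u t) x) * head c t x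
     + snd (u t x) * (c * (1 / (2 * Pr) * (2 * fst (u t x) * fst (dx1 (u t) x) + 2 * snd (u t x) * snd (dx1 (u t) x)) + dx1 (p t) x))
     - c * ((fst (dx1 (dx2 (u t)) x) + snd (dx1 (dx1 (u t)) x)) * fst (u t x) + (fst (dx2 (u t) x) + snd (dx1 (u t) x)) * fst (dx1 (u t) x)
        + 2 * (snd (dx1 (dx2 (u t)) x) * snd (u t x) + snd (dx2 (u t) x) * snd (dx1 (u t) x)))
     + (fst (dx1 (u t) x) * snd (dx1 (u t) x) + fst (u t x) * snd (dx1 (dx1 (u t)) x)
        + (snd (dx1 (u t) x) * snd (dx2 (u t) x) + snd (u t x) * snd (dx1 (dx2 (u t)) x)))"

definition flux2_d2 where
  "flux2_d2 c t x = snd (dx2 (u t) x) * head c t x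
     + snd (u t x) * (c * (1 / (2 * Pr) * (2 * fst (u t x) * fst (dx2 (u t) x) + 2 * snd (u t x) * snd (dx2 (u t) x)) + dx2 (p t) x))
     - c * ((fst (dx2 (dx2 (u t)) x) + snd (dx2 (dx1 (u t)) x)) * fst (u t x) + (fst (dx2 (u t) x) + snd (dx1 (u t) x)) * fst (dx2 (u t) x)
        + 2 * (snd (dx2 (dx2 (u t)) x) * snd (u t x) + snd (dx2 (u t) x) * snd (dx2 (u t) x)))
     + (fst (dx2 (u t) x) * snd (dx1 (u t) x) + fst (u t x) * snd (dx2 (dx1 (u t)) x)
        + (snd (dx2 (u t) x) * snd (dx2 (u t) x) + snd (u t x) * snd (dx2 (dx2 (u t)) x)))"

lemma energy_flux_spatial:
  assumes tx: "0 < t" "x \<in> S"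
  shows "plane_deriv (energy_flux1 c t) (flux1_d1 c t x) (flux1_d2 c t x) x"
    "plane_deriv (energy_flux2 c t) (flux2_d1 c t x) (flux2_d2 c t x) x"
proof -
  note d = u_components[OF tx]
  have head: "plane_deriv (head c t)
     (c * (1 / (2 * Pr) * (2 * fst (u t x) * fst (dx1 (u t) x) + 2 * snd (u t x) * snd (dx1 (u t) x)) + dx1 (p t) x))
     (c * (1 / (2 * Pr) * (2 * fst (u t x) * fst (dx2 (u t) x) + 2 * snd (u t x) * snd (dx2 (u t) x)) + dx2 (p t) x)) x"
    unfolding head_def[abs_def]
    by (rule plane_deriv_eqI, (rule d plane_deriv_intros)+) (simp_all add: algebra_simps)
  show "plane_deriv (energy_flux1 c t) (flux1_d1 c t x) (flux1_d2 c t x) x"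
    unfolding energy_flux1_def[abs_def] flux1_d1_def flux1_d2_def
    by (rule plane_deriv_eqI, (rule head d plane_deriv_intros)+) (simp_all only: mult_zero_left add_0_left)
  show "plane_deriv (energy_flux2 c t) (flux2_d1 c t x) (flux2_d2 c t x) x"
    unfolding energy_flux2_def[abs_def] flux2_d1_def flux2_d2_def
    by (rule plane_deriv_eqI, (rule head d plane_deriv_intros)+) (simp_all only: mult_zero_left add_0_left)
qed

lemma energy_identity:
  assumes tx: "0 < t" "x \<in> S"
  shows "kinetic_dt c t x + flux1_d1 c t x + flux2_d2 c t x =
    c * Ra * (\<theta> t x * snd (u t x))
    - (c - 1) * (2 * (fst (dx1 (u t) x))\<^sup>2 + 2 * (snd (dx2 (u t) x))\<^sup>2 + (fst (dx2 (u t) x) + snd (dx1 (u t) x))\<^sup>2)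
    - grad_sq t x"
proof -
  have e: "(1 / Pr) *\<^sub>R (dt u t x + advect (u t x) (u t) x) + grad (p t) x - laplace (u t) x = (Ra * \<theta> t x) *\<^sub>R (0, 1)"
    by (rule equations(1)[OF tx])
  have r: "2 * (1 / (2 * Pr)) = 1 / Pr" by simp
  have e': "fst ((1 / Pr) *\<^sub>R (dt u t x + advect (u t x) (u t) x) + grad (p t) x - laplace (u t) x) = 0"
    "snd ((1 / Pr) *\<^sub>R (dt u t x + advect (u t x) (u t) x) + grad (p t) x - laplace (u t) x) = Ra * \<theta> t x"
    unfolding e by simp_all
  have m: "1 / Pr * (fst (dt u t x) + (fst (u t x) * fst (dx1 (u t) x) + snd (u t x) * fst (dx2 (u t) x))) + dx1 (p t) x
      - (fst (dx1 (dx1 (u t)) x) + fst (dx2 (dx2 (u t)) x)) = 0"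
    "1 / Pr * (snd (dt u t x) + (fst (u t x) * snd (dx1 (u t) x) + snd (u t x) * snd (dx2 (u t) x))) + dx2 (p t) x
      - (snd (dx1 (dx1 (u t)) x) + snd (dx2 (dx2 (u t)) x)) = Ra * \<theta> t x"
    using e'(1) apply (simp only: advect_def laplace_def grad_def fst_add fst_diff fst_scaleR
          fst_conv snd_conv real_scaleR_def)
    using e'(2) apply (simp only: advect_def laplace_def grad_def snd_add snd_diff snd_scaleR
          fst_conv snd_conv real_scaleR_def)
    done
  show ?thesis
    unfolding flux1_d1_def flux2_d2_def grad_sq_def
    by (rule momentum_algebra[OF _ _ equations(2)[OF tx] second_derivatives(3,4)[OF tx] second_derivatives(1,2)[OF tx]])
      (rule m[folded r])+
qed

lemma kinetic_continuous: "continuous_on ({0<..} \<times> cS) (\<lambda>(t, x). kinetic c t x)"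
  unfolding kinetic_def split_beta' using u_continuous unfolding split_beta' by (intro continuous_intros)

lemma interior_continuous:
  "continuous_on ({0<..} \<times> S) (\<lambda>(t, x). u t x)" "continuous_on ({0<..} \<times> S) (\<lambda>(t, x). \<theta> t x)"
  "continuous_on ({0<..} \<times> S) (\<lambda>(t, x). dt u t x)"
  "continuous_on ({0<..} \<times> S) (\<lambda>(t, x). dx1 (u t) x)" "continuous_on ({0<..} \<times> S) (\<lambda>(t, x). dx2 (u t) x)"
  "continuous_on ({0<..} \<times> S) (\<lambda>(t, x). dx1 (dx1 (u t)) x)" "continuous_on ({0<..} \<times> S) (\<lambda>(t, x). dx2 (dx1 (u t)) x)"
  "continuous_on ({0<..} \<times> S) (\<lambda>(t, x). dx1 (dx2 (u t)) x)" "continuous_on ({0<..} \<times> S) (\<lambda>(t, x). dx2 (dx2 (u t)) x)"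
  "continuous_on ({0<..} \<times> S) (\<lambda>(t, x). p t x)" "continuous_on ({0<..} \<times> S) (\<lambda>(t, x). dx1 (p t) x)"
  "continuous_on ({0<..} \<times> S) (\<lambda>(t, x). dx2 (p t) x)"
proof -
  have sm: "C1_in_space S u" "C1_in_space S (\<lambda>t. dx1 (u t))" "C1_in_space S (\<lambda>t. dx2 (u t))" "C1_in_space S \<theta>"
    "C1_in_time S u"
    using smooth by (auto simp: C1_C2_def)
  show "continuous_on ({0<..} \<times> S) (\<lambda>(t, x). dt u t x)" using sm(5) by (simp add: C1_in_time_def)
qed (use smooth in \<open>auto simp: C1_C2_def intro: C1_in_space_continuous\<close>)

lemma interior_continuous_pair:
  fixes f :: "real \<Rightarrow> point \<Rightarrow> 'z::topological_space"
  assumes "0 < a" "X \<subseteq> S" "continuous_on ({0<..} \<times> S) (\<lambda>(t, x). f t x)"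
  shows "continuous_on ({a..b} \<times> X) (\<lambda>z. f (fst z) (snd z))"
  by (rule continuous_on_compose_pair[OF assms(3)]) (use assms in \<open>auto intro!: continuous_intros\<close>)

lemma grad_sq_continuous: "continuous_on ({0<..} \<times> S) (\<lambda>(t, x). grad_sq t x)"
  unfolding grad_sq_def split_beta' using interior_continuous(4,5) unfolding split_beta' by (intro continuous_intros)

lemma energy_flux1_periodic:
  assumes t: "0 < t" and y: "(0, y) \<in> S"
  shows "energy_flux1 c t (0, y) = energy_flux1 c t (\<Gamma>, y)"
proof -
  have sh: "(\<Gamma>, y) \<in> S" using strip_shift[OF y] by simp
  have "u t differentiable (at (\<Gamma>, y))"
    using u_spatial(1)[OF t sh] unfolding plane_deriv_def differentiable_def by blast
  moreover have per: "u t (fst x + \<Gamma>, snd x) = u t x" if "x \<in> S" for x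
    using periodic(1)[OF t, of x] that S_subset_cS by auto
  ultimately have "dx1 (u t) (\<Gamma>, y) = dx1 (u t) (0, y)" "dx2 (u t) (\<Gamma>, y) = dx2 (u t) (0, y)"
    using gradient_periodic[OF open_strip y, of "u t" \<Gamma>] by auto
  then show ?thesis
    using per[OF y] periodic(2)[OF t y] by (simp add: energy_flux1_def head_def)
qed

text \<open>The energy balance between two level curves inside the channel, as the velocity gradient is
continuous only there.  The surplus \<open>2 (c - 1) |D u|\<^sup>2\<close> of the dissipation and the final energy are
nonnegative.\<close>

lemma dissipation_level_le:
  assumes ab: "0 < a" "a \<le> b" and c: "1 \<le> c" and s: "0 < s"
    and gap: "\<And>x. 0 \<le> x \<Longrightarrow> x \<le> \<Gamma> \<Longrightarrow> hm x + s \<le> hp x - s"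
  shows "integral {a..b} (\<lambda>t. area \<Gamma> (\<lambda>x. hm x + s) (\<lambda>x. hp x - s) (grad_sq t)) \<le>
    c * Ra * integral {a..b} (\<lambda>t. area \<Gamma> (\<lambda>x. hm x + s) (\<lambda>x. hp x - s) (\<lambda>x. \<theta> t x * snd (u t x))) +
    area \<Gamma> (\<lambda>x. hm x + s) (\<lambda>x. hp x - s) (kinetic c a) +
    flux a b \<Gamma> (\<lambda>x. hm x + s) (deriv hm) (energy_flux1 c) (energy_flux2 c) -
    flux a b \<Gamma> (\<lambda>x. hp x - s) (deriv hp) (energy_flux1 c) (energy_flux2 c)"
proof -
  let ?l = "\<lambda>x. hm x + s" and ?r = "\<lambda>x. hp x - s"
  let ?K = "region \<Gamma> ?l ?r"
  have K: "?K \<subseteq> S" using s by (force simp: region_def strip_def)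
  have KcS: "?K \<subseteq> cS" using K S_subset_cS by blast
  have lr: "continuous_on {0..\<Gamma>} ?l" "continuous_on {0..\<Gamma>} ?r"
    by (intro continuous_intros continuous_walls)+
  note cc = interior_continuous[THEN interior_continuous_pair[OF ab(1) K, where b = b]]
  define f where "f t x = c * Ra * (\<theta> t x * snd (u t x))
    - (c - 1) * (2 * (fst (dx1 (u t) x))\<^sup>2 + 2 * (snd (dx2 (u t) x))\<^sup>2 + (fst (dx2 (u t) x) + snd (dx1 (u t) x))\<^sup>2)
    - grad_sq t x" for t x
  have tpos: "0 < t" if "t \<in> {a..b}" for t using that ab by auto
  have fc: "continuous_on ({a..b} \<times> ?K) (\<lambda>(t, x). f t x)"
    "continuous_on ({a..b} \<times> ?K) (\<lambda>(t, x). grad_sq t x)"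
    "continuous_on ({a..b} \<times> ?K) (\<lambda>(t, x). \<theta> t x * snd (u t x))"
    unfolding split_beta' f_def grad_sq_def by (intro continuous_intros cc)+
  have bal: "area \<Gamma> ?l ?r (kinetic c b) - area \<Gamma> ?l ?r (kinetic c a) +
      flux a b \<Gamma> ?r (deriv hp) (energy_flux1 c) (energy_flux2 c) - flux a b \<Gamma> ?l (deriv hm) (energy_flux1 c) (energy_flux2 c) =
      integral {a..b} (\<lambda>t. area \<Gamma> ?l ?r (f t))"
  proof (rule spacetime_divergence[OF ab(2) less_imp_le[OF \<Gamma>_pos] _ _ continuous_walls(3,4) gap,
        where e' = "kinetic_dt c" and ?A11.0 = "flux1_d1 c" and ?A12.0 = "flux1_d2 c" and ?A21.0 = "flux2_d1 c" and ?A22.0 = "flux2_d2 c"])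
    show "(?l has_real_derivative deriv hm x) (at x)" "(?r has_real_derivative deriv hp x) (at x)" for x
      using DERIV_walls[of x] by (auto intro!: derivative_eq_intros)
    show "hm 0 + s = hm \<Gamma> + s" "hp 0 - s = hp \<Gamma> - s" using periodic_walls[of 0] by simp_all
    fix t assume t: "t \<in> {a..b}"
    show "energy_flux1 c t (0, y) = energy_flux1 c t (\<Gamma>, y)" if "hm 0 + s \<le> y" "y \<le> hp 0 - s" for y
      using that s by (intro energy_flux1_periodic tpos t) (simp add: strip_def)
    fix x assume "x \<in> ?K"
    then have x: "x \<in> S" using K by blast
    note tx = tpos[OF t] x
    show "((\<lambda>s. kinetic c s x) has_real_derivative kinetic_dt c t x) (at t)" by (rule kinetic_temporal[OF tx])
    show "plane_deriv (energy_flux1 c t) (flux1_d1 c t x) (flux1_d2 c t x) x"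
      "plane_deriv (energy_flux2 c t) (flux2_d1 c t x) (flux2_d2 c t x) x" by (rule energy_flux_spatial[OF tx])+
    show "kinetic_dt c t x + flux1_d1 c t x + flux2_d2 c t x = f t x"
      unfolding f_def by (rule energy_identity[OF tx])
  qed (assumption | (simp only: split_beta' kinetic_def energy_flux1_def energy_flux2_def flux1_d1_def flux1_d2_def flux2_d2_def head_def,
       intro continuous_intros cc))+
  have slice: "continuous_on ?K (g t)" if "continuous_on ({a..b} \<times> ?K) (\<lambda>(t, x). g t x)" "t \<in> {a..b}"
    for g :: "real \<Rightarrow> point \<Rightarrow> real" and t
    by (rule continuous_on_compose_pair[OF that(1), of ?K "\<lambda>_. t" "\<lambda>x. x"]) (use that(2) in \<open>auto intro!: continuous_intros\<close>)
  have int: "(\<lambda>t. area \<Gamma> ?l ?r (g t)) integrable_on {a..b}" if g: "continuous_on ({a..b} \<times> ?K) (\<lambda>(t, x). g t x)"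
    for g :: "real \<Rightarrow> point \<Rightarrow> real"
  proof (rule integrable_continuous_real[OF area_continuous_on_param])
    show "continuous_on ({a..b} \<times> {0..\<Gamma>}) (\<lambda>(p, x). ?l x)" "continuous_on ({a..b} \<times> {0..\<Gamma>}) (\<lambda>(p, x). ?r x)"
      unfolding split_beta'
      by (intro continuous_on_compose2[OF lr(1)] continuous_on_compose2[OF lr(2)] continuous_intros; auto)+
  qed (use g gap in auto)
  have "integral {a..b} (\<lambda>t. area \<Gamma> ?l ?r (f t)) \<le>
    integral {a..b} (\<lambda>t. c * Ra * area \<Gamma> ?l ?r (\<lambda>x. \<theta> t x * snd (u t x)) - area \<Gamma> ?l ?r (grad_sq t))"
  proof (rule integral_le)
    show "(\<lambda>t. area \<Gamma> ?l ?r (f t)) integrable_on {a..b}" by (rule int[OF fc(1)])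
    show "(\<lambda>t. c * Ra * area \<Gamma> ?l ?r (\<lambda>x. \<theta> t x * snd (u t x)) - area \<Gamma> ?l ?r (grad_sq t)) integrable_on {a..b}"
      by (intro integrable_diff integrable_on_mult_right int fc)
    fix t assume t: "t \<in> {a..b}"
    have "area \<Gamma> ?l ?r (f t) \<le> area \<Gamma> ?l ?r (\<lambda>x. c * Ra * (\<theta> t x * snd (u t x)) + (-1) * grad_sq t x)"
      using c by (intro area_mono lr gap continuous_intros slice[OF fc(1) t] slice[OF fc(2) t] slice[OF fc(3) t])
        (auto simp: f_def intro!: mult_nonneg_nonneg add_nonneg_nonneg)
    also have "\<dots> = c * Ra * area \<Gamma> ?l ?r (\<lambda>x. \<theta> t x * snd (u t x)) + (-1) * area \<Gamma> ?l ?r (grad_sq t)"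
      by (intro area_linear lr gap slice[OF fc(2) t] slice[OF fc(3) t])
    finally show "area \<Gamma> ?l ?r (f t) \<le> c * Ra * area \<Gamma> ?l ?r (\<lambda>x. \<theta> t x * snd (u t x)) - area \<Gamma> ?l ?r (grad_sq t)"
      by simp
  qed
  moreover have "integral {a..b} (\<lambda>t. c * Ra * area \<Gamma> ?l ?r (\<lambda>x. \<theta> t x * snd (u t x)) - area \<Gamma> ?l ?r (grad_sq t)) =
    c * Ra * integral {a..b} (\<lambda>t. area \<Gamma> ?l ?r (\<lambda>x. \<theta> t x * snd (u t x))) - integral {a..b} (\<lambda>t. area \<Gamma> ?l ?r (grad_sq t))"
    using int[OF fc(2)] int[OF fc(3)] by (simp add: integral_diff integrable_on_mult_right)
  moreover have "0 \<le> area \<Gamma> ?l ?r (kinetic c b)"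
  proof (rule area_nonneg)
    show "continuous_on ?K (kinetic c b)"
      by (rule continuous_on_compose_pair[OF kinetic_continuous, of ?K "\<lambda>_. b" "\<lambda>x. x"])
        (use ab KcS in \<open>auto intro!: continuous_intros\<close>)
    show "0 \<le> kinetic c b x" for x
      using c Pr_pos by (auto simp: kinetic_def intro!: mult_nonneg_nonneg add_nonneg_nonneg divide_nonneg_nonneg)
  qed (use lr gap in auto)
  ultimately show ?thesis using bal by linarith
qed

end

section \<open>The energy flux at the walls\<close>

lemma set_integral_box_iterated:
  fixes F :: "real \<times> real \<Rightarrow> real"
  assumes "set_integrable lborel (cbox (a, 0) (b, \<Gamma>)) F"
  shows "(LINT w:cbox (a, 0) (b, \<Gamma>)|lborel. F w) = (LINT t|lborel. indicator {a..b} t * (LINT x:{0..\<Gamma>}|lborel. F (t, x)))"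
proof -
  let ?F = "\<lambda>w. indicator (cbox (a, 0) (b, \<Gamma>)) w *\<^sub>R F w"
  have "integrable (lborel \<Otimes>\<^sub>M lborel) ?F" using assms by (simp add: set_integrable_def lborel_prod)
  then have "(LINT w|(lborel \<Otimes>\<^sub>M lborel). ?F w) = (LINT t|lborel. LINT x|lborel. ?F (t, x))"
    by (rule lborel_pair.integral_fst'[symmetric])
  moreover have eq: "?F (t, x) = indicator {a..b} t * (indicator {0..\<Gamma>} x *\<^sub>R F (t, x))" for t x
    by (auto simp: indicator_def cbox_Pair_eq)
  have "(LINT t|lborel. LINT x|lborel. ?F (t, x)) = (LINT t|lborel. indicator {a..b} t * (LINT x:{0..\<Gamma>}|lborel. F (t, x)))"
    unfolding set_lebesgue_integral_def eq by simp
  ultimately show ?thesis by (simp only: set_lebesgue_integral_def lborel_prod)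
qed

lemma set_integral_box_nonpos:
  fixes F :: "real \<times> real \<Rightarrow> real"
  assumes "set_integrable lborel (cbox (a, 0) (b, \<Gamma>)) F"
    and "AE t in lborel. a \<le> t \<longrightarrow> t \<le> b \<longrightarrow> (AE x in lborel. 0 \<le> x \<longrightarrow> x \<le> \<Gamma> \<longrightarrow> F (t, x) \<le> 0)"
  shows "(LINT w:cbox (a, 0) (b, \<Gamma>)|lborel. F w) \<le> 0"
proof -
  have "0 \<le> (LINT t|lborel. - (indicator {a..b} t * (LINT x:{0..\<Gamma>}|lborel. F (t, x))))"
  proof (rule integral_nonneg_AE)
    show "AE t in lborel. 0 \<le> - (indicator {a..b} t * (LINT x:{0..\<Gamma>}|lborel. F (t, x)))"
      using assms(2)
    proof eventually_elim
      fix t assume t: "a \<le> t \<longrightarrow> t \<le> b \<longrightarrow> (AE x in lborel. 0 \<le> x \<longrightarrow> x \<le> \<Gamma> \<longrightarrow> F (t, x) \<le> 0)"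
      have "0 \<le> (LINT x|lborel. - (indicator {0..\<Gamma>} x *\<^sub>R F (t, x)))" if "a \<le> t" "t \<le> b"
      proof (rule integral_nonneg_AE)
        have "AE x in lborel. 0 \<le> x \<longrightarrow> x \<le> \<Gamma> \<longrightarrow> F (t, x) \<le> 0" using t that by blast
        then show "AE x in lborel. 0 \<le> - (indicator {0..\<Gamma>} x *\<^sub>R F (t, x))"
          by eventually_elim (auto simp: indicator_def)
      qed
      then show "0 \<le> - (indicator {a..b} t * (LINT x:{0..\<Gamma>}|lborel. F (t, x)))"
        by (auto simp: indicator_def set_lebesgue_integral_def)
    qed
  qed
  then show ?thesis by (simp add: set_integral_box_iterated[OF assms(1)])
qed

lemma set_integral_box_eq_integral:
  fixes F :: "real \<times> real \<Rightarrow> real"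
  assumes "continuous_on (cbox a b) F"
  shows "set_integrable lborel (cbox a b) F" "(LINT w:cbox a b|lborel. F w) = integral (cbox a b) F"
proof -
  show "set_integrable lborel (cbox a b) F"
    unfolding set_integrable_def using borel_integrable_compact[OF compact_cbox assms]
    by (simp add: indicator_def if_distrib cong: if_cong)
  then show "(LINT w:cbox a b|lborel. F w) = integral (cbox a b) F"
    by (rule set_borel_integral_eq_integral(2))
qed

context rb_solution
begin

text \<open>The energy flux through the curve at distance \<open>s\<close> from a wall has a limit as \<open>s \<down> 0\<close>, and its sign is
that of the friction corrected by the curvature.  The normal component of \<open>(u \<cdot> \<nabla>) u\<close> is the delicate
term, since its limit would involve a tangential derivative of the velocity trace.  Writing
\<open>v = u\<^sub>2 - h' u\<^sub>1\<close>, it equals, up to gradient components multiplied by \<open>v\<close>, the tangential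
derivative of \<open>u\<^sub>1 u\<^sub>2\<close> minus \<open>h'\<close> times that of \<open>u\<^sub>1\<^sup>2\<close>.  The former integrates to zero; integration by
parts moves the latter to \<open>h''\<close>, which is bounded and exists almost everywhere.  In the remaining
terms continuous coefficients multiply the pressure and the velocity gradient, which converge in
\<open>L\<^sup>1\<close>, and the coefficients containing \<open>v\<close> tend to zero.\<close>

lemma wall_flux_limit:
  fixes h g' :: "real \<Rightarrow> real" and pw :: "real \<Rightarrow> point \<Rightarrow> real" and G :: "real \<Rightarrow> point \<Rightarrow> point \<times> point"
  assumes ab: "0 < a" "a \<le> b" and s0: "0 < s0"
    and h: "\<And>x. (h has_real_derivative deriv h x) (at x)" "K-lipschitz_on UNIV (deriv h)"
      "\<And>x. h (x + \<Gamma>) = h x" "\<And>x. deriv h (x + \<Gamma>) = deriv h x"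
    and level: "\<And>s x. 0 < s \<Longrightarrow> s \<le> s0 \<Longrightarrow> (x, h x + \<sigma> * s) \<in> S" "\<And>x. (x, h x) \<in> cS"
    and wall: "\<And>t x. 0 < t \<Longrightarrow> 0 \<le> x \<Longrightarrow> x \<le> \<Gamma> \<Longrightarrow> snd (u t (x, h x)) = deriv h x * fst (u t (x, h x))"
    and pw: "(\<lambda>(t, x). pw t x) \<in> borel_measurable borel"
      "((\<lambda>s. \<integral>\<^sup>+t\<in>{a..b}. (\<integral>\<^sup>+x. ennreal ((norm (p t (x + (0, \<sigma> * s)) - pw t x))\<^sup>2)
                 \<partial>arc_measure \<Gamma> h) \<partial>lborel) \<longlongrightarrow> 0) (at_right 0)"
    and G: "(\<lambda>(t, x). G t x) \<in> borel_measurable borel"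
      "((\<lambda>s. \<integral>\<^sup>+t\<in>{a..b}. (\<integral>\<^sup>+x. ennreal ((norm (grad (u t) (x + (0, \<sigma> * s)) - G t x))\<^sup>2)
                 \<partial>arc_measure \<Gamma> h) \<partial>lborel) \<longlongrightarrow> 0) (at_right 0)"
    and g': "g' \<in> borel_measurable borel" "\<And>x. \<bar>g' x\<bar> \<le> K" "AE x in lborel. (deriv h has_real_derivative g' x) (at x)"
    and sign: "AE t in lborel. a \<le> t \<longrightarrow> t \<le> b \<longrightarrow> (AE x in lborel. 0 \<le> x \<longrightarrow> x \<le> \<Gamma> \<longrightarrow>
       \<sigma> * (g' x * (fst (u t (x, h x)))\<^sup>2 - c * (
         (fst (snd (G t (x, h x))) + snd (fst (G t (x, h x)))) * fst (u t (x, h x)) + 2 * snd (snd (G t (x, h x))) * snd (u t (x, h x))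
         - deriv h x * (2 * fst (fst (G t (x, h x))) * fst (u t (x, h x)) +
             (fst (snd (G t (x, h x))) + snd (fst (G t (x, h x)))) * snd (u t (x, h x))))) \<le> 0)"
  shows "\<exists>Z\<le>0. ((\<lambda>s. \<sigma> * flux a b \<Gamma> (\<lambda>x. h x + \<sigma> * s) (deriv h) (energy_flux1 c) (energy_flux2 c)) \<longlongrightarrow> Z) (at_right 0)"
proof -
  let ?B = "cbox (a, 0) (b, \<Gamma>) :: (real \<times> real) set"
  let ?d = "deriv h"
  have hc: "continuous_on UNIV h" using h(1) by (auto intro!: continuous_at_imp_continuous_on DERIV_isCont)
  have dc: "continuous_on UNIV ?d" using lipschitz_on_continuous_on[OF h(2)] .
  have tpos: "0 < fst w" "0 \<le> snd w" "snd w \<le> \<Gamma>" if "w \<in> ?B" for w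
    using that ab by (auto simp: cbox_Pair_eq)
  define pt where "pt s w = (snd w, h (snd w) + \<sigma> * s)" for s and w :: "real \<times> real"
  define D where "D w = ?d (snd w)" for w :: "real \<times> real"
  define U1 where "U1 s w = fst (u (fst w) (pt s w))" for s w
  define U2 where "U2 s w = snd (u (fst w) (pt s w))" for s w
  define v where "v s w = U2 s w - D w * U1 s w" for s w
  define A11 where "A11 s w = fst (dx1 (u (fst w)) (pt s w))" for s w
  define A21 where "A21 s w = snd (dx1 (u (fst w)) (pt s w))" for s w
  define A12 where "A12 s w = fst (dx2 (u (fst w)) (pt s w))" for s w
  define A22 where "A22 s w = snd (dx2 (u (fst w)) (pt s w))" for s w
  define pp where "pp s w = p (fst w) (pt s w)" for s w
  have ptS: "pt s w \<in> S" if "0 < s" "s \<le> s0" for s w using level(1)[OF that] by (simp add: pt_def)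
  have ptcS: "pt s w \<in> cS" if "0 \<le> s" "s \<le> s0" for s w
    using ptS[of s w] level(2)[of "snd w"] that S_subset_cS by (cases "s = 0") (auto simp: pt_def)
  have dB: "continuous_on X (\<lambda>z. ?d (f z))" if "continuous_on X f" for X :: "'x::topological_space set" and f
    by (rule continuous_on_compose2[OF dc that]) simp
  have hB: "continuous_on X (\<lambda>z. h (f z))" if "continuous_on X f" for X :: "'x::topological_space set" and f
    by (rule continuous_on_compose2[OF hc that]) simp
  have u0: "continuous_on ({0..s0} \<times> ?B) (\<lambda>z. u (fst (snd z)) (pt (fst z) (snd z)))"
    unfolding pt_def
    by (intro continuous_on_compose_pair[OF u_continuous] continuous_intros hB)
      (use tpos ptcS in \<open>auto simp: pt_def\<close>)
  have Uc: "continuous_on ({0..s0} \<times> ?B) (\<lambda>z. U1 (fst z) (snd z))" "continuous_on ({0..s0} \<times> ?B) (\<lambda>z. U2 (fst z) (snd z))"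
     "continuous_on ({0..s0} \<times> ?B) (\<lambda>z. D (snd z))"
    unfolding U1_def U2_def D_def by (intro continuous_intros u0 dB)+
  have vc: "continuous_on ({0..s0} \<times> ?B) (\<lambda>z. v (fst z) (snd z))"
    unfolding v_def by (intro continuous_intros Uc)
  have lev: "continuous_on ?B (\<lambda>w. f (fst w) (pt s w))"
    if "continuous_on ({0<..} \<times> S) (\<lambda>(t, x). f t x)" "0 < s" "s \<le> s0" for f :: "real \<Rightarrow> point \<Rightarrow> 'z::topological_space" and s
    unfolding pt_def
    by (intro continuous_on_compose_pair[OF that(1)] continuous_intros hB)
      (use tpos ptS that in \<open>auto simp: pt_def\<close>)
  have Ac: "continuous_on ?B (A11 s)" "continuous_on ?B (A21 s)" "continuous_on ?B (A12 s)" "continuous_on ?B (A22 s)"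
     "continuous_on ?B (pp s)" "continuous_on ?B (U1 s)" "continuous_on ?B (U2 s)" "continuous_on ?B D" "continuous_on ?B (v s)"
    if "0 < s" "s \<le> s0" for s
    unfolding A11_def A21_def A12_def A22_def pp_def U1_def U2_def D_def v_def
    by (intro continuous_intros dB lev[OF _ that] interior_continuous)+
  note cint = set_integral_box_eq_integral
  \<comment> \<open>The coefficients of the pressure and of the velocity gradient in the flux, after the derivatives
    along the curve have been split off, and the coefficient of \<open>h''\<close>.\<close>
  define \<phi>0 where "\<phi>0 s w = c * (1 / (2 * Pr) * (U1 s w * U1 s w + U2 s w * U2 s w)) * v s w" for s w
  define \<phi>p where "\<phi>p s w = c * v s w" for s w
  define \<phi>11 where "\<phi>11 s w = 2 * c * D w * U1 s w - v s w" for s w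
  define \<phi>12 where "\<phi>12 s w = - c * (U1 s w - D w * U2 s w) - 2 * D w * v s w" for s w
  define \<phi>21 where "\<phi>21 s w = - c * (U1 s w - D w * U2 s w)" for s w
  define \<phi>22 where "\<phi>22 s w = - 2 * c * U2 s w + v s w" for s w
  define \<phi>g where "\<phi>g s w = (U1 s w)\<^sup>2" for s w
  have \<phi>c: "continuous_on ({0..s0} \<times> ?B) (\<lambda>(s, w). \<phi>0 s w)" "continuous_on ({0..s0} \<times> ?B) (\<lambda>(s, w). \<phi>p s w)"
     "continuous_on ({0..s0} \<times> ?B) (\<lambda>(s, w). \<phi>11 s w)" "continuous_on ({0..s0} \<times> ?B) (\<lambda>(s, w). \<phi>12 s w)"
     "continuous_on ({0..s0} \<times> ?B) (\<lambda>(s, w). \<phi>21 s w)" "continuous_on ({0..s0} \<times> ?B) (\<lambda>(s, w). \<phi>22 s w)"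
     "continuous_on ({0..s0} \<times> ?B) (\<lambda>(s, w). \<phi>g s w)"
    unfolding split_beta' \<phi>0_def \<phi>p_def \<phi>11_def \<phi>12_def \<phi>21_def \<phi>22_def \<phi>g_def
    by (intro continuous_intros Uc vc)+
  have hm: "h \<in> borel_measurable borel" using hc by (rule borel_measurable_continuous_onI)
  have trm: "(\<lambda>w. g (fst w) (snd w, h (snd w))) \<in> borel_measurable borel"
    if "(\<lambda>(t, x). g t x) \<in> borel_measurable borel" for g :: "real \<Rightarrow> point \<Rightarrow> 'z::euclidean_space"
  proof -
    have "(\<lambda>w::real \<times> real. (fst w, (snd w, h (snd w)))) \<in> borel \<rightarrow>\<^sub>M borel"
      by (intro borel_measurable_continuous_onI continuous_intros hB)
    from measurable_compose[OF this that] show ?thesis by simp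
  qed
  define Gw where "Gw w = G (fst w) (snd w, h (snd w))" for w :: "real \<times> real"
  have Gm: "Gw \<in> borel_measurable borel" unfolding Gw_def[abs_def] by (rule trm[OF G(1)])
  have pm: "(\<lambda>w. pw (fst w) (snd w, h (snd w))) \<in> borel_measurable borel" by (rule trm[OF pw(1)])
  have small: "\<forall>\<^sub>F s in at_right 0. 0 < s \<and> s \<le> s0"
    using s0 unfolding eventually_at_right_field by (intro exI[of _ s0]) auto
  have pconv: "((\<lambda>s. \<integral>\<^sup>+w\<in>?B. ennreal \<bar>pp s w - pw (fst w) (snd w, h (snd w))\<bar> \<partial>lborel) \<longlongrightarrow> 0) (at_right 0)"
  proof -
    have "\<forall>\<^sub>F s in at_right 0. continuous_on ?B (\<lambda>w. p (fst w) (snd w, h (snd w) + \<sigma> * s))"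
      using small by eventually_elim (use Ac(5) in \<open>simp add: pp_def[abs_def] pt_def\<close>)
    from trace_limit_L1[OF hc dc pw this] show ?thesis by (simp add: pp_def pt_def)
  qed
  have gconv0: "((\<lambda>s. \<integral>\<^sup>+w\<in>?B. ennreal (norm (grad (u (fst w)) (pt s w) - Gw w)) \<partial>lborel) \<longlongrightarrow> 0) (at_right 0)"
  proof -
    have "continuous_on ({0<..} \<times> S) (\<lambda>(t, x). grad (u t) x)"
      unfolding grad_def split_beta' using interior_continuous(4,5) unfolding split_beta' by (intro continuous_intros)
    note gc = lev[OF this]
    have "\<forall>\<^sub>F s in at_right 0. continuous_on ?B (\<lambda>w. grad (u (fst w)) (snd w, h (snd w) + \<sigma> * s))"
      using small by eventually_elim (use gc in \<open>simp add: pt_def\<close>)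
    from trace_limit_L1[OF hc dc G this] show ?thesis by (simp add: Gw_def pt_def)
  qed
  have gconv: "((\<lambda>s. \<integral>\<^sup>+w\<in>?B. ennreal \<bar>l (grad (u (fst w)) (pt s w)) - l (Gw w)\<bar> \<partial>lborel) \<longlongrightarrow> 0) (at_right 0)"
    if l: "\<And>x y. \<bar>l x - l y\<bar> \<le> norm (x - y)" for l :: "point \<times> point \<Rightarrow> real"
  proof (rule tendsto_sandwich[OF _ _ tendsto_const gconv0])
    show "\<forall>\<^sub>F s in at_right 0. (\<integral>\<^sup>+w\<in>?B. ennreal \<bar>l (grad (u (fst w)) (pt s w)) - l (Gw w)\<bar> \<partial>lborel)
       \<le> (\<integral>\<^sup>+w\<in>?B. ennreal (norm (grad (u (fst w)) (pt s w) - Gw w)) \<partial>lborel)"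
      using l by (intro always_eventually allI nn_integral_mono mult_right_mono ennreal_leI) auto
  qed auto
  have comp: "\<bar>fst (fst x) - fst (fst y)\<bar> \<le> norm (x - y)" "\<bar>snd (fst x) - snd (fst y)\<bar> \<le> norm (x - y)"
     "\<bar>fst (snd x) - fst (snd y)\<bar> \<le> norm (x - y)" "\<bar>snd (snd x) - snd (snd y)\<bar> \<le> norm (x - y)" for x y :: "point \<times> point"
  proof -
    have f: "\<bar>fst z\<bar> \<le> norm z" "\<bar>snd z\<bar> \<le> norm z" for z :: point
      using norm_fst_le[of "fst z" "snd z"] norm_snd_le[of "snd z" "fst z"] by simp_all
    have n: "norm (fst (x - y)) \<le> norm (x - y)" "norm (snd (x - y)) \<le> norm (x - y)"
      using norm_fst_le[of "fst (x - y)" "snd (x - y)"] norm_snd_le[of "snd (x - y)" "fst (x - y)"]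
      unfolding prod.collapse by blast+
    show "\<bar>fst (fst x) - fst (fst y)\<bar> \<le> norm (x - y)" "\<bar>snd (fst x) - snd (fst y)\<bar> \<le> norm (x - y)"
      "\<bar>fst (snd x) - fst (snd y)\<bar> \<le> norm (x - y)" "\<bar>snd (snd x) - snd (snd y)\<bar> \<le> norm (x - y)"
      using f[of "fst (x - y)"] f[of "snd (x - y)"] n by auto
  qed
  have Aconv: "((\<lambda>s. \<integral>\<^sup>+w\<in>?B. ennreal \<bar>A11 s w - fst (fst (Gw w))\<bar> \<partial>lborel) \<longlongrightarrow> 0) (at_right 0)"
    "((\<lambda>s. \<integral>\<^sup>+w\<in>?B. ennreal \<bar>A21 s w - snd (fst (Gw w))\<bar> \<partial>lborel) \<longlongrightarrow> 0) (at_right 0)"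
    "((\<lambda>s. \<integral>\<^sup>+w\<in>?B. ennreal \<bar>A12 s w - fst (snd (Gw w))\<bar> \<partial>lborel) \<longlongrightarrow> 0) (at_right 0)"
    "((\<lambda>s. \<integral>\<^sup>+w\<in>?B. ennreal \<bar>A22 s w - snd (snd (Gw w))\<bar> \<partial>lborel) \<longlongrightarrow> 0) (at_right 0)"
    using gconv[OF comp(1)] gconv[OF comp(2)] gconv[OF comp(3)] gconv[OF comp(4)]
    by (simp_all add: A11_def A21_def A12_def A22_def grad_def)
  have Gcm: "(\<lambda>w. fst (fst (Gw w))) \<in> borel_measurable borel" "(\<lambda>w. snd (fst (Gw w))) \<in> borel_measurable borel"
     "(\<lambda>w. fst (snd (Gw w))) \<in> borel_measurable borel" "(\<lambda>w. snd (snd (Gw w))) \<in> borel_measurable borel"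
  proof -
    have m: "(\<lambda>w. l (Gw w)) \<in> borel_measurable borel" if "continuous_on UNIV l" for l :: "point \<times> point \<Rightarrow> real"
      using measurable_compose[OF Gm borel_measurable_continuous_onI[OF that]] .
    show "(\<lambda>w. fst (fst (Gw w))) \<in> borel_measurable borel" "(\<lambda>w. snd (fst (Gw w))) \<in> borel_measurable borel"
     "(\<lambda>w. fst (snd (Gw w))) \<in> borel_measurable borel" "(\<lambda>w. snd (snd (Gw w))) \<in> borel_measurable borel"
      by (rule m, intro continuous_intros)+
  qed
  have g'm: "(\<lambda>w::real \<times> real. g' (snd w)) \<in> borel_measurable borel"
  proof -
    have "(snd :: real \<times> real \<Rightarrow> real) \<in> borel_measurable borel"
      by (intro borel_measurable_continuous_onI continuous_intros)
    from measurable_compose[OF this g'(1)] show ?thesis .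
  qed
  have g'int: "set_integrable lborel ?B (\<lambda>w. g' (snd w))"
    unfolding set_integrable_def
  proof (rule Bochner_Integration.integrable_bound[where f = "\<lambda>w. indicator ?B w *\<^sub>R K"])
    show "integrable lborel (\<lambda>w. indicator ?B w *\<^sub>R K)"
      using cint(1)[of "(a, 0)" "(b, \<Gamma>)" "\<lambda>_. K"] by (simp add: set_integrable_def continuous_on_const)
    show "AE w in lborel. norm (indicator ?B w *\<^sub>R g' (snd w)) \<le> norm (indicator ?B w *\<^sub>R K)"
      using g'(2) by (intro AE_I2) (auto simp: indicator_def intro: order_trans[OF _ abs_ge_self])
    show "(\<lambda>w. indicator ?B w *\<^sub>R g' (snd w)) \<in> borel_measurable lborel" using g'm by simp
  qed
  note L0 = product_limit_L1[OF s0 \<phi>c(1), of "\<lambda>_ _. 1" "\<lambda>_. 1"]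
  note Lp = product_limit_L1[OF s0 \<phi>c(2) cint(1)[OF Ac(5)] pm pconv]
  note L11 = product_limit_L1[OF s0 \<phi>c(3) cint(1)[OF Ac(1)] Gcm(1) Aconv(1)]
  note L12 = product_limit_L1[OF s0 \<phi>c(4) cint(1)[OF Ac(3)] Gcm(3) Aconv(3)]
  note L21 = product_limit_L1[OF s0 \<phi>c(5) cint(1)[OF Ac(2)] Gcm(2) Aconv(2)]
  note L22 = product_limit_L1[OF s0 \<phi>c(6) cint(1)[OF Ac(4)] Gcm(4) Aconv(4)]
  have Lg: "set_integrable lborel ?B (\<lambda>w. \<phi>g 0 w * g' (snd w))"
    "((\<lambda>s. LINT w:?B|lborel. \<phi>g s w * g' (snd w)) \<longlongrightarrow> (LINT w:?B|lborel. \<phi>g 0 w * g' (snd w))) (at_right 0)"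
    using product_limit_L1[OF s0 \<phi>c(7), of "\<lambda>_ w. g' (snd w)" "\<lambda>w. g' (snd w)"] g'int g'm by simp_all
  have L0: "set_integrable lborel ?B (\<lambda>w. \<phi>0 0 w)"
    "((\<lambda>s. LINT w:?B|lborel. \<phi>0 s w) \<longlongrightarrow> (LINT w:?B|lborel. \<phi>0 0 w)) (at_right 0)"
    using L0 cint(1)[of "(a, 0)" "(b, \<Gamma>)" "\<lambda>_. 1"] by (simp_all add: continuous_on_const)
  \<comment> \<open>The flux density splits into a part linear in the traces and derivatives along the curve.\<close>
  define Y where "Y s w = \<phi>0 s w + \<phi>p s w * pp s w + \<phi>11 s w * A11 s w + \<phi>12 s w * A12 s w +
     \<phi>21 s w * A21 s w + \<phi>22 s w * A22 s w" for s w
  define X where "X s w = energy_flux2 c (fst w) (pt s w) - D w * energy_flux1 c (fst w) (pt s w)" for s w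
  define B1 where "B1 s w = A11 s w + A12 s w * D w" for s w
  define B2 where "B2 s w = A21 s w + A22 s w * D w" for s w
  define k where "k = 1 / (2 * Pr)"
  have XY: "X s w = Y s w + (B1 s w * U2 s w + B2 s w * U1 s w) - D w * (2 * U1 s w * B1 s w)" for s w
    unfolding X_def Y_def energy_flux1_def energy_flux2_def head_def B1_def B2_def
      \<phi>0_def \<phi>p_def \<phi>11_def \<phi>12_def \<phi>21_def \<phi>22_def v_def
      U1_def[symmetric] U2_def[symmetric] A11_def[symmetric] A21_def[symmetric] A12_def[symmetric] A22_def[symmetric] pp_def[symmetric]
      k_def[symmetric]
    by (simp add: algebra_simps power2_eq_square)
  have \<phi>cs: "continuous_on ?B (\<phi>0 s)" "continuous_on ?B (\<phi>p s)" "continuous_on ?B (\<phi>11 s)" "continuous_on ?B (\<phi>12 s)"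
      "continuous_on ?B (\<phi>21 s)" "continuous_on ?B (\<phi>22 s)" "continuous_on ?B (\<phi>g s)" if s: "0 < s" "s \<le> s0" for s
    unfolding \<phi>0_def \<phi>p_def \<phi>11_def \<phi>12_def \<phi>21_def \<phi>22_def \<phi>g_def
    by (intro continuous_intros Ac[OF s])+
  have Yc: "continuous_on ?B (Y s)" and Xc: "continuous_on ?B (X s)"
    and Bc: "continuous_on ?B (B1 s)" "continuous_on ?B (B2 s)" if s: "0 < s" "s \<le> s0" for s
  proof -
    show Y: "continuous_on ?B (Y s)" unfolding Y_def by (intro continuous_intros \<phi>cs[OF s] Ac[OF s])
    show B: "continuous_on ?B (B1 s)" "continuous_on ?B (B2 s)" unfolding B1_def B2_def by (intro continuous_intros Ac[OF s])+
    show "continuous_on ?B (X s)" unfolding XY[abs_def] by (intro continuous_intros Y B Ac[OF s])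
  qed
  have slice: "continuous_on {0..\<Gamma>} (\<lambda>x. F (t, x))" if "continuous_on ?B F" "t \<in> {a..b}" for F :: "real \<times> real \<Rightarrow> real" and t
    by (rule continuous_on_compose2[OF that(1)]) (use that(2) in \<open>auto intro!: continuous_intros simp: cbox_Pair_eq\<close>)
  have slice_id: "integral {0..\<Gamma>} (\<lambda>x. X s (t, x)) =
     integral {0..\<Gamma>} (\<lambda>x. Y s (t, x)) + (LINT x:{0..\<Gamma>}|lborel. \<phi>g s (t, x) * g' x)"
    if s: "0 < s" "s \<le> s0" and t: "t \<in> {a..b}" for s t
  proof -
    have t0: "0 < t" using t ab by auto
    have pS: "(x, h x + \<sigma> * s) \<in> S" for x by (rule level(1)[OF s])
    have hd: "((\<lambda>x. h x + \<sigma> * s) has_real_derivative ?d x) (at x)" for x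
      using h(1)[of x] by (auto intro!: derivative_eq_intros)
    have dU1: "((\<lambda>x. U1 s (t, x)) has_real_derivative B1 s (t, x)) (at x)" for x
      using plane_deriv_graph[OF u_components(1)[OF t0 pS] hd]
      by (simp add: U1_def pt_def B1_def A11_def A12_def D_def)
    have dU2: "((\<lambda>x. U2 s (t, x)) has_real_derivative B2 s (t, x)) (at x)" for x
      using plane_deriv_graph[OF u_components(2)[OF t0 pS] hd]
      by (simp add: U2_def pt_def B2_def A21_def A22_def D_def)
    have uper: "u t (x + \<Gamma>, h (x + \<Gamma>) + \<sigma> * s) = u t (x, h x + \<sigma> * s)" for x
      using periodic(1)[OF t0, of "(x, h x + \<sigma> * s)"] pS S_subset_cS h(3) by auto
    have per: "U1 s (t, x + \<Gamma>) = U1 s (t, x)" "U2 s (t, x + \<Gamma>) = U2 s (t, x)" for x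
      using uper by (simp_all add: U1_def U2_def pt_def)
    have p1: "((\<lambda>x. B1 s (t, x) * U2 s (t, x) + B2 s (t, x) * U1 s (t, x)) has_integral
       (U1 s (t, \<Gamma>) * U2 s (t, \<Gamma>) - U1 s (t, 0) * U2 s (t, 0))) {0..\<Gamma>}"
      using \<Gamma>_pos
    proof (intro fundamental_theorem_of_calculus)
      fix x
      show "((\<lambda>x. U1 s (t, x) * U2 s (t, x)) has_vector_derivative B1 s (t, x) * U2 s (t, x) + B2 s (t, x) * U1 s (t, x)) (at x within {0..\<Gamma>})"
        using DERIV_mult[OF dU1[of x] dU2[of x]]
        by (simp add: has_real_derivative_iff_has_vector_derivative has_vector_derivative_at_within)
    qed simp
    then have p1': "integral {0..\<Gamma>} (\<lambda>x. B1 s (t, x) * U2 s (t, x) + B2 s (t, x) * U1 s (t, x)) = 0"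
      using per[of 0] by (simp add: integral_unique)
    have Aall: "continuous_on UNIV (\<lambda>x. f t (x, h x + \<sigma> * s))"
      if "continuous_on ({0<..} \<times> S) (\<lambda>(t, x). f t x)" for f :: "real \<Rightarrow> point \<Rightarrow> 'z::topological_space"
      by (intro continuous_on_compose_pair[OF that] continuous_intros hB) (use t0 pS in auto)
    have B1all: "continuous_on UNIV (\<lambda>x. B1 s (t, x))"
      unfolding B1_def A11_def A12_def D_def pt_def fst_conv snd_conv
      by (intro continuous_intros Aall interior_continuous dc)
    have U1all: "continuous_on UNIV (\<lambda>x. U1 s (t, x))"
      unfolding U1_def pt_def fst_conv snd_conv by (intro continuous_intros Aall interior_continuous)
    have p2: "(LINT x:{0..\<Gamma>}|lborel. g' x * (U1 s (t, x))\<^sup>2) = - integral {0..\<Gamma>} (\<lambda>x. ?d x * (2 * U1 s (t, x) * B1 s (t, x)))"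
    proof (rule integral_by_parts_lipschitz_periodic[OF \<Gamma>_pos h(2) h(4) g'])
      show "((\<lambda>x. (U1 s (t, x))\<^sup>2) has_real_derivative 2 * U1 s (t, x) * B1 s (t, x)) (at x)" for x
        using dU1[of x] by (auto intro!: derivative_eq_intros)
      show "continuous_on UNIV (\<lambda>x. 2 * U1 s (t, x) * B1 s (t, x))" by (intro continuous_intros B1all U1all)
    qed (simp add: per)
    have ci: "(\<lambda>x. Y s (t, x)) integrable_on {0..\<Gamma>}" "(\<lambda>x. D (t, x) * (2 * U1 s (t, x) * B1 s (t, x))) integrable_on {0..\<Gamma>}"
      by (intro integrable_continuous_real slice[OF _ t] Yc[OF s] continuous_on_mult continuous_on_const
          Ac(6)[OF s] Ac(8)[OF s] Bc(1)[OF s])+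
    have "integral {0..\<Gamma>} (\<lambda>x. X s (t, x)) = integral {0..\<Gamma>} (\<lambda>x. Y s (t, x)) +
       integral {0..\<Gamma>} (\<lambda>x. B1 s (t, x) * U2 s (t, x) + B2 s (t, x) * U1 s (t, x)) -
       integral {0..\<Gamma>} (\<lambda>x. D (t, x) * (2 * U1 s (t, x) * B1 s (t, x)))"
      unfolding XY using ci p1 by (subst integral_diff integral_add; auto intro!: integrable_add simp: has_integral_iff)+
    then show ?thesis using p1' p2 by (simp add: D_def \<phi>g_def mult.commute)
  qed
  have flux_eq: "flux a b \<Gamma> (\<lambda>x. h x + \<sigma> * s) ?d (energy_flux1 c) (energy_flux2 c) =
     (LINT w:?B|lborel. \<phi>0 s w) + (LINT w:?B|lborel. \<phi>p s w * pp s w) + (LINT w:?B|lborel. \<phi>11 s w * A11 s w) +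
     (LINT w:?B|lborel. \<phi>12 s w * A12 s w) + (LINT w:?B|lborel. \<phi>21 s w * A21 s w) + (LINT w:?B|lborel. \<phi>22 s w * A22 s w) +
     (LINT w:?B|lborel. \<phi>g s w * g' (snd w))" if s: "0 < s" "s \<le> s0" for s
  proof -
    have gi: "set_integrable lborel ?B (\<lambda>w. \<phi>g s w * g' (snd w))"
    proof -
      have "continuous_on ({0..s} \<times> ?B) (\<lambda>(r, w). \<phi>g s w)"
        unfolding split_beta' using \<phi>cs(7)[OF s] by (intro continuous_on_compose2[OF \<phi>cs(7)[OF s]] continuous_intros) auto
      from product_limit_L1(1)[OF s(1) this, of "\<lambda>_ w. g' (snd w)" "\<lambda>w. g' (snd w)"] g'int g'm
      show ?thesis by simp
    qed
    have Ii: "continuous_on {a..b} (\<lambda>t. integral {0..\<Gamma>} (\<lambda>x. F (t, x)))" if "continuous_on ?B F" for F :: "real \<times> real \<Rightarrow> real"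
      using integral_continuous_on_param[of "{a..b}" 0 \<Gamma> "\<lambda>t x. F (t, x)"] that by (simp add: cbox_Pair_eq)
    have box: "integral ?B F = integral {a..b} (\<lambda>t. integral {0..\<Gamma>} (\<lambda>x. F (t, x)))" if "continuous_on ?B F" for F :: "real \<times> real \<Rightarrow> real"
      using integral_prod_continuous[OF that] by simp
    have "(LINT w:?B|lborel. \<phi>g s w * g' (snd w)) =
       (LINT t|lborel. indicator {a..b} t * (LINT x:{0..\<Gamma>}|lborel. \<phi>g s (t, x) * g' x))"
      using set_integral_box_iterated[OF gi] by simp
    also have "\<dots> = (LINT t|lborel. indicator {a..b} t *\<^sub>R (integral {0..\<Gamma>} (\<lambda>x. X s (t, x)) - integral {0..\<Gamma>} (\<lambda>x. Y s (t, x))))"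
      by (rule Bochner_Integration.integral_cong) (use slice_id[OF s] in \<open>auto simp: indicator_def\<close>)
    also have "\<dots> = (LINT t:{a..b}|lborel. integral {0..\<Gamma>} (\<lambda>x. X s (t, x)) - integral {0..\<Gamma>} (\<lambda>x. Y s (t, x)))"
      by (simp only: set_lebesgue_integral_def)
    also have "\<dots> = integral {a..b} (\<lambda>t. integral {0..\<Gamma>} (\<lambda>x. X s (t, x)) - integral {0..\<Gamma>} (\<lambda>x. Y s (t, x)))"
      by (intro set_borel_integral_eq_integral borel_integrable_atLeastAtMost' continuous_intros Ii Xc Yc s)
    also have "\<dots> = integral ?B (X s) - integral ?B (Y s)"
      unfolding box[OF Xc[OF s]] box[OF Yc[OF s]]
      by (intro integral_diff integrable_continuous_real Ii Xc Yc s)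
    finally have gX: "(LINT w:?B|lborel. \<phi>g s w * g' (snd w)) = integral ?B (X s) - integral ?B (Y s)" .
    have i: "set_integrable lborel ?B (\<phi>0 s)" "set_integrable lborel ?B (\<lambda>w. \<phi>p s w * pp s w)"
      "set_integrable lborel ?B (\<lambda>w. \<phi>11 s w * A11 s w)" "set_integrable lborel ?B (\<lambda>w. \<phi>12 s w * A12 s w)"
      "set_integrable lborel ?B (\<lambda>w. \<phi>21 s w * A21 s w)" "set_integrable lborel ?B (\<lambda>w. \<phi>22 s w * A22 s w)"
      by (intro cint(1) continuous_intros \<phi>cs[OF s] Ac[OF s])+
    have "integral ?B (Y s) = (LINT w:?B|lborel. Y s w)" using cint(2)[OF Yc[OF s]] by simp
    also have "\<dots> = (LINT w:?B|lborel. \<phi>0 s w) + (LINT w:?B|lborel. \<phi>p s w * pp s w) + (LINT w:?B|lborel. \<phi>11 s w * A11 s w) +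
     (LINT w:?B|lborel. \<phi>12 s w * A12 s w) + (LINT w:?B|lborel. \<phi>21 s w * A21 s w) + (LINT w:?B|lborel. \<phi>22 s w * A22 s w)"
      unfolding Y_def using i by (simp add: set_integral_add)
    finally have YL: "integral ?B (Y s) = \<dots>" .
    have "flux a b \<Gamma> (\<lambda>x. h x + \<sigma> * s) ?d (energy_flux1 c) (energy_flux2 c) = integral ?B (X s)"
      unfolding flux_def X_def pt_def D_def by simp
    then show ?thesis using gX YL by simp
  qed
  define Z0 where "Z0 = (LINT w:?B|lborel. \<phi>0 0 w) + (LINT w:?B|lborel. \<phi>p 0 w * pw (fst w) (snd w, h (snd w))) +
     (LINT w:?B|lborel. \<phi>11 0 w * fst (fst (Gw w))) + (LINT w:?B|lborel. \<phi>12 0 w * fst (snd (Gw w))) +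
     (LINT w:?B|lborel. \<phi>21 0 w * snd (fst (Gw w))) + (LINT w:?B|lborel. \<phi>22 0 w * snd (snd (Gw w))) +
     (LINT w:?B|lborel. \<phi>g 0 w * g' (snd w))"
  have lim: "((\<lambda>s. flux a b \<Gamma> (\<lambda>x. h x + \<sigma> * s) ?d (energy_flux1 c) (energy_flux2 c)) \<longlongrightarrow> Z0) (at_right 0)"
  proof (rule Lim_transform_eventually)
    show "((\<lambda>s. (LINT w:?B|lborel. \<phi>0 s w) + (LINT w:?B|lborel. \<phi>p s w * pp s w) + (LINT w:?B|lborel. \<phi>11 s w * A11 s w) +
     (LINT w:?B|lborel. \<phi>12 s w * A12 s w) + (LINT w:?B|lborel. \<phi>21 s w * A21 s w) + (LINT w:?B|lborel. \<phi>22 s w * A22 s w) +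
     (LINT w:?B|lborel. \<phi>g s w * g' (snd w))) \<longlongrightarrow> Z0) (at_right 0)"
      unfolding Z0_def by (intro tendsto_add L0(2) Lp(2) L11(2) L12(2) L21(2) L22(2) Lg(2))
    show "\<forall>\<^sub>F s in at_right 0. (LINT w:?B|lborel. \<phi>0 s w) + (LINT w:?B|lborel. \<phi>p s w * pp s w) + (LINT w:?B|lborel. \<phi>11 s w * A11 s w) +
     (LINT w:?B|lborel. \<phi>12 s w * A12 s w) + (LINT w:?B|lborel. \<phi>21 s w * A21 s w) + (LINT w:?B|lborel. \<phi>22 s w * A22 s w) +
     (LINT w:?B|lborel. \<phi>g s w * g' (snd w)) = flux a b \<Gamma> (\<lambda>x. h x + \<sigma> * s) ?d (energy_flux1 c) (energy_flux2 c)"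
      using small by eventually_elim (use flux_eq in simp)
  qed
  define W where "W w = \<phi>0 0 w + \<phi>p 0 w * pw (fst w) (snd w, h (snd w)) + \<phi>11 0 w * fst (fst (Gw w)) + \<phi>12 0 w * fst (snd (Gw w)) +
     \<phi>21 0 w * snd (fst (Gw w)) + \<phi>22 0 w * snd (snd (Gw w)) + \<phi>g 0 w * g' (snd w)" for w
  note ints = L0(1) Lp(1) L11(1) L12(1) L21(1) L22(1) Lg(1)
  have Wi: "set_integrable lborel ?B W"
    unfolding W_def by (intro set_integral_add(1) ints)
  have ZW: "Z0 = (LINT w:?B|lborel. W w)"
    unfolding W_def Z0_def using ints by (simp add: set_integral_add)
  have "(LINT w:?B|lborel. \<sigma> * W w) \<le> 0"
  proof (rule set_integral_box_nonpos)
    show "set_integrable lborel ?B (\<lambda>w. \<sigma> * W w)" by (intro set_integrable_mult_right impI Wi)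
    show "AE t in lborel. a \<le> t \<longrightarrow> t \<le> b \<longrightarrow> (AE x in lborel. 0 \<le> x \<longrightarrow> x \<le> \<Gamma> \<longrightarrow> \<sigma> * W (t, x) \<le> 0)"
      using sign
    proof eventually_elim
      case (elim t)
      show ?case
      proof (intro impI)
        assume t: "a \<le> t" "t \<le> b"
        then have t0: "0 < t" using ab by simp
        have "AE x in lborel. 0 \<le> x \<longrightarrow> x \<le> \<Gamma> \<longrightarrow>
          \<sigma> * (g' x * (fst (u t (x, h x)))\<^sup>2 - c * (
          (fst (snd (G t (x, h x))) + snd (fst (G t (x, h x)))) * fst (u t (x, h x)) + 2 * snd (snd (G t (x, h x))) * snd (u t (x, h x))
          - ?d x * (2 * fst (fst (G t (x, h x))) * fst (u t (x, h x)) +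
             (fst (snd (G t (x, h x))) + snd (fst (G t (x, h x)))) * snd (u t (x, h x))))) \<le> 0"
          using elim t by blast
        then show "AE x in lborel. 0 \<le> x \<longrightarrow> x \<le> \<Gamma> \<longrightarrow> \<sigma> * W (t, x) \<le> 0"
        proof eventually_elim
          case (elim x)
          show ?case
          proof (intro impI)
            assume x: "0 \<le> x" "x \<le> \<Gamma>"
            have v0: "v 0 (t, x) = 0"
              using wall[OF t0 x] by (simp add: v_def U1_def U2_def D_def pt_def)
            have "W (t, x) = g' x * (fst (u t (x, h x)))\<^sup>2 - c * (
              (fst (snd (G t (x, h x))) + snd (fst (G t (x, h x)))) * fst (u t (x, h x)) + 2 * snd (snd (G t (x, h x))) * snd (u t (x, h x))
              - ?d x * (2 * fst (fst (G t (x, h x))) * fst (u t (x, h x)) +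
               (fst (snd (G t (x, h x))) + snd (fst (G t (x, h x)))) * snd (u t (x, h x))))"
              unfolding W_def \<phi>0_def \<phi>p_def \<phi>11_def \<phi>12_def \<phi>21_def \<phi>22_def \<phi>g_def v0
              by (simp add: U1_def U2_def D_def pt_def Gw_def algebra_simps)
            then show "\<sigma> * W (t, x) \<le> 0" using elim x by simp
          qed
        qed
      qed
    qed
  qed
  then have "\<sigma> * Z0 \<le> 0" by (simp add: ZW)
  moreover have "((\<lambda>s. \<sigma> * flux a b \<Gamma> (\<lambda>x. h x + \<sigma> * s) ?d (energy_flux1 c) (energy_flux2 c)) \<longlongrightarrow> \<sigma> * Z0) (at_right 0)"
    by (intro tendsto_mult lim tendsto_const)
  ultimately show ?thesis by blast
qed

end

section \<open>Curvature and friction\<close>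

context rb_channel
begin

lemma outer_normal_walls:
  "outer_normal hm hp (x, hm x) = (1 / sqrt (1 + (deriv hm x)\<^sup>2)) *\<^sub>R (deriv hm x, - 1)"
  "outer_normal hm hp (x, hp x) = (1 / sqrt (1 + (deriv hp x)\<^sup>2)) *\<^sub>R (- deriv hp x, 1)"
  using hm_less_hp[of x] by (auto simp: outer_normal_def)

text \<open>The usual curvature of a graph; the sign reflects the direction of the outward normal.\<close>

lemma curvature_walls:
  "(deriv hm has_real_derivative g) (at x) \<Longrightarrow> curvature hm hp (x, hm x) = - g / (sqrt (1 + (deriv hm x)\<^sup>2)) ^ 3"
  "(deriv hp has_real_derivative g) (at x) \<Longrightarrow> curvature hm hp (x, hp x) = g / (sqrt (1 + (deriv hp x)\<^sup>2)) ^ 3"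
proof -
  have key: "((\<lambda>s. (1 / sqrt (1 + (d s)\<^sup>2), d s / sqrt (1 + (d s)\<^sup>2))) has_vector_derivative
      (- (d x * g) / \<rho> ^ 3, g / \<rho> - (d x)\<^sup>2 * g / \<rho> ^ 3)) (at x)"
    if d: "(d has_real_derivative g) (at x)" and \<rho>: "\<rho> = sqrt (1 + (d x)\<^sup>2)" for d :: "real \<Rightarrow> real" and \<rho>
  proof -
    have pos: "0 < 1 + (d x)\<^sup>2" by (simp add: add_pos_nonneg)
    then have \<rho>0: "\<rho> \<noteq> 0" by (simp add: \<rho>)
    have in1: "((\<lambda>s. 1 + (d s)\<^sup>2) has_real_derivative 2 * d x * g) (at x)"
      using d by (auto intro!: derivative_eq_intros)
    have r: "((\<lambda>s. sqrt (1 + (d s)\<^sup>2)) has_real_derivative d x * g / \<rho>) (at x)"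
      using DERIV_chain2[OF DERIV_real_sqrt[OF pos] in1] by (simp add: \<rho> field_simps)
    have a: "((\<lambda>s. 1 / sqrt (1 + (d s)\<^sup>2)) has_real_derivative - (d x * g) / \<rho> ^ 3) (at x)"
      by (rule DERIV_cong[OF DERIV_divide[OF DERIV_const r]])
        (use \<rho>0 in \<open>simp_all add: \<rho>[symmetric] field_simps power3_eq_cube\<close>)
    have b: "((\<lambda>s. d s / sqrt (1 + (d s)\<^sup>2)) has_real_derivative g / \<rho> - (d x)\<^sup>2 * g / \<rho> ^ 3) (at x)"
    proof (rule DERIV_cong[OF DERIV_divide[OF d r]])
      show "sqrt (1 + (d x)\<^sup>2) \<noteq> 0" using \<rho>0 \<rho> by simp
      have "(g * \<rho> - d x * (d x * g / \<rho>)) / (\<rho> * \<rho>) = g / \<rho> - (d x)\<^sup>2 * g / \<rho> ^ 3"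
        using \<rho>0 by (simp add: field_simps power3_eq_cube power2_eq_square)
      then show "(g * sqrt (1 + (d x)\<^sup>2) - d x * (d x * g / \<rho>)) / (sqrt (1 + (d x)\<^sup>2) * sqrt (1 + (d x)\<^sup>2)) =
          g / \<rho> - (d x)\<^sup>2 * g / \<rho> ^ 3" unfolding \<rho>[symmetric] .
    qed
    show ?thesis
      using a b unfolding has_real_derivative_iff_has_vector_derivative by (rule has_vector_derivative_Pair)
  qed
  show "curvature hm hp (x, hm x) = - g / (sqrt (1 + (deriv hm x)\<^sup>2)) ^ 3"
    if g: "(deriv hm has_real_derivative g) (at x)"
  proof -
    define \<rho> where "\<rho> = sqrt (1 + (deriv hm x)\<^sup>2)"
    have \<rho>0: "\<rho> \<noteq> 0" unfolding \<rho>_def by (simp add: add_nonneg_eq_0_iff)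
    have t: "tangent hm hp (s, hm s) = (1 / sqrt (1 + (deriv hm s)\<^sup>2), deriv hm s / sqrt (1 + (deriv hm s)\<^sup>2))" for s
      by (simp add: tangent_def outer_normal_walls perp_def)
    have vd: "vector_derivative (\<lambda>s. tangent hm hp (s, hm s)) (at x) =
        (- (deriv hm x * g) / \<rho> ^ 3, g / \<rho> - (deriv hm x)\<^sup>2 * g / \<rho> ^ 3)"
      unfolding t by (rule vector_derivative_at[OF key[OF g \<rho>_def]])
    have "fst (tangent hm hp (x, hm x)) = 1 / \<rho>" by (simp add: t \<rho>_def)
    then have "curvature hm hp (x, hm x) = outer_normal hm hp (x, hm x) \<bullet>
         ((1 / \<rho>) *\<^sub>R (- (deriv hm x * g) / \<rho> ^ 3, g / \<rho> - (deriv hm x)\<^sup>2 * g / \<rho> ^ 3))"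
      by (simp only: curvature_def Let_def fst_conv snd_conv if_True refl simp_thms vd)
    also have "\<dots> = - g / \<rho> ^ 3"
      unfolding outer_normal_walls \<rho>_def[symmetric] using \<rho>0
      by (simp add: inner_prod_def field_simps power3_eq_cube power2_eq_square)
    finally show ?thesis by (simp add: \<rho>_def)
  qed
  show "curvature hm hp (x, hp x) = g / (sqrt (1 + (deriv hp x)\<^sup>2)) ^ 3"
    if g: "(deriv hp has_real_derivative g) (at x)"
  proof -
    define \<rho> where "\<rho> = sqrt (1 + (deriv hp x)\<^sup>2)"
    have \<rho>0: "\<rho> \<noteq> 0" unfolding \<rho>_def by (simp add: add_nonneg_eq_0_iff)
    have t: "tangent hm hp (s, hp s) = - (1 / sqrt (1 + (deriv hp s)\<^sup>2), deriv hp s / sqrt (1 + (deriv hp s)\<^sup>2))" for s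
      by (simp add: tangent_def outer_normal_walls perp_def)
    have ne: "hp x \<noteq> hm x" using hm_less_hp[of x] by simp
    have vd: "vector_derivative (\<lambda>s. tangent hm hp (s, hp s)) (at x) =
        - (- (deriv hp x * g) / \<rho> ^ 3, g / \<rho> - (deriv hp x)\<^sup>2 * g / \<rho> ^ 3)"
      unfolding t by (rule vector_derivative_at[OF has_vector_derivative_minus[OF key[OF g \<rho>_def]]])
    have "fst (tangent hm hp (x, hp x)) = - 1 / \<rho>" by (simp add: t \<rho>_def)
    then have "curvature hm hp (x, hp x) = outer_normal hm hp (x, hp x) \<bullet>
         ((- 1 / \<rho>) *\<^sub>R (- (- (deriv hp x * g) / \<rho> ^ 3, g / \<rho> - (deriv hp x)\<^sup>2 * g / \<rho> ^ 3)))"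
      using ne by (simp only: curvature_def Let_def fst_conv snd_conv if_False simp_thms vd)
    also have "\<dots> = g / \<rho> ^ 3"
      unfolding outer_normal_walls \<rho>_def[symmetric] using \<rho>0
      by (simp add: inner_prod_def field_simps power3_eq_cube power2_eq_square)
    finally show ?thesis by (simp add: \<rho>_def)
  qed
qed

end

text \<open>With \<open>\<epsilon> = 1\<close> at the bottom and \<open>\<epsilon> = - 1\<close> at the top, the outward normal is
\<open>\<epsilon> (d, - 1) / \<rho>\<close>.  A velocity tangential to the wall is \<open>w\<^sub>1 (1, d)\<close>, so that the slip condition
determines \<open>u \<cdot> (D u) n\<close>.\<close>

lemma friction_algebra:
  fixes d \<rho> al w1 w2 G11 G12 G21 G22 \<epsilon> :: real
  assumes \<rho>: "0 < \<rho>" "\<rho>\<^sup>2 = 1 + d\<^sup>2" and w: "w2 = d * w1" and \<epsilon>: "\<epsilon> = 1 \<or> \<epsilon> = -1"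
    and slip: "\<epsilon> * (1 / \<rho>) * (G11 * (\<epsilon> * (1 / \<rho>) * d) + (G21 + G12) / 2 * (- \<epsilon> * (1 / \<rho>)) + al * w1) +
      \<epsilon> * (d / \<rho>) * ((G21 + G12) / 2 * (\<epsilon> * (1 / \<rho>) * d) + G22 * (- \<epsilon> * (1 / \<rho>)) + al * w2) = 0"
  shows "(G12 + G21) * w1 + 2 * G22 * w2 - d * (2 * G11 * w1 + (G12 + G21) * w2) = \<epsilon> * (2 * al * w1\<^sup>2 * \<rho> ^ 3)"
proof -
  define E where "E = (G21 + G12) / 2"
  have \<epsilon>2: "\<epsilon> * \<epsilon> = 1" using \<epsilon> by auto
  have "(\<epsilon> * \<epsilon>) * (1 / \<rho>\<^sup>2) * (G11 * d - E + d * (E * d - G22)) + \<epsilon> * (1 / \<rho>) * (al * w1 + d * (al * w2)) = 0"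
  proof -
    define m where "m = 1 / \<rho>"
    have m: "d / \<rho> = d * m" "1 / \<rho>\<^sup>2 = m * m" by (simp_all add: m_def power2_eq_square)
    show ?thesis using slip unfolding E_def[symmetric] m m_def[symmetric] by (simp add: algebra_simps)
  qed
  then have "(1 / \<rho>\<^sup>2) * (G11 * d - E + d * (E * d - G22)) + \<epsilon> * (1 / \<rho>) * (al * w1 * \<rho>\<^sup>2) = 0"
    unfolding \<epsilon>2 \<rho>(2) w by (simp add: power2_eq_square algebra_simps)
  moreover define X where "X = G11 * d - E + d * (E * d - G22)"
  ultimately have "\<rho>\<^sup>2 * ((1 / \<rho>\<^sup>2) * X + \<epsilon> * (1 / \<rho>) * (al * w1 * \<rho>\<^sup>2)) = 0" by simp
  moreover have "\<rho>\<^sup>2 * ((1 / \<rho>\<^sup>2) * X + \<epsilon> * (1 / \<rho>) * (al * w1 * \<rho>\<^sup>2)) = X + \<epsilon> * (al * w1 * \<rho> ^ 3)"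
    using \<rho>(1) by (simp add: power2_eq_square power3_eq_cube field_simps)
  ultimately have "X + \<epsilon> * (al * w1 * \<rho> ^ 3) = 0" by (simp only:)
  then have "G11 * d - E + d * (E * d - G22) = - \<epsilon> * (al * w1 * \<rho> ^ 3)"
    unfolding X_def by (simp add: eq_neg_iff_add_eq_0)
  then have "- 2 * w1 * (G11 * d - E + d * (E * d - G22)) = \<epsilon> * (2 * al * w1\<^sup>2 * \<rho> ^ 3)"
    by (simp add: power2_eq_square)
  moreover have "G12 + G21 = 2 * E" by (simp add: E_def)
  ultimately show ?thesis unfolding w by (simp add: algebra_simps)
qed

locale rb_traces = rb_solution +
  fixes pw :: "real \<Rightarrow> point \<Rightarrow> real" and G :: "real \<Rightarrow> point \<Rightarrow> point \<times> point"
  assumes p_trace: "has_trace \<Gamma> hm hp p pw"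
    and grad_trace: "has_trace \<Gamma> hm hp (\<lambda>t. grad (u t)) G"
    and slip: "AE t in lborel. 0 < t \<longrightarrow> AE_walls \<Gamma> hm hp (\<lambda>x.
           tangent hm hp x \<bullet> (strain (G t x) (outer_normal hm hp x) + \<alpha> x *\<^sub>R u t x) = 0)"
begin

text \<open>This is \<open>2 u \<cdot> (D u) n\<close> times the arc length element, with the negative sign at the bottom.\<close>

definition friction :: "(real \<Rightarrow> real) \<Rightarrow> real \<Rightarrow> real \<Rightarrow> real" where
  "friction h t x =
     (fst (snd (G t (x, h x))) + snd (fst (G t (x, h x)))) * fst (u t (x, h x)) + 2 * snd (snd (G t (x, h x))) * snd (u t (x, h x))
      - deriv h x * (2 * fst (fst (G t (x, h x))) * fst (u t (x, h x)) +
             (fst (snd (G t (x, h x))) + snd (fst (G t (x, h x)))) * snd (u t (x, h x)))"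

lemma friction_walls:
  assumes t: "0 < t" and x: "0 \<le> x" "x \<le> \<Gamma>"
  shows "tangent hm hp (x, hm x) \<bullet> (strain (G t (x, hm x)) (outer_normal hm hp (x, hm x)) + \<alpha> (x, hm x) *\<^sub>R u t (x, hm x)) = 0 \<Longrightarrow>
      friction hm t x = 2 * \<alpha> (x, hm x) * (fst (u t (x, hm x)))\<^sup>2 * (sqrt (1 + (deriv hm x)\<^sup>2)) ^ 3"
    "tangent hm hp (x, hp x) \<bullet> (strain (G t (x, hp x)) (outer_normal hm hp (x, hp x)) + \<alpha> (x, hp x) *\<^sub>R u t (x, hp x)) = 0 \<Longrightarrow>
      friction hp t x = - (2 * \<alpha> (x, hp x) * (fst (u t (x, hp x)))\<^sup>2 * (sqrt (1 + (deriv hp x)\<^sup>2)) ^ 3)"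
proof -
  have \<rho>: "0 < sqrt (1 + d\<^sup>2)" "(sqrt (1 + d\<^sup>2))\<^sup>2 = 1 + d\<^sup>2" for d :: real
    by (auto simp: add_pos_nonneg)
  assume "tangent hm hp (x, hm x) \<bullet> (strain (G t (x, hm x)) (outer_normal hm hp (x, hm x)) + \<alpha> (x, hm x) *\<^sub>R u t (x, hm x)) = 0"
  then have "friction hm t x = 1 * (2 * \<alpha> (x, hm x) * (fst (u t (x, hm x)))\<^sup>2 * (sqrt (1 + (deriv hm x)\<^sup>2)) ^ 3)"
    unfolding friction_def
    by (intro friction_algebra \<rho> wall_values[OF t x])
      (simp_all add: tangent_def perp_def outer_normal_walls strain_def inner_prod_def Let_def)
  then show "friction hm t x = 2 * \<alpha> (x, hm x) * (fst (u t (x, hm x)))\<^sup>2 * (sqrt (1 + (deriv hm x)\<^sup>2)) ^ 3" by simp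
next
  have \<rho>: "0 < sqrt (1 + d\<^sup>2)" "(sqrt (1 + d\<^sup>2))\<^sup>2 = 1 + d\<^sup>2" for d :: real
    by (auto simp: add_pos_nonneg)
  assume "tangent hm hp (x, hp x) \<bullet> (strain (G t (x, hp x)) (outer_normal hm hp (x, hp x)) + \<alpha> (x, hp x) *\<^sub>R u t (x, hp x)) = 0"
  then have "friction hp t x = -1 * (2 * \<alpha> (x, hp x) * (fst (u t (x, hp x)))\<^sup>2 * (sqrt (1 + (deriv hp x)\<^sup>2)) ^ 3)"
    unfolding friction_def
    by (intro friction_algebra \<rho> wall_values[OF t x])
      (simp_all add: tangent_def perp_def outer_normal_walls strain_def inner_prod_def Let_def)
  then show "friction hp t x = - (2 * \<alpha> (x, hp x) * (fst (u t (x, hp x)))\<^sup>2 * (sqrt (1 + (deriv hp x)\<^sup>2)) ^ 3)" by simp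
qed

end

section \<open>The dissipation bound\<close>

context rb_channel
begin

lemma periodic_int:
  fixes h :: "real \<Rightarrow> real"
  assumes "\<And>x. h (x + \<Gamma>) = h x"
  shows "h (x + of_int n * \<Gamma>) = h x"
proof (induction n rule: int_induct[where k = 0])
  case (step1 i)
  have "h (x + of_int (i + 1) * \<Gamma>) = h ((x + of_int i * \<Gamma>) + \<Gamma>)" by (simp add: algebra_simps)
  then show ?case using step1 assms by simp
next
  case (step2 i)
  have "h (x + of_int (i - 1) * \<Gamma>) = h ((x + of_int (i - 1) * \<Gamma>) + \<Gamma>)" by (simp add: assms)
  also have "\<dots> = h (x + of_int i * \<Gamma>)" by (simp add: algebra_simps)
  finally show ?case using step2 by simp
qed simp

lemma uniform_gap: "\<exists>e>0. \<forall>x. hm x + e \<le> hp x - e"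
proof -
  have "continuous_on {0..\<Gamma>} (\<lambda>z. hp z - hm z)" by (intro continuous_intros continuous_walls)
  then obtain z0 where "z0 \<in> {0..\<Gamma>}" and z0: "\<And>z. z \<in> {0..\<Gamma>} \<Longrightarrow> hp z0 - hm z0 \<le> hp z - hm z"
    using continuous_attains_inf[of "{0..\<Gamma>}" "\<lambda>z. hp z - hm z"] \<Gamma>_pos by auto
  define e where "e = (hp z0 - hm z0) / 2"
  have "hm x + e \<le> hp x - e" for x
  proof -
    define n where "n = \<lfloor>x / \<Gamma>\<rfloor>"
    define y where "y = x - of_int n * \<Gamma>"
    have "of_int n \<le> x / \<Gamma>" "x / \<Gamma> \<le> of_int n + 1" by (auto simp: n_def)
    then have "y \<in> {0..\<Gamma>}" using \<Gamma>_pos by (simp add: y_def field_simps)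
    moreover have "hm x = hm y" "hp x = hp y"
      using periodic_int[of hm y n] periodic_int[of hp y n] periodic_walls by (auto simp: y_def)
    ultimately have "2 * e \<le> hp x - hm x" using z0[of y] by (simp add: e_def)
    then show ?thesis by simp
  qed
  moreover have "0 < e" using hm_less_hp[of z0] by (simp add: e_def)
  ultimately show ?thesis by blast
qed

end

context rb_solution
begin

lemma shrunk_area_continuous:
  fixes f :: "real \<Rightarrow> point \<Rightarrow> real"
  assumes f: "continuous_on ({0<..} \<times> cS) (\<lambda>(t, x). f t x)" and a: "0 < a"
    and gap: "\<And>x. hm x + s0 \<le> hp x - s0"
  shows "continuous_on ({0..s0} \<times> {a..b}) (\<lambda>p. area \<Gamma> (\<lambda>x. hm x + fst p) (\<lambda>x. hp x - fst p) (f (snd p)))"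
proof (rule area_continuous_on_param)
  have c: "continuous_on X (\<lambda>z. hm (f z))" "continuous_on X (\<lambda>z. hp (f z))" if "continuous_on X f"
    for X :: "'x::topological_space set" and f
    by (rule continuous_on_compose2[OF continuous_walls(1) that subset_UNIV] continuous_on_compose2[OF continuous_walls(2) that subset_UNIV])+
  show "continuous_on (({0..s0} \<times> {a..b}) \<times> {0..\<Gamma>}) (\<lambda>(p, x). hm x + fst p)"
    "continuous_on (({0..s0} \<times> {a..b}) \<times> {0..\<Gamma>}) (\<lambda>(p, x). hp x - fst p)"
    unfolding split_beta' by (intro continuous_intros c)+
  show "continuous_on (SIGMA p:{0..s0} \<times> {a..b}. region \<Gamma> (\<lambda>x. hm x + fst p) (\<lambda>x. hp x - fst p)) (\<lambda>(p, x). f (snd p) x)"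
    unfolding split_beta'
    by (intro continuous_on_compose_pair[OF f] continuous_intros)
      (use a in \<open>auto simp: region_def closed_strip_def\<close>)
  fix p x assume "p \<in> {0..s0} \<times> {a..b}"
  then show "hm x + fst p \<le> hp x - fst p" using gap[of x] by auto
qed

end

lemma eventually_ball_at_right:
  assumes "\<forall>\<^sub>F s in at_right (0::real). P s"
  shows "\<forall>\<^sub>F s in at_right 0. \<forall>r. 0 < r \<longrightarrow> r \<le> s \<longrightarrow> P r"
proof -
  obtain b where b: "0 < b" "\<And>s. 0 < s \<Longrightarrow> s < b \<Longrightarrow> P s"
    using assms unfolding eventually_at_right_field by auto
  then show ?thesis unfolding eventually_at_right_field by (intro exI[of _ b]) auto
qed

context rb_traces
begin

text \<open>By the formulas for curvature and friction, \<open>|h'' u\<^sub>1\<^sup>2| = |\<kappa>| \<rho>\<^sup>3 u\<^sub>1\<^sup>2\<close> is at most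
\<open>c \<cdot> 2 \<alpha> \<rho>\<^sup>3 u\<^sub>1\<^sup>2\<close>, the work of the friction.\<close>

lemma wall_sign:
  assumes \<kappa>: "AE_walls \<Gamma> hm hp (\<lambda>x. \<bar>curvature hm hp x\<bar> \<le> 2 * c * \<alpha> x)" and c: "0 \<le> c"
    and gm: "AE x in lborel. (deriv hm has_real_derivative gm x) (at x)"
    and gp: "AE x in lborel. (deriv hp has_real_derivative gp x) (at x)"
  shows "AE t in lborel. 0 < t \<longrightarrow> (AE x in lborel. 0 \<le> x \<longrightarrow> x \<le> \<Gamma> \<longrightarrow>
      1 * (gm x * (fst (u t (x, hm x)))\<^sup>2 - c * friction hm t x) \<le> 0)"
    "AE t in lborel. 0 < t \<longrightarrow> (AE x in lborel. 0 \<le> x \<longrightarrow> x \<le> \<Gamma> \<longrightarrow>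
      -1 * (gp x * (fst (u t (x, hp x)))\<^sup>2 - c * friction hp t x) \<le> 0)"
proof -
  have \<kappa>': "AE x in lborel. 0 \<le> x \<longrightarrow> x \<le> \<Gamma> \<longrightarrow> \<bar>curvature hm hp (x, hm x)\<bar> \<le> 2 * c * \<alpha> (x, hm x)"
    "AE x in lborel. 0 \<le> x \<longrightarrow> x \<le> \<Gamma> \<longrightarrow> \<bar>curvature hm hp (x, hp x)\<bar> \<le> 2 * c * \<alpha> (x, hp x)"
    using \<kappa> arc_measure_AE[of hm] arc_measure_AE[of hp] continuous_walls unfolding AE_walls_def by blast+
  have key: "\<bar>g\<bar> * w\<^sup>2 \<le> c * (2 * al * w\<^sup>2 * \<rho> ^ 3)" if "\<bar>g / \<rho> ^ 3\<bar> \<le> 2 * c * al" "0 < \<rho>" for g w al \<rho> :: real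
  proof -
    have "\<bar>g\<bar> \<le> 2 * c * al * \<rho> ^ 3" using that by (simp add: abs_divide pos_divide_le_eq)
    then have "\<bar>g\<bar> * w\<^sup>2 \<le> 2 * c * al * \<rho> ^ 3 * w\<^sup>2" by (intro mult_right_mono) auto
    then show ?thesis by (simp add: mult_ac)
  qed
  have \<rho>: "0 < sqrt (1 + d\<^sup>2)" for d :: real by (simp add: add_pos_nonneg)
  show "AE t in lborel. 0 < t \<longrightarrow> (AE x in lborel. 0 \<le> x \<longrightarrow> x \<le> \<Gamma> \<longrightarrow>
      1 * (gm x * (fst (u t (x, hm x)))\<^sup>2 - c * friction hm t x) \<le> 0)"
    using slip
  proof eventually_elim
    case (elim t)
    show ?case
    proof
      assume t: "0 < t"
      then have "AE x in arc_measure \<Gamma> hm. tangent hm hp x \<bullet> (strain (G t x) (outer_normal hm hp x) + \<alpha> x *\<^sub>R u t x) = 0"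
        using elim by (simp add: AE_walls_def)
      from arc_measure_AE[OF continuous_walls(1) continuous_walls(3) this] \<kappa>'(1) gm
      show "AE x in lborel. 0 \<le> x \<longrightarrow> x \<le> \<Gamma> \<longrightarrow> 1 * (gm x * (fst (u t (x, hm x)))\<^sup>2 - c * friction hm t x) \<le> 0"
      proof eventually_elim
        case (elim x)
        show ?case
        proof (intro impI)
          assume x: "0 \<le> x" "x \<le> \<Gamma>"
          have f: "friction hm t x = 2 * \<alpha> (x, hm x) * (fst (u t (x, hm x)))\<^sup>2 * (sqrt (1 + (deriv hm x)\<^sup>2)) ^ 3"
            using elim(1) x by (intro friction_walls(1) t x) auto
          have "\<bar>gm x\<bar> * (fst (u t (x, hm x)))\<^sup>2 \<le> c * friction hm t x"
            unfolding f using elim(2) x curvature_walls(1)[OF elim(3)] by (intro key \<rho>) simp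
          moreover have "gm x * (fst (u t (x, hm x)))\<^sup>2 \<le> \<bar>gm x\<bar> * (fst (u t (x, hm x)))\<^sup>2"
            by (intro mult_right_mono) auto
          ultimately show "1 * (gm x * (fst (u t (x, hm x)))\<^sup>2 - c * friction hm t x) \<le> 0" by simp
        qed
      qed
    qed
  qed
  show "AE t in lborel. 0 < t \<longrightarrow> (AE x in lborel. 0 \<le> x \<longrightarrow> x \<le> \<Gamma> \<longrightarrow>
      -1 * (gp x * (fst (u t (x, hp x)))\<^sup>2 - c * friction hp t x) \<le> 0)"
    using slip
  proof eventually_elim
    case (elim t)
    show ?case
    proof
      assume t: "0 < t"
      then have "AE x in arc_measure \<Gamma> hp. tangent hm hp x \<bullet> (strain (G t x) (outer_normal hm hp x) + \<alpha> x *\<^sub>R u t x) = 0"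
        using elim by (simp add: AE_walls_def)
      from arc_measure_AE[OF continuous_walls(2) continuous_walls(4) this] \<kappa>'(2) gp
      show "AE x in lborel. 0 \<le> x \<longrightarrow> x \<le> \<Gamma> \<longrightarrow> -1 * (gp x * (fst (u t (x, hp x)))\<^sup>2 - c * friction hp t x) \<le> 0"
      proof eventually_elim
        case (elim x)
        show ?case
        proof (intro impI)
          assume x: "0 \<le> x" "x \<le> \<Gamma>"
          have f: "friction hp t x = - (2 * \<alpha> (x, hp x) * (fst (u t (x, hp x)))\<^sup>2 * (sqrt (1 + (deriv hp x)\<^sup>2)) ^ 3)"
            using elim(1) x by (intro friction_walls(2) t x) auto
          have "\<bar>gp x\<bar> * (fst (u t (x, hp x)))\<^sup>2 \<le> - (c * friction hp t x)"
            unfolding f using key[OF _ \<rho>, of "gp x" "deriv hp x" "\<alpha> (x, hp x)" "fst (u t (x, hp x))"]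
              elim(2) x curvature_walls(2)[OF elim(3)] by simp
          moreover have "- gp x * (fst (u t (x, hp x)))\<^sup>2 \<le> \<bar>gp x\<bar> * (fst (u t (x, hp x)))\<^sup>2"
            by (intro mult_right_mono) auto
          ultimately show "-1 * (gp x * (fst (u t (x, hp x)))\<^sup>2 - c * friction hp t x) \<le> 0" by simp
        qed
      qed
    qed
  qed
qed

text \<open>In the limit of vanishing distance to the walls the boundary terms of the energy balance drop out
because of their sign.\<close>

lemma dissipation_le:
  assumes ab: "0 < a" "a \<le> b" and c: "1 \<le> c" and e: "0 < e"
    and \<kappa>: "AE_walls \<Gamma> hm hp (\<lambda>x. \<bar>curvature hm hp x\<bar> \<le> 2 * c * \<alpha> x)"
  shows "\<forall>\<^sub>F s in at_right 0. integral {a..b} (\<lambda>t. area \<Gamma> (\<lambda>x. hm x + s) (\<lambda>x. hp x - s) (grad_sq t)) \<le>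
    c * Ra * integral {a..b} (\<lambda>t. area \<Gamma> hm hp (\<lambda>x. \<theta> t x * snd (u t x))) + area \<Gamma> hm hp (kinetic c a) + e"
proof -
  obtain s0 where s0: "0 < s0" "\<And>x. hm x + s0 \<le> hp x - s0" using uniform_gap by blast
  obtain Km where Km: "Km-lipschitz_on UNIV (deriv hm)" using deriv_walls_lipschitz by blast
  obtain Kp where Kp: "Kp-lipschitz_on UNIV (deriv hp)" using deriv_walls_lipschitz by blast
  obtain gm where gm: "gm \<in> borel_measurable borel" "\<And>x. \<bar>gm x\<bar> \<le> Km" "AE x in lborel. (deriv hm has_real_derivative gm x) (at x)"
    using lipschitz_obtains_derivative[OF Km] by blast
  obtain gp where gp: "gp \<in> borel_measurable borel" "\<And>x. \<bar>gp x\<bar> \<le> Kp" "AE x in lborel. (deriv hp has_real_derivative gp x) (at x)"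
    using lipschitz_obtains_derivative[OF Kp] by blast
  have c0: "0 \<le> c" using c by simp
  note sign = wall_sign[OF \<kappa> c0 gm(3) gp(3)]
  have levm: "(x, hm x + 1 * s) \<in> S" and levp: "(x, hp x + - 1 * s) \<in> S" if "0 < s" "s \<le> s0" for s x
    using s0(1) s0(2)[of x] that by (auto simp: strip_def)
  have on: "(x, hm x) \<in> cS" "(x, hp x) \<in> cS" for x by (auto simp: closed_strip_def hm_le_hp)
  have pos: "0 < b" using ab by simp
  have tb: "((\<lambda>s. \<integral>\<^sup>+t\<in>{a..b}. (\<integral>\<^sup>+x. ennreal ((norm (f t (x + (0, 1 * s)) - g t x))\<^sup>2) \<partial>arc_measure \<Gamma> hm) \<partial>lborel) \<longlongrightarrow> 0) (at_right 0)"
    and tt: "((\<lambda>s. \<integral>\<^sup>+t\<in>{a..b}. (\<integral>\<^sup>+x. ennreal ((norm (f t (x + (0, - 1 * s)) - g t x))\<^sup>2) \<partial>arc_measure \<Gamma> hp) \<partial>lborel) \<longlongrightarrow> 0) (at_right 0)"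
    if tr: "has_trace \<Gamma> hm hp f g" and "a < b" for f g :: "real \<Rightarrow> point \<Rightarrow> 'z::euclidean_space"
  proof -
    have eq: "x + (0, - 1 * s) = x - (0, s)" for x :: point and s by (simp add: prod_eq_iff)
    show "((\<lambda>s. \<integral>\<^sup>+t\<in>{a..b}. (\<integral>\<^sup>+x. ennreal ((norm (f t (x + (0, 1 * s)) - g t x))\<^sup>2) \<partial>arc_measure \<Gamma> hm) \<partial>lborel) \<longlongrightarrow> 0) (at_right 0)"
      using tr ab(1) \<open>a < b\<close> unfolding has_trace_def mult_1 by blast
    show "((\<lambda>s. \<integral>\<^sup>+t\<in>{a..b}. (\<integral>\<^sup>+x. ennreal ((norm (f t (x + (0, - 1 * s)) - g t x))\<^sup>2) \<partial>arc_measure \<Gamma> hp) \<partial>lborel) \<longlongrightarrow> 0) (at_right 0)"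
      using tr ab(1) \<open>a < b\<close> unfolding has_trace_def eq by blast
  qed
  let ?Fm = "\<lambda>s. flux a b \<Gamma> (\<lambda>x. hm x + s) (deriv hm) (energy_flux1 c) (energy_flux2 c)"
  let ?Fp = "\<lambda>s. flux a b \<Gamma> (\<lambda>x. hp x - s) (deriv hp) (energy_flux1 c) (energy_flux2 c)"
  have small_fluxes: "\<forall>\<^sub>F s in at_right 0. ?Fm s < e / 4" "\<forall>\<^sub>F s in at_right 0. - ?Fp s < e / 4"
  proof -
    have "(\<exists>Z\<le>0. ((\<lambda>s. 1 * flux a b \<Gamma> (\<lambda>x. hm x + 1 * s) (deriv hm) (energy_flux1 c) (energy_flux2 c)) \<longlongrightarrow> Z) (at_right 0)) \<and>
      (\<exists>Z\<le>0. ((\<lambda>s. - 1 * flux a b \<Gamma> (\<lambda>x. hp x + - 1 * s) (deriv hp) (energy_flux1 c) (energy_flux2 c)) \<longlongrightarrow> Z) (at_right 0))"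
    proof (cases "a < b")
      case True
      have "\<exists>Z\<le>0. ((\<lambda>s. 1 * flux a b \<Gamma> (\<lambda>x. hm x + 1 * s) (deriv hm) (energy_flux1 c) (energy_flux2 c)) \<longlongrightarrow> Z) (at_right 0)"
      proof (rule wall_flux_limit[OF ab s0(1) DERIV_walls(1) Km periodic_walls(1) deriv_walls_periodic(1) levm on(1) wall_values(3)])
        show "(\<lambda>(t, x). pw t x) \<in> borel_measurable borel" "(\<lambda>(t, x). G t x) \<in> borel_measurable borel"
          using p_trace grad_trace by (auto simp: has_trace_def)
        show "AE t in lborel. a \<le> t \<longrightarrow> t \<le> b \<longrightarrow> (AE x in lborel. 0 \<le> x \<longrightarrow> x \<le> \<Gamma> \<longrightarrow>
          1 * (gm x * (fst (u t (x, hm x)))\<^sup>2 - c * (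
         (fst (snd (G t (x, hm x))) + snd (fst (G t (x, hm x)))) * fst (u t (x, hm x)) + 2 * snd (snd (G t (x, hm x))) * snd (u t (x, hm x))
         - deriv hm x * (2 * fst (fst (G t (x, hm x))) * fst (u t (x, hm x)) +
             (fst (snd (G t (x, hm x))) + snd (fst (G t (x, hm x)))) * snd (u t (x, hm x))))) \<le> 0)"
          using sign(1) unfolding friction_def by eventually_elim (use ab in auto)
      qed (use tb[OF p_trace True] tb[OF grad_trace True] gm in auto)
      moreover have "\<exists>Z\<le>0. ((\<lambda>s. - 1 * flux a b \<Gamma> (\<lambda>x. hp x + - 1 * s) (deriv hp) (energy_flux1 c) (energy_flux2 c)) \<longlongrightarrow> Z) (at_right 0)"
      proof (rule wall_flux_limit[OF ab s0(1) DERIV_walls(2) Kp periodic_walls(2) deriv_walls_periodic(2) levp on(2) wall_values(4)])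
        show "(\<lambda>(t, x). pw t x) \<in> borel_measurable borel" "(\<lambda>(t, x). G t x) \<in> borel_measurable borel"
          using p_trace grad_trace by (auto simp: has_trace_def)
        show "AE t in lborel. a \<le> t \<longrightarrow> t \<le> b \<longrightarrow> (AE x in lborel. 0 \<le> x \<longrightarrow> x \<le> \<Gamma> \<longrightarrow>
          - 1 * (gp x * (fst (u t (x, hp x)))\<^sup>2 - c * (
         (fst (snd (G t (x, hp x))) + snd (fst (G t (x, hp x)))) * fst (u t (x, hp x)) + 2 * snd (snd (G t (x, hp x))) * snd (u t (x, hp x))
         - deriv hp x * (2 * fst (fst (G t (x, hp x))) * fst (u t (x, hp x)) +
             (fst (snd (G t (x, hp x))) + snd (fst (G t (x, hp x)))) * snd (u t (x, hp x))))) \<le> 0)"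
          using sign(2) unfolding friction_def by eventually_elim (use ab in auto)
      qed (use tt[OF p_trace True] tt[OF grad_trace True] gp in auto)
      ultimately show ?thesis by blast
    next
      case False
      then have "a = b" using ab by simp
      then have "flux a b \<Gamma> h h' V1 V2 = 0" for h h' V1 V2
        by (simp add: flux_def content_Pair integral_null)
      then show ?thesis by (auto intro!: exI[of _ 0])
    qed
    then obtain Z1 Z2 where Z: "Z1 \<le> 0" "(?Fm \<longlongrightarrow> Z1) (at_right 0)" "Z2 \<le> 0" "((\<lambda>s. - ?Fp s) \<longlongrightarrow> Z2) (at_right 0)"
      by auto
    show "\<forall>\<^sub>F s in at_right 0. ?Fm s < e / 4" using Z(1) e by (intro order_tendstoD(2)[OF Z(2)]) auto
    show "\<forall>\<^sub>F s in at_right 0. - ?Fp s < e / 4" using Z(3) e by (intro order_tendstoD(2)[OF Z(4)]) auto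
  qed
  have fc: "continuous_on ({0<..} \<times> cS) (\<lambda>(t, x). \<theta> t x * snd (u t x))"
    using u_continuous \<theta>_continuous unfolding split_beta' by (intro continuous_intros)
  let ?W = "\<lambda>s. c * Ra * integral {a..b} (\<lambda>t. area \<Gamma> (\<lambda>x. hm x + s) (\<lambda>x. hp x - s) (\<lambda>x. \<theta> t x * snd (u t x)))"
  let ?E = "\<lambda>s. area \<Gamma> (\<lambda>x. hm x + s) (\<lambda>x. hp x - s) (kinetic c a)"
  have "continuous_on {0..s0} (\<lambda>s. integral {a..b} (\<lambda>t. area \<Gamma> (\<lambda>x. hm x + s) (\<lambda>x. hp x - s) (\<lambda>x. \<theta> t x * snd (u t x))))"
    using shrunk_area_continuous[OF fc ab(1) s0(2)]
    by (intro integral_continuous_on_param[of "{0..s0}" a b, simplified]) (simp add: split_beta')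
  then have Wc: "continuous_on {0..s0} ?W" by (intro continuous_intros)
  have Ec: "continuous_on {0..s0} ?E"
    using continuous_on_compose2[OF shrunk_area_continuous[OF kinetic_continuous ab(1) s0(2), of b], of "{0..s0}" "\<lambda>s. (s, a)"] ab
    by (simp add: image_subset_iff continuous_on_Pair)
  have lim0: "(f \<longlongrightarrow> f 0) (at_right 0)" if "continuous_on {0..s0} f" for f :: "real \<Rightarrow> real"
  proof -
    have "(f \<longlongrightarrow> f 0) (at 0 within {0..s0})" using that s0(1) by (auto simp: continuous_on_def)
    then show ?thesis using s0(1) by (simp add: at_within_Icc_at_right)
  qed
  have "\<forall>\<^sub>F s in at_right 0. ?W s < ?W 0 + e / 4" "\<forall>\<^sub>F s in at_right 0. ?E s < ?E 0 + e / 4"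
    using order_tendstoD(2)[OF lim0[OF Wc]] order_tendstoD(2)[OF lim0[OF Ec]] e by auto
  moreover have "\<forall>\<^sub>F s in at_right 0. 0 < s \<and> s \<le> s0"
    using s0 unfolding eventually_at_right_field by (intro exI[of _ s0]) auto
  ultimately show ?thesis using small_fluxes
  proof eventually_elim
    case (elim s)
    have gap: "hm x + s \<le> hp x - s" for x using s0(2)[of x] elim(3) by auto
    have "integral {a..b} (\<lambda>t. area \<Gamma> (\<lambda>x. hm x + s) (\<lambda>x. hp x - s) (grad_sq t)) \<le> ?W s + ?E s + ?Fm s - ?Fp s"
      using dissipation_level_le[OF ab c _ gap] elim(3) by auto
    moreover have "?W 0 = c * Ra * integral {a..b} (\<lambda>t. area \<Gamma> hm hp (\<lambda>x. \<theta> t x * snd (u t x)))" "?E 0 = area \<Gamma> hm hp (kinetic c a)"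
      by simp_all
    ultimately show ?case using elim by argo
  qed
qed

end

section \<open>The velocity in the boundary layer\<close>

context rb_traces
begin

text \<open>The component \<open>v = u\<^sub>2 - h' u\<^sub>1\<close> vanishes on the wall, so \<open>|v|\<close> is bounded by the integral of
\<open>|\<partial>\<^sub>2 v|\<close> along vertical segments, and \<open>|\<partial>\<^sub>2 v| \<le> \<eta> |\<nabla> u|\<^sup>2 + (1 + L\<^sup>2) / (4 \<eta>)\<close>.  Since the
gradient is not controlled on the wall itself, the integration starts at distance \<open>s\<close>, where
\<open>|v| \<le> \<epsilon>\<close> by uniform continuity.\<close>

lemma boundary_layer_velocity:
  assumes ab: "0 < a" "a \<le> b" and \<delta>: "0 < \<delta>" and g0: "0 < g0"
    and gap: "\<And>x. 0 \<le> x \<Longrightarrow> x \<le> \<Gamma> \<Longrightarrow> hm x + \<delta> \<le> hp x - g0"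
    and \<eta>: "0 < \<eta>" and \<epsilon>: "0 < \<epsilon>"
  shows "\<forall>\<^sub>F s in at_right 0.
    (1 / \<delta>) * integral {a..b} (\<lambda>t. area \<Gamma> hm (\<lambda>x. hm x + \<delta>) (\<lambda>x. \<bar>snd (u t x) - deriv hm (fst x) * fst (u t x)\<bar>))
    \<le> \<Gamma> * (\<epsilon> + (1 + L\<^sup>2) * \<delta> / (4 * \<eta>)) * (b - a) +
      \<eta> * integral {a..b} (\<lambda>t. area \<Gamma> (\<lambda>x. hm x + s) (\<lambda>x. hp x - s) (grad_sq t))"
proof -
  let ?B = "cbox (a, 0) (b, \<Gamma>) :: (real \<times> real) set"
  define v where "v t x = snd (u t x) - deriv hm (fst x) * fst (u t x)" for t and x :: point
  define k2 where "k2 = 1 + L\<^sup>2"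
  have k2: "0 < k2" by (simp add: k2_def add_pos_nonneg)
  have dc: "continuous_on X (\<lambda>z. deriv hm (f z))" if "continuous_on X f" for X :: "'x::topological_space set" and f
    by (rule continuous_on_compose2[OF continuous_walls(3) that subset_UNIV])
  have hc: "continuous_on X (\<lambda>z. hm (f z))" if "continuous_on X f" for X :: "'x::topological_space set" and f
    by (rule continuous_on_compose2[OF continuous_walls(1) that subset_UNIV])
  have vc: "continuous_on ({0<..} \<times> cS) (\<lambda>(t, x). v t x)"
    unfolding v_def split_beta' using u_continuous unfolding split_beta' by (intro continuous_intros dc)
  have absv: "continuous_on ({0<..} \<times> cS) (\<lambda>(t, x). \<bar>v t x\<bar>)"
    using vc unfolding split_beta' by (intro continuous_intros)
  define \<Phi> where "\<Phi> s w = v (fst w) (snd w, hm (snd w) + s)" for s and w :: "real \<times> real"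
  have "continuous_on ({0..\<delta>} \<times> ?B) (\<lambda>(s, w). \<Phi> s w)"
    unfolding \<Phi>_def split_beta'
    by (intro continuous_on_compose_pair[OF vc] continuous_intros hc)
      (use ab gap g0 in \<open>force simp: cbox_Pair_eq closed_strip_def\<close>)+
  from uniform_in_parameter[OF \<delta> compact_cbox this \<epsilon>]
  have "\<forall>\<^sub>F s in at_right 0. \<forall>r. 0 < r \<longrightarrow> r \<le> s \<longrightarrow> (\<forall>w\<in>?B. \<bar>\<Phi> r w - \<Phi> 0 w\<bar> < \<epsilon>)"
    by (rule eventually_ball_at_right)
  moreover have "\<forall>\<^sub>F s in at_right 0. 0 < s \<and> s < \<delta> \<and> s \<le> g0"
    unfolding eventually_at_right_field using \<delta> g0 by (intro exI[of _ "min \<delta> g0"]) auto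
  ultimately show ?thesis
  proof eventually_elim
    case (elim s)
    then have s: "0 < s" "s < \<delta>" "s \<le> g0" by auto
    let ?l = "\<lambda>x. hm x + s" and ?r = "\<lambda>x. hp x - s"
    have in3: "hm x \<le> hm x \<and> hm x \<le> hm x + \<delta> \<and> hm x + \<delta> \<le> hp x" if "0 \<le> x" "x \<le> \<Gamma>" for x
      using gap[OF that] g0 \<delta> by simp
    have lr: "continuous_on X ?l" "continuous_on X ?r" "continuous_on X (\<lambda>x. hm x + \<delta>)" for X
      by (intro continuous_intros continuous_walls)+
    have lle: "?l x \<le> ?r x" if "0 \<le> x" "x \<le> \<Gamma>" for x using gap[OF that] s by simp
    have RS: "region \<Gamma> ?l ?r \<subseteq> S" using s by (force simp: region_def strip_def)
    have gsc: "continuous_on (region \<Gamma> ?l ?r) (grad_sq t)" if "0 < t" for t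
      by (rule continuous_on_compose_pair[OF grad_sq_continuous, of _ "\<lambda>_. t" "\<lambda>x. x"])
        (use that RS in \<open>auto intro!: continuous_intros\<close>)
    have gs0: "0 \<le> grad_sq t x" for t x by (simp add: grad_sq_def)
    define I where "I t x = integral {?l x..?r x} (\<lambda>y. grad_sq t (x, y))" for t x
    have Ic: "continuous_on {0..\<Gamma>} (I t)" if "0 < t" for t
      unfolding I_def by (rule iterated_integral_continuous[OF gsc[OF that] lr(1,2) lle])
    have I_area: "integral {0..\<Gamma>} (I t) = area \<Gamma> ?l ?r (grad_sq t)" if "0 < t" for t
      unfolding I_def by (rule area_eq_iterated[symmetric, OF gsc[OF that] lr(1,2) lle])
    have pw: "\<bar>v t (x, y)\<bar> \<le> \<epsilon> + k2 * \<delta> / (4 * \<eta>) + \<eta> * I t x"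
      if t: "t \<in> {a..b}" and x: "0 \<le> x" "x \<le> \<Gamma>" and y: "hm x \<le> y" "y \<le> hm x + \<delta>" for t x y
    proof -
      have t0: "0 < t" using t ab by auto
      have w: "(t, x) \<in> ?B" using t x by (auto simp: cbox_Pair_eq)
      have v0: "\<Phi> 0 (t, x) = 0" using wall_values(3)[OF t0 x] by (simp add: \<Phi>_def v_def)
      have gint: "(\<lambda>y. grad_sq t (x, y)) integrable_on {c..d}" if "?l x \<le> c" "d \<le> ?r x" for c d
        using that x by (intro integrable_continuous_real continuous_on_compose2[OF gsc[OF t0]] continuous_intros)
          (auto simp: region_def)
      have I0: "0 \<le> I t x" unfolding I_def by (intro integral_nonneg gint gs0) auto
      have near: "\<bar>v t (x, hm x + r)\<bar> \<le> \<epsilon>" if "0 \<le> r" "r \<le> s" for r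
      proof (cases "r = 0")
        case True then show ?thesis using v0 \<epsilon> by (simp add: \<Phi>_def)
      next
        case False
        then have "\<bar>\<Phi> r (t, x) - \<Phi> 0 (t, x)\<bar> < \<epsilon>" using elim(1) that w by auto
        then show ?thesis unfolding v0 by (simp add: \<Phi>_def)
      qed
      show ?thesis
      proof (cases "y \<le> hm x + s")
        case True
        have "\<bar>v t (x, y)\<bar> \<le> \<epsilon>" using near[of "y - hm x"] True y by simp
        moreover have "0 \<le> k2 * \<delta> / (4 * \<eta>)" "0 \<le> \<eta> * I t x" using k2 \<delta> \<eta> I0 by auto
        ultimately show ?thesis by linarith
      next
        case False
        define dv where "dv y = snd (dx2 (u t) (x, y)) - deriv hm x * fst (dx2 (u t) (x, y))" for y
        have sub: "{?l x..y} \<subseteq> {?l x..?r x}" using y gap[OF x] s by auto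
        have inS: "(x, z) \<in> S" if "z \<in> {?l x..y}" for z
          using that sub RS x by (force simp: region_def)
        have "((\<lambda>y. v t (x, y)) has_real_derivative dv z) (at z within {?l x..y})" if "z \<in> {?l x..y}" for z
        proof -
          note d = plane_deriv_vertical[where g = "\<lambda>z. z" and x = x and T = "{?l x..y}" and f = "\<lambda>x. fst (u t x)", OF u_components(1)[OF t0 inS[OF that]]]
            plane_deriv_vertical[where g = "\<lambda>z. z" and x = x and T = "{?l x..y}" and f = "\<lambda>x. snd (u t x)", OF u_components(2)[OF t0 inS[OF that]]]
          have "((\<lambda>y. snd (u t (x, y)) - deriv hm x * fst (u t (x, y))) has_real_derivative
             snd (dx2 (u t) (x, z)) * 1 - deriv hm x * (fst (dx2 (u t) (x, z)) * 1)) (at z within {?l x..y})"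
            by (intro DERIV_diff DERIV_cmult d DERIV_ident)
          then show ?thesis by (simp add: v_def dv_def)
        qed
        then have ftc: "(dv has_integral (v t (x, y) - v t (x, ?l x))) {?l x..y}"
          using False by (intro fundamental_theorem_of_calculus) (auto simp: has_real_derivative_iff_has_vector_derivative)
        have dvb: "norm (dv z) \<le> \<eta> * grad_sq t (x, z) + k2 / (4 * \<eta>)" for z
        proof -
          let ?A = "fst (dx2 (u t) (x, z))" and ?B = "snd (dx2 (u t) (x, z))" and ?d = "deriv hm x"
          have "(dv z)\<^sup>2 + (?A + ?d * ?B)\<^sup>2 = (1 + ?d\<^sup>2) * (?A\<^sup>2 + ?B\<^sup>2)"
            unfolding dv_def by (simp add: power2_eq_square algebra_simps)
          then have "(dv z)\<^sup>2 \<le> (1 + ?d\<^sup>2) * (?A\<^sup>2 + ?B\<^sup>2)"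
            using zero_le_power2[of "?A + ?d * ?B"] by linarith
          also have "\<dots> \<le> k2 * grad_sq t (x, z)"
            using power_mono[OF deriv_walls_bound(1)[of x], of 2]
            by (intro mult_mono) (auto simp: k2_def grad_sq_def)
          finally have sq: "(dv z)\<^sup>2 \<le> k2 * grad_sq t (x, z)" .
          have "0 \<le> (2 * \<eta> * \<bar>dv z\<bar> - k2)\<^sup>2" by simp
          then have "4 * \<eta> * k2 * \<bar>dv z\<bar> \<le> 4 * \<eta>\<^sup>2 * (dv z)\<^sup>2 + k2 * k2"
            by (simp add: power2_eq_square algebra_simps)
          also have "\<dots> \<le> 4 * \<eta>\<^sup>2 * (k2 * grad_sq t (x, z)) + k2 * k2"
            using sq by (intro add_right_mono mult_left_mono) auto
          also have "\<dots> = 4 * \<eta> * k2 * (\<eta> * grad_sq t (x, z) + k2 / (4 * \<eta>))"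
            using \<eta> by (simp add: power2_eq_square field_simps)
          finally show ?thesis using \<eta> k2 by simp
        qed
        have "norm (v t (x, y) - v t (x, ?l x)) \<le> integral {?l x..y} (\<lambda>z. \<eta> * grad_sq t (x, z) + k2 / (4 * \<eta>))"
        proof -
          have "dv integrable_on {?l x..y}" using ftc by blast
          moreover have "(\<lambda>z. \<eta> * grad_sq t (x, z) + k2 / (4 * \<eta>)) integrable_on {?l x..y}"
            using sub False by (intro integrable_add integrable_on_mult_right gint integrable_const_ivl) auto
          ultimately have "norm (integral {?l x..y} dv) \<le> integral {?l x..y} (\<lambda>z. \<eta> * grad_sq t (x, z) + k2 / (4 * \<eta>))"
            by (rule integral_norm_bound_integral) (rule dvb)
          then show ?thesis using integral_unique[OF ftc] by simp
        qed
        also have "\<dots> = \<eta> * integral {?l x..y} (\<lambda>z. grad_sq t (x, z)) + k2 / (4 * \<eta>) * (y - ?l x)"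
        proof -
          have "((\<lambda>z. k2 / (4 * \<eta>)) has_integral (k2 / (4 * \<eta>) * (y - ?l x))) {?l x..y}"
            using has_integral_const_real[of "k2 / (4 * \<eta>)" "?l x" y] False by (simp add: mult.commute)
          moreover have "((\<lambda>z. grad_sq t (x, z)) has_integral integral {?l x..y} (\<lambda>z. grad_sq t (x, z))) {?l x..y}"
            using sub False by (intro integrable_integral gint) auto
          ultimately show ?thesis
            by (intro integral_unique has_integral_add has_integral_mult_right)
        qed
        also have "\<dots> \<le> \<eta> * I t x + k2 / (4 * \<eta>) * \<delta>"
        proof (intro add_mono mult_left_mono)
          show "integral {?l x..y} (\<lambda>z. grad_sq t (x, z)) \<le> I t x"
            unfolding I_def using sub False gs0 by (intro integral_subset_le gint) auto
        qed (use \<eta> k2 y s in auto)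
        finally have 1: "\<bar>v t (x, y) - v t (x, ?l x)\<bar> \<le> \<eta> * I t x + k2 / (4 * \<eta>) * \<delta>" by simp
        have 2: "\<bar>v t (x, ?l x)\<bar> \<le> \<epsilon>" using near[of s] s by simp
        have 3: "k2 / (4 * \<eta>) * \<delta> = k2 * \<delta> / (4 * \<eta>)" by simp
        show ?thesis using 1 2 unfolding 3 by linarith
      qed
    qed
    have area_le: "area \<Gamma> hm (\<lambda>x. hm x + \<delta>) (\<lambda>x. \<bar>v t x\<bar>) \<le>
       \<delta> * (\<Gamma> * (\<epsilon> + k2 * \<delta> / (4 * \<eta>)) + \<eta> * area \<Gamma> ?l ?r (grad_sq t))" if t: "t \<in> {a..b}" for t
    proof -
      have t0: "0 < t" using t ab by auto
      have c: "continuous_on (region \<Gamma> hm (\<lambda>x. hm x + \<delta>)) (\<lambda>x. \<bar>v t x\<bar>)"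
        by (rule region_slice_continuous[OF absv t0]) (use in3 in auto)
      have "area \<Gamma> hm (\<lambda>x. hm x + \<delta>) (\<lambda>x. \<bar>v t x\<bar>) = integral {0..\<Gamma>} (\<lambda>x. integral {hm x..hm x + \<delta>} (\<lambda>y. \<bar>v t (x, y)\<bar>))"
        using \<delta> by (intro area_eq_iterated c continuous_walls lr) auto
      also have "\<dots> \<le> integral {0..\<Gamma>} (\<lambda>x. \<delta> * (\<epsilon> + k2 * \<delta> / (4 * \<eta>)) + \<delta> * \<eta> * I t x)"
      proof (rule integral_le)
        show "(\<lambda>x. integral {hm x..hm x + \<delta>} (\<lambda>y. \<bar>v t (x, y)\<bar>)) integrable_on {0..\<Gamma>}"
          using \<delta> by (intro integrable_continuous_real iterated_integral_continuous c continuous_walls lr) auto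
        show "(\<lambda>x. \<delta> * (\<epsilon> + k2 * \<delta> / (4 * \<eta>)) + \<delta> * \<eta> * I t x) integrable_on {0..\<Gamma>}"
          by (intro integrable_continuous_real continuous_on_add continuous_on_mult continuous_on_const Ic[OF t0])
        fix x assume x: "x \<in> {0..\<Gamma>}"
        have "integral {hm x..hm x + \<delta>} (\<lambda>y. \<bar>v t (x, y)\<bar>) \<le>
            integral {hm x..hm x + \<delta>} (\<lambda>y. \<epsilon> + k2 * \<delta> / (4 * \<eta>) + \<eta> * I t x)"
        proof (rule integral_le)
          show "(\<lambda>y. \<bar>v t (x, y)\<bar>) integrable_on {hm x..hm x + \<delta>}"
            using x by (intro integrable_continuous_real continuous_on_compose2[OF c] continuous_intros) (auto simp: region_def)
        qed (use pw[OF t] x in auto)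
        also have "\<dots> = \<delta> * (\<epsilon> + k2 * \<delta> / (4 * \<eta>) + \<eta> * I t x)" using \<delta> by simp
        finally show "integral {hm x..hm x + \<delta>} (\<lambda>y. \<bar>v t (x, y)\<bar>) \<le> \<delta> * (\<epsilon> + k2 * \<delta> / (4 * \<eta>)) + \<delta> * \<eta> * I t x"
          by (simp add: algebra_simps)
      qed
      also have "\<dots> = \<delta> * (\<epsilon> + k2 * \<delta> / (4 * \<eta>)) * \<Gamma> + \<delta> * \<eta> * area \<Gamma> ?l ?r (grad_sq t)"
      proof (rule integral_unique, intro has_integral_add has_integral_mult_right)
        show "((\<lambda>x. \<delta> * (\<epsilon> + k2 * \<delta> / (4 * \<eta>))) has_integral \<delta> * (\<epsilon> + k2 * \<delta> / (4 * \<eta>)) * \<Gamma>) {0..\<Gamma>}"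
          using has_integral_const_real[of "\<delta> * (\<epsilon> + k2 * \<delta> / (4 * \<eta>))" 0 \<Gamma>] \<Gamma>_pos by (simp add: mult.commute)
        show "(I t has_integral area \<Gamma> ?l ?r (grad_sq t)) {0..\<Gamma>}"
          unfolding I_area[OF t0, symmetric] by (intro integrable_integral integrable_continuous_real Ic t0)
      qed
      finally show ?thesis by (simp add: algebra_simps)
    qed
    let ?A = "\<lambda>t. area \<Gamma> ?l ?r (grad_sq t)"
    have Ai: "?A integrable_on {a..b}"
    proof (rule integrable_continuous_real[OF area_continuous_on_param])
      show "continuous_on ({a..b} \<times> {0..\<Gamma>}) (\<lambda>(p, x). ?l x)" "continuous_on ({a..b} \<times> {0..\<Gamma>}) (\<lambda>(p, x). ?r x)"
        unfolding split_beta'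
        by (intro continuous_on_compose2[OF lr(1)[of UNIV]] continuous_on_compose2[OF lr(2)[of UNIV]] continuous_intros subset_UNIV)+
      show "continuous_on ({a..b} \<times> region \<Gamma> ?l ?r) (\<lambda>(t, x). grad_sq t x)"
        using interior_continuous_pair[OF ab(1) RS grad_sq_continuous] unfolding split_beta' .
    qed (use lle in auto)
    have Vi: "(\<lambda>t. area \<Gamma> hm (\<lambda>x. hm x + \<delta>) (\<lambda>x. \<bar>v t x\<bar>)) integrable_on {a..b}"
      by (intro integrable_continuous_real time_area_continuous[OF absv ab(1)] in3 continuous_walls lr)
    define c0 where "c0 = \<delta> * (\<Gamma> * (\<epsilon> + k2 * \<delta> / (4 * \<eta>)))"
    have hi: "((\<lambda>t. c0 + \<delta> * \<eta> * ?A t) has_integral (c0 * (b - a) + \<delta> * \<eta> * integral {a..b} ?A)) {a..b}"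
    proof (intro has_integral_add has_integral_mult_right integrable_integral Ai)
      show "((\<lambda>t. c0) has_integral c0 * (b - a)) {a..b}"
        using has_integral_const_real[of c0 a b] ab by (simp add: mult.commute)
    qed
    have "integral {a..b} (\<lambda>t. area \<Gamma> hm (\<lambda>x. hm x + \<delta>) (\<lambda>x. \<bar>v t x\<bar>)) \<le> integral {a..b} (\<lambda>t. c0 + \<delta> * \<eta> * ?A t)"
    proof (rule integral_le[OF Vi])
      show "(\<lambda>t. c0 + \<delta> * \<eta> * ?A t) integrable_on {a..b}" using hi by blast
      show "area \<Gamma> hm (\<lambda>x. hm x + \<delta>) (\<lambda>x. \<bar>v t x\<bar>) \<le> c0 + \<delta> * \<eta> * ?A t" if "t \<in> {a..b}" for t
        using area_le[OF that] by (simp add: c0_def distrib_left mult.assoc)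
    qed
    also have "integral {a..b} (\<lambda>t. c0 + \<delta> * \<eta> * ?A t) = c0 * (b - a) + \<delta> * \<eta> * integral {a..b} ?A"
      using hi by (rule integral_unique)
    finally have "(1 / \<delta>) * integral {a..b} (\<lambda>t. area \<Gamma> hm (\<lambda>x. hm x + \<delta>) (\<lambda>x. \<bar>v t x\<bar>)) \<le>
       (1 / \<delta>) * (c0 * (b - a) + \<delta> * \<eta> * integral {a..b} ?A)"
      using \<delta> by (intro mult_left_mono) auto
    also have "\<dots> = \<Gamma> * (\<epsilon> + k2 * \<delta> / (4 * \<eta>)) * (b - a) + \<eta> * integral {a..b} ?A"
    proof -
      have "(1 / \<delta>) * (\<delta> * m * (b - a) + \<delta> * \<eta> * i) = m * (b - a) + \<eta> * i" for m i
        using \<delta> by (simp add: field_simps)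
      from this[of "\<Gamma> * (\<epsilon> + k2 * \<delta> / (4 * \<eta>))"] show ?thesis by (simp only: c0_def)
    qed
    finally show ?case unfolding v_def k2_def .
  qed
qed

text \<open>The boundary layer estimate bounds the incoming heat by the velocity in the layer, hence by the
dissipation, hence by the work of the buoyancy, hence by the incoming heat.  The free parameter \<open>\<eta>\<close>
is chosen so that this circle returns only a fraction of what one started with.\<close>

lemma heat_in_growth:
  assumes a: "0 < a" and c: "1 \<le> c" and \<delta>: "0 < \<delta>" and g0: "0 < g0"
    and gap: "\<And>x. 0 \<le> x \<Longrightarrow> x \<le> \<Gamma> \<Longrightarrow> hm x + \<delta> \<le> hp x - g0"
    and \<kappa>: "AE_walls \<Gamma> hm hp (\<lambda>x. \<bar>curvature hm hp x\<bar> \<le> 2 * c * \<alpha> x)"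
  shows "\<exists>C. \<forall>b\<ge>a. heat_in a b \<le> C + \<Gamma> * (2 * (1 + L\<^sup>2) * (2 * \<delta> * c * Ra * oscillation + 1 / \<delta>)) * (b - a)"
proof -
  define k2 where "k2 = 1 + L\<^sup>2"
  define R where "R = c * Ra * oscillation"
  have R: "0 < R" using c Ra_ge_1 oscillation_ge_1 by (simp add: R_def)
  \<comment> \<open>With this choice a quarter of the incoming heat reappears; \<open>heat_in_boundary_layer\<close> costs another
    quarter.\<close>
  define \<eta> where "\<eta> = 1 / (4 * R)"
  have \<eta>: "0 < \<eta>" using R by (simp add: \<eta>_def)
  have k2: "0 < k2" by (simp add: k2_def add_pos_nonneg)
  define \<epsilon> where "\<epsilon> = k2 * \<delta> / (4 * \<eta>)"
  have \<epsilon>: "0 < \<epsilon>" using k2 \<delta> \<eta> by (simp add: \<epsilon>_def)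
  have \<epsilon>R: "\<epsilon> = k2 * \<delta> * R" using R by (simp add: \<epsilon>_def \<eta>_def)
  define E where "E = area \<Gamma> hm hp (kinetic c a)"
  define C where "C = 2 * (\<delta> * \<Gamma> + \<Gamma> / 4 + \<Gamma> / 2 + \<eta> * (E + 1))"
  have "heat_in a b \<le> C + \<Gamma> * (2 * k2 * (2 * \<delta> * c * Ra * oscillation + 1 / \<delta>)) * (b - a)" if ab: "a \<le> b" for b
  proof -
    let ?V = "(1 / \<delta>) * integral {a..b} (\<lambda>t. area \<Gamma> hm (\<lambda>x. hm x + \<delta>) (\<lambda>x. \<bar>snd (u t x) - deriv hm (fst x) * fst (u t x)\<bar>))"
    let ?W = "integral {a..b} (\<lambda>t. area \<Gamma> hm hp (\<lambda>x. \<theta> t x * snd (u t x)))"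
    have bl: "\<forall>\<^sub>F s in at_right 0. ?V \<le> \<Gamma> * (\<epsilon> + (1 + L\<^sup>2) * \<delta> / (4 * \<eta>)) * (b - a) +
      \<eta> * integral {a..b} (\<lambda>t. area \<Gamma> (\<lambda>x. hm x + s) (\<lambda>x. hp x - s) (grad_sq t))"
      by (rule boundary_layer_velocity[OF a ab \<delta> g0 _ \<eta> \<epsilon>]) (rule gap)
    have "\<forall>\<^sub>F s in at_right (0::real). ?V \<le> \<Gamma> * (\<epsilon> + k2 * \<delta> / (4 * \<eta>)) * (b - a) + \<eta> * (c * Ra * ?W + E + 1)"
      using bl dissipation_le[OF a ab c zero_less_one \<kappa>]
    proof eventually_elim
      case (elim s)
      have "\<eta> * integral {a..b} (\<lambda>t. area \<Gamma> (\<lambda>x. hm x + s) (\<lambda>x. hp x - s) (grad_sq t)) \<le> \<eta> * (c * Ra * ?W + E + 1)"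
        using elim(2) \<eta> unfolding E_def by (intro mult_left_mono) auto
      then show ?case using elim(1) unfolding k2_def by linarith
    qed
    then have V: "?V \<le> \<Gamma> * (\<epsilon> + k2 * \<delta> / (4 * \<eta>)) * (b - a) + \<eta> * (c * Ra * ?W + E + 1)"
      by (simp add: trivial_limit_at_right_real eventually_const_iff)
    have "c * Ra * ?W \<le> c * Ra * (oscillation * (heat_in a b + 2 * \<Gamma>))"
      using buoyancy_work_le[OF a ab] c Ra_ge_1 by (intro mult_left_mono) auto
    then have "c * Ra * ?W + E + 1 \<le> R * (heat_in a b + 2 * \<Gamma>) + (E + 1)"
      by (simp add: R_def mult.assoc)
    then have "\<eta> * (c * Ra * ?W + E + 1) \<le> \<eta> * (R * (heat_in a b + 2 * \<Gamma>) + (E + 1))"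
      using \<eta> by (intro mult_left_mono) auto
    also have "\<dots> = (heat_in a b + 2 * \<Gamma>) / 4 + \<eta> * (E + 1)"
      using R by (simp add: \<eta>_def field_simps)
    finally have W: "\<eta> * (c * Ra * ?W + E + 1) \<le> (heat_in a b + 2 * \<Gamma>) / 4 + \<eta> * (E + 1)" .
    have le_hp: "hm x + \<delta> \<le> hp x" if "0 \<le> x" "x \<le> \<Gamma>" for x using gap[OF that] g0 by simp
    have "heat_in a b \<le> \<delta> * \<Gamma> + ?V + (heat_in a b + \<Gamma>) / 4 + k2 / \<delta> * \<Gamma> * (b - a)"
      using heat_in_boundary_layer[OF a ab \<delta> le_hp] by (simp add: k2_def)
    moreover have "\<Gamma> * (\<epsilon> + k2 * \<delta> / (4 * \<eta>)) * (b - a) + k2 / \<delta> * \<Gamma> * (b - a) =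
        (\<Gamma> * (2 * k2 * (2 * \<delta> * c * Ra * oscillation + 1 / \<delta>)) * (b - a)) / 2"
      unfolding \<epsilon>_def[symmetric] \<epsilon>R R_def by (simp add: algebra_simps)
    ultimately show ?thesis using V W unfolding C_def by argo
  qed
  then show ?thesis unfolding k2_def by blast
qed

end

section \<open>The Nusselt number\<close>

context rb_channel
begin

text \<open>The values of \<open>f\<close> off the graph may spoil its measurability; its integral is then zero by
convention.\<close>

lemma arc_measure_integral:
  assumes h: "continuous_on UNIV h" "continuous_on UNIV (deriv h)" and g: "continuous_on {0..\<Gamma>} g"
    and f: "\<And>y. 0 \<le> y \<Longrightarrow> y \<le> \<Gamma> \<Longrightarrow> sqrt (1 + (deriv h y)\<^sup>2) * f (y, h y) = g y"
  shows "(LINT x|arc_measure \<Gamma> h. f x) = integral {0..\<Gamma>} g \<or> (LINT x|arc_measure \<Gamma> h. f x) = (0 :: real)"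
proof (cases "f \<in> borel_measurable borel")
  case True
  have [measurable]: "h \<in> borel_measurable borel" "deriv h \<in> borel_measurable borel"
    using h by (auto intro: borel_measurable_continuous_onI)
  have eq: "(\<lambda>s. indicator {0..\<Gamma>} s * ennreal (sqrt (1 + (deriv h s)\<^sup>2))) =
      (\<lambda>s. ennreal (indicator {0..\<Gamma>} s * sqrt (1 + (deriv h s)\<^sup>2)))"
    by (auto simp: indicator_def)
  have "(LINT x|arc_measure \<Gamma> h. f x) =
      (LINT s|density lborel (\<lambda>s. ennreal (indicator {0..\<Gamma>} s * sqrt (1 + (deriv h s)\<^sup>2))). f (s, h s))"
    unfolding arc_measure_def eq using True by (intro integral_distr) measurable
  also have "\<dots> = (LINT s|lborel. (indicator {0..\<Gamma>} s * sqrt (1 + (deriv h s)\<^sup>2)) *\<^sub>R f (s, h s))"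
    using True by (intro integral_density AE_I2) (measurable, auto)
  also have "\<dots> = (LINT s:{0..\<Gamma>}|lborel. g s)"
    unfolding set_lebesgue_integral_def
    by (intro Bochner_Integration.integral_cong refl) (auto simp: f indicator_def)
  also have "\<dots> = integral {0..\<Gamma>} g"
    using borel_integrable_atLeastAtMost'[OF g] by (rule set_borel_integral_eq_integral)
  finally show ?thesis by simp
next
  case False
  have "sets (arc_measure \<Gamma> h) = sets borel" by (simp add: arc_measure_def)
  then have "f \<notin> borel_measurable (arc_measure \<Gamma> h)"
    using False measurable_cong_sets[OF _ refl, of "arc_measure \<Gamma> h" borel "borel :: real measure"] by simp
  then have "\<not> integrable (arc_measure \<Gamma> h) f" by (metis borel_measurable_integrable)
  then show ?thesis by (simp add: not_integrable_integral_eq)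
qed

lemma gap_ge:
  assumes "0 \<le> x" "x \<le> \<Gamma>"
  shows "(INF s\<in>{0..\<Gamma>}. hp s - hm s) \<le> hp x - hm x"
proof (rule cINF_lower)
  show "bdd_below ((\<lambda>s. hp s - hm s) ` {0..\<Gamma>})"
    by (intro bdd_belowI2[of _ 0]) (simp add: hm_less_hp less_imp_le)
qed (use assms in simp)

end

context rb_solution
begin

lemma wall_gradient:
  assumes t: "0 < t"
  shows "Lim (at (x, hm x) within S) (grad (\<theta> t)) = q t (x, hm x)"
proof (rule tendsto_Lim)
  have "(x, hm x) islimpt S"
    unfolding islimpt_approachable
  proof (intro allI impI)
    fix e :: real assume e: "0 < e"
    define s where "s = min e (hp x - hm x) / 2"
    have s: "0 < s" "s < e" "s < hp x - hm x" using e hm_less_hp[of x] by (auto simp: s_def)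
    have "(x, hm x + s) \<in> S" "(x, hm x + s) \<noteq> (x, hm x)" "dist (x, hm x + s) (x, hm x) < e"
      using s by (auto simp: strip_def dist_Pair_Pair dist_real_def)
    then show "\<exists>x'\<in>S. x' \<noteq> (x, hm x) \<and> dist x' (x, hm x) < e" by blast
  qed
  then show "\<not> trivial_limit (at (x, hm x) within S)" by (simp add: trivial_limit_within)
  have "continuous_on cS (q t)"
    by (rule continuous_on_compose_pair[OF q_continuous, of _ "\<lambda>_. t" "\<lambda>x. x"])
      (use t in \<open>auto intro!: continuous_intros\<close>)
  then have "(q t \<longlongrightarrow> q t (x, hm x)) (at (x, hm x) within cS)"
    using hm_le_hp by (auto simp: continuous_on_def closed_strip_def)
  then have "(q t \<longlongrightarrow> q t (x, hm x)) (at (x, hm x) within S)"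
    by (rule tendsto_within_subset) (rule S_subset_cS)
  then show "(grad (\<theta> t) \<longlongrightarrow> q t (x, hm x)) (at (x, hm x) within S)"
    by (rule Lim_transform_eventually) (auto simp: eventually_at_filter q_grad[OF t])
qed

lemma nusselt_integrand_bounds:
  assumes t: "0 < t"
  shows "0 \<le> (LINT x|arc_measure \<Gamma> hm. outer_normal hm hp x \<bullet> Lim (at x within S) (grad (\<theta> t)))"
    "(LINT x|arc_measure \<Gamma> hm. outer_normal hm hp x \<bullet> Lim (at x within S) (grad (\<theta> t)))
       \<le> integral {0..\<Gamma>} (wall_flux_bottom t)"
proof -
  have g: "continuous_on {0..\<Gamma>} (wall_flux_bottom t)"
    by (rule continuous_on_compose2[OF wall_flux_continuous(1)[of "{t}"], of _ "\<lambda>x. (t, x)", simplified])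
      (use t in \<open>auto intro!: continuous_intros\<close>)
  have "0 \<le> integral {0..\<Gamma>} (wall_flux_bottom t)"
    using wall_flux_nonneg(1)[OF t] by (intro integral_nonneg integrable_continuous_real g) auto
  moreover have "(LINT x|arc_measure \<Gamma> hm. outer_normal hm hp x \<bullet> Lim (at x within S) (grad (\<theta> t)))
      = integral {0..\<Gamma>} (wall_flux_bottom t) \<or>
    (LINT x|arc_measure \<Gamma> hm. outer_normal hm hp x \<bullet> Lim (at x within S) (grad (\<theta> t))) = 0"
  proof (rule arc_measure_integral[OF continuous_walls(1,3) g])
    fix y assume "0 \<le> y" "y \<le> \<Gamma>"
    have "sqrt (1 + (deriv hm y)\<^sup>2) \<noteq> 0" by (simp add: add_nonneg_eq_0_iff)
    then show "sqrt (1 + (deriv hm y)\<^sup>2) * (outer_normal hm hp (y, hm y) \<bullet>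
        Lim (at (y, hm y) within S) (grad (\<theta> t))) = wall_flux_bottom t y"
      unfolding wall_gradient[OF t] outer_normal_walls wall_flux_bottom_def
      by (simp add: inner_prod_def right_diff_distrib)
  qed
  ultimately show "0 \<le> (LINT x|arc_measure \<Gamma> hm. outer_normal hm hp x \<bullet> Lim (at x within S) (grad (\<theta> t)))"
    "(LINT x|arc_measure \<Gamma> hm. outer_normal hm hp x \<bullet> Lim (at x within S) (grad (\<theta> t)))
       \<le> integral {0..\<Gamma>} (wall_flux_bottom t)" by auto
qed

text \<open>The integrand of the Nusselt number is at most the heat flux for positive times, possibly zero where
an integral is undefined.  The flux near \<open>t = 0\<close> is not controlled, but if the time integral exists,
the contribution of the unit time interval is a constant that the time average forgets.\<close>

lemma nusselt_le_growth:
  assumes growth: "\<And>b. 1 \<le> b \<Longrightarrow> heat_in 1 b \<le> C + \<Gamma> * A * (b - 1)" and A: "0 \<le> A"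
  shows "nusselt \<Gamma> hm hp \<theta> \<le> ereal A"
proof -
  define N where "N t = 1 / \<Gamma> * (LINT x|arc_measure \<Gamma> hm. outer_normal hm hp x \<bullet> Lim (at x within S) (grad (\<theta> t)))" for t
  define m where "m t = integral {0..\<Gamma>} (wall_flux_bottom t)" for t
  have N: "N t \<le> m t / \<Gamma>" if "0 < t" for t
    using nusselt_integrand_bounds[OF that] \<Gamma>_pos by (simp add: N_def m_def divide_right_mono)
  define K where "K = \<bar>LINT t:{0..<1}|lborel. N t\<bar> + \<bar>C\<bar> / \<Gamma>"
  have K: "0 \<le> K" using \<Gamma>_pos by (simp add: K_def)
  have bound: "1 / T * (LINT t:{0..T}|lborel. N t) \<le> K / T + A" if T: "1 \<le> T" for T
  proof -
    have "(LINT t:{0..T}|lborel. N t) \<le> K + A * T"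
    proof (cases "set_integrable lborel {0..T} N")
      case True
      have mc: "continuous_on {1..T} m"
        unfolding m_def cbox_interval[symmetric]
        by (rule integral_continuous_on_param)
          (use wall_flux_continuous(1)[of "{1..T}"] in \<open>force simp: split_beta' cbox_interval\<close>)
      have mi: "set_integrable lborel {1..T} (\<lambda>t. m t / \<Gamma>)"
        using mc by (intro borel_integrable_atLeastAtMost' continuous_intros) (use \<Gamma>_pos in auto)
      have i: "set_integrable lborel {0..<1} N" "set_integrable lborel {1..T} N"
        by (rule set_integrable_subset[OF True]; use T in auto)+
      have un: "{0..T} = {0..<1} \<union> {1..T}" using T by auto
      have "(LINT t:{0..T}|lborel. N t) = (LINT t:{0..<1}|lborel. N t) + (LINT t:{1..T}|lborel. N t)"
        unfolding un by (rule set_integral_Un[OF _ i]) auto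
      also have "(LINT t:{1..T}|lborel. N t) \<le> (LINT t:{1..T}|lborel. m t / \<Gamma>)"
        by (rule set_integral_mono[OF i(2) mi]) (use N in auto)
      also have "(LINT t:{1..T}|lborel. m t / \<Gamma>) = integral {1..T} m / \<Gamma>"
        using set_borel_integral_eq_integral(2)[OF mi] by simp
      also have "integral {1..T} m = heat_in 1 T"
        using integral_prod_continuous[OF wall_flux_continuous_box(1)[of 1 T]]
        by (simp add: heat_in_def m_def[abs_def] cbox_interval)
      also have "heat_in 1 T / \<Gamma> \<le> (\<bar>C\<bar> + \<Gamma> * A * T) / \<Gamma>"
      proof -
        have "\<Gamma> * A * (T - 1) \<le> \<Gamma> * A * T" using \<Gamma>_pos A by (intro mult_left_mono) auto
        then have "heat_in 1 T \<le> \<bar>C\<bar> + \<Gamma> * A * T" using growth[OF T] by linarith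
        then show ?thesis using \<Gamma>_pos by (intro divide_right_mono) auto
      qed
      also have "(\<bar>C\<bar> + \<Gamma> * A * T) / \<Gamma> = \<bar>C\<bar> / \<Gamma> + A * T" using \<Gamma>_pos by (simp add: add_divide_distrib)
      finally show ?thesis unfolding K_def by linarith
    next
      case False
      then have "(LINT t:{0..T}|lborel. N t) = 0"
        by (simp add: set_integrable_def set_lebesgue_integral_def not_integrable_integral_eq)
      then show ?thesis using K A T by simp
    qed
    then have "1 / T * (LINT t:{0..T}|lborel. N t) \<le> 1 / T * (K + A * T)"
      using T by (intro mult_left_mono) auto
    also have "\<dots> = K / T + A" using T by (simp add: field_simps)
    finally show ?thesis .
  qed
  have "nusselt \<Gamma> hm hp \<theta> = Limsup at_top (\<lambda>T. ereal (1 / T * (LINT t:{0..T}|lborel. N t)))"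
    by (simp only: nusselt_def N_def)
  also have "\<dots> \<le> Limsup at_top (\<lambda>T. ereal (K / T + A))"
    by (rule Limsup_mono) (use bound in \<open>auto simp: eventually_at_top_linorder\<close>)
  also have "\<dots> = ereal A"
  proof (rule lim_imp_Limsup)
    have "((\<lambda>T. K / T + A) \<longlongrightarrow> 0 + A) at_top"
      by (intro tendsto_intros tendsto_divide_0[OF tendsto_const] filterlim_at_top_imp_at_infinity filterlim_ident)
    then show "((\<lambda>T. ereal (K / T + A)) \<longlongrightarrow> ereal A) at_top" by simp
  qed simp
  finally show ?thesis .
qed

end

context rb_traces
begin

text \<open>With \<open>s = sqrt (c Ra)\<close>, the thickness \<open>\<delta> = 1 / (2 s)\<close> balances the two terms of the growth rate.
It is replaced by \<open>d / 2\<close> in a channel that is too narrow, which cannot occur if \<open>Ra \<ge> 1 / d\<^sup>2\<close>.\<close>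

lemma nusselt_bound:
  assumes c: "1 \<le> c" and \<kappa>: "AE_walls \<Gamma> hm hp (\<lambda>x. \<bar>curvature hm hp x\<bar> \<le> 2 * c * \<alpha> x)"
    and d: "d = (INF s\<in>{0..\<Gamma>}. hp s - hm s)" "0 < d"
  shows "nusselt \<Gamma> hm hp \<theta> \<le> ereal (2 * (1 + L\<^sup>2) * (\<bar>1 + 2 * L * \<Gamma>\<bar> + 2 + 2 / \<bar>d\<bar>) * (sqrt c * sqrt Ra))"
    "1 / d\<^sup>2 \<le> Ra \<Longrightarrow> nusselt \<Gamma> hm hp \<theta> \<le> ereal (2 * (1 + L\<^sup>2) * (\<bar>1 + 2 * L * \<Gamma>\<bar> + 2) * (sqrt c * sqrt Ra))"
proof -
  define s where "s = sqrt c * sqrt Ra"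
  have s2: "s * s = c * Ra" using c Ra_ge_1 by (simp add: s_def algebra_simps)
  have sRa: "sqrt Ra \<le> s" using c Ra_ge_1 mult_right_mono[of 1 "sqrt c" "sqrt Ra"] by (simp add: s_def)
  have s1: "1 \<le> s" using sRa Ra_ge_1 real_sqrt_ge_one[of Ra] by linarith
  define \<delta> where "\<delta> = min (d / 2) (1 / (2 * s))"
  have \<delta>: "0 < \<delta>" "\<delta> \<le> d / 2" "\<delta> \<le> 1 / (2 * s)" using d s1 by (auto simp: \<delta>_def)
  have inv: "1 / \<delta> = max (2 / d) (2 * s)"
    using d s1 by (auto simp: \<delta>_def min_def max_def field_simps)
  have gap: "hm x + \<delta> \<le> hp x - d / 2" if "0 \<le> x" "x \<le> \<Gamma>" for x
    using gap_ge[OF that] \<delta>(2) unfolding d(1)[symmetric] by simp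
  define A where "A = 2 * (1 + L\<^sup>2) * (2 * \<delta> * c * Ra * oscillation + 1 / \<delta>)"
  have A0: "0 \<le> A" using \<delta> c Ra_ge_1 oscillation_ge_1 by (auto simp: A_def intro!: mult_nonneg_nonneg add_nonneg_nonneg)
  obtain C where "\<forall>b\<ge>1. heat_in 1 b \<le> C + \<Gamma> * A * (b - 1)"
    using heat_in_growth[OF _ c \<delta>(1) _ gap \<kappa>, of 1] d unfolding A_def by auto
  then have nu: "nusselt \<Gamma> hm hp \<theta> \<le> ereal A" using A0 by (intro nusselt_le_growth) auto
  have osc: "oscillation = \<bar>1 + 2 * L * \<Gamma>\<bar>" using oscillation_ge_1 by (simp add: oscillation_def)
  have "2 * \<delta> * (s * s) * oscillation \<le> 2 * (1 / (2 * s)) * (s * s) * oscillation"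
    using \<delta> s1 oscillation_ge_1 by (intro mult_right_mono mult_left_mono) auto
  also have "\<dots> = \<bar>1 + 2 * L * \<Gamma>\<bar> * s" using s1 by (simp add: osc)
  finally have 1: "2 * \<delta> * c * Ra * oscillation \<le> \<bar>1 + 2 * L * \<Gamma>\<bar> * s" by (simp add: s2 mult.assoc)
  have final: "nusselt \<Gamma> hm hp \<theta> \<le> ereal (2 * (1 + L\<^sup>2) * (\<bar>1 + 2 * L * \<Gamma>\<bar> + B) * (sqrt c * sqrt Ra))"
    if "1 / \<delta> \<le> B * s" for B
  proof -
    have "A \<le> 2 * (1 + L\<^sup>2) * (\<bar>1 + 2 * L * \<Gamma>\<bar> * s + B * s)"
      unfolding A_def using 1 that by (intro mult_left_mono add_mono) auto
    also have "\<dots> = 2 * (1 + L\<^sup>2) * (\<bar>1 + 2 * L * \<Gamma>\<bar> + B) * (sqrt c * sqrt Ra)"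
      by (simp only: s_def[symmetric] distrib_right mult.assoc)
    finally show ?thesis using nu by (meson ereal_less_eq(3) order_trans)
  qed
  have "2 / d \<le> 2 / d * s" using s1 d by (simp add: field_simps)
  moreover have "0 \<le> 2 / d" using d by simp
  ultimately have "1 / \<delta> \<le> (2 + 2 / \<bar>d\<bar>) * s"
    using inv s1 d(2) unfolding distrib_right by simp
  from final[OF this] show "nusselt \<Gamma> hm hp \<theta> \<le> ereal (2 * (1 + L\<^sup>2) * (\<bar>1 + 2 * L * \<Gamma>\<bar> + 2 + 2 / \<bar>d\<bar>) * (sqrt c * sqrt Ra))"
    by (simp only: add.assoc)
  assume "1 / d\<^sup>2 \<le> Ra"
  then have "sqrt (1 / d\<^sup>2) \<le> sqrt Ra" by (rule real_sqrt_le_mono)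
  then have "1 / d \<le> s" using sRa d by (simp add: real_sqrt_divide)
  then have "1 / \<delta> \<le> 2 * s" using inv by auto
  from final[OF this] show "nusselt \<Gamma> hm hp \<theta> \<le> ereal (2 * (1 + L\<^sup>2) * (\<bar>1 + 2 * L * \<Gamma>\<bar> + 2) * (sqrt c * sqrt Ra))" .
qed

end

context rb_channel
begin

lemma arc_measure_nontrivial:
  assumes h: "continuous_on UNIV h" "continuous_on UNIV (deriv h)"
  shows "\<not> (AE x in arc_measure \<Gamma> h. False)"
proof
  assume "AE x in arc_measure \<Gamma> h. False"
  from arc_measure_AE[OF h this] have "AE y in lborel. y \<notin> {0..\<Gamma>}" by simp
  then have "{0..\<Gamma>} \<in> null_sets lborel" by (subst AE_iff_null_sets) auto
  then show False using \<Gamma>_pos by (simp add: null_sets_def)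
qed

text \<open>Almost everywhere \<open>\<alpha>\<^sup>-\<^sup>1 (1 + |\<kappa>|) \<le> c - 1\<close> with \<open>c = C\<^sub>2\<close>, hence \<open>|\<kappa>| \<le> (c - 1) \<alpha>\<close>.\<close>

lemma curvature_le_C2:
  assumes \<alpha>: "AE_walls \<Gamma> hm hp (\<lambda>x. 0 < \<alpha> x)" and fin: "C2_const \<Gamma> hm hp \<alpha> \<noteq> \<infinity>"
  obtains c where "1 \<le> c" "C2_const \<Gamma> hm hp \<alpha> = ereal c"
    "AE_walls \<Gamma> hm hp (\<lambda>x. \<bar>curvature hm hp x\<bar> \<le> 2 * c * \<alpha> x)"
proof -
  let ?f = "\<lambda>x. inverse (\<alpha> x) * (1 + \<bar>curvature hm hp x\<bar>)"
  define N where "N = sup_norm_walls \<Gamma> hm hp ?f"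
  have C2: "C2_const \<Gamma> hm hp \<alpha> = 1 + N" by (simp add: C2_const_def N_def)
  have AE: "AE x in arc_measure \<Gamma> h. ereal \<bar>?f x\<bar> \<le> N \<and> 0 < \<alpha> x" if "h = hm \<or> h = hp" for h
  proof -
    have "AE x in arc_measure \<Gamma> h. ereal \<bar>?f x\<bar> \<le> esssup (arc_measure \<Gamma> h) (\<lambda>x. ereal \<bar>?f x\<bar>)"
      by (rule esssup_AE)
    moreover have "esssup (arc_measure \<Gamma> h) (\<lambda>x. ereal \<bar>?f x\<bar>) \<le> N"
      using that by (auto simp: N_def sup_norm_walls_def)
    moreover have "AE x in arc_measure \<Gamma> h. 0 < \<alpha> x" using \<alpha> that by (auto simp: AE_walls_def)
    ultimately show ?thesis by (auto elim!: eventually_elim2 intro: order_trans)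
  qed
  have "0 < N"
  proof (rule ccontr)
    assume n: "\<not> 0 < N"
    have "AE x in arc_measure \<Gamma> hm. False"
      using AE[OF disjI1[OF refl]]
    proof (rule AE_mp, intro AE_I2 impI)
      fix x assume x: "ereal \<bar>?f x\<bar> \<le> N \<and> 0 < \<alpha> x"
      then have "0 < ?f x" by (intro mult_pos_pos) auto
      then have "0 < ereal \<bar>?f x\<bar>" by simp
      then show False using x n by (meson less_le_trans)
    qed
    with arc_measure_nontrivial[OF continuous_walls(1,3)] show False by simp
  qed
  moreover have "N \<noteq> \<infinity>" using fin by (auto simp: C2)
  ultimately obtain n where n: "N = ereal n" "0 < n" by (cases N) auto
  have "AE x in arc_measure \<Gamma> h. \<bar>curvature hm hp x\<bar> \<le> 2 * (1 + n) * \<alpha> x" if "h = hm \<or> h = hp" for h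
    using AE[OF that]
  proof (rule AE_mp, intro AE_I2 impI)
    fix x assume x: "ereal \<bar>?f x\<bar> \<le> N \<and> 0 < \<alpha> x"
    then have "?f x \<le> n" using abs_ge_self[of "?f x"] n by auto
    then have "\<alpha> x * ?f x \<le> \<alpha> x * n" using x by (intro mult_left_mono) auto
    then have "1 + \<bar>curvature hm hp x\<bar> \<le> \<alpha> x * n" using x by (simp add: mult.assoc[symmetric])
    moreover have "\<alpha> x * n \<le> 2 * (1 + n) * \<alpha> x" using x n by (simp add: algebra_simps)
    ultimately show "\<bar>curvature hm hp x\<bar> \<le> 2 * (1 + n) * \<alpha> x" by simp
  qed
  then have "AE_walls \<Gamma> hm hp (\<lambda>x. \<bar>curvature hm hp x\<bar> \<le> 2 * (1 + n) * \<alpha> x)" by (simp add: AE_walls_def)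
  moreover have "C2_const \<Gamma> hm hp \<alpha> = ereal (1 + n)" by (simp add: C2 n one_ereal_def)
  ultimately show ?thesis using n by (intro that[of "1 + n"]) auto
qed

end

theorem theorem9:
  shows "\<exists>(C0 :: real \<Rightarrow> real \<Rightarrow> real \<Rightarrow> real) (C0' :: real \<Rightarrow> real \<Rightarrow> real).
    (\<forall>d L \<Gamma>. 0 < C0 d L \<Gamma>) \<and> (\<forall>L \<Gamma>. 0 < C0' L \<Gamma>) \<and>
    (\<forall>\<Gamma> hm hp L d \<alpha> Pr Ra u0 \<theta>0 u p \<theta>.
       channel \<Gamma> hm hp \<and> class_Ck1 1 hm \<and> class_Ck1 1 hp \<and>
       L-lipschitz_on UNIV hm \<and> L-lipschitz_on UNIV hp \<and>
       d = (INF s\<in>{0..\<Gamma>}. hp s - hm s) \<and> 0 < d \<and>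
       \<alpha> \<in> borel_measurable borel \<and> sup_norm_walls \<Gamma> hm hp \<alpha> < \<infinity> \<and>
       AE_walls \<Gamma> hm hp (\<lambda>x. 0 < \<alpha> x) \<and>
       0 < Pr \<and> 1 \<le> Ra \<and>
       L2_on (cell \<Gamma> hm hp) u0 \<and>
       set_borel_measurable lborel (cell \<Gamma> hm hp) \<theta>0 \<and>
       (AE x in lborel. x \<in> cell \<Gamma> hm hp \<longrightarrow> 0 \<le> \<theta>0 x \<and> \<theta>0 x \<le> 1) \<and>
       rayleigh_benard_solution \<Gamma> hm hp \<alpha> Pr Ra u0 \<theta>0 u p \<theta>
       \<longrightarrow>
       nusselt \<Gamma> hm hp \<theta>
         \<le> ereal (C0 d L \<Gamma>) * ereal_sqrt (C2_const \<Gamma> hm hp \<alpha>) * ereal (sqrt Ra) \<and>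
       (1 / d\<^sup>2 \<le> Ra \<longrightarrow>
         nusselt \<Gamma> hm hp \<theta>
           \<le> ereal (C0' L \<Gamma>) * ereal_sqrt (C2_const \<Gamma> hm hp \<alpha>) * ereal (sqrt Ra)) \<and>
       (AE_walls \<Gamma> hm hp (\<lambda>x. \<bar>curvature hm hp x\<bar> \<le> 2 * \<alpha> x) \<longrightarrow>
         nusselt \<Gamma> hm hp \<theta> \<le> ereal (C0 d L \<Gamma>) * ereal (sqrt Ra) \<and>
         (1 / d\<^sup>2 \<le> Ra \<longrightarrow>
           nusselt \<Gamma> hm hp \<theta> \<le> ereal (C0' L \<Gamma>) * ereal (sqrt Ra))))"
proof -
  \<comment> \<open>Absolute values make the constants positive for arguments of either sign.\<close>
  define C0 :: "real \<Rightarrow> real \<Rightarrow> real \<Rightarrow> real"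
    where "C0 d L \<Gamma> = 2 * (1 + L\<^sup>2) * (\<bar>1 + 2 * L * \<Gamma>\<bar> + 2 + 2 / \<bar>d\<bar>)" for d L \<Gamma>
  define C0' :: "real \<Rightarrow> real \<Rightarrow> real" where "C0' L \<Gamma> = 2 * (1 + L\<^sup>2) * (\<bar>1 + 2 * L * \<Gamma>\<bar> + 2)" for L \<Gamma>
  have C0: "0 < C0 d L \<Gamma>" for d L \<Gamma>
    unfolding C0_def by (intro mult_pos_pos add_pos_nonneg add_nonneg_pos) auto
  have C0': "0 < C0' L \<Gamma>" for L \<Gamma>
    unfolding C0'_def by (intro mult_pos_pos add_pos_nonneg add_nonneg_pos) auto
  have main: "nusselt \<Gamma> hm hp \<theta> \<le> ereal (C0 d L \<Gamma>) * ereal_sqrt (C2_const \<Gamma> hm hp \<alpha>) * ereal (sqrt Ra) \<and>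
       (1 / d\<^sup>2 \<le> Ra \<longrightarrow>
         nusselt \<Gamma> hm hp \<theta>
           \<le> ereal (C0' L \<Gamma>) * ereal_sqrt (C2_const \<Gamma> hm hp \<alpha>) * ereal (sqrt Ra)) \<and>
       (AE_walls \<Gamma> hm hp (\<lambda>x. \<bar>curvature hm hp x\<bar> \<le> 2 * \<alpha> x) \<longrightarrow>
         nusselt \<Gamma> hm hp \<theta> \<le> ereal (C0 d L \<Gamma>) * ereal (sqrt Ra) \<and>
         (1 / d\<^sup>2 \<le> Ra \<longrightarrow>
           nusselt \<Gamma> hm hp \<theta> \<le> ereal (C0' L \<Gamma>) * ereal (sqrt Ra)))"
    if walls: "channel \<Gamma> hm hp" "class_Ck1 1 hm" "class_Ck1 1 hp" "L-lipschitz_on UNIV hm" "L-lipschitz_on UNIV hp"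
      and d: "d = (INF s\<in>{0..\<Gamma>}. hp s - hm s)" "0 < d"
      and \<alpha>: "AE_walls \<Gamma> hm hp (\<lambda>x. 0 < \<alpha> x)"
      and par: "0 < Pr" "1 \<le> Ra"
      and \<theta>0: "set_borel_measurable lborel (cell \<Gamma> hm hp) \<theta>0"
        "AE x in lborel. x \<in> cell \<Gamma> hm hp \<longrightarrow> 0 \<le> \<theta>0 x \<and> \<theta>0 x \<le> 1"
      and sol: "rayleigh_benard_solution \<Gamma> hm hp \<alpha> Pr Ra u0 \<theta>0 u p \<theta>"
    for \<Gamma> hm hp L d \<alpha> Pr Ra u0 \<theta>0 u p \<theta>
  proof -
    obtain q where q: "continuous_on ({0<..} \<times> closed_strip hm hp) (\<lambda>(t, x). q t x)"
      "\<forall>t>0. \<forall>x\<in>strip hm hp. q t x = grad (\<theta> t) x"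
      using sol unfolding rayleigh_benard_solution_def regular_solution_def by blast
    obtain pw where pw: "has_trace \<Gamma> hm hp p pw"
      using sol unfolding rayleigh_benard_solution_def regular_solution_def by blast
    obtain G where G: "has_trace \<Gamma> hm hp (\<lambda>t. grad (u t)) G"
      "AE t in lborel. 0 < t \<longrightarrow> AE_walls \<Gamma> hm hp (\<lambda>x.
         tangent hm hp x \<bullet> (strain (G t x) (outer_normal hm hp x) + \<alpha> x *\<^sub>R u t x) = 0)"
      using sol unfolding rayleigh_benard_solution_def by blast
    interpret rb_traces \<Gamma> hm hp L \<alpha> Pr Ra u0 \<theta>0 u p \<theta> q pw G
      by unfold_locales (use walls par \<theta>0 sol q pw G in auto)
    note nu = nusselt_bound[OF _ _ d, folded C0_def C0'_def]
    have first: "nusselt \<Gamma> hm hp \<theta> \<le> ereal K * ereal_sqrt (C2_const \<Gamma> hm hp \<alpha>) * ereal (sqrt Ra)"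
      if K: "0 < K" and le: "\<And>c. 1 \<le> c \<Longrightarrow> AE_walls \<Gamma> hm hp (\<lambda>x. \<bar>curvature hm hp x\<bar> \<le> 2 * c * \<alpha> x) \<Longrightarrow>
          nusselt \<Gamma> hm hp \<theta> \<le> ereal (K * (sqrt c * sqrt Ra))" for K
    proof (cases "C2_const \<Gamma> hm hp \<alpha> = \<infinity>")
      case True
      then show ?thesis using K par by (simp add: ereal_sqrt_def)
    next
      case False
      from curvature_le_C2[OF \<alpha> this] obtain c where "1 \<le> c" "C2_const \<Gamma> hm hp \<alpha> = ereal c"
        "AE_walls \<Gamma> hm hp (\<lambda>x. \<bar>curvature hm hp x\<bar> \<le> 2 * c * \<alpha> x)" .
      then show ?thesis using le[of c] by (simp add: ereal_sqrt_def mult.assoc)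
    qed
    \<comment> \<open>The curvature condition is the case \<open>c = 1\<close>.\<close>
    have second: "nusselt \<Gamma> hm hp \<theta> \<le> ereal K * ereal (sqrt Ra)"
      if "\<And>c. 1 \<le> c \<Longrightarrow> AE_walls \<Gamma> hm hp (\<lambda>x. \<bar>curvature hm hp x\<bar> \<le> 2 * c * \<alpha> x) \<Longrightarrow>
          nusselt \<Gamma> hm hp \<theta> \<le> ereal (K * (sqrt c * sqrt Ra))"
        and "AE_walls \<Gamma> hm hp (\<lambda>x. \<bar>curvature hm hp x\<bar> \<le> 2 * \<alpha> x)" for K
      using that(1)[of 1] that(2) by simp
    show ?thesis
      using first[OF C0 nu(1)] first[OF C0' nu(2)] second[OF nu(1)] second[OF nu(2)] by blast
  qed
  show ?thesis
    by (rule exI[of _ C0], rule exI[of _ C0'], intro conjI allI impI C0 C0'; (elim conjE)?)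
      (use main in blast)+
qed

end
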